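(* Let $k\geq 5$ be an integer. Let $G$ be a connected graph of girth at least $k$ and let $x_1,\dots,x_k$ be terminals of $G$. Then exactly one of the following holds: \begin{itemize} \item $G$ contains a $k$-structure $K$ with respect to $x_1,\dots,x_k$ and $K$ decomposes $G$; \item $k=6$, $G$ contains a $K_4$-structure $K$ with respect to $x_1,\dots,x_6$ and $K$ decomposes $G$; \item $G$ contains an induced subgraph that is a tree and contains $x_1,\dots,x_k$. \end{itemize} Moreover, there is an algorithm running in time $O(n^4)$ (with $n$ the number of vertices of $G$) that outputs either such a tree or such a decomposing structure certifying that no such tree exists.
   Context: Graphs are finite and simple; the girth is the length of a shortest cycle; a terminal is a vertex of degree one; "contains" refers to induced subgraphs. Let $X=\{x_1,\dots,x_k\}$. A graph is a $k$-structure with respect to $k$ distinct terminals $x_1,\dots,x_k$ if it consists of $k$ vertex-disjoint induced paths of length at least one $P_1=x_1-\cdots-s_1$, \dots, $P_k=x_k-\cdots-s_k$, such that the only edges between distinct paths are $s_1s_2,\dots,s_{k-1}s_k,s_ks_1$; it decomposes $G$ if for every $i$, $\{s_i\}$ is a cutset of $G$ separating $x_i$ from $X\setminus\{x_i\}$. A graph is a $K_4$-structure with respect to 6 distinct terminals (labelled $x_{ab},x_{ac},x_{ad},x_{bc},x_{bd},x_{cd}$) if it consists of 6 vertex-disjoint induced paths of length at least one $P_{ij}=x_{ij}-\cdots-s_{ij}$, $ij\in\{ab,ac,ad,bc,bd,cd\}$, together with four further vertices $a,b,c,d$, such that the only edges besides path edges are $as_{ab},as_{ac},as_{ad},bs_{ab},bs_{bc},bs_{bd},cs_{ac},cs_{bc},cs_{cd},ds_{ad},ds_{bd},ds_{cd}$.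 With $a<b<c<d$ and $X$ the set of the 6 terminals, a $K_4$-structure decomposes $G$ if for all $i<j$ in $\{a,b,c,d\}$ both $\{i,j\}$ and $\{s_{ij}\}$ are cutsets of $G$ separating $x_{ij}$ from $X\setminus\{x_{ij}\}$. *)

theory Defs
  imports Main "HOL-Library.Extended_Nat" "HOL-Library.Landau_Symbols"
begin

record 'a graph =
  verts :: "'a set"
  edges :: "'a set set"

definition simple_graph :: "'a graph \<Rightarrow> bool" where
  "simple_graph G \<longleftrightarrow> finite (verts G) \<and> (\<forall>e\<in>edges G. e \<subseteq> verts G \<and> card e = 2)"

definition adj :: "'a graph \<Rightarrow> 'a \<Rightarrow> 'a \<Rightarrow> bool" where
  "adj G u v \<longleftrightarrow> {u, v} \<in> edges G"

definition degree :: "'a graph \<Rightarrow> 'a \<Rightarrow> nat" where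
  "degree G v = card {u \<in> verts G. adj G v u}"

definition terminal :: "'a graph \<Rightarrow> 'a \<Rightarrow> bool" where
  "terminal G v \<longleftrightarrow> v \<in> verts G \<and> degree G v = 1"

definition induced :: "'a graph \<Rightarrow> 'a set \<Rightarrow> 'a graph" where
  "induced G S = \<lparr>verts = verts G \<inter> S, edges = {e \<in> edges G. e \<subseteq> S}\<rparr>"

definition connected_graph :: "'a graph \<Rightarrow> bool" where
  "connected_graph G \<longleftrightarrow> verts G \<noteq> {} \<and> (\<forall>u\<in>verts G. \<forall>v\<in>verts G. (adj G)\<^sup>*\<^sup>* u v)"

definition path_edges :: "'a list \<Rightarrow> 'a set set" where
  "path_edges p = {{p ! j, p ! Suc j} | j. Suc j < length p}"

definition is_cycle :: "'a graph \<Rightarrow> 'a list \<Rightarrow> bool" where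
  "is_cycle G c \<longleftrightarrow> 3 \<le> length c \<and> distinct c \<and> set c \<subseteq> verts G \<and>
     path_edges c \<subseteq> edges G \<and> {last c, hd c} \<in> edges G"

text \<open>The girth of a graph without cycles is \<open>\<infinity>\<close>.\<close>

definition girth :: "'a graph \<Rightarrow> enat" where
  "girth G = Inf {enat (length c) | c. is_cycle G c}"

definition is_tree :: "'a graph \<Rightarrow> bool" where
  "is_tree G \<longleftrightarrow> simple_graph G \<and> connected_graph G \<and> (\<nexists>c. is_cycle G c)"

definition induced_tree_containing :: "'a graph \<Rightarrow> 'a set \<Rightarrow> 'a set \<Rightarrow> bool" where
  "induced_tree_containing G X S \<longleftrightarrow> S \<subseteq> verts G \<and> X \<subseteq> S \<and> is_tree (induced G S)"

definition cutset :: "'a graph \<Rightarrow> 'a set \<Rightarrow> bool" where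
  "cutset G C \<longleftrightarrow> C \<subseteq> verts G \<and> \<not> connected_graph (induced G (verts G - C))"

definition separating_cutset :: "'a graph \<Rightarrow> 'a set \<Rightarrow> 'a \<Rightarrow> 'a set \<Rightarrow> bool" where
  "separating_cutset G C x Y \<longleftrightarrow> cutset G C \<and> x \<in> verts G - C \<and> Y \<subseteq> verts G - C \<and>
     (\<forall>y\<in>Y. \<not> (adj (induced G (verts G - C)))\<^sup>*\<^sup>* x y)"

text \<open>
  A path is the list of its vertices, starting at the terminal (so \<open>x\<^sub>i = hd (P i)\<close>) and
  ending in \<open>s\<^sub>i = last (P i)\<close>.  Indices run over \<open>0, \<dots>, k - 1\<close>.  A structure with respect to
  given terminals is one whose terminals form the given set \<open>X\<close>: the order in which they
  occur around the cycle (respectively their labelling by the pairs \<open>ab, \<dots>, cd\<close>) is part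
  of the structure and not prescribed by an enumeration of \<open>X\<close>.

  Listing all edges of \<open>H\<close> expresses both that the paths are induced and which edges
  there are between distinct paths.
\<close>

definition k_structure :: "nat \<Rightarrow> 'a set \<Rightarrow> 'a graph \<Rightarrow> (nat \<Rightarrow> 'a list) \<Rightarrow> bool" where
  "k_structure k X H P \<longleftrightarrow>
     simple_graph H \<and>
     bij_betw (\<lambda>i. hd (P i)) {..<k} X \<and> (\<forall>x\<in>X. terminal H x) \<and>
     (\<forall>i<k. 2 \<le> length (P i) \<and> distinct (P i)) \<and>
     (\<forall>i<k. \<forall>j<k. i \<noteq> j \<longrightarrow> set (P i) \<inter> set (P j) = {}) \<and>
     verts H = (\<Union>i<k. set (P i)) \<and>
     edges H = (\<Union>i<k. path_edges (P i)) \<union>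
       {{last (P i), last (P (Suc i mod k))} | i. i < k}"

definition decomposing_k_structure :: "nat \<Rightarrow> 'a set \<Rightarrow> 'a graph \<Rightarrow> (nat \<Rightarrow> 'a list) \<Rightarrow> bool" where
  "decomposing_k_structure k X G P \<longleftrightarrow>
     (\<Union>i<k. set (P i)) \<subseteq> verts G \<and>
     k_structure k X (induced G (\<Union>i<k. set (P i))) P \<and>
     (\<forall>i<k. separating_cutset G {last (P i)} (hd (P i)) (X - {hd (P i)}))"

text \<open>The vertices \<open>a, b, c, d\<close> are \<open>w 0, w 1, w 2, w 3\<close>.\<close>

definition K4_pairs :: "(nat \<times> nat) set" where
  "K4_pairs = {(i, j). i < j \<and> j < 4}"

definition K4_verts :: "(nat \<Rightarrow> 'a) \<Rightarrow> (nat \<times> nat \<Rightarrow> 'a list) \<Rightarrow> 'a set" where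
  "K4_verts w P = w ` {..<4} \<union> (\<Union>e\<in>K4_pairs. set (P e))"

definition K4_structure ::
    "'a set \<Rightarrow> 'a graph \<Rightarrow> (nat \<Rightarrow> 'a) \<Rightarrow> (nat \<times> nat \<Rightarrow> 'a list) \<Rightarrow> bool" where
  "K4_structure X H w P \<longleftrightarrow>
     simple_graph H \<and>
     bij_betw (\<lambda>e. hd (P e)) K4_pairs X \<and> (\<forall>x\<in>X. terminal H x) \<and>
     (\<forall>e\<in>K4_pairs. 2 \<le> length (P e) \<and> distinct (P e)) \<and>
     (\<forall>e\<in>K4_pairs. \<forall>f\<in>K4_pairs. e \<noteq> f \<longrightarrow> set (P e) \<inter> set (P f) = {}) \<and>
     inj_on w {..<4} \<and>
     (\<forall>e\<in>K4_pairs. w ` {..<4} \<inter> set (P e) = {}) \<and>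
     verts H = K4_verts w P \<and>
     edges H = (\<Union>e\<in>K4_pairs. path_edges (P e)) \<union>
       (\<Union>(i, j)\<in>K4_pairs. {{w i, last (P (i, j))}, {w j, last (P (i, j))}})"

definition decomposing_K4_structure ::
    "'a set \<Rightarrow> 'a graph \<Rightarrow> (nat \<Rightarrow> 'a) \<Rightarrow> (nat \<times> nat \<Rightarrow> 'a list) \<Rightarrow> bool" where
  "decomposing_K4_structure X G w P \<longleftrightarrow>
     K4_verts w P \<subseteq> verts G \<and>
     K4_structure X (induced G (K4_verts w P)) w P \<and>
     (\<forall>(i, j)\<in>K4_pairs.
        separating_cutset G {w i, w j} (hd (P (i, j))) (X - {hd (P (i, j))}) \<and>
        separating_cutset G {last (P (i, j))} (hd (P (i, j))) (X - {hd (P (i, j))}))"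

definition k_in_a_tree_input :: "nat \<Rightarrow> 'a graph \<Rightarrow> (nat \<Rightarrow> 'a) \<Rightarrow> bool" where
  "k_in_a_tree_input k G x \<longleftrightarrow>
     simple_graph G \<and> connected_graph G \<and> enat k \<le> girth G \<and>
     inj_on x {..<k} \<and> (\<forall>i<k. terminal G (x i))"

text \<open>
  Programs of a random access machine under the uniform cost criterion, in structured
  form.  The store consists of scalar variables and arrays of natural numbers; an array index is
  an arbitrary expression (indirect addressing).  The arithmetic is addition and truncated
  subtraction; there is deliberately no multiplication, so that unit costs stay realistic.
\<close>

datatype aexp =
    Const nat
  | Var string
  | Get string aexp
  | Plus aexp aexp
  | Minus aexp aexp

datatype bexp =
    Less aexp aexp
  | Equal aexp aexp
  | Not bexp
  | And bexp bexp

datatype com =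
    Skip
  | Assign string aexp
  | Store string aexp aexp
  | Seq com com
  | If bexp com com
  | While bexp com

record store =
  var :: "string \<Rightarrow> nat"
  arr :: "string \<Rightarrow> nat \<Rightarrow> nat"

fun aval :: "aexp \<Rightarrow> store \<Rightarrow> nat" where
  "aval (Const n) s = n"
| "aval (Var x) s = var s x"
| "aval (Get a e) s = arr s a (aval e s)"
| "aval (Plus e f) s = aval e s + aval f s"
| "aval (Minus e f) s = aval e s - aval f s"

fun bval :: "bexp \<Rightarrow> store \<Rightarrow> bool" where
  "bval (Less e f) s \<longleftrightarrow> aval e s < aval f s"
| "bval (Equal e f) s \<longleftrightarrow> aval e s = aval f s"
| "bval (Not b) s \<longleftrightarrow> \<not> bval b s"
| "bval (And b c) s \<longleftrightarrow> bval b s \<and> bval c s"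

text \<open>
  \<open>exec p s t s'\<close>: program \<open>p\<close> started in \<open>s\<close> halts in \<open>s'\<close> after \<open>t\<close> steps.  Every
  elementary command and every evaluated test counts as one step; expressions contribute
  only a constant factor, because their sizes are bounded by the size of the program.
\<close>

inductive exec :: "com \<Rightarrow> store \<Rightarrow> nat \<Rightarrow> store \<Rightarrow> bool" where
  Skip: "exec Skip s 1 s"
| Assign: "exec (Assign x e) s 1 (s\<lparr>var := (var s)(x := aval e s)\<rparr>)"
| Store: "exec (Store a e f) s 1
            (s\<lparr>arr := (arr s)(a := (arr s a)(aval e s := aval f s))\<rparr>)"
| Seq: "exec c s t s' \<Longrightarrow> exec d s' u s'' \<Longrightarrow> exec (Seq c d) s (t + u) s''"
| IfTrue: "bval b s \<Longrightarrow> exec c s t s' \<Longrightarrow> exec (If b c d) s (Suc t) s'"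
| IfFalse: "\<not> bval b s \<Longrightarrow> exec d s t s' \<Longrightarrow> exec (If b c d) s (Suc t) s'"
| WhileFalse: "\<not> bval b s \<Longrightarrow> exec (While b c) s 1 s"
| WhileTrue: "bval b s \<Longrightarrow> exec c s t s' \<Longrightarrow> exec (While b c) s' u s'' \<Longrightarrow>
    exec (While b c) s (Suc (t + u)) s''"

text \<open>
  The input is a graph with vertices \<open>0, \<dots>, n - 1\<close>, given by its adjacency matrix in
  row-major order, together with the \<open>k\<close> terminals.  All other cells are initially \<open>0\<close>.
\<close>

definition input_store :: "nat \<Rightarrow> nat graph \<Rightarrow> nat \<Rightarrow> (nat \<Rightarrow> nat) \<Rightarrow> store" where
  "input_store n G k x = \<lparr>
     var = (\<lambda>_. 0)(''n'' := n, ''k'' := k),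
     arr = (\<lambda>_ _. 0)(
       ''adj'' := (\<lambda>m. if m < n * n \<and> adj G (m div n) (m mod n) then 1 else 0),
       ''term'' := (\<lambda>i. if i < k then x i else 0))\<rparr>"

text \<open>
  The variable \<open>result\<close> tells which kind of object is returned: \<open>0\<close> for a tree, given by the
  characteristic vector of its vertex set; \<open>1\<close> for a \<open>k\<close>-structure; \<open>2\<close> for a \<open>K\<^sub>4\<close>-structure.
  The \<open>i\<close>-th path of a structure has \<open>len[i]\<close> vertices, stored in \<open>path\<close> from position
  \<open>i * n\<close> on.  The six paths of a \<open>K\<^sub>4\<close>-structure come in the order \<open>ab, ac, ad, bc, bd, cd\<close>.
\<close>

definition out_tree :: "nat \<Rightarrow> store \<Rightarrow> nat set" where
  "out_tree n s = {v. v < n \<and> arr s ''tree'' v \<noteq> 0}"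

definition out_path :: "nat \<Rightarrow> store \<Rightarrow> nat \<Rightarrow> nat list" where
  "out_path n s i = map (\<lambda>j. arr s ''path'' (i * n + j)) [0..<arr s ''len'' i]"

definition K4_index :: "nat \<times> nat \<Rightarrow> nat" where
  "K4_index = (\<lambda>_. 0)((0,1) := 0, (0,2) := 1, (0,3) := 2, (1,2) := 3, (1,3) := 4, (2,3) := 5)"

definition correct_output :: "nat \<Rightarrow> nat graph \<Rightarrow> nat \<Rightarrow> nat set \<Rightarrow> store \<Rightarrow> bool" where
  "correct_output n G k X s \<longleftrightarrow>
     var s ''result'' = 0 \<and> induced_tree_containing G X (out_tree n s) \<or>
     var s ''result'' = 1 \<and> decomposing_k_structure k X G (out_path n s) \<or>
     var s ''result'' = 2 \<and> k = 6 \<and>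
       decomposing_K4_structure X G (arr s ''branch'') (\<lambda>e. out_path n s (K4_index e))"

end

theory Submission
  imports Defs
begin

text \<open>
  Call a set of vertices linked if it contains the terminals and connects them inside itself.
  In a minimal linked set every vertex of a cycle has a neighbour off the cycle, since otherwise it could be
  deleted; as the girth is at least the number of terminals, each vertex of the cycle leads to exactly one
  terminal.  So a minimal linked set either induces a tree or is a \<open>k\<close>-structure.
  If the latter does not decompose the graph, some set of vertices around it leaks: it contains a way around
  one of the end vertices \<open>s\<^sub>i\<close>.  In a minimal leaky set one can delete a bounded number of end vertices and
  their predecessors so that every minimal linked set which remains induces a tree; the only exception is one
  extra vertex attached to every other path for \<open>k = 6\<close>, which gives a structure on \<open>K\<^sub>4\<close>, and a leak of that
  structure reduces to leaks of the cycle structures obtained by deleting one of \<open>a, b, c, d\<close>.  Conversely a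
  decomposing structure forces its end vertices, hence a cycle, into every linked set.

  All steps are searches for minimal sets with a monotone property testable in time \<open>O(n\<^sup>3)\<close>, once for
  each vertex, and a number of trials that depends on \<open>k\<close> only.
\<close>

section \<open>Minimal sets linking the terminals\<close>

text \<open>Deletions are chosen so that every cycle left over consists of one vertex outside the
  structure and a stretch of a single path. As there are no triangles, the stretch has an interior
  vertex; all its neighbours lie on the cycle, so no minimal linked set contains that cycle. The
  obstacle is an outside vertex that sees several paths near their ends. Give a path weight 1 if its
  end is seen, and weight 2 if only the predecessor of the end is. Two such paths at cyclic distance
  g close a cycle with the outside vertex, so k is at most g plus their weights. Hence any two are
  at least k - 4 apart, three of them need 3(k - 4) \<le> k, and k \<le> 6. For k = 5 a finite case
  analysis finds a deletion. For k = 6 all gaps are 2, and if no other path is seen, the outside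
  vertex and every second end become the branch vertices of K4. A K4 structure has no further
  exception: a vertex in exceptional position after the deletion of one branch vertex is in regular
  position after the deletion of a second one. A structure is recovered from its vertex set alone,
  by walking from each terminal while the way is unique.\<close>

definition reach :: "'a graph \<Rightarrow> 'a set \<Rightarrow> 'a \<Rightarrow> 'a \<Rightarrow> bool" where
  "reach G S = (adj (induced G S))\<^sup>*\<^sup>*"

text \<open>\<open>reach\<close> is reflexive even outside \<open>S\<close>, so the inclusion of
  \<open>X\<close> in \<open>S\<close> is demanded separately.\<close>

definition linked :: "'a graph \<Rightarrow> 'a set \<Rightarrow> 'a set \<Rightarrow> bool" where
  "linked G X S \<longleftrightarrow> X \<subseteq> S \<and> (\<forall>x\<in>X. \<forall>y\<in>X. reach G S x y)"

text \<open>Only single deletions are tested, which is what a greedy pass can verify. As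
  \<open>linked\<close> is monotone in the vertex set, this already is minimality under inclusion
  (\<open>min_linked_subset\<close>).\<close>

definition min_linked :: "'a graph \<Rightarrow> 'a set \<Rightarrow> 'a set \<Rightarrow> bool" where
  "min_linked G X S \<longleftrightarrow> linked G X S \<and> (\<forall>u\<in>S. \<not> linked G X (S - {u}))"

definition walk_in :: "'a graph \<Rightarrow> 'a set \<Rightarrow> 'a list \<Rightarrow> bool" where
  "walk_in G S p \<longleftrightarrow> p \<noteq> [] \<and> set p \<subseteq> S \<and> successively (adj G) p"

definition chordless :: "'a graph \<Rightarrow> 'a list \<Rightarrow> bool" where
  "chordless G p \<longleftrightarrow> (\<forall>i j. i < j \<longrightarrow> j < length p \<longrightarrow> (adj G (p ! i) (p ! j) \<longleftrightarrow> j = Suc i))"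

section \<open>Reachability inside a vertex set, walks and induced paths\<close>

lemma adj_commute: "adj G u v \<longleftrightarrow> adj G v u"
  by (simp add: adj_def insert_commute)

lemma adj_induced: "adj (induced G S) u v \<longleftrightarrow> adj G u v \<and> u \<in> S \<and> v \<in> S"
  by (auto simp: adj_def induced_def)

lemma reach_refl [simp]: "reach G S u u"
  by (simp add: reach_def)

lemma reach_trans: "reach G S u v \<Longrightarrow> reach G S v w \<Longrightarrow> reach G S u w"
  by (simp add: reach_def)

lemma reach_commute: "reach G S u v \<longleftrightarrow> reach G S v u"
proof -
  have "symp (adj (induced G S))"
    by (auto intro!: sympI simp: adj_commute)
  then show ?thesis
    unfolding reach_def by (metis symp_rtranclp sympD)
qed

lemma reach_step: "adj G u v \<Longrightarrow> u \<in> S \<Longrightarrow> v \<in> S \<Longrightarrow> reach G S u v"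
  by (simp add: reach_def adj_induced r_into_rtranclp)

lemma reach_mono: "reach G S u v \<Longrightarrow> S \<subseteq> T \<Longrightarrow> reach G T u v"
  unfolding reach_def by (erule rtranclp_mono[THEN predicate2D, rotated]) (auto simp: adj_induced)

lemma reach_in': "reach G S u v \<Longrightarrow> u \<noteq> v \<Longrightarrow> u \<in> S \<and> v \<in> S"
  unfolding reach_def by (metis adj_induced converse_rtranclpE rtranclp.cases)

text \<open>The means of confinement used throughout: the rest of a cycle after the removal of one
  vertex is connected, so it cannot leave a set that is closed under steps inside
  \<open>W\<close>.\<close>

lemma reach_closed:
  assumes "reach G W x y" "x \<in> Z" "\<And>z w. z \<in> Z \<Longrightarrow> z \<in> W \<Longrightarrow> w \<in> W \<Longrightarrow> adj G z w \<Longrightarrow> w \<in> Z"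
  shows "y \<in> Z"
  using assms(1,2) unfolding reach_def
  by (induction rule: rtranclp_induct) (auto simp: adj_induced intro: assms(3))

text \<open>Cuts a walk at its first vertex in \<open>B\<close>. The part before it runs in
  \<open>S - B\<close>, and only the vertex that is hit has to be put back.\<close>

lemma reach_first_hit:
  assumes "reach G S x y" "y \<in> B" "x \<in> S" "x \<notin> B"
  obtains z where "z \<in> B" "z \<in> S" "reach G (insert z (S - B)) x z"
proof -
  have "(\<exists>z\<in>B \<inter> S. reach G (insert z (S - B)) x z) \<or> (y \<notin> B \<and> reach G (S - B) x y)"
    using assms(1) unfolding reach_def
  proof (induction rule: rtranclp_induct)
    case base
    then show ?case using assms by auto
  next
    case (step y z)
    show ?case
    proof (cases "y \<notin> B \<and> (adj (induced G (S - B)))\<^sup>*\<^sup>* x y")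
      case True
      then have yz: "adj G y z" "y \<in> S" "z \<in> S" "y \<notin> B" "reach G (S - B) x y"
        using step by (auto simp: adj_induced reach_def)
      show ?thesis
      proof (cases "z \<in> B")
        case True
        have "reach G (insert z (S - B)) x y" "reach G (insert z (S - B)) y z"
          using yz by (auto intro: reach_mono[OF yz(5)] reach_step)
        then have "reach G (insert z (S - B)) x z" by (rule reach_trans)
        then show ?thesis using True yz(3) unfolding reach_def by blast
      next
        case False
        have "reach G (S - B) y z" using yz False by (auto intro: reach_step)
        then show ?thesis using False reach_trans[OF yz(5)] unfolding reach_def by blast
      qed
    next
      case False
      then show ?thesis using step by blast
    qed
  qed
  then show ?thesis using assms that by auto
qed

lemma successively_nth: "successively P p \<longleftrightarrow> (\<forall>j. Suc j < length p \<longrightarrow> P (p ! j) (p ! Suc j))"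
proof (induction p rule: induct_list012)
  case (3 x y zs)
  then show ?case
    by (auto simp: nth_Cons split: nat.splits)
qed auto

lemma path_edges_subset: "path_edges p \<subseteq> edges G \<longleftrightarrow> successively (adj G) p"
  by (auto simp: path_edges_def successively_nth adj_def)

lemma is_cycle_iff:
  "is_cycle G c \<longleftrightarrow> 3 \<le> length c \<and> distinct c \<and> set c \<subseteq> verts G \<and>
     successively (adj G) c \<and> adj G (last c) (hd c)"
  by (simp add: is_cycle_def path_edges_subset adj_def)

lemma is_cycle_induced:
  "is_cycle (induced G S) c \<longleftrightarrow> is_cycle G c \<and> set c \<subseteq> S"
proof (cases c)
  case (Cons x xs)
  have "successively (adj (induced G S)) c \<longleftrightarrow> successively (adj G) c" if "set c \<subseteq> S"
    using that by (auto simp: successively_nth adj_induced subset_iff)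
  moreover have "last c \<in> set c" "hd c \<in> set c" using Cons by auto
  moreover have "verts (induced G S) = verts G \<inter> S" by (simp add: induced_def)
  ultimately show ?thesis
    by (auto simp: is_cycle_iff adj_induced)
qed (simp add: is_cycle_iff)

lemma walk_in_reach:
  assumes "walk_in G S p" "u \<in> set p" "v \<in> set p"
  shows "reach G S u v"
proof -
  have *: "\<forall>v\<in>set p. reach G S (hd p) v" if "walk_in G S p" for p
    using that
  proof (induction p rule: induct_list012)
    case (3 x y zs)
    then have "walk_in G S (y # zs)" by (auto simp: walk_in_def)
    then have "\<forall>v\<in>set (y # zs). reach G S y v" using 3 by simp
    moreover have "reach G S x y" using 3 by (auto simp: walk_in_def intro: reach_step)
    ultimately show ?case by (auto intro: reach_trans)
  qed (auto simp: walk_in_def)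
  show ?thesis using *[OF assms(1)] assms by (meson reach_trans reach_commute)
qed

lemma walk_in_mono: "walk_in G S p \<Longrightarrow> S \<subseteq> T \<Longrightarrow> walk_in G T p"
  by (auto simp: walk_in_def)

lemma reach_walk:
  assumes "reach G S u v" "u \<in> S"
  obtains p where "walk_in G S p" "hd p = u" "last p = v"
proof -
  have "\<exists>p. walk_in G S p \<and> hd p = u \<and> last p = v"
    using assms(1) unfolding reach_def
  proof (induction rule: rtranclp_induct)
    case base
    show ?case by (rule exI[of _ "[u]"]) (use assms in \<open>auto simp: walk_in_def\<close>)
  next
    case (step y z)
    then obtain p where "walk_in G S p" "hd p = u" "last p = y" by auto
    then show ?case using step
      by (intro exI[of _ "p @ [z]"]) (auto simp: walk_in_def successively_append_iff adj_induced)
  qed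
  then show ?thesis using that by auto
qed

text \<open>A chord or a repeated vertex lets the walk jump from position \<open>i\<close> to
  position \<open>j\<close>. In the case of a repetition the second copy is dropped as well; if that
  copy was the last vertex, the walk still ends there, because the first copy is the same
  vertex.\<close>

lemma walk_in_shorten:
  assumes "walk_in G S p" "i < j" "j < length p" "adj G (p ! i) (p ! j) \<or> p ! i = p ! j" "Suc i < j \<or> p ! i = p ! j"
  obtains q where "walk_in G S q" "hd q = hd p" "last q = last p" "length q < length p"
proof -
  have sp: "successively (adj G) (take (Suc i) p)" "successively (adj G) (drop m p)" for m
    using assms by (auto simp: walk_in_def successively_nth)
  have st: "set (take (Suc i) p) \<subseteq> S" "set (drop m p) \<subseteq> S" for m
    using assms by (auto simp: walk_in_def dest: in_set_takeD in_set_dropD)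
  have la: "last (take (Suc i) p) = p ! i"
    using assms by (simp add: take_Suc_conv_app_nth)
  have tn: "take (Suc i) p \<noteq> []" "hd (take (Suc i) p) = hd p"
    using assms by (auto simp: walk_in_def)
  show ?thesis
  proof (cases "p ! i = p ! j")
    case False
    let ?q = "take (Suc i) p @ drop j p"
    have "walk_in G S ?q"
      using sp st la assms False tn
      by (auto simp: walk_in_def successively_append_iff hd_drop_conv_nth)
    moreover have "last ?q = last p" "length ?q < length p" "hd ?q = hd p"
      using assms False tn by auto
    ultimately show ?thesis using that by blast
  next
    case True
    let ?q = "take (Suc i) p @ drop (Suc j) p"
    have "adj G (p ! i) (p ! Suc j)" if "Suc j < length p"
      using assms True that by (auto simp: walk_in_def successively_nth)
    then have "walk_in G S ?q"
      using sp st la assms tn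
      by (cases "Suc j < length p") (auto simp: walk_in_def successively_append_iff hd_drop_conv_nth)
    moreover have "last ?q = last p"
    proof (cases "Suc j < length p")
      case True
      then show ?thesis by (simp add: last_drop)
    next
      case False
      then have "j = length p - 1" "p \<noteq> []" using assms by auto
      then have "last p = p ! j" by (simp add: last_conv_nth)
      then show ?thesis using False la \<open>p ! i = p ! j\<close> by simp
    qed
    moreover have "length ?q < length p" "hd ?q = hd p"
      using assms tn by auto
    ultimately show ?thesis using that by blast
  qed
qed

lemma shortest_walk_chordless:
  assumes p: "walk_in G S p"
    and shortest: "\<And>q. walk_in G S q \<Longrightarrow> hd q = hd p \<Longrightarrow> last q = last p \<Longrightarrow> length p \<le> length q"
  shows "distinct p \<and> chordless G p"
proof
  show "distinct p"
    unfolding distinct_conv_nth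
  proof (intro allI impI notI)
    have *: False if "i < j" "j < length p" "p ! i = p ! j" for i j
      using walk_in_shorten[OF p that(1,2)] that(3) shortest by (metis not_less)
    fix i j assume "i < length p" "j < length p" "i \<noteq> j" "p ! i = p ! j"
    then show False using *[of i j] *[of j i] by (metis linorder_neqE_nat)
  qed
  show "chordless G p"
    unfolding chordless_def
  proof (intro allI impI)
    fix i j assume ij: "i < j" "j < length p"
    show "adj G (p ! i) (p ! j) \<longleftrightarrow> j = Suc i"
    proof
      assume "adj G (p ! i) (p ! j)"
      then have a: "adj G (p ! i) (p ! j) \<or> p ! i = p ! j" by simp
      show "j = Suc i"
      proof (rule ccontr)
        assume "j \<noteq> Suc i"
        then have "Suc i < j \<or> p ! i = p ! j" using ij by simp
        from walk_in_shorten[OF p ij a this] obtain q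
          where "walk_in G S q" "hd q = hd p" "last q = last p" "length q < length p" .
        then show False using shortest[of q] by simp
      qed
    qed (use p ij in \<open>auto simp: walk_in_def successively_nth\<close>)
  qed
qed

lemma reach_path:
  assumes "reach G S u v" "u \<in> S"
  obtains p where "walk_in G S p" "hd p = u" "last p = v" "distinct p" "chordless G p"
proof -
  let ?Q = "\<lambda>p. walk_in G S p \<and> hd p = u \<and> last p = v"
  obtain p0 where "?Q p0" using reach_walk[OF assms] by blast
  then obtain p where "?Q p" "\<And>q. ?Q q \<Longrightarrow> length p \<le> length q"
    using ex_has_least_nat[of ?Q p0 length] by blast
  then show ?thesis using shortest_walk_chordless[of G S p] that by metis
qed

text \<open>The cyclic list is read from the successor of \<open>z\<close> round to its predecessor.
  This passes over the place where the list \<open>c\<close> is closed up, hence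
  \<open>ys @ xs\<close>.\<close>

lemma cycle_split:
  assumes "is_cycle G c" "z \<in> set c"
  obtains q where "walk_in G (set c - {z}) q" "set q = set c - {z}" "distinct q" "2 \<le> length q"
    "adj G z (hd q)" "adj G z (last q)"
proof -
  obtain xs ys where c: "c = xs @ z # ys" using assms(2) by (meson split_list)
  let ?q = "ys @ xs"
  have l: "3 \<le> length c" "distinct c" "successively (adj G) c" "adj G (last c) (hd c)"
    using assms(1) by (auto simp: is_cycle_iff)
  have len: "2 \<le> length ?q" using l c by auto
  have set: "set ?q = set c - {z}" using l(2) c by auto
  have s: "successively (adj G) xs" "successively (adj G) ys" "xs \<noteq> [] \<Longrightarrow> adj G (last xs) z" "ys \<noteq> [] \<Longrightarrow> adj G z (hd ys)"
    using l(3) c by (auto simp: successively_append_iff successively_Cons)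
  have "successively (adj G) ?q"
  proof (cases "xs = [] \<or> ys = []")
    case False
    then have "adj G (last ys) (hd xs)" using l(4) c by simp
    then show ?thesis using s by (simp add: successively_append_iff)
  next
    case True
    then show ?thesis using s(1,2) by auto
  qed
  then have B: "walk_in G (set c - {z}) ?q" using set len unfolding walk_in_def by force
  have C: "adj G z (hd ?q)"
  proof (cases "ys = []")
    case True
    then have "last c = z" "hd c = hd xs" using c len by (auto simp: hd_append)
    then show ?thesis using True l(4) by simp
  qed (use s(4) in simp)
  have D: "adj G z (last ?q)"
  proof (cases "xs = []")
    case True
    then have "last c = last ys" "hd c = z" using c len by auto
    then show ?thesis using True l(4) by (simp add: adj_commute)
  qed (use s(3) in \<open>simp add: adj_commute\<close>)
  show ?thesis using that[OF B set _ len C D] l(2) c by auto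
qed

lemma cycle_minus_reach:
  assumes "is_cycle G c" "u \<in> set c - {z}" "v \<in> set c - {z}"
  shows "reach G (set c - {z}) u v"
proof (cases "z \<in> set c")
  case True
  then show ?thesis using cycle_split[OF assms(1) True] assms walk_in_reach by metis
next
  case False
  then have "walk_in G (set c - {z}) c"
    using assms by (auto simp: walk_in_def is_cycle_iff)
  then show ?thesis using assms walk_in_reach by fastforce
qed

lemma cycle_two_neighbours:
  assumes "is_cycle G c" "z \<in> set c"
  obtains p q where "p \<noteq> q" "p \<in> set c - {z}" "q \<in> set c - {z}" "adj G z p" "adj G z q"
proof -
  obtain l where l: "walk_in G (set c - {z}) l" "set l = set c - {z}" "distinct l" "2 \<le> length l"
    "adj G z (hd l)" "adj G z (last l)" using cycle_split[OF assms] .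
  have ne: "l \<noteq> []" using l(4) by auto
  then have "hd l \<noteq> last l" using l(3,4)
    by (cases l) (auto split: if_splits)
  then show ?thesis using that[of "hd l" "last l"] l ne by (metis hd_in_set last_in_set)
qed

lemma girth_cycle: "enat k \<le> girth G \<Longrightarrow> is_cycle G c \<Longrightarrow> k \<le> length c"
  unfolding girth_def by (metis (mono_tags, lifting) Inf_lower enat_ord_simps(1) mem_Collect_eq order_trans)

lemma linked_mono: "linked G X S \<Longrightarrow> S \<subseteq> T \<Longrightarrow> linked G X T"
  unfolding linked_def by (meson reach_mono subset_trans)

lemma min_linked_subset: "min_linked G X S \<Longrightarrow> linked G X T \<Longrightarrow> T \<subseteq> S \<Longrightarrow> T = S"
  unfolding min_linked_def by (metis Diff_empty linked_mono subset_Diff_insert subset_antisym subsetI)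

lemma ex_min_linked:
  assumes "linked G X S" "finite S"
  obtains M where "M \<subseteq> S" "min_linked G X M"
proof -
  have "\<exists>M. M \<subseteq> S \<and> min_linked G X M"
    using assms(2,1)
  proof (induction S rule: finite_psubset_induct)
    case (psubset S)
    show ?case
    proof (cases "min_linked G X S")
      case False
      then obtain u where "u \<in> S" "linked G X (S - {u})" using psubset by (auto simp: min_linked_def)
      then show ?thesis using psubset.IH[of "S - {u}"] by blast
    qed auto
  qed
  then show ?thesis using that by blast
qed

text \<open>A vertex that a terminal does not reach lies on no walk between terminals, so it could
  be deleted.\<close>

lemma min_linked_connected:
  assumes "min_linked G X S" "X \<noteq> {}" "u \<in> S" "v \<in> S"
  shows "reach G S u v"
proof -
  obtain x where x: "x \<in> X" using assms by auto
  have l: "linked G X S" using assms by (simp add: min_linked_def)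
  have *: "reach G S x w" if w: "w \<in> S" for w
  proof (rule ccontr)
    assume n: "\<not> reach G S x w"
    have "reach G (S - {w}) x y" if "y \<in> X" for y
    proof -
      have xS: "x \<in> S" using x l by (auto simp: linked_def)
      have r: "reach G S x y" using that x l by (auto simp: linked_def)
      obtain p where p: "walk_in G S p" "hd p = x" "last p = y"
        using reach_walk[OF r xS] by blast
      have "w \<notin> set p"
        using n walk_in_reach[OF p(1), of x w] p by (metis hd_in_set walk_in_def)
      then have "walk_in G (S - {w}) p" using p by (auto simp: walk_in_def)
      then show ?thesis using walk_in_reach p by (metis hd_in_set last_in_set walk_in_def)
    qed
    moreover have "X \<subseteq> S - {w}" using n l x by (auto simp: linked_def)
    ultimately have "linked G X (S - {w})"
      unfolding linked_def using reach_commute reach_trans by metis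
    then show False using assms w by (auto simp: min_linked_def)
  qed
  then show ?thesis using assms by (meson reach_commute reach_trans)
qed

text \<open>Deleting a vertex all of whose neighbours lie on a cycle through it disconnects nothing.\<close>

lemma min_linked_cycle_escape:
  assumes m: "min_linked G X M" and c: "is_cycle G c" "set c \<subseteq> M" and u: "u \<in> set c" "u \<notin> X" and X: "X \<noteq> {}"
  obtains w where "w \<in> M" "adj G u w" "w \<notin> set c"
proof (rule ccontr)
  assume "\<not> thesis"
  then have nb: "\<And>w. w \<in> M \<Longrightarrow> adj G u w \<Longrightarrow> w \<in> set c" using that by blast
  obtain z where z: "z \<in> set c - {u}" using cycle_two_neighbours[OF c(1) u(1)] by blast
  have l: "linked G X M" using m by (simp add: min_linked_def)
  have *: "reach G (M - {u}) x z" if x: "x \<in> X" for x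
  proof -
    have xM: "x \<in> M" "x \<noteq> u" using x u l by (auto simp: linked_def)
    show ?thesis
    proof (cases "x \<in> set c")
      case True
      then show ?thesis using cycle_minus_reach[OF c(1), of x u z] xM z c(2)
        by (auto elim!: reach_mono)
    next
      case False
      have "reach G M x z" using min_linked_connected[OF m X xM(1)] z c by auto
      then obtain y where y: "y \<in> set c" "y \<in> M" "reach G (insert y (M - set c)) x y"
        using reach_first_hit[of G M x z "set c"] z False xM by auto
      have "y \<noteq> u"
      proof
        assume "y = u"
        then have r: "reach G (insert u (M - set c)) u x" using y reach_commute by metis
        \<comment> \<open>The singleton is closed: among the vertices of \<open>M\<close> off the
          cycle, \<open>u\<close> has no neighbour.\<close>
        have "x \<in> {u}"
          by (rule reach_closed[OF r]) (use nb in auto)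
        then show False using xM by auto
      qed
      then have "reach G (M - {u}) x y" using y u by (auto elim!: reach_mono)
      moreover have "reach G (M - {u}) y z"
        using cycle_minus_reach[OF c(1), of y u z] \<open>y \<noteq> u\<close> y z c(2) by (auto elim!: reach_mono)
      ultimately show ?thesis by (rule reach_trans)
    qed
  qed
  then have "linked G X (M - {u})"
    unfolding linked_def using l u by (auto simp: linked_def intro: reach_trans dest: reach_commute[THEN iffD1])
  then show False using m c u by (auto simp: min_linked_def)
qed

section \<open>Graphs whose girth is at least the number of terminals\<close>

locale kgraph =
  fixes G :: "'a graph" and k :: nat and X :: "'a set"
  assumes simple: "simple_graph G"
    and girth: "enat k \<le> girth G"
    and k5: "5 \<le> k"
    and card_X: "card X = k"
    and terminals: "\<And>x. x \<in> X \<Longrightarrow> terminal G x"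
begin

lemma finite_verts: "finite (verts G)"
  using simple by (simp add: simple_graph_def)

lemma adj_in_verts: "adj G u v \<Longrightarrow> u \<in> verts G \<and> v \<in> verts G"
  using simple by (auto simp: simple_graph_def adj_def)

lemma adj_irrefl: "\<not> adj G u u"
  using simple by (auto simp: simple_graph_def adj_def)

lemma finite_X: "finite X" and X_nonempty: "X \<noteq> {}"
  using card_X k5 by (auto intro: card_ge_0_finite)

lemma X_verts: "X \<subseteq> verts G"
  using terminals by (auto simp: terminal_def)

lemma terminal_unique:
  assumes "x \<in> X" "adj G x u" "adj G x v" shows "u = v"
proof -
  have "card {u \<in> verts G. adj G x u} = 1"
    using terminals[OF assms(1)] by (simp add: terminal_def degree_def)
  then obtain w where w: "{u \<in> verts G. adj G x u} = {w}" by (meson card_1_singletonE)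
  have "u \<in> {u \<in> verts G. adj G x u}" "v \<in> {u \<in> verts G. adj G x u}"
    using assms adj_in_verts by auto
  then show ?thesis unfolding w by simp
qed

lemma cycle_length: "is_cycle G c \<Longrightarrow> k \<le> length c"
  using girth girth_cycle by blast

lemma cycle_terminal: "is_cycle G c \<Longrightarrow> x \<in> set c \<Longrightarrow> x \<notin> X"
  using cycle_two_neighbours terminal_unique by metis

text \<open>Because of this a vertex outside a path never sees two consecutive vertices of it, which
  is the source of the interior vertex in \<open>cycle_through_outside\<close>.\<close>

lemma no_triangle: "adj G u v \<Longrightarrow> adj G v w \<Longrightarrow> \<not> adj G w u"
  using cycle_length[of "[u, v, w]"] k5 adj_in_verts adj_irrefl
  by (force simp: is_cycle_iff)

text \<open>Its purpose is to exclude, for a \<open>K4\<close> structure, an extra vertex adjacent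
  to the ends of two paths that meet in the same branch vertex.\<close>

lemma no_square: "adj G u v \<Longrightarrow> adj G v w \<Longrightarrow> adj G w t \<Longrightarrow> adj G t u \<Longrightarrow> u = w \<or> v = t"
  using cycle_length[of "[u, v, w, t]"] k5 adj_in_verts adj_irrefl
  by (force simp: is_cycle_iff)

lemma edges_induced: "edges (induced G S) = {{u, v} | u v. u \<in> S \<and> v \<in> S \<and> adj G u v}"
proof (intro set_eqI iffI)
  fix e assume "e \<in> edges (induced G S)"
  then have e: "e \<in> edges G" "e \<subseteq> S" by (auto simp: induced_def)
  then have "card e = 2" using simple by (auto simp: simple_graph_def)
  then obtain u v where "e = {u, v}" by (meson card_2_iff)
  then show "e \<in> {{u, v} | u v. u \<in> S \<and> v \<in> S \<and> adj G u v}"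
    using e by (auto simp: adj_def)
qed (auto simp: induced_def adj_def)

lemma simple_induced: "simple_graph (induced G S)"
  using simple by (auto simp: simple_graph_def induced_def)

lemma terminal_induced:
  assumes "x \<in> X" "x \<in> S" "y \<in> S" "adj G x y"
  shows "terminal (induced G S) x"
proof -
  have "{u \<in> verts (induced G S). adj (induced G S) x u} = {y}"
    using assms terminal_unique adj_in_verts by (auto simp: adj_induced) (auto simp: induced_def)
  then show ?thesis
    using assms X_verts by (auto simp: terminal_def degree_def induced_def)
qed

text \<open>A \<open>k_structure\<close> expressed by adjacency in \<open>G\<close> instead of by
  the edge set of an induced subgraph, so that neighbours can be read off directly;
  \<open>kst_iff\<close> shows that both notions agree.\<close>

definition kst :: "(nat \<Rightarrow> 'a list) \<Rightarrow> bool" where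
  "kst P \<longleftrightarrow> (\<Union>i<k. set (P i)) \<subseteq> verts G \<and> bij_betw (\<lambda>i. hd (P i)) {..<k} X \<and>
     (\<forall>i<k. 2 \<le> length (P i) \<and> distinct (P i) \<and> chordless G (P i)) \<and>
     (\<forall>i<k. \<forall>j<k. i \<noteq> j \<longrightarrow> set (P i) \<inter> set (P j) = {}) \<and>
     (\<forall>i<k. \<forall>j<k. i \<noteq> j \<longrightarrow> (\<forall>u\<in>set (P i). \<forall>v\<in>set (P j). adj G u v \<longleftrightarrow>
        u = last (P i) \<and> v = last (P j) \<and> (j = Suc i mod k \<or> i = Suc j mod k)))"

lemma Suc_mod_neq: "i < k \<Longrightarrow> Suc i mod k \<noteq> i"
  using k5 by (cases "Suc i = k") auto

lemma Suc_mod_less: "Suc i mod k < k"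
  using k5 by auto

lemma kst_structure:
  assumes "kst P"
  shows "k_structure k X (induced G (\<Union>i<k. set (P i))) P"
proof -
  let ?S = "\<Union>i<k. set (P i)"
  have V: "?S \<subseteq> verts G" and bij: "bij_betw (\<lambda>i. hd (P i)) {..<k} X"
    and len: "\<And>i. i < k \<Longrightarrow> 2 \<le> length (P i)" and dist: "\<And>i. i < k \<Longrightarrow> distinct (P i)"
    and chord: "\<And>i. i < k \<Longrightarrow> chordless G (P i)"
    and disj: "\<And>i j. i < k \<Longrightarrow> j < k \<Longrightarrow> i \<noteq> j \<Longrightarrow> set (P i) \<inter> set (P j) = {}"
    and cross: "\<And>i j u v. i < k \<Longrightarrow> j < k \<Longrightarrow> i \<noteq> j \<Longrightarrow> u \<in> set (P i) \<Longrightarrow> v \<in> set (P j) \<Longrightarrow> adj G u v \<longleftrightarrow>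
        u = last (P i) \<and> v = last (P j) \<and> (j = Suc i mod k \<or> i = Suc j mod k)"
    using assms unfolding kst_def by blast+
  have edg: "edges (induced G ?S) = (\<Union>i<k. path_edges (P i)) \<union> {{last (P i), last (P (Suc i mod k))} | i. i < k}"
  proof (intro set_eqI iffI)
    fix e assume "e \<in> edges (induced G ?S)"
    then obtain u v i j where e: "e = {u, v}" "adj G u v" "i < k" "j < k" "u \<in> set (P i)" "v \<in> set (P j)"
      unfolding edges_induced by blast
    show "e \<in> (\<Union>i<k. path_edges (P i)) \<union> {{last (P i), last (P (Suc i mod k))} | i. i < k}"
    proof (cases "i = j")
      case True
      obtain a b where ab: "a < length (P i)" "b < length (P i)" "u = P i ! a" "v = P i ! b"
        using e True by (metis in_set_conv_nth)
      have "a \<noteq> b" using e ab adj_irrefl by auto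
      then have "b = Suc a \<or> a = Suc b"
        using chord[OF e(3)] ab e(2) unfolding chordless_def by (metis adj_commute linorder_neqE_nat)
      then have "e \<in> path_edges (P i)"
        unfolding path_edges_def using ab e by (auto simp: insert_commute)
      then show ?thesis using e by auto
    next
      case False
      then show ?thesis using cross[of i j u v] e by (auto simp: insert_commute)
    qed
  next
    fix e assume "e \<in> (\<Union>i<k. path_edges (P i)) \<union> {{last (P i), last (P (Suc i mod k))} | i. i < k}"
    then consider i j where "i < k" "Suc j < length (P i)" "e = {P i ! j, P i ! Suc j}"
      | i where "i < k" "e = {last (P i), last (P (Suc i mod k))}"
      unfolding path_edges_def by blast
    then show "e \<in> edges (induced G ?S)"
    proof cases
      case 1
      then have "adj G (P i ! j) (P i ! Suc j)" using chord[of i] by (auto simp: chordless_def)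
      moreover have "P i ! j \<in> ?S" "P i ! Suc j \<in> ?S" using 1 by (auto intro!: bexI[of _ i])
      ultimately show ?thesis unfolding edges_induced using 1 by blast
    next
      case 2
      let ?j = "Suc i mod k"
      have j: "?j < k" "i \<noteq> ?j" using Suc_mod_neq[of i] Suc_mod_less 2 by auto
      have l: "last (P i) \<in> set (P i)" "last (P ?j) \<in> set (P ?j)"
        using len[of i] len[of ?j] 2 j by (auto intro!: last_in_set)
      then have "adj G (last (P i)) (last (P ?j))" using cross[of i ?j] j 2 by auto
      then show ?thesis unfolding edges_induced using 2 j l by blast
    qed
  qed
  have "terminal (induced G ?S) x" if x: "x \<in> X" for x
  proof -
    obtain i where i: "i < k" "x = hd (P i)" using bij x by (auto simp: bij_betw_def)
    then have l: "2 \<le> length (P i)" "P i \<noteq> []" using len by force+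
    then have x0: "x = P i ! 0" "P i ! 0 \<in> set (P i)" "P i ! 1 \<in> set (P i)" using i by (auto simp: hd_conv_nth)
    then have "adj G x (P i ! 1)" using chord[OF i(1)] l unfolding chordless_def by auto
    then show ?thesis using x0 i x by (intro terminal_induced[where y = "P i ! 1"]) auto
  qed
  moreover have "verts (induced G ?S) = ?S" using V by (auto simp: induced_def)
  ultimately show ?thesis
    unfolding k_structure_def using simple_induced bij len dist disj edg by blast
qed

lemma structure_kst:
  assumes "(\<Union>i<k. set (P i)) \<subseteq> verts G" "k_structure k X (induced G (\<Union>i<k. set (P i))) P"
  shows "kst P"
proof -
  let ?S = "\<Union>i<k. set (P i)"
  have bij: "bij_betw (\<lambda>i. hd (P i)) {..<k} X"
    and len: "\<And>i. i < k \<Longrightarrow> 2 \<le> length (P i)" and dist: "\<And>i. i < k \<Longrightarrow> distinct (P i)"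
    and disj: "\<And>i j. i < k \<Longrightarrow> j < k \<Longrightarrow> i \<noteq> j \<Longrightarrow> set (P i) \<inter> set (P j) = {}"
    and edg: "edges (induced G ?S) = (\<Union>i<k. path_edges (P i)) \<union> {{last (P i), last (P (Suc i mod k))} | i. i < k}"
    using assms(2) unfolding k_structure_def by (elim conjE; simp)+
  have last_in: "last (P i) \<in> set (P i)" if "i < k" for i using len[OF that] by (intro last_in_set) auto
  have same: "i = j" if "u \<in> set (P i)" "u \<in> set (P j)" "i < k" "j < k" for u i j
    using disj that by blast
  have adj: "adj G u v \<longleftrightarrow> (\<exists>l<k. {u, v} \<in> path_edges (P l)) \<or> (\<exists>l<k. {u, v} = {last (P l), last (P (Suc l mod k))})"
    if "u \<in> ?S" "v \<in> ?S" for u v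
  proof -
    have "adj G u v \<longleftrightarrow> {u, v} \<in> edges (induced G ?S)" using that by (auto simp: adj_def induced_def)
    then show ?thesis unfolding edg by blast
  qed
  have pe: "u \<in> set (P l) \<and> v \<in> set (P l)" if "{u, v} \<in> path_edges (P l)" for u v l
    using that unfolding path_edges_def by (auto simp: doubleton_eq_iff)
  have ch: "chordless G (P i)" if i: "i < k" for i
    unfolding chordless_def
  proof (intro allI impI)
    fix a b assume ab: "a < b" "b < length (P i)"
    have S: "P i ! a \<in> set (P i)" "P i ! b \<in> set (P i)" using ab by auto
    then have "adj G (P i ! a) (P i ! b) \<longleftrightarrow> (\<exists>l<k. {P i ! a, P i ! b} \<in> path_edges (P l)) \<or>
       (\<exists>l<k. {P i ! a, P i ! b} = {last (P l), last (P (Suc l mod k))})" using adj i by blast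
    moreover have False if "l < k" "{P i ! a, P i ! b} = {last (P l), last (P (Suc l mod k))}" for l
    proof -
      have "last (P l) \<in> set (P i)" "last (P (Suc l mod k)) \<in> set (P i)" using that S by (metis doubleton_eq_iff)+
      then show False using same[of _ i l] same[of _ i "Suc l mod k"] last_in that i Suc_mod_less Suc_mod_neq by metis
    qed
    moreover have "(\<exists>l<k. {P i ! a, P i ! b} \<in> path_edges (P l)) \<longleftrightarrow> {P i ! a, P i ! b} \<in> path_edges (P i)"
      using pe same S i by metis
    moreover have "{P i ! a, P i ! b} \<in> path_edges (P i) \<longleftrightarrow> b = Suc a"
      using ab dist[OF i] unfolding path_edges_def by (auto simp: doubleton_eq_iff nth_eq_iff_index_eq)
    ultimately show "adj G (P i ! a) (P i ! b) \<longleftrightarrow> b = Suc a" by blast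
  qed
  have cr: "adj G u v \<longleftrightarrow> u = last (P i) \<and> v = last (P j) \<and> (j = Suc i mod k \<or> i = Suc j mod k)"
    if ij: "i < k" "j < k" "i \<noteq> j" "u \<in> set (P i)" "v \<in> set (P j)" for i j u v
  proof -
    have "adj G u v \<longleftrightarrow> (\<exists>l<k. {u, v} \<in> path_edges (P l)) \<or> (\<exists>l<k. {u, v} = {last (P l), last (P (Suc l mod k))})"
      using adj ij by blast
    moreover have "\<not> (\<exists>l<k. {u, v} \<in> path_edges (P l))" using pe same ij by metis
    moreover have "(\<exists>l<k. {u, v} = {last (P l), last (P (Suc l mod k))}) \<longleftrightarrow>
      u = last (P i) \<and> v = last (P j) \<and> (j = Suc i mod k \<or> i = Suc j mod k)" (is "?L \<longleftrightarrow> ?R")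
    proof
      assume ?L
      then obtain l where l: "l < k" "{u, v} = {last (P l), last (P (Suc l mod k))}" by blast
      then have "u = last (P l) \<and> v = last (P (Suc l mod k)) \<or> v = last (P l) \<and> u = last (P (Suc l mod k))"
        by (auto simp: doubleton_eq_iff)
      then show ?R using same last_in ij l Suc_mod_less by metis
    next
      assume ?R
      then show ?L using ij by (metis doubleton_eq_iff)
    qed
    ultimately show ?thesis by blast
  qed
  show ?thesis
    unfolding kst_def
  proof (intro conjI allI impI ballI)
    fix i j u v assume "i < k" "j < k" "i \<noteq> j" "u \<in> set (P i)" "v \<in> set (P j)"
    then show "adj G u v \<longleftrightarrow> u = last (P i) \<and> v = last (P j) \<and> (j = Suc i mod k \<or> i = Suc j mod k)"
      by (rule cr)
  qed (simp_all add: assms(1) bij len dist ch disj)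
qed

lemma kst_iff:
  "kst P \<longleftrightarrow> (\<Union>i<k. set (P i)) \<subseteq> verts G \<and> k_structure k X (induced G (\<Union>i<k. set (P i))) P"
proof -
  have "kst P \<Longrightarrow> (\<Union>i<k. set (P i)) \<subseteq> verts G" by (simp add: kst_def)
  then show ?thesis using kst_structure[of P] structure_kst[of P] by argo
qed

text \<open>The chord closes up the arc from \<open>c ! i\<close> to \<open>c ! j\<close> to a cycle
  with \<open>j - i + 1\<close> vertices. That is fewer than \<open>k\<close> unless the arc is the
  whole list, and it fails to be a cycle only for consecutive positions.\<close>

lemma cycle_chord:
  assumes c: "is_cycle G c" "length c = k" and ij: "i < j" "j < k" and a: "adj G (c ! i) (c ! j)"
  shows "j = Suc i \<or> i = 0 \<and> Suc j = k"
proof (rule ccontr)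
  assume n: "\<not> ?thesis"
  let ?d = "take (Suc j - i) (drop i c)"
  have len: "length ?d = Suc j - i" using ij c by auto
  have nth: "?d ! m = c ! (i + m)" if "m < Suc j - i" for m using that c ij by auto
  have ne: "?d \<noteq> []" using len ij by auto
  have "hd ?d = c ! i" unfolding hd_conv_nth[OF ne] using nth[of 0] ij by simp
  moreover have e: "Suc j - i - 1 = j - i" using ij by simp
  have "last ?d = ?d ! (j - i)" unfolding last_conv_nth[OF ne] len e ..
  then have "last ?d = c ! j" using nth[of "j - i"] ij by simp
  moreover have "successively (adj G) ?d"
    using c by (auto simp: is_cycle_iff successively_nth)
  moreover have "distinct ?d" "set ?d \<subseteq> verts G"
    using c by (auto simp: is_cycle_iff dest!: in_set_takeD in_set_dropD)
  ultimately have "is_cycle G ?d" unfolding is_cycle_iff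
    using len n ij a by (auto simp: adj_commute)
  then show False using cycle_length len ij n by fastforce
qed

text \<open>Each vertex \<open>z\<close> of the cycle is indispensable, so its deletion cuts some
  terminal \<open>f z\<close> off from the rest of the cycle. Different vertices have different such
  terminals. Hence the cycle has at most \<open>k\<close> vertices, by the girth exactly
  \<open>k\<close>, and every terminal belongs to one of them; the paths of the structure are
  shortest connections from \<open>f z\<close> to \<open>z\<close>.\<close>

lemma min_linked_cycle:
  assumes m: "min_linked G X S" and S: "S \<subseteq> verts G" and c: "is_cycle G c" "set c \<subseteq> S"
  obtains P where "kst P" "S = (\<Union>i<k. set (P i))"
proof -
  let ?C = "set c"
  have lS: "linked G X S" using m by (simp add: min_linked_def)
  have CX: "?C \<inter> X = {}" using cycle_terminal[OF c(1)] by auto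
  \<comment> \<open>If every terminal still reached the rest of the cycle, that rest would link all
    of them, and \<open>z\<close> could be deleted.\<close>
  have "\<exists>x\<in>X. \<forall>w\<in>?C - {z}. \<not> reach G (S - {z}) x w" if z: "z \<in> ?C" for z
  proof (rule ccontr)
    assume "\<not> ?thesis"
    then have *: "\<forall>x\<in>X. \<exists>w\<in>?C - {z}. reach G (S - {z}) x w" by blast
    have "reach G (S - {z}) x y" if xy: "x \<in> X" "y \<in> X" for x y
    proof -
      obtain w w' where w: "w \<in> ?C - {z}" "w' \<in> ?C - {z}" "reach G (S - {z}) x w" "reach G (S - {z}) y w'"
        using * xy by blast
      have "reach G (S - {z}) w w'"
        using cycle_minus_reach[OF c(1) w(1,2)] c(2) by (auto elim!: reach_mono)
      then show ?thesis using w by (meson reach_trans reach_commute)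
    qed
    then have "linked G X (S - {z})" using lS CX z by (auto simp: linked_def)
    then show False using m z c by (auto simp: min_linked_def)
  qed
  then obtain f where f: "\<And>z. z \<in> ?C \<Longrightarrow> f z \<in> X"
    "\<And>z w. z \<in> ?C \<Longrightarrow> w \<in> ?C - {z} \<Longrightarrow> \<not> reach G (S - {z}) (f z) w"
    by metis
  have fS: "f z \<in> S" if "z \<in> ?C" for z using f(1)[OF that] lS by (auto simp: linked_def)
  \<comment> \<open>The walk from \<open>f z\<close> meets the cycle first in \<open>z\<close>: if
    it met the cycle elsewhere, it would reach the rest of the cycle without
    \<open>z\<close>.\<close>
  have fr: "reach G (insert z (S - ?C)) (f z) z" if z: "z \<in> ?C" for z
  proof -
    have "reach G S (f z) z" using min_linked_connected[OF m X_nonempty fS[OF z]] z c by auto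
    then obtain y where y: "y \<in> ?C" "y \<in> S" "reach G (insert y (S - ?C)) (f z) y"
      using reach_first_hit[of G S "f z" z ?C] z fS CX f by blast
    have "y = z"
    proof (rule ccontr)
      assume "y \<noteq> z"
      then have "reach G (S - {z}) (f z) y" using y z by (auto elim!: reach_mono)
      then show False using f(2)[OF z] y \<open>y \<noteq> z\<close> by auto
    qed
    then show ?thesis using y by simp
  qed
  \<comment> \<open>If \<open>z\<close> and \<open>w\<close> shared their terminal, the connection
    that belongs to \<open>w\<close> would lead it to \<open>w\<close> without passing
    \<open>z\<close>.\<close>
  have inj: "inj_on f ?C"
  proof (rule inj_onI, rule ccontr)
    fix z w assume zw: "z \<in> ?C" "w \<in> ?C" "f z = f w" "z \<noteq> w"
    have "insert w (S - ?C) \<subseteq> S - {z}" using zw c(2) by auto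
    then have "reach G (S - {z}) (f z) w" using fr[OF zw(2)] unfolding zw(3) by (rule reach_mono[rotated])
    then show False using f(2)[OF zw(1), of w] zw by auto
  qed
  have "card ?C \<le> k" using card_inj_on_le[OF inj, of X] f(1) finite_X card_X by auto
  moreover have dc: "distinct c" using c by (simp add: is_cycle_iff)
  ultimately have lk: "length c = k" using cycle_length[OF c(1)] by (simp add: distinct_card)
  then have cardC: "card ?C = k" using dc by (simp add: distinct_card)
  have img: "f ` ?C = X"
    using card_image[OF inj] cardC card_X finite_X f(1) by (intro card_subset_eq) auto
  have ci: "c ! i \<in> ?C" if "i < k" for i using that lk by simp
  have "\<exists>p. walk_in G (insert z (S - ?C)) p \<and> hd p = f z \<and> last p = z \<and> distinct p \<and> chordless G p" if z: "z \<in> ?C" for z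
    using reach_path[OF fr[OF z]] fS[OF z] f(1)[OF z] CX z by blast
  then obtain p where p: "\<And>z. z \<in> ?C \<Longrightarrow> walk_in G (insert z (S - ?C)) (p z) \<and> hd (p z) = f z \<and> last (p z) = z \<and> distinct (p z) \<and> chordless G (p z)"
    by metis
  define P where "P i = p (c ! i)" for i
  have W: "walk_in G (insert (c ! i) (S - ?C)) (P i)" "hd (P i) = f (c ! i)" "last (P i) = c ! i" "distinct (P i)" "chordless G (P i)"
    if "i < k" for i using p ci[OF that] unfolding P_def by auto
  have sub: "set (P i) \<subseteq> insert (c ! i) (S - ?C)" "P i \<noteq> []" if "i < k" for i using W[OF that] by (auto simp: walk_in_def)
  have neq: "c ! i \<noteq> c ! j" if "i < k" "j < k" "i \<noteq> j" for i j using that dc lk by (simp add: nth_eq_iff_index_eq)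
  have len: "2 \<le> length (P i)" if i: "i < k" for i
  proof -
    have "f (c ! i) \<noteq> c ! i" using f(1)[OF ci[OF i]] ci[OF i] CX by (metis IntI empty_iff)
    then have "hd (P i) \<noteq> last (P i)" using W(2,3)[OF i] by simp
    then show ?thesis using sub(2)[OF i] by (cases "P i") (auto simp: Suc_le_eq split: if_splits)
  qed
  \<comment> \<open>All of \<open>P i\<close> except its last vertex lies off the cycle, so the
    terminal reaches it there.\<close>
  have bl: "reach G (S - ?C) (f (c ! i)) u" if i: "i < k" and u: "u \<in> set (P i)" "u \<noteq> c ! i" for i u
  proof -
    have e: "P i = butlast (P i) @ [c ! i]" using W[OF i] sub[OF i] by (metis append_butlast_last_id)
    have ne: "butlast (P i) \<noteq> []" using len[OF i] by (cases "P i") auto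
    have "distinct (butlast (P i) @ [c ! i])" using W(4)[OF i] e by simp
    then have "c ! i \<notin> set (butlast (P i))" by simp
    moreover have "set (butlast (P i)) \<subseteq> set (P i)" by (meson in_set_butlastD subsetI)
    moreover have "successively (adj G) (butlast (P i))"
      using W(1)[OF i] e by (metis successively_append_iff walk_in_def)
    ultimately have w: "walk_in G (S - ?C) (butlast (P i))" using ne sub[OF i] by (auto simp: walk_in_def)
    have "hd (butlast (P i)) = f (c ! i)" using W(2)[OF i] e ne by (metis hd_append2)
    moreover have "u \<in> set (butlast (P i) @ [c ! i])" using u(1) e by simp
    then have "u \<in> set (butlast (P i))" using u(2) by simp
    ultimately show ?thesis using walk_in_reach[OF w] ne by (metis hd_in_set)
  qed
  \<comment> \<open>The common source of disjointness and of missing edges: if \<open>P i\<close>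
    touched another path anywhere but at \<open>c ! i\<close>, its terminal would reach
    \<open>c ! j\<close> with \<open>c ! i\<close> deleted.\<close>
  have no: False if ij: "i < k" "j < k" "i \<noteq> j" and u: "u \<in> set (P i)" "u \<noteq> c ! i" and w: "w \<in> set (P j)" "u = w \<or> adj G u w" for i j u w
  proof -
    have "S - ?C \<subseteq> S - {c ! i}" using ci[OF ij(1)] by blast
    then have "reach G (S - {c ! i}) (f (c ! i)) u" by (rule reach_mono[OF bl[OF ij(1) u]])
    moreover have "w \<in> insert (c ! j) (S - ?C)" "u \<in> insert (c ! i) (S - ?C)"
      using w(1) u(1) sub(1)[OF ij(1)] sub(1)[OF ij(2)] by blast+
    then have "w \<in> S - {c ! i}" "u \<in> S - {c ! i}"
      using u(2) neq[OF ij] ci[OF ij(1)] ci[OF ij(2)] c(2) by auto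
    then have "reach G (S - {c ! i}) u w" using w by (auto intro: reach_step)
    moreover have "walk_in G (S - {c ! i}) (P j)"
      by (rule walk_in_mono[OF W(1)[OF ij(2)]]) (use neq[OF ij] ci ij c(2) in auto)
    then have "reach G (S - {c ! i}) w (c ! j)"
      using walk_in_reach w W(3)[OF ij(2)] sub(2)[OF ij(2)] by (metis last_in_set)
    ultimately have "reach G (S - {c ! i}) (f (c ! i)) (c ! j)" by (meson reach_trans)
    then show False using f(2)[OF ci[OF ij(1)]] ci[OF ij(2)] neq[OF ij] by auto
  qed
  have cyc: "adj G (c ! i) (c ! j) \<longleftrightarrow> j = Suc i mod k \<or> i = Suc j mod k" if ij: "i < k" "j < k" "i \<noteq> j" for i j
  proof -
    have *: "adj G (c ! i) (c ! (Suc i mod k))" if "i < k" for i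
    proof (cases "Suc i = k")
      case True
      have "c \<noteq> []" "i = length c - 1" "Suc i mod k = 0" using lk k5 True by auto
      then have "c ! i = last c" "c ! (Suc i mod k) = hd c" by (simp_all add: last_conv_nth hd_conv_nth)
      then show ?thesis using c by (simp add: is_cycle_iff)
    next
      case False
      then show ?thesis using c lk that by (auto simp: is_cycle_iff successively_nth)
    qed
    have "j = Suc i mod k \<or> i = Suc j mod k" if a: "adj G (c ! i) (c ! j)" "i < j" "j < k" for i j
      using cycle_chord[OF c(1) lk a(2,3,1)] a by auto
    from this[of i j] this[of j i] show ?thesis using *[of i] *[of j] ij adj_commute[of G "c ! i" "c ! j"]
      by (cases "i < j") auto
  qed
  have K: "kst P"
    unfolding kst_def
  proof (intro conjI allI impI ballI)
    show "(\<Union>i<k. set (P i)) \<subseteq> verts G" using sub S ci c(2) by blast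
    show "bij_betw (\<lambda>i. hd (P i)) {..<k} X"
    proof -
      have "bij_betw f ?C X" using inj img by (simp add: bij_betw_def)
      moreover have "bij_betw (\<lambda>i. c ! i) {..<k} ?C" using dc lk bij_betw_nth by blast
      ultimately have "bij_betw (f \<circ> (\<lambda>i. c ! i)) {..<k} X" by (meson bij_betw_trans)
      then show ?thesis using W(2) by (subst bij_betw_cong[where g = "f \<circ> (\<lambda>i. c ! i)"]) auto
    qed
    fix i assume i: "i < k"
    show "2 \<le> length (P i)" "distinct (P i)" "chordless G (P i)" using len W i by auto
    fix j assume j: "j < k" "i \<noteq> j"
    show "set (P i) \<inter> set (P j) = {}"
    proof (rule ccontr)
      assume "set (P i) \<inter> set (P j) \<noteq> {}"
      then obtain u where u: "u \<in> set (P i)" "u \<in> set (P j)" by blast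
      have "u \<noteq> c ! i \<or> u \<noteq> c ! j" using neq[OF i j] by auto
      then show False using no[OF i j u(1) _ u(2)] no[OF j(1) i j(2)[symmetric] u(2) _ u(1)] by auto
    qed
    fix u v assume u: "u \<in> set (P i)" and v: "v \<in> set (P j)"
    show "adj G u v \<longleftrightarrow> u = last (P i) \<and> v = last (P j) \<and> (j = Suc i mod k \<or> i = Suc j mod k)"
      using no[OF i j u _ v] no[OF j(1) i j(2)[symmetric] v _ u] cyc[OF i j] W(3)[OF i] W(3)[OF j(1)] adj_commute by metis
  qed
  let ?U = "\<Union>i<k. set (P i)"
  have US: "?U \<subseteq> S" using sub ci c(2) by blast
  have CU: "?C \<subseteq> ?U"
  proof
    fix z assume "z \<in> ?C"
    then obtain i where "i < k" "z = c ! i" using lk by (metis in_set_conv_nth)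
    then show "z \<in> ?U" using W(3)[of i] sub(2)[of i] by (metis UN_iff last_in_set lessThan_iff)
  qed
  have to0: "\<exists>i<k. reach G ?U x (c ! i)" if x: "x \<in> X" for x
  proof -
    obtain z where "z \<in> ?C" "x = f z" using x img by auto
    then obtain i where i: "i < k" "x = f (c ! i)" using lk by (metis in_set_conv_nth)
    have "walk_in G ?U (P i)" using W(1)[OF i(1)] i(1) by (auto simp: walk_in_def)
    then have "reach G ?U x (c ! i)" using walk_in_reach W(2,3)[OF i(1)] sub(2)[OF i(1)] i(2) by (metis hd_in_set last_in_set)
    then show ?thesis using i by blast
  qed
  have wc: "walk_in G ?U c" using c(1) CU by (auto simp: walk_in_def is_cycle_iff)
  \<comment> \<open>The union of the paths is itself linked, so minimality turns its inclusion in
    \<open>S\<close> into an equality.\<close>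
  have "linked G X ?U"
    unfolding linked_def
  proof (intro conjI ballI)
    show "X \<subseteq> ?U"
    proof
      fix x assume "x \<in> X"
      then obtain z where "z \<in> ?C" "x = f z" using img by auto
      then obtain i where i: "i < k" "x = f (c ! i)" using lk by (metis in_set_conv_nth)
      then show "x \<in> ?U" using W(2)[OF i(1)] sub(2)[OF i(1)] by (metis UN_iff hd_in_set lessThan_iff)
    qed
    fix x y assume "x \<in> X" "y \<in> X"
    then obtain i j where "i < k" "j < k" "reach G ?U x (c ! i)" "reach G ?U y (c ! j)" using to0 by blast
    then show "reach G ?U x y" using walk_in_reach[OF wc ci ci] by (meson reach_trans reach_commute)
  qed
  then have "?U = S" using min_linked_subset[OF m] US by blast
  then show ?thesis using that K by blast
qed

lemma min_linked_tree:
  assumes "min_linked G X S" "S \<subseteq> verts G" "\<nexists>c. is_cycle G c \<and> set c \<subseteq> S"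
  shows "induced_tree_containing G X S"
proof -
  have X: "X \<subseteq> S" using assms by (simp add: min_linked_def linked_def)
  have "connected_graph (induced G S)"
    unfolding connected_graph_def using X X_nonempty X_verts min_linked_connected[OF assms(1)]
    by (auto simp: induced_def reach_def)
  then show ?thesis
    unfolding induced_tree_containing_def is_tree_def using assms simple_induced is_cycle_induced X by metis
qed

end

section \<open>Connectors attached to a cycle structure\<close>

text \<open>A pair \<open>(D, x)\<close> is a test: \<open>D\<close> ought to separate
  \<open>x\<close> from the other terminals. One notion serves both kinds of structures, is monotone
  in the vertex set, and for the tests of a structure its failure on \<open>verts G\<close> means
  that the structure decomposes the graph. As \<open>y\<close> differs from \<open>x\<close>,
  reachability here forces both into \<open>S - D\<close>.\<close>

definition leaky :: "'a graph \<Rightarrow> 'a set \<Rightarrow> ('a set \<times> 'a) set \<Rightarrow> 'a set \<Rightarrow> bool" where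
  "leaky G X T S \<longleftrightarrow> (\<exists>(D, x)\<in>T. \<exists>y\<in>X - {x}. reach G (S - D) x y)"

definition k_tests :: "nat \<Rightarrow> (nat \<Rightarrow> 'a list) \<Rightarrow> ('a set \<times> 'a) set" where
  "k_tests k P = (\<lambda>i. ({last (P i)}, hd (P i))) ` {..<k}"

text \<open>The condition ranges over all minimal linked subsets, since it cannot be predicted in
  which of them a search by deletions ends.\<close>

definition good_cut :: "'a graph \<Rightarrow> 'a set \<Rightarrow> 'a set \<Rightarrow> 'a set \<Rightarrow> bool" where
  "good_cut G X S U \<longleftrightarrow> linked G X (S - U) \<and>
     (\<forall>M. M \<subseteq> S - U \<longrightarrow> min_linked G X M \<longrightarrow> (\<nexists>c. is_cycle G c \<and> set c \<subseteq> M))"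

lemma leaky_mono: "leaky G X T S \<Longrightarrow> S \<subseteq> S' \<Longrightarrow> leaky G X T S'"
  unfolding leaky_def by (fastforce intro: reach_mono)

lemma cyclic_shift:
  fixes i j k :: nat assumes "i < k" "j < k"
  obtains t where "t < k" "j = (i + t) mod k"
proof
  \<comment> \<open>Adding \<open>k\<close> before subtracting keeps the subtraction of natural
    numbers from being truncated when \<open>j < i\<close>.\<close>
  show "(j + k - i) mod k < k" using assms by simp
  show "j = (i + (j + k - i) mod k) mod k" using assms by (simp add: mod_add_right_eq)
qed

lemma mod_shift_eq:
  fixes i t t' k :: nat assumes "t < k" "t' < k"
  shows "(i + t) mod k = (i + t') mod k \<longleftrightarrow> t = t'"
proof
  have *: False if "(i + t) mod k = (i + t') mod k" "t < t'" "t' < k" for t t'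
  proof -
    have "k dvd (i + t') - (i + t)"
      using that by (metis mod_eq_dvd_iff_nat add_le_mono less_imp_le order_refl)
    then have "k dvd t' - t" by simp
    then show False using that by (auto dest!: dvd_imp_le)
  qed
  assume "(i + t) mod k = (i + t') mod k"
  then show "t = t'" using *[of t t'] *[of t' t] assms by (metis linorder_neqE_nat)
qed auto

lemma successively_appendI:
  "successively P xs \<Longrightarrow> successively P ys \<Longrightarrow> (xs \<noteq> [] \<Longrightarrow> ys \<noteq> [] \<Longrightarrow> P (last xs) (hd ys)) \<Longrightarrow>
    successively P (xs @ ys)"
  unfolding successively_append_iff by blast

locale kstruct = kgraph +
  fixes P :: "nat \<Rightarrow> 'a list"
  assumes kst: "kst P"
begin

definition K where "K = (\<Union>i<k. set (P i))"
abbreviation L where "L i \<equiv> length (P i)"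
abbreviation p where "p i a \<equiv> P i ! a"
abbreviation s where "s i \<equiv> last (P i)"
text \<open>The vertices that a cut may delete: ends of paths and their predecessors. There are at
  most \<open>2 * k\<close> of them, which bounds the number of cuts to be tried.\<close>

abbreviation opts where "opts \<equiv> {p i (L i - 1) | i. i < k} \<union> {p i (L i - 2) | i. i < k}"

lemma K_verts: "K \<subseteq> verts G"
  using kst by (simp add: kst_def K_def)

lemma path_K: "i < k \<Longrightarrow> set (P i) \<subseteq> K"
  by (auto simp: K_def)

lemma L2: "i < k \<Longrightarrow> 2 \<le> L i"
  using kst by (simp add: kst_def)

lemma k_pos: "0 < k" using k5 by simp

lemma s_nth: "i < k \<Longrightarrow> s i = p i (L i - 1)"
  using L2[of i] by (intro last_conv_nth) auto

lemma x_nth: "i < k \<Longrightarrow> hd (P i) = p i 0"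
  using L2[of i] by (intro hd_conv_nth) auto

lemma p_in: "i < k \<Longrightarrow> a < L i \<Longrightarrow> p i a \<in> K"
  using nth_mem unfolding K_def by blast

lemma in_K: "u \<in> K \<Longrightarrow> \<exists>i a. i < k \<and> a < L i \<and> u = p i a"
  by (auto simp: K_def in_set_conv_nth)

lemma disjoint: "i < k \<Longrightarrow> j < k \<Longrightarrow> i \<noteq> j \<Longrightarrow> set (P i) \<inter> set (P j) = {}"
  using kst unfolding kst_def by meson

lemma p_eq: "i < k \<Longrightarrow> j < k \<Longrightarrow> a < L i \<Longrightarrow> b < L j \<Longrightarrow> p i a = p j b \<longleftrightarrow> i = j \<and> a = b"
proof (cases "i = j")
  case True
  assume "i < k" "j < k" "a < L i" "b < L j"
  moreover have "distinct (P i)" using kst \<open>i < k\<close> by (simp add: kst_def)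
  ultimately show ?thesis using True by (simp add: nth_eq_iff_index_eq)
next
  case False
  assume *: "i < k" "j < k" "a < L i" "b < L j"
  then have "p i a \<in> set (P i)" "p j b \<in> set (P j)" by simp_all
  then show ?thesis using False disjoint[OF *(1,2) False] by auto
qed

lemma p_in_path: "i < k \<Longrightarrow> j < k \<Longrightarrow> a < L i \<Longrightarrow> p i a \<in> set (P j) \<longleftrightarrow> i = j"
  using disjoint[of i j] nth_mem[of a "P i"] by blast

lemma adj_same: "i < k \<Longrightarrow> a < L i \<Longrightarrow> b < L i \<Longrightarrow> adj G (p i a) (p i b) \<longleftrightarrow> b = Suc a \<or> a = Suc b"
proof -
  assume *: "i < k" "a < L i" "b < L i"
  have "chordless G (P i)" using kst *(1) by (simp add: kst_def)
  then show ?thesis using * adj_irrefl adj_commute[of G "p i a" "p i b"] unfolding chordless_def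
    by (cases a b rule: linorder_cases) auto
qed

lemma adj_diff: "i < k \<Longrightarrow> j < k \<Longrightarrow> i \<noteq> j \<Longrightarrow> a < L i \<Longrightarrow> b < L j \<Longrightarrow>
   adj G (p i a) (p j b) \<longleftrightarrow> a = L i - 1 \<and> b = L j - 1 \<and> (j = Suc i mod k \<or> i = Suc j mod k)"
proof -
  assume *: "i < k" "j < k" "i \<noteq> j" "a < L i" "b < L j"
  have "\<forall>i<k. \<forall>j<k. i \<noteq> j \<longrightarrow> (\<forall>u\<in>set (P i). \<forall>v\<in>set (P j). adj G u v \<longleftrightarrow>
        u = s i \<and> v = s j \<and> (j = Suc i mod k \<or> i = Suc j mod k))"
    using kst unfolding kst_def by (elim conjE)
  note cross = this[rule_format, OF *(1-3)]
  from cross[of "p i a" "p j b"] show ?thesis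
    using * L2[of i] L2[of j] p_eq[of i i a "L i - 1"] p_eq[of j j b "L j - 1"] by (simp add: s_nth)
qed

lemma adj_s: "i < k \<Longrightarrow> adj G (s i) (s (Suc i mod k))"
  using adj_diff[of i "Suc i mod k" "L i - 1" "L (Suc i mod k) - 1"] Suc_mod_neq[of i] Suc_mod_less[of i]
    L2[of i] L2[of "Suc i mod k"] by (simp add: s_nth)

lemma adj_last: "i < k \<Longrightarrow> adj G (p i (L i - 2)) (s i)"
proof -
  assume i: "i < k"
  obtain n where n: "L i = Suc (Suc n)" using L2[OF i] by (metis Suc_le_D numeral_2_eq_2 Suc_le_mono)
  then have "adj G (p i n) (p i (Suc n))" using adj_same[OF i, of n "Suc n"] by simp
  then show ?thesis using n by (simp add: s_nth[OF i])
qed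

lemma X_eq: "X = (\<lambda>i. p i 0) ` {..<k}"
proof -
  have "X = (\<lambda>i. hd (P i)) ` {..<k}" using kst by (auto simp: kst_def bij_betw_def)
  then show ?thesis using x_nth by (auto simp: image_iff)
qed

lemma neighbours_K:
  assumes "i < k" "a < L i" "w \<in> K" "adj G (p i a) w"
  shows "(\<exists>b<L i. w = p i b \<and> (b = Suc a \<or> a = Suc b)) \<or>
    a = L i - 1 \<and> (\<exists>j<k. j \<noteq> i \<and> w = s j \<and> (j = Suc i mod k \<or> i = Suc j mod k))"
proof -
  obtain j b where jb: "j < k" "b < L j" "w = p j b" using in_K[OF assms(3)] by blast
  show ?thesis
  proof (cases "i = j")
    case True
    then show ?thesis using adj_same[of i a b] assms jb by auto
  next
    case False
    then have d: "a = L i - 1" "b = L j - 1" "j = Suc i mod k \<or> i = Suc j mod k"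
      using adj_diff[OF assms(1) jb(1) False assms(2) jb(2)] assms(4) jb(3) by simp_all
    have "w = s j" using d(2) jb s_nth by simp
    then have "a = L i - 1 \<and> (\<exists>j<k. j \<noteq> i \<and> w = s j \<and> (j = Suc i mod k \<or> i = Suc j mod k))"
      using d(1,3) jb(1) False by (intro conjI exI[of _ j]) simp_all
    then show ?thesis by (rule disjI2)
  qed
qed

lemma neighbours_inner:
  assumes "i < k" "a < L i - 1" "w \<in> K" "adj G (p i a) w"
  shows "w = p i (Suc a) \<or> a > 0 \<and> w = p i (a - 1)"
proof -
  have "a < L i" "a \<noteq> L i - 1" using assms by simp_all
  then show ?thesis using neighbours_K[OF assms(1) _ assms(3,4)] by auto
qed

lemma segment_reach:
  assumes "i < k" "a \<le> b" "b < L i" "\<And>c. a \<le> c \<Longrightarrow> c \<le> b \<Longrightarrow> p i c \<in> W"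
  shows "reach G W (p i a) (p i b)"
  using assms(2-4)
proof (induction b rule: dec_induct)
  case (step n)
  have "reach G W (p i a) (p i n)" using step by auto
  moreover have "reach G W (p i n) (p i (Suc n))"
    using step by (intro reach_step) (auto simp: adj_same[OF assms(1)])
  ultimately show ?case by (rule reach_trans)
qed auto

lemma arc_reach:
  assumes "\<And>t. t \<le> m \<Longrightarrow> s ((a + t) mod k) \<in> W"
  shows "reach G W (s (a mod k)) (s ((a + m) mod k))"
  using assms
proof (induction m)
  case (Suc m)
  have "reach G W (s (a mod k)) (s ((a + m) mod k))" using Suc by auto
  moreover have "adj G (s ((a + m) mod k)) (s ((a + Suc m) mod k))"
    using adj_s[of "(a + m) mod k"] k_pos by (simp add: mod_Suc_eq)
  then have "reach G W (s ((a + m) mod k)) (s ((a + Suc m) mod k))"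
    using Suc.prems[of m] Suc.prems[of "Suc m"] by (intro reach_step) auto
  ultimately show ?case by (rule reach_trans)
qed auto

text \<open>Below its end a path offers a cycle no place to turn: each vertex there would force the
  one before it onto the cycle, down to the terminal, which has a single neighbour. So only ends
  remain, and each of them forces the next one. Consequently the deletion of any end destroys all
  cycles inside \<open>K\<close>.\<close>

lemma cycle_in_K:
  assumes c: "is_cycle G c" "set c \<subseteq> K" and i: "i < k"
  shows "s i \<in> set c"
proof -
  have inner: "p i a \<notin> set c" if "i < k" "a < L i - 1" for i a
    using that(2)
  proof (induction a rule: less_induct)
    case (less a)
    show ?case
    proof
      assume a: "p i a \<in> set c"
      obtain u w where uw: "u \<noteq> w" "u \<in> set c" "w \<in> set c" "adj G (p i a) u" "adj G (p i a) w"
        using cycle_two_neighbours[OF c(1) a] by blast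
      have "u = p i (Suc a) \<or> a > 0 \<and> u = p i (a - 1)" "w = p i (Suc a) \<or> a > 0 \<and> w = p i (a - 1)"
        using neighbours_inner[OF that(1) less.prems] uw c(2) by blast+
      then have "a > 0" "p i (a - 1) \<in> set c" using uw by auto
      moreover have "a - 1 < L i - 1" using less.prems by simp
      ultimately show False using less.IH[of "a - 1"] by simp
    qed
  qed
  have ends: "\<exists>i<k. u = s i" if "u \<in> set c" for u
  proof -
    have "u \<in> K" using that c(2) by blast
    then obtain i a where ia: "i < k" "a < L i" "u = p i a" using in_K by blast
    then have "\<not> a < L i - 1" using inner that by blast
    then have "a = L i - 1" using ia by simp
    then show ?thesis using ia s_nth by auto
  qed
  have s_inj: "s i = s j \<longleftrightarrow> i = j" if "i < k" "j < k" for i j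
    using that L2[of i] L2[of j] by (auto simp: s_nth p_eq)
  \<comment> \<open>The cycle uses two different neighbours of \<open>s i\<close> among the ends,
    and there is only one cyclic predecessor, so the successor is among them.\<close>
  have nxt: "s (Suc i mod k) \<in> set c" if i: "i < k" "s i \<in> set c" for i
  proof -
    obtain u w where uw: "u \<noteq> w" "u \<in> set c" "w \<in> set c" "adj G (s i) u" "adj G (s i) w"
      using cycle_two_neighbours[OF c(1) i(2)] by blast
    obtain a b where ab: "a < k" "b < k" "u = s a" "w = s b" using ends uw by meson
    have ne: "a \<noteq> i" "b \<noteq> i" "a \<noteq> b" using uw ab adj_irrefl by auto
    have cyc: "j = Suc i mod k \<or> i = Suc j mod k" if "j < k" "j \<noteq> i" "adj G (s i) (s j)" for j
      using adj_diff[OF i(1) that(1) that(2)[symmetric], of "L i - 1" "L j - 1"] that i L2[of i] L2[of j] by (simp add: s_nth)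
    have "a = Suc i mod k \<or> b = Suc i mod k"
    proof (rule ccontr)
      assume "\<not> ?thesis"
      then have "i = Suc a mod k" "i = Suc b mod k" using cyc[of a] cyc[of b] ab uw ne by auto
      then have "Suc a mod k = Suc b mod k" by simp
      then have "a = b" using ab(1,2) by (cases "Suc a = k"; cases "Suc b = k") auto
      then show False using ne by simp
    qed
    then show ?thesis using ab uw by auto
  qed
  have "c \<noteq> []" using c(1) by (auto simp: is_cycle_iff)
  then have "hd c \<in> set c" by simp
  then obtain j where j: "j < k" "s j \<in> set c" using ends by metis
  have "s ((j + t) mod k) \<in> set c" for t
  proof (induction t)
    case (Suc t)
    then show ?case using nxt[of "(j + t) mod k"] k_pos by (simp add: mod_Suc_eq)
  qed (use j in auto)
  moreover obtain t where "i = (j + t) mod k" using cyclic_shift[OF j(1) i] by blast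
  ultimately show ?thesis by simp
qed

text \<open>The cycle consists of \<open>v\<close> and the stretch of \<open>P i\<close> between two
  neighbours of \<open>v\<close>. These are not consecutive, so the stretch has an interior vertex,
  and such a vertex sees only its two path neighbours and possibly \<open>v\<close>, all of them on
  the cycle. It is the vertex that \<open>good_cutI\<close> asks for.\<close>

lemma cycle_through_outside:
  assumes c: "is_cycle G c" and v: "v \<notin> K" "v \<in> set c" "set c - {v} \<subseteq> K" and i: "i < k"
    and nb: "\<And>w. w \<in> set c \<Longrightarrow> adj G v w \<Longrightarrow> w \<in> set (P i)"
  obtains a where "Suc a < L i" "p i a \<in> set c" "\<And>w. w \<in> insert v K \<Longrightarrow> adj G (p i a) w \<Longrightarrow> w \<in> set c"
proof -
  obtain u w where uw: "u \<noteq> w" "u \<in> set c - {v}" "w \<in> set c - {v}" "adj G v u" "adj G v w"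
    using cycle_two_neighbours[OF c v(2)] by blast
  have "\<exists>a b. a < b \<and> b < L i \<and> p i a \<in> set c \<and> p i b \<in> set c \<and> adj G v (p i a) \<and> adj G v (p i b)"
  proof -
    obtain a where a: "a < L i" "u = p i a" using nb[of u] uw by (auto simp: in_set_conv_nth)
    obtain b where b: "b < L i" "w = p i b" using nb[of w] uw by (auto simp: in_set_conv_nth)
    have "a \<noteq> b" using uw a b by auto
    then show ?thesis
    proof (cases "a < b")
      case True
      then show ?thesis using a b uw by blast
    next
      case False
      then have "b < a" using \<open>a \<noteq> b\<close> by simp
      then show ?thesis using a b uw by blast
    qed
  qed
  then obtain a b where ab: "a < b" "b < L i" "p i a \<in> set c" "p i b \<in> set c" "adj G v (p i a)" "adj G v (p i b)"
    by blast
  have "b \<noteq> Suc a"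
  proof
    assume "b = Suc a"
    then have "adj G (p i a) (p i b)" using adj_same[OF i, of a b] ab by simp
    then show False using no_triangle[of v "p i a" "p i b"] ab adj_commute[of G "p i b" v] by simp
  qed
  \<comment> \<open>If position \<open>e\<close> were missing, the positions below \<open>e\<close>
    would be closed in the cycle without \<open>v\<close>, so \<open>p i b\<close> could not be
    reached from \<open>p i a\<close>.\<close>
  have between: "p i e \<in> set c" if "a < e" "e < b" for e
  proof (rule ccontr)
    assume e: "p i e \<notin> set c"
    have pv: "p i a \<noteq> v" "p i b \<noteq> v" using v(1) p_in[OF i] ab by auto
    have "reach G (set c - {v}) (p i a) (p i b)"
      using cycle_minus_reach[OF c, of "p i a" v "p i b"] ab pv by simp
    then have "p i b \<in> (p i) ` {..<e}"
    proof (rule reach_closed)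
      show "p i a \<in> (p i) ` {..<e}" using that by simp
      fix z w assume z: "z \<in> (p i) ` {..<e}" and w: "w \<in> set c - {v}" "adj G z w"
      then obtain d where d: "d < e" "z = p i d" by auto
      have "d < L i - 1" using d that ab by simp
      then have "w = p i (Suc d) \<or> d > 0 \<and> w = p i (d - 1)" using neighbours_inner[OF i] w v(3) d by blast
      then show "w \<in> (p i) ` {..<e}"
      proof
        assume wd: "w = p i (Suc d)"
        then have "Suc d \<noteq> e" using e w by auto
        then show ?thesis using wd d by simp
      qed (use d in auto)
    qed
    then obtain d where "d < e" "p i b = p i d" by auto
    then show False using p_eq[OF i i, of b d] ab that by simp
  qed
  show ?thesis
  proof (rule that)
    show "Suc (Suc a) < L i" "p i (Suc a) \<in> set c" using between[of "Suc a"] ab \<open>b \<noteq> Suc a\<close> by auto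
    fix w assume w: "w \<in> insert v K" "adj G (p i (Suc a)) w"
    show "w \<in> set c"
    proof (cases "w = v")
      case False
      then have "w = p i (Suc (Suc a)) \<or> w = p i a"
        using neighbours_inner[OF i, of "Suc a" w] w ab \<open>b \<noteq> Suc a\<close> by auto
      moreover have "p i (Suc (Suc a)) \<in> set c"
        using between[of "Suc (Suc a)"] ab \<open>b \<noteq> Suc a\<close> by (cases "b = Suc (Suc a)") auto
      ultimately show ?thesis using ab by auto
    qed (use v in simp)
  qed
qed

text \<open>By \<open>min_linked_cycle_escape\<close> a cycle in a minimal linked set has no vertex
  whose neighbours all lie on it; the neighbours in \<open>M\<close> are among those in
  \<open>S - U\<close>.\<close>

lemma good_cutI:
  assumes "linked G X (S - U)"
    and "\<And>c. is_cycle G c \<Longrightarrow> set c \<subseteq> S - U \<Longrightarrow> \<exists>u\<in>set c. \<forall>w\<in>S - U. adj G u w \<longrightarrow> w \<in> set c"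
  shows "good_cut G X S U"
  unfolding good_cut_def
proof (intro conjI allI impI notI)
  fix M assume M: "M \<subseteq> S - U" "min_linked G X M" "\<exists>c. is_cycle G c \<and> set c \<subseteq> M"
  then obtain c where c: "is_cycle G c" "set c \<subseteq> M" by blast
  then obtain u where u: "u \<in> set c" "\<forall>w\<in>S - U. adj G u w \<longrightarrow> w \<in> set c"
    using assms(2)[of c] M(1) by blast
  obtain w where "w \<in> M" "adj G u w" "w \<notin> set c"
    using min_linked_cycle_escape[OF M(2) c u(1) cycle_terminal[OF c(1) u(1)] X_nonempty] by blast
  then show False using u M(1) by blast
qed (rule assms(1))

lemma linkedI: "X \<subseteq> W \<Longrightarrow> (\<And>i. i < k \<Longrightarrow> reach G W (p i 0) v) \<Longrightarrow> linked G X W"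
proof -
  assume X: "X \<subseteq> W" and r: "\<And>i. i < k \<Longrightarrow> reach G W (p i 0) v"
  have "reach G W x v" if "x \<in> X" for x using that r X_eq by auto
  then show ?thesis unfolding linked_def using X by (metis reach_trans reach_commute)
qed

text \<open>The part of a leak around \<open>s i\<close> that runs outside the structure. Contacts
  of \<open>Q\<close> with \<open>s i\<close> itself are left open, as that vertex counts as
  deleted.\<close>

definition connector :: "'a set \<Rightarrow> nat \<Rightarrow> 'a list \<Rightarrow> bool" where
  "connector S i Q \<longleftrightarrow> i < k \<and> walk_in G (S - K) Q \<and> (\<exists>u\<in>set (P i) - {s i}. adj G u (hd Q)) \<and>
     (\<exists>q\<in>K - set (P i). adj G (last Q) q)"

lemma connector_leaky:
  assumes "connector S i Q" "K \<subseteq> S"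
  shows "leaky G X (k_tests k P) S"
proof -
  obtain u q where i: "i < k" and Q: "walk_in G (S - K) Q" and u: "u \<in> set (P i) - {s i}" "adj G u (hd Q)"
    and q: "q \<in> K - set (P i)" "adj G (last Q) q"
    using assms(1) unfolding connector_def by blast
  let ?W = "S - {s i}"
  obtain a where a: "a < L i" "u = p i a" using u by (auto simp: in_set_conv_nth)
  have "a \<noteq> L i - 1" using u a s_nth[OF i] by auto
  then have aL: "a < L i - 1" using a by simp
  obtain j b where jb: "j < k" "b < L j" "q = p j b" using in_K q by blast
  have ji: "j \<noteq> i" using q jb by auto
  have seg: "p i c \<in> ?W" if "c < L i - 1" for c
    using that s_nth[OF i] p_eq[OF i i, of c "L i - 1"] p_in[OF i, of c] assms(2) by auto
  have sj: "p j c \<in> ?W" if "c < L j" for c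
    using that s_nth[OF i] p_eq[OF jb(1) i, of c "L i - 1"] L2[OF i] ji p_in[OF jb(1), of c] assms(2) by auto
  have siK: "s i \<in> K" using s_nth[OF i] p_in[OF i] L2[OF i] by simp
  have Qw: "walk_in G ?W Q" by (rule walk_in_mono[OF Q]) (use siK in blast)
  then have "Q \<noteq> []" "set Q \<subseteq> ?W" by (auto simp: walk_in_def)
  then have hl: "hd Q \<in> ?W" "last Q \<in> ?W" "hd Q \<in> set Q" "last Q \<in> set Q"
    using hd_in_set last_in_set by blast+
  have "reach G ?W (p i 0) u" unfolding a(2) by (rule segment_reach[OF i]) (use a seg aL in auto)
  also have "reach G ?W u (hd Q)" using u hl seg[OF aL] a by (intro reach_step) auto
  also (reach_trans) have "reach G ?W (hd Q) (last Q)" by (rule walk_in_reach[OF Qw hl(3,4)])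
  also (reach_trans) have "reach G ?W (last Q) q" using q hl sj[OF jb(2)] jb by (intro reach_step) auto
  also (reach_trans) have "reach G ?W (p j 0) q"
    unfolding jb(3) by (rule segment_reach[OF jb(1)]) (use jb(2) sj in auto)
  then have "reach G ?W q (p j 0)" using reach_commute by metis
  finally (reach_trans) have "reach G ?W (hd (P i)) (p j 0)" using x_nth[OF i] by simp
  moreover have "p j 0 \<in> X - {hd (P i)}"
  proof -
    have "0 < L i" "0 < L j" using L2[OF i] L2[OF jb(1)] by linarith+
    then have "p j 0 \<noteq> p i 0" using p_eq[OF jb(1) i, of 0 0] ji by blast
    then show ?thesis using X_eq jb(1) x_nth[OF i] by auto
  qed
  ultimately show ?thesis unfolding leaky_def k_tests_def using i by fastforce
qed

text \<open>Stop the leaking walk at its first vertex \<open>z\<close> on another path, and go back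
  from there to the first vertex \<open>z'\<close> of \<open>P i\<close> other than
  \<open>s i\<close>. In between the walk runs outside \<open>K\<close>. It has a vertex there,
  since \<open>z'\<close> is not an end and hence not adjacent to \<open>z\<close>.\<close>

lemma leaky_connector:
  assumes "leaky G X (k_tests k P) S" "K \<subseteq> S"
  obtains i Q where "connector S i Q"
proof -
  obtain i y where i: "i < k" and y: "y \<in> X - {hd (P i)}" and r: "reach G (S - {s i}) (hd (P i)) y"
    using assms(1) unfolding leaky_def k_tests_def by auto
  obtain j where j: "j < k" "y = p j 0" using y X_eq by auto
  have ji: "j \<noteq> i" using y j x_nth[OF i] by auto
  let ?A = "set (P i) - {s i}" and ?B = "K - set (P i)"
  have yB: "y \<in> ?B" using j ji p_in[OF j(1), of 0] p_in_path[OF j(1) i, of 0] L2[OF j(1)] by fastforce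
  have xA: "hd (P i) \<in> ?A"
    using x_nth[OF i] s_nth[OF i] p_eq[OF i i, of 0 "L i - 1"] L2[OF i] by (cases "P i") auto
  have xS: "hd (P i) \<in> S - {s i}" using xA assms(2) path_K[OF i] by auto
  obtain z where z: "z \<in> ?B" "z \<in> S - {s i}" "reach G (insert z (S - {s i} - ?B)) (hd (P i)) z"
    using reach_first_hit[OF r yB xS] xA by blast
  have r2: "reach G (insert z (S - {s i} - ?B)) z (hd (P i))" using z(3) reach_commute by metis
  obtain z' where z': "z' \<in> ?A" "z' \<in> insert z (S - {s i} - ?B)"
    "reach G (insert z' (insert z (S - {s i} - ?B) - ?A)) z z'"
    using reach_first_hit[OF r2 xA] z by blast
  let ?W = "insert z' (insert z (S - {s i} - ?B) - ?A)"
  have W: "?W \<subseteq> insert z' (insert z (S - K))" using path_K[OF i] by auto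
  have "reach G ?W z' z" using z'(3) reach_commute by metis
  then obtain q where q: "walk_in G ?W q" "hd q = z'" "last q = z" "distinct q" by (rule reach_path) auto
  have nadj: "\<not> adj G z' z"
  proof
    assume "adj G z' z"
    obtain a where a: "a < L i" "z' = p i a" using z' by (auto simp: in_set_conv_nth)
    have "a \<noteq> L i - 1" using z' a s_nth[OF i] by auto
    then have "z = p i (Suc a) \<or> a > 0 \<and> z = p i (a - 1)" "Suc a < L i"
      using neighbours_inner[OF i, of a z] a z(1) \<open>adj G z' z\<close> by auto
    then show False using z(1) by auto
  qed
  have "z \<noteq> z'" using z z' by auto
  then have "q \<noteq> []" "tl q \<noteq> []" using q(1,2,3) by (cases q; force simp: walk_in_def)+
  then obtain q1 where q1: "q = z' # q1" "q1 \<noteq> []" using q(2) by (metis list.collapse)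
  define Q where "Q = butlast q1"
  have q1Q: "q1 = Q @ [z]" using q1 q(3) unfolding Q_def by (metis append_butlast_last_id last.simps)
  have "Q \<noteq> []" using q(1) q1 q1Q nadj by (auto simp: walk_in_def)
  moreover have "set Q \<subseteq> S - K" using q(1,4) q1 q1Q W unfolding walk_in_def by auto
  moreover have "successively (adj G) Q" "adj G z' (hd Q)" "adj G (last Q) z"
    using q(1) q1 q1Q \<open>Q \<noteq> []\<close> by (auto simp: walk_in_def successively_Cons successively_append_iff)
  ultimately have "connector S i Q"
    unfolding connector_def walk_in_def using i z(1) z'(1) by blast
  then show ?thesis using that by blast
qed

definition short_connector :: "'a set \<Rightarrow> nat \<Rightarrow> 'a list \<Rightarrow> bool" where
  "short_connector S i Q \<longleftrightarrow> connector S i Q \<and> (\<forall>j Q'. connector S j Q' \<longrightarrow> length Q \<le> length Q')"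

lemma ex_short_connector:
  assumes "leaky G X (k_tests k P) S" "K \<subseteq> S"
  obtains i Q where "short_connector S i Q"
proof -
  obtain i0 Q0 where "connector S i0 Q0" using leaky_connector[OF assms] .
  then have "\<exists>Q. (\<exists>i. connector S i Q) \<and> (\<forall>Q'. (\<exists>j. connector S j Q') \<longrightarrow> length Q \<le> length Q')"
    using ex_has_least_nat[of "\<lambda>Q. \<exists>i. connector S i Q" Q0 length] by blast
  then show ?thesis using that unfolding short_connector_def by blast
qed

text \<open>A contact with \<open>P i\<close> after the first vertex, or with another path before
  the last one, would allow dropping an initial or a final piece of \<open>Q\<close>.\<close>

lemma short_connector_props:
  assumes "short_connector S i Q"
  shows "distinct Q" "chordless G Q"
    and "\<And>a u. 0 < a \<Longrightarrow> a < length Q \<Longrightarrow> u \<in> set (P i) - {s i} \<Longrightarrow> \<not> adj G u (Q ! a)"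
    and "\<And>a q. Suc a < length Q \<Longrightarrow> q \<in> K - set (P i) \<Longrightarrow> \<not> adj G (Q ! a) q"
proof -
  have c: "i < k" "walk_in G (S - K) Q" "\<exists>u\<in>set (P i) - {s i}. adj G u (hd Q)" "\<exists>q\<in>K - set (P i). adj G (last Q) q"
    using assms unfolding short_connector_def connector_def by blast+
  have m: "length Q \<le> length Q'" if "connector S i Q'" for Q'
    using assms that unfolding short_connector_def by blast
  have "length Q \<le> length q" if "walk_in G (S - K) q" "hd q = hd Q" "last q = last Q" for q
    using m[of q] c that unfolding connector_def by simp
  then have "distinct Q \<and> chordless G Q" using shortest_walk_chordless[OF c(2)] by blast
  then show "distinct Q" "chordless G Q" by auto
  have sQ: "successively (adj G) Q" "set Q \<subseteq> S - K" "Q \<noteq> []" using c(2) by (auto simp: walk_in_def)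
  show "\<not> adj G u (Q ! a)" if a: "0 < a" "a < length Q" "u \<in> set (P i) - {s i}" for a u
  proof
    assume adj: "adj G u (Q ! a)"
    have "walk_in G (S - K) (drop a Q)"
      using sQ a by (auto simp: walk_in_def successively_nth dest: in_set_dropD)
    moreover have "hd (drop a Q) = Q ! a" "last (drop a Q) = last Q" using a by (auto simp: hd_drop_conv_nth)
    ultimately have "connector S i (drop a Q)" unfolding connector_def using c(1,4) adj a(3) by auto
    then show False using m a by fastforce
  qed
  show "\<not> adj G (Q ! a) q" if a: "Suc a < length Q" "q \<in> K - set (P i)" for a q
  proof
    assume adj: "adj G (Q ! a) q"
    have "walk_in G (S - K) (take (Suc a) Q)"
      using sQ a by (auto simp: walk_in_def successively_nth dest: in_set_takeD)
    moreover have "hd (take (Suc a) Q) = hd Q" using sQ(3) by simp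
    moreover have "last (take (Suc a) Q) = Q ! a" using a by (simp add: take_Suc_conv_app_nth)
    ultimately have "connector S i (take (Suc a) Q)" unfolding connector_def using c(1,3) adj a(2) by auto
    then show False using m a by fastforce
  qed
qed

text \<open>The right-hand side is the length of an actual cycle: from \<open>v\<close> up the path
  \<open>i\<close>, along \<open>g\<close> edges between ends, and down the path \<open>j\<close>
  back to \<open>v\<close>. All distance conditions on attachments come from this bound.\<close>

lemma two_paths_cycle:
  assumes v: "v \<in> verts G" "v \<notin> K" and i: "i < k" and g: "0 < g" "g < k" and j: "j = (i + g) mod k"
    and a: "a < L i" "adj G v (p i a)" and b: "b < L j" "adj G v (p j b)"
  shows "k \<le> (L i - a) + (L j - b) + g"
proof -
  have jk: "j < k" using j k_pos by simp
  have modeq: "(i + t) mod k = (i + t') mod k \<longleftrightarrow> t = t'" if "t < k" "t' < k" for t t'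
    using that mod_shift_eq by blast
  have ij: "i \<noteq> j" using modeq[of 0 g] g j i k_pos by auto
  let ?A = "map (p i) [a..<L i - 1]"
  let ?B = "rev (map (p j) [b..<L j - 1])"
  let ?M = "map (\<lambda>t. s ((i + t) mod k)) [0..<Suc g]"
  \<comment> \<open>The ends are counted in \<open>?M\<close>, so \<open>?A\<close> and
    \<open>?B\<close> stop just below them; \<open>?B\<close> is reversed, as it is traversed
    downwards.\<close>
  let ?c = "v # ?A @ ?M @ ?B"
  have len: "length ?c = (L i - a) + (L j - b) + g" using a b by auto
  have Mset: "s ((i + t) mod k) \<in> set (P ((i + t) mod k))" "s ((i + t) mod k) \<in> K" for t
    using s_nth[of "(i + t) mod k"] L2[of "(i + t) mod k"] k_pos p_in[of "(i + t) mod k"] by auto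
  have sub: "set (?A @ ?M @ ?B) \<subseteq> K" using Mset(2) p_in[OF i] p_in[OF jk] by auto
  have dA: "distinct ?A" "distinct ?B" using p_eq[OF i i] p_eq[OF jk jk] by (auto simp: distinct_map inj_on_def)
  have sinj: "s x = s y \<longleftrightarrow> x = y" if "x < k" "y < k" for x y
    using that L2[of x] L2[of y] by (auto simp: s_nth p_eq)
  have dM: "distinct ?M" using modeq g k_pos by (auto simp: distinct_map inj_on_def sinj simp del: upt_Suc)
  have AB: "set ?A \<inter> set ?B = {}" using p_eq[OF i jk] ij by auto
  have sX: "p x y \<noteq> s z" if "x < k" "y < L x - 1" "z < k" for x y z
    using that L2[of z] L2[of x] by (auto simp: s_nth p_eq)
  have "u \<noteq> w" if uw: "u \<in> set ?A \<union> set ?B" "w \<in> set ?M" for u w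
  proof -
    obtain t where t: "w = s ((i + t) mod k)" using uw(2) by auto
    obtain x y where "x < k" "y < L x - 1" "u = p x y" using uw(1) i jk by fastforce
    then show ?thesis using sX[of x y "(i + t) mod k"] k_pos t by simp
  qed
  then have AM: "set ?A \<inter> set ?M = {}" "set ?B \<inter> set ?M = {}" by blast+
  have "v \<notin> set (?A @ ?M @ ?B)" using sub v(2) by blast
  then have dist: "distinct ?c" unfolding distinct.simps distinct_append
    using dA dM AB AM by (simp del: upt_Suc set_map) blast
  have sA: "successively (adj G) ?A" "successively (adj G) ?B"
    using adj_same[OF i] adj_same[OF jk] by (auto simp: successively_nth rev_nth)
  have sM: "successively (adj G) ?M"
  proof -
    have "adj G (s ((i + t) mod k)) (s ((i + Suc t) mod k))" for t
      using adj_s[of "(i + t) mod k"] k_pos by (simp add: mod_Suc_eq)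
    then show ?thesis by (auto simp: successively_nth simp del: upt_Suc)
  qed
  have hM: "?M \<noteq> []" "hd ?M = s i" "last ?M = s j"
    using i j by (auto simp: hd_map last_map simp del: upt_Suc)
  have c1: "adj G (last ?A) (s i)" if "?A \<noteq> []"
    using that adj_last[OF i] by (auto simp: last_map numeral_2_eq_2)
  have c2: "adj G (s j) (hd ?B)" if "?B \<noteq> []"
    using that adj_last[OF jk] adj_commute[of G "s j"] by (auto simp: hd_rev last_map numeral_2_eq_2)
  have hA: "adj G v (hd (?A @ ?M))"
  proof (cases "a = L i - 1")
    case True
    then show ?thesis using a hM s_nth[OF i] by simp
  next
    case False
    then have "a < L i - 1" using a by simp
    then show ?thesis using a by (simp add: upt_conv_Cons)
  qed
  have lB: "adj G (last (?M @ ?B)) v"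
  proof (cases "b = L j - 1")
    case True
    then show ?thesis using b hM s_nth[OF jk] adj_commute[of G v] by simp
  next
    case False
    then have "b < L j - 1" using b by simp
    then show ?thesis using b adj_commute[of G v] by (simp add: upt_conv_Cons)
  qed
  have "successively (adj G) (?M @ ?B)"
  proof (rule successively_appendI[OF sM sA(2)])
    assume "?B \<noteq> []"
    from c2[OF this] show "adj G (last ?M) (hd ?B)" unfolding hM(3) .
  qed
  then have "successively (adj G) (?A @ ?M @ ?B)"
  proof (rule successively_appendI[OF sA(1)])
    assume "?A \<noteq> []"
    from c1[OF this] show "adj G (last ?A) (hd (?M @ ?B))" unfolding hd_append2[OF hM(1)] hM(2) .
  qed
  then have "successively (adj G) ?c"
    using hA hM by (auto simp: successively_Cons hd_append simp del: upt_Suc)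
  then have "is_cycle G ?c"
    unfolding is_cycle_iff using dist sub K_verts v lB hM a b len g L2[OF i] k5
    by (auto simp del: upt_Suc)
  then show ?thesis using cycle_length len by metis
qed

end

context kstruct
begin

lemma s_K: "i < k \<Longrightarrow> s i \<in> K"
  using s_nth p_in[of i "L i - 1"] L2[of i] by simp

lemma s_eq: "i < k \<Longrightarrow> j < k \<Longrightarrow> s i = s j \<longleftrightarrow> i = j"
  using L2[of i] L2[of j] by (auto simp: s_nth p_eq)

lemma p_neq_s: "i < k \<Longrightarrow> j < k \<Longrightarrow> a < L i - 1 \<Longrightarrow> p i a \<noteq> s j"
  using L2[of i] L2[of j] by (auto simp: s_nth p_eq)

text \<open>Both arcs between the two ends close up with \<open>v\<close>, to cycles with
  \<open>g + 2\<close> and \<open>k - g + 2\<close> vertices. If both are at least \<open>k\<close>,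
  then \<open>g \<le> 2\<close> and \<open>k \<le> 4\<close>.\<close>

lemma two_ends: "v \<in> verts G \<Longrightarrow> v \<notin> K \<Longrightarrow> i < k \<Longrightarrow> j < k \<Longrightarrow> adj G v (s i) \<Longrightarrow> adj G v (s j) \<Longrightarrow> i = j"
proof (rule ccontr)
  assume v: "v \<in> verts G" "v \<notin> K" and ij: "i < k" "j < k" "adj G v (s i)" "adj G v (s j)" "i \<noteq> j"
  have l: "L i - (L i - 1) = 1" "L j - (L j - 1) = 1" "L i - 1 < L i" "L j - 1 < L j"
    using L2[OF ij(1)] L2[OF ij(2)] by simp_all
  have s: "s i = p i (L i - 1)" "s j = p j (L j - 1)" using s_nth ij by auto
  have *: "k \<le> 2 + (j - i)" "k \<le> 2 + (k - (j - i))"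
    if ij: "i < j" "j < k" "adj G v (p i (L i - 1))" "adj G v (p j (L j - 1))"
      "L i - (L i - 1) = 1" "L j - (L j - 1) = 1" "L i - 1 < L i" "L j - 1 < L j" for i j
  proof -
    have m: "j = (i + (j - i)) mod k" "i = (j + (k - (j - i))) mod k" using ij by simp_all
    show "k \<le> 2 + (j - i)"
      using two_paths_cycle[OF v, of i "j - i" j "L i - 1" "L j - 1"] ij m by simp
    show "k \<le> 2 + (k - (j - i))"
      using two_paths_cycle[OF v, of j "k - (j - i)" i "L j - 1" "L i - 1"] ij m by simp
  qed
  show False
  proof (cases "i < j")
    case True
    then show ?thesis using *[of i j] ij l s k5 by auto
  next
    case False
    then have "j < i" using ij by simp
    then show ?thesis using *[of j i] ij l s k5 by auto
  qed
qed

text \<open>Without \<open>s i\<close> the terminal of \<open>P i\<close> is still linked through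
  \<open>Q\<close>. The vertices of \<open>Q\<close> other than the first and the last see nothing
  of what remains of \<open>K\<close>, so a remaining cycle leaves \<open>K\<close> in one vertex
  only: in \<open>hd Q\<close>, attached to \<open>P i\<close>, or in \<open>last Q\<close>,
  attached to a single other path. Both cases are settled by
  \<open>cycle_through_outside\<close>.\<close>

lemma long_connector_good:
  assumes Q: "short_connector S i Q" "2 \<le> length Q" and S: "S = K \<union> set Q" "S \<subseteq> verts G"
    and lst: "\<And>j u. j < k \<Longrightarrow> u \<in> set (P j) - {s j} \<Longrightarrow> adj G u (last Q) \<Longrightarrow>
      (\<forall>w\<in>K. adj G (last Q) w \<longrightarrow> w \<in> set (P j))"
  shows "good_cut G X S {s i}"
proof -
  let ?m = "length Q" and ?v = "last Q" and ?W = "S - {s i}"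
  have c: "i < k" "walk_in G (S - K) Q" and uq: "\<exists>u\<in>set (P i) - {s i}. adj G u (hd Q)" "\<exists>q\<in>K - set (P i). adj G (last Q) q"
    using Q(1) unfolding short_connector_def connector_def by blast+
  note pr = short_connector_props[OF Q(1)]
  have Qn: "Q \<noteq> []" "set Q \<inter> K = {}" "successively (adj G) Q" using c(2) by (auto simp: walk_in_def)
  have hl: "hd Q = Q ! 0" "?v = Q ! (?m - 1)" using Qn by (simp_all add: hd_conv_nth last_conv_nth)
  have vQ: "?v \<in> set Q" "hd Q \<in> set Q" using Qn by auto
  have vK: "?v \<notin> K" "hd Q \<notin> K" using vQ Qn(2) by blast+
  have vV: "?v \<in> verts G" using vQ S by auto
  obtain q where q: "q \<in> K - set (P i)" "adj G ?v q" using uq by blast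
  obtain u where u: "u \<in> set (P i) - {s i}" "adj G u (hd Q)" using uq by blast
  obtain j where j: "j < k" "j \<noteq> i" "q \<in> set (P j)" using q by (auto simp: K_def)
  \<comment> \<open>If \<open>last Q\<close> sees a path below its end, the hypothesis confines its
    neighbours in \<open>K\<close> to that path; if it sees only ends, it sees a single one by
    \<open>two_ends\<close>.\<close>
  have nbv: "w \<in> set (P j)" if w: "w \<in> K" "adj G ?v w" for w
  proof (cases "\<exists>l u. l < k \<and> u \<in> set (P l) - {s l} \<and> adj G u ?v")
    case True
    then obtain l where l: "l < k" "\<forall>w\<in>K. adj G (last Q) w \<longrightarrow> w \<in> set (P l)" using lst by blast
    then have "q \<in> set (P l)" "w \<in> set (P l)" using q w by auto
    moreover have "l = j" using disjoint[OF l(1) j(1)] j(3) \<open>q \<in> set (P l)\<close> by blast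
    ultimately show ?thesis by simp
  next
    case False
    have e: "\<exists>l<k. x \<in> set (P l) \<and> x = s l" if x: "x \<in> K" "adj G ?v x" for x
    proof -
      obtain l where "l < k" "x \<in> set (P l)" using x(1) by (auto simp: K_def)
      moreover have "adj G x ?v" using x(2) adj_commute by metis
      ultimately show ?thesis using False by blast
    qed
    obtain l where l: "l < k" "w = s l" using e[OF w] by blast
    obtain l' where l': "l' < k" "q = s l'" "q \<in> set (P l')" using e[of q] q by blast
    have "l = l'" using two_ends[OF vV vK(1) l(1) l'(1)] w q l l' by simp
    then show ?thesis using l l' j by simp
  qed
  have siK: "s i \<in> K" using s_K c(1) by simp
  have Qw: "walk_in G ?W Q" by (rule walk_in_mono[OF c(2)]) (use siK in blast)
  have QW: "hd Q \<in> ?W" "?v \<in> ?W" using Qw vQ unfolding walk_in_def by blast+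
  have inW: "w \<in> K \<Longrightarrow> w \<noteq> s i \<Longrightarrow> w \<in> ?W" for w using S by auto
  have toq: "reach G ?W (p l 0) q" if l: "l < k" for l
  proof (cases "l = i")
    case False
    have pw: "p l' b \<in> ?W" if "l' < k" "l' \<noteq> i" "b < L l'" for l' b
      using that inW[OF p_in, of l' b] s_nth[OF c(1)] p_eq[of l' i b "L i - 1"] L2[OF c(1)] c(1) by auto
    obtain b where b: "b < L j" "q = p j b" using j by (auto simp: in_set_conv_nth)
    have "reach G ?W (p l 0) (s l)" unfolding s_nth[OF l]
      by (rule segment_reach[OF l]) (use pw[OF l False] L2[OF l] in auto)
    moreover have "reach G ?W (s l) (s j)"
    proof -
      have arc: "reach G ?W (s (Suc i mod k)) (s l')" if l': "l' < k" "l' \<noteq> i" for l'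
      proof -
        obtain t where t: "t < k" "l' = (Suc i mod k + t) mod k"
          using cyclic_shift[OF Suc_mod_less l'(1)] by blast
        have tt: "l' = (Suc i + t) mod k" using t by (simp add: mod_add_left_eq)
        \<comment> \<open>Counted from \<open>Suc i\<close>, offset \<open>k - 1\<close> is the
          deleted index \<open>i\<close>; an arc that ends at a smaller offset does not pass
          it.\<close>
        have "t \<noteq> k - 1"
        proof
          assume "t = k - 1"
          then have "(Suc i + t) mod k = i" using c(1) k_pos by simp
          then show False using tt l' by simp
        qed
        then have "t < k - 1" using t by simp
        have "s ((Suc i + t') mod k) \<in> ?W" if t': "t' \<le> t" for t'
        proof -
          have "(i + Suc t') mod k \<noteq> (i + 0) mod k"
            using mod_shift_eq[of "Suc t'" k 0 i] \<open>t < k - 1\<close> t' by simp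
          then have "(Suc i + t') mod k \<noteq> i" using c(1) by simp
          moreover have "(Suc i + t') mod k < k" using k_pos by simp
          ultimately show ?thesis using inW[OF s_K] s_eq[of _ i] c(1) by blast
        qed
        then show ?thesis using arc_reach[of t "Suc i" ?W] tt by simp
      qed
      show ?thesis using arc[OF l False] arc[OF j(1,2)] by (meson reach_trans reach_commute)
    qed
    moreover have "reach G ?W (p j b) (s j)" unfolding s_nth[OF j(1)]
      by (rule segment_reach[OF j(1)]) (use pw[OF j(1,2)] L2[OF j(1)] b in auto)
    ultimately show ?thesis unfolding b(2) by (meson reach_trans reach_commute)
  next
    case True
    obtain a where a: "a < L i" "u = p i a" using u by (auto simp: in_set_conv_nth)
    have aL: "a < L i - 1" using a u s_nth[OF c(1)] by (cases "a = L i - 1") auto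
    have "p i e \<in> ?W" if "e < L i - 1" for e
      using that inW[OF p_in[OF c(1)]] p_neq_s[OF c(1) c(1)] by simp
    then have "reach G ?W (p i 0) u" "u \<in> ?W" unfolding a(2) using aL by (auto intro!: segment_reach c(1))
    moreover have "reach G ?W u (hd Q)" using u(2) \<open>u \<in> ?W\<close> QW by (intro reach_step)
    moreover have "reach G ?W (hd Q) ?v" using walk_in_reach[OF Qw] vQ by blast
    moreover have "s i \<in> set (P i)" using L2[OF c(1)] by (cases "P i") auto
    then have "q \<in> ?W" using q inW[of q] by blast
    then have "reach G ?W ?v q" using q(2) QW by (intro reach_step)
    ultimately show ?thesis using True by (meson reach_trans)
  qed
  have sX: "s i \<notin> X"
  proof
    assume "s i \<in> X"
    then obtain l where "l < k" "s i = p l 0" using X_eq by auto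
    then show False using p_neq_s[of l i 0] c(1) L2[of l] by simp
  qed
  have XW: "X \<subseteq> ?W"
  proof
    fix x assume x: "x \<in> X"
    then obtain l where l: "l < k" "x = p l 0" using X_eq by auto
    then have "x \<in> K" using p_in[of l 0] L2[of l] by (cases "P l") auto
    then show "x \<in> ?W" using inW x sX by blast
  qed
  have link: "linked G X (S - {s i})" using linkedI[OF XW toq] .
  show ?thesis
  proof (rule good_cutI[OF link])
    fix D assume D: "is_cycle G D" "set D \<subseteq> ?W"
    have DK: "\<not> set D \<subseteq> K" using cycle_in_K[OF D(1) _ c(1)] D(2) by blast
    let ?A = "set (P i) - {s i}"
    show "\<exists>u\<in>set D. \<forall>w\<in>?W. adj G u w \<longrightarrow> w \<in> set D"
    proof (cases "set D \<inter> ?A = {}")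
      case False
      then obtain w where w: "w \<in> set D" "w \<in> ?A" by blast
      let ?v1 = "hd Q"
      have wv: "w \<noteq> ?v1" using w vK path_K[OF c(1)] by auto
      \<comment> \<open>A cycle that meets the rest of \<open>P i\<close> is trapped there: the exit
        through \<open>s i\<close> is deleted, and the later vertices of \<open>Q\<close> are not
        adjacent to it, so only \<open>hd Q\<close> remains.\<close>
      have "set D - {?v1} \<subseteq> ?A"
      proof
        fix y assume y: "y \<in> set D - {?v1}"
        have "reach G (set D - {?v1}) w y" using cycle_minus_reach[OF D(1)] y w wv by blast
        then show "y \<in> ?A"
        proof (rule reach_closed[OF _ w(2)])
          fix z w' assume z: "z \<in> ?A" and w': "w' \<in> set D - {?v1}" "adj G z w'"
          obtain a where a: "a < L i" "z = p i a" using z by (auto simp: in_set_conv_nth)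
          have aL: "a < L i - 1" using a z s_nth[OF c(1)] by (cases "a = L i - 1") auto
          have w'W: "w' \<in> K \<union> set Q" "w' \<noteq> s i" using w' D(2) S by auto
          show "w' \<in> ?A"
          proof (cases "w' \<in> K")
            case True
            then have "w' = p i (Suc a) \<or> a > 0 \<and> w' = p i (a - 1)"
              using neighbours_inner[OF c(1) aL True] w'(2) a by simp
            then have "w' \<in> set (P i)" using aL by auto
            then show ?thesis using w'W by simp
          next
            case False
            then obtain b where b: "b < ?m" "w' = Q ! b" using w'W by (auto simp: in_set_conv_nth)
            then have "0 < b" using w' hl by (cases b) auto
            then show ?thesis using pr(3)[of b z] b z w'(2) by metis
          qed
        qed
      qed
      moreover have "?v1 \<in> set D"
      proof (rule ccontr)
        assume "?v1 \<notin> set D"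
        then have "set D \<subseteq> K" using calculation path_K[OF c(1)] by auto
        then show False using DK by simp
      qed
      moreover have "w \<in> set (P i)" if "w \<in> set D" "adj G ?v1 w" for w
        using that calculation(1) adj_irrefl by auto
      ultimately obtain a where a: "Suc a < L i" "p i a \<in> set D"
        "\<And>w. w \<in> insert ?v1 K \<Longrightarrow> adj G (p i a) w \<Longrightarrow> w \<in> set D"
        using cycle_through_outside[OF D(1) vK(2) _ _ c(1)] path_K[OF c(1)] by (metis Diff_subset subset_trans)
      have "w \<in> set D" if w: "w \<in> ?W" "adj G (p i a) w" for w
      proof (cases "w \<in> insert ?v1 K")
        case False
        then obtain b where b: "b < ?m" "w = Q ! b" using w S by (auto simp: in_set_conv_nth)
        then have "0 < b" using False hl by (cases b) auto
        moreover have "p i a \<in> ?A" using a(1) p_neq_s[OF c(1) c(1), of a] by simp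
        ultimately show ?thesis using pr(3)[of b "p i a"] b w by metis
      qed (use a w in blast)
      then show ?thesis using a by blast
    next
      case True
        \<comment> \<open>With neither \<open>P i\<close> nor the predecessor on the cycle,
          \<open>Q ! a\<close> has only its successor in \<open>Q\<close> as a neighbour there, one
          too few. By induction the cycle avoids all of \<open>Q\<close> but the last
          vertex.\<close>
        have key: "Q ! a \<notin> set D" if a: "Suc a < ?m" and pre: "a = 0 \<or> Q ! (a - 1) \<notin> set D" for a
        proof
          assume aD: "Q ! a \<in> set D"
          obtain y z where yz: "y \<noteq> z" "y \<in> set D" "z \<in> set D" "adj G (Q ! a) y" "adj G (Q ! a) z"
            using cycle_two_neighbours[OF D(1) aD] by blast
          have "w = Q ! Suc a" if w: "w \<in> set D" "adj G (Q ! a) w" for w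
          proof -
            have "w \<in> K \<union> set Q" "w \<noteq> s i" using w D(2) S by auto
            moreover have "w \<notin> K"
            proof
              assume "w \<in> K"
              then have "w \<in> K - set (P i)" using True w \<open>w \<noteq> s i\<close> by blast
              then show False using pr(4)[OF a] w by blast
            qed
            ultimately obtain b where b: "b < ?m" "w = Q ! b" by (auto simp: in_set_conv_nth)
            have "b \<noteq> a" using b w adj_irrefl by auto
            then have "b = Suc a \<or> a = Suc b"
              using pr(2) a b w adj_commute[of G "Q ! a" "Q ! b"] unfolding chordless_def
              by (cases a b rule: linorder_cases) auto
            moreover have "a \<noteq> Suc b" using pre b w by auto
            ultimately show ?thesis using b by simp
          qed
          then show False using yz by metis
        qed
      have notQ: "Q ! a \<notin> set D" if "Suc a < ?m" for a
        using that
      proof (induction a)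
        case 0
        then show ?case using key by simp
      next
        case (Suc a)
        then show ?case using key[of "Suc a"] by simp
      qed
      have "set D \<subseteq> insert ?v K"
      proof
        fix w assume w: "w \<in> set D"
        show "w \<in> insert ?v K"
        proof (cases "w \<in> K")
          case False
          then have "w \<in> set Q" using w D(2) S(1) by blast
          then obtain b where b: "b < ?m" "w = Q ! b" by (auto simp: in_set_conv_nth)
          then have "\<not> Suc b < ?m" using notQ w by auto
          then have "b = ?m - 1" using b by simp
          then show ?thesis using b hl by simp
        qed simp
      qed
      moreover have "?v \<in> set D" using calculation DK by blast
      moreover have "w \<in> set (P j)" if "w \<in> set D" "adj G ?v w" for w
      proof -
        have "w \<in> K" using that calculation(1) adj_irrefl by blast
        then show ?thesis using nbv that by blast
      qed
      ultimately obtain a where a: "Suc a < L j" "p j a \<in> set D"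
        "\<And>w. w \<in> insert ?v K \<Longrightarrow> adj G (p j a) w \<Longrightarrow> w \<in> set D"
        using cycle_through_outside[OF D(1) vK(1) _ _ j(1)] by (metis Diff_subset_conv insert_is_Un)
      have "w \<in> set D" if w: "w \<in> ?W" "adj G (p j a) w" for w
      proof (cases "w \<in> insert ?v K")
        case False
        then obtain b where b: "b < ?m" "w = Q ! b" using w S by (auto simp: in_set_conv_nth)
        have "b \<noteq> ?m - 1" using False b hl by auto
        then have "Suc b < ?m" using b by simp
        moreover have "p j a \<in> K - set (P i)" using p_in[OF j(1), of a] p_in_path[OF j(1) c(1), of a] a(1) j(2) by simp
        ultimately show ?thesis using pr(4)[of b "p j a"] b w adj_commute by metis
      qed (use a w in blast)
      then show ?thesis using a by blast
    qed
  qed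
qed

text \<open>\<open>v\<close> attaches to the paths \<open>i\<close> with \<open>N i \<noteq> {}\<close>. Deleting the ends \<open>s i\<close> outside a cyclic
  interval \<open>A\<close> of indices and cutting the paths to \<open>v\<close> inside \<open>A\<close>, except the one at \<open>l0\<close>, leaves
  no cycle other than those formed by \<open>v\<close> and a part of a single path.\<close>

lemma arc_good:
  assumes v: "v \<notin> K" and N: "\<And>i. N i = {a. a < L i \<and> adj G v (p i a)}"
    and A: "A = (\<lambda>t. (b + t) mod k) ` {..<m}" "r < k" "r \<notin> A"
    and l0: "l0 \<in> A" "N l0 \<noteq> {}"
    and out: "\<And>i. i < k \<Longrightarrow> i \<notin> A \<Longrightarrow> N i \<noteq> {} \<and> L i - 1 \<notin> N i"
    and ins: "\<And>i. i \<in> A \<Longrightarrow> i \<noteq> l0 \<Longrightarrow> N i \<noteq> {} \<Longrightarrow> L i - 1 \<notin> N i \<and> (\<exists>a\<in>N i. a < L i - 2)"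
  shows "\<exists>U\<subseteq>opts. good_cut G X (insert v K) U"
proof -
  \<comment> \<open>Outside \<open>A\<close> the end is deleted and the path hangs on
    \<open>v\<close>. Inside \<open>A\<close> the ends stay and are linked to each other; a path
    that also sees \<open>v\<close> is cut below its end, so that its terminal hangs on
    \<open>v\<close> and its end stays in the arc. Only the path \<open>l0\<close> joins the arc to
    \<open>v\<close>.\<close>
  define U where "U = {p i (L i - 1) | i. i < k \<and> i \<notin> A} \<union> {p i (L i - 2) | i. i < k \<and> i \<in> A \<and> i \<noteq> l0 \<and> N i \<noteq> {}}"
  let ?W = "insert v K - U"
  have Ak: "i < k" if "i \<in> A" for i using that A(1) k_pos by auto
  have l0k: "l0 < k" using l0 Ak by simp
  have UK: "U \<subseteq> K"
  proof
    fix u assume "u \<in> U"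
    then obtain i where "i < k" "u = p i (L i - 1) \<or> u = p i (L i - 2)" unfolding U_def by blast
    then show "u \<in> K" using p_in[of i "L i - 1"] p_in[of i "L i - 2"] L2[of i] by auto
  qed
  have inU: "p i a \<in> U \<longleftrightarrow> (i \<notin> A \<and> a = L i - 1) \<or> (i \<in> A \<and> i \<noteq> l0 \<and> N i \<noteq> {} \<and> a = L i - 2)"
    if "i < k" "a < L i" for i a
  proof -
    have e: "p i a = p j (L j - 1) \<longleftrightarrow> i = j \<and> a = L j - 1" "p i a = p j (L j - 2) \<longleftrightarrow> i = j \<and> a = L j - 2" if "j < k" for j
      using p_eq[OF \<open>i < k\<close> that \<open>a < L i\<close>, of "L j - 1"] p_eq[OF \<open>i < k\<close> that \<open>a < L i\<close>, of "L j - 2"] L2[OF that] by auto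
    show ?thesis (is "_ \<longleftrightarrow> ?R")
    proof
      assume "p i a \<in> U"
      then obtain j where j: "j < k" "j \<notin> A \<and> p i a = p j (L j - 1) \<or>
          j \<in> A \<and> j \<noteq> l0 \<and> N j \<noteq> {} \<and> p i a = p j (L j - 2)" unfolding U_def by blast
      then show ?R using e[OF j(1)] by metis
    qed (use that(1) in \<open>auto simp: U_def\<close>)
  qed
  have vW: "v \<in> ?W" using v UK by auto
  have pW: "p i a \<in> ?W" if "i < k" "a < L i" "p i a \<notin> U" for i a using that p_in by simp
  have tov: "reach G ?W (p i 0) v" if "i < k" "a \<in> N i" "\<And>e. e \<le> a \<Longrightarrow> p i e \<notin> U" for i a
  proof -
    have a: "a < L i" "adj G v (p i a)" using that N by auto
    have w: "p i e \<in> ?W" if "e \<le> a" for e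
      using pW[of i e] a(1) \<open>i < k\<close> that \<open>\<And>e. e \<le> a \<Longrightarrow> p i e \<notin> U\<close> by simp
    have "reach G ?W (p i 0) (p i a)" by (rule segment_reach[OF that(1)]) (use a w in auto)
    moreover have "reach G ?W (p i a) v"
      using a vW pW[OF that(1) a(1)] that(3)[of a] adj_commute[of G v] by (intro reach_step) auto
    ultimately show ?thesis by (rule reach_trans)
  qed
  have intact: "reach G ?W (p i 0) (s i)" "s i \<in> ?W" if "i < k" "i \<in> A" "i = l0 \<or> N i = {}" for i
  proof -
    have w: "p i c \<in> ?W" if "c < L i" for c
      using pW[OF \<open>i < k\<close> that] inU[OF \<open>i < k\<close> that] \<open>i \<in> A\<close> \<open>i = l0 \<or> N i = {}\<close> by blast
    have "reach G ?W (p i 0) (p i (L i - 1))"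
      by (rule segment_reach[OF \<open>i < k\<close>]) (use w L2[OF \<open>i < k\<close>] in auto)
    then show "reach G ?W (p i 0) (s i)" using s_nth that by simp
    show "s i \<in> ?W" using s_nth[OF that(1)] w[of "L i - 1"] L2[OF that(1)] by auto
  qed
  have sW: "s i \<in> ?W" if "i \<in> A" for i
  proof -
    have l: "L i - 1 < L i" "L i - 1 \<noteq> L i - 2" using L2[OF Ak[OF that]] by auto
    then have "p i (L i - 1) \<notin> U" using inU[OF Ak[OF that] l(1)] that by blast
    then show ?thesis using pW[OF Ak[OF that] l(1)] s_nth[OF Ak[OF that]] by simp
  qed
  have arc: "reach G ?W (s (b mod k)) (s i)" if iA: "i \<in> A" for i
  proof -
    obtain t where t: "t < m" "i = (b + t) mod k" using iA A(1) by auto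
    show ?thesis unfolding t(2) by (rule arc_reach) (use t A(1) sW in auto)
  qed
  have "reach G ?W (p i 0) v" if i: "i < k" for i
  proof -
    consider "i \<notin> A" | "i \<in> A" "i \<noteq> l0" "N i \<noteq> {}" | "i \<in> A" "i = l0 \<or> N i = {}" by blast
    then show ?thesis
    proof cases
      case 1
      then obtain a where a: "a \<in> N i" "L i - 1 \<notin> N i" using out[OF i] by blast
      then have "a < L i" "a \<noteq> L i - 1" using N by auto
      then have "p i e \<notin> U" if "e \<le> a" for e using inU[OF i, of e] 1 that by auto
      then show ?thesis using tov[OF i a(1)] by blast
    next
      case 2
      then obtain a where a: "a \<in> N i" "a < L i - 2" using ins by blast
      then have "p i e \<notin> U" if "e \<le> a" for e using inU[OF i, of e] 2 that by auto
      then show ?thesis using tov[OF i a(1)] by blast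
    next
      case 3
      obtain a where a: "a \<in> N l0" using l0 by blast
      have "p l0 e \<notin> U" if "e \<le> a" for e using inU[OF l0k, of e] l0(1) a N that by auto
      then have "reach G ?W (p l0 0) v" using tov[OF l0k a] by blast
      moreover have "reach G ?W (p l0 0) (s l0)" using intact l0k l0 by auto
      moreover have "reach G ?W (p i 0) (s i)" using intact i 3 by auto
      moreover have "reach G ?W (s i) (s l0)" using arc[OF 3(1)] arc[OF l0(1)] by (meson reach_trans reach_commute)
      ultimately show ?thesis by (meson reach_trans reach_commute)
    qed
  qed note tv = this
  have XW: "X \<subseteq> ?W"
  proof
    fix x assume "x \<in> X"
    then obtain i where i: "i < k" "x = p i 0" using X_eq by auto
    have "0 < L i" using L2[OF i(1)] by linarith
    have "x \<noteq> v" using p_in[OF i(1) \<open>0 < L i\<close>] v i by auto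
    then show "x \<in> ?W" using reach_in'[OF tv[OF i(1)]] i by simp
  qed
  have link: "linked G X ?W" using linkedI[OF XW tv] .
  have "good_cut G X (insert v K) U"
  proof (rule good_cutI[OF link])
    fix D assume D: "is_cycle G D" "set D \<subseteq> ?W"
    have srU: "s r \<in> U" using s_nth[OF A(2)] inU[OF A(2), of "L r - 1"] A(3) L2[OF A(2)] by simp
    have vD: "v \<in> set D"
    proof (rule ccontr)
      assume "v \<notin> set D"
      then have "set D \<subseteq> K" using D by auto
      then show False using cycle_in_K[OF D(1) _ A(2)] srU D(2) by blast
    qed
    have DK: "set D - {v} \<subseteq> K - U" using D by auto
    \<comment> \<open>The vertex of \<open>P i\<close> at position \<open>?h\<close> is deleted, so
      the positions below it are closed in the cycle without \<open>v\<close>. The neighbours of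
      \<open>v\<close> on the cycle therefore lie on one path; two on different paths could not both
      belong to \<open>l0\<close>.\<close>
    have sev: "j = i" if "i < k" "j < k" "i \<noteq> l0" "p i a \<in> set D" "p j e \<in> set D" "a \<in> N i" "e \<in> N j" for i j a e
    proof -
      have ae: "a < L i" "e < L j" using that N by auto
      have nv: "p i a \<noteq> v" "p j e \<noteq> v" using p_in[OF that(1) ae(1)] p_in[OF that(2) ae(2)] v by auto
      have r: "reach G (set D - {v}) (p i a) (p j e)"
        using cycle_minus_reach[OF D(1)] that nv by blast
      let ?h = "if i \<in> A then L i - 2 else L i - 1"
      have h: "p i ?h \<in> U" "?h < L i" using inU[OF that(1), of ?h] L2[OF that(1)] that(3,6) by auto
      have ah: "a < ?h"
      proof -
        have "p i a \<notin> U" using that D by auto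
        then have "a \<noteq> ?h" using h by auto
        moreover have "a \<noteq> L i - 1" using that(6) out[OF that(1)] ins[of i] that(3) by (cases "i \<in> A") auto
        ultimately show ?thesis using ae(1) by (auto split: if_splits)
      qed
      have "p j e \<in> p i ` {..<?h}"
      proof (rule reach_closed[OF r])
        show "p i a \<in> p i ` {..<?h}" using ah by blast
        fix z w assume z: "z \<in> p i ` {..<?h}" and w: "w \<in> set D - {v}" "adj G z w"
        obtain d where d: "d < ?h" "z = p i d" using z by auto
        have dl: "d < L i - 1" using d h(2) by (auto split: if_splits)
        have wK: "w \<in> K" "w \<notin> U" using w DK by auto
        have "w = p i (Suc d) \<or> d > 0 \<and> w = p i (d - 1)"
          using neighbours_inner[OF that(1) dl wK(1)] w(2) d(2) by simp
        then show "w \<in> p i ` {..<?h}"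
        proof
          assume wd: "w = p i (Suc d)"
          then have "Suc d \<noteq> ?h" using h(1) wK(2) by metis
          then have "Suc d < ?h" using d(1) by simp
          then show ?thesis using wd by blast
        next
          assume "d > 0 \<and> w = p i (d - 1)"
          then show ?thesis using d(1) by (intro image_eqI[of _ _ "d - 1"]) auto
        qed
      qed
      then obtain d where "d < ?h" "p j e = p i d" by auto
      then show ?thesis using p_eq[OF that(2,1) ae(2), of d] h(2) by simp
    qed
    have rep: "\<exists>i a. i < k \<and> a \<in> N i \<and> w = p i a" if "w \<in> set D" "adj G v w" for w
    proof -
      have "w \<in> K" using that D adj_irrefl by auto
      then obtain i a where "i < k" "a < L i" "w = p i a" using in_K by blast
      then show ?thesis using N that by auto
    qed
    obtain w0 where w0: "w0 \<in> set D" "adj G v w0" using cycle_two_neighbours[OF D(1) vD] by blast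
    obtain i a where ia: "i < k" "a \<in> N i" "w0 = p i a" using rep[OF w0] by blast
    have "w \<in> set (P i)" if w: "w \<in> set D" "adj G v w" for w
    proof -
      obtain j e where je: "j < k" "e \<in> N j" "w = p j e" using rep[OF w] by blast
      have "j = i"
        using sev[OF ia(1) je(1) _ _ _ ia(2) je(2)] sev[OF je(1) ia(1) _ _ _ je(2) ia(2)] w w0 je ia by auto
      then show ?thesis using je N by auto
    qed
    then obtain a where "Suc a < L i" "p i a \<in> set D"
      "\<And>w. w \<in> insert v K \<Longrightarrow> adj G (p i a) w \<Longrightarrow> w \<in> set D"
      using cycle_through_outside[OF D(1) v vD _ ia(1)] DK by (metis Diff_subset subset_trans)
    then show "\<exists>u\<in>set D. \<forall>w\<in>?W. adj G u w \<longrightarrow> w \<in> set D" by blast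
  qed
  moreover have "U \<subseteq> opts" unfolding U_def by auto
  ultimately show ?thesis by blast
qed

end

text \<open>What \<open>arc_good\<close> demands of the index sets: \<open>I\<close> stands for the
  paths seen by \<open>v\<close>, \<open>sp\<close> for those whose end is seen, and
  \<open>J\<close> for those that cannot be cut at the predecessor of their end. The index
  \<open>h\<close> is the path that joins the arc to \<open>v\<close>; \<open>r\<close> witnesses
  that some end is deleted, which destroys the cycle of ends.\<close>

definition arc_ok :: "nat \<Rightarrow> nat set \<Rightarrow> nat set \<Rightarrow> nat set \<Rightarrow> bool" where
  "arc_ok k I J sp \<longleftrightarrow> (\<exists>b m h r. h \<in> (\<lambda>t. (b + t) mod k) ` {..<m} \<and> h \<in> I \<and>
     r < k \<and> r \<notin> (\<lambda>t. (b + t) mod k) ` {..<m} \<and>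
     (\<forall>i<k. i \<notin> (\<lambda>t. (b + t) mod k) ` {..<m} \<longrightarrow> i \<in> I - sp) \<and>
     (\<forall>i\<in>(\<lambda>t. (b + t) mod k) ` {..<m}. i \<noteq> h \<longrightarrow> i \<in> I \<longrightarrow> i \<notin> J))"

lemma arc_okI:
  "A = (\<lambda>t. (b + t) mod k) ` {..<m} \<Longrightarrow> h \<in> A \<Longrightarrow> h \<in> I \<Longrightarrow> r < k \<Longrightarrow> r \<notin> A \<Longrightarrow>
   (\<And>i. i < k \<Longrightarrow> i \<notin> A \<Longrightarrow> i \<in> I - sp) \<Longrightarrow> (\<And>i. i \<in> A \<Longrightarrow> i \<noteq> h \<Longrightarrow> i \<in> I \<Longrightarrow> i \<notin> J) \<Longrightarrow> arc_ok k I J sp"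
  unfolding arc_ok_def by (intro exI[of _ b] exI[of _ m] exI[of _ h] exI[of _ r]) simp

lemma arc_all_but_one:
  assumes "r < (k :: nat)"
  shows "{..<k} - {r} = (\<lambda>t. (Suc r + t) mod k) ` {..<k - 1}"
proof (intro set_eqI iffI)
  fix j assume "j \<in> {..<k} - {r}"
  then have j: "j < k" "j \<noteq> r" by auto
  obtain t where t: "t < k" "j = (r + t) mod k" using cyclic_shift[OF assms j(1)] by blast
  then have "t \<noteq> 0" using j assms by (cases "t = 0") auto
  then obtain t' where "t = Suc t'" using not0_implies_Suc by blast
  then show "j \<in> (\<lambda>t. (Suc r + t) mod k) ` {..<k - 1}" using t by (intro image_eqI[of _ _ t']) auto
next
  fix j assume "j \<in> (\<lambda>t. (Suc r + t) mod k) ` {..<k - 1}"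
  then obtain t where t: "t < k - 1" "j = (r + Suc t) mod k" by auto
  have "j \<noteq> (r + 0) mod k" using mod_shift_eq[of "Suc t" k 0 r] t assms by simp
  then show "j \<in> {..<k} - {r}" using t assms by simp
qed

text \<open>The interval consists of all indices but \<open>r\<close>, so a single end is deleted.
  This settles every \<open>J\<close> with at most two elements.\<close>

lemma arc_ok_single:
  assumes "r \<in> I - sp" "r < k" "h \<in> I" "h < k" "h \<noteq> r" "\<And>i. i \<in> J \<Longrightarrow> i = r \<or> i = h"
  shows "arc_ok k I J sp"
  by (rule arc_okI[OF arc_all_but_one[OF assms(2)], of h I r]) (use assms in auto)

lemma below_5: "(n :: nat) < 5 \<longleftrightarrow> n = 0 \<or> n = 1 \<or> n = 2 \<or> n = 3 \<or> n = 4"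
  by auto

lemma below_6: "(n :: nat) < 6 \<longleftrightarrow> n = 0 \<or> n = 1 \<or> n = 2 \<or> n = 3 \<or> n = 4 \<or> n = 5"
  by auto

lemma image_lessThan_small:
  "f 0 = x \<Longrightarrow> {x} = f ` {..<1 :: nat}" "f 0 = x \<Longrightarrow> f 1 = y \<Longrightarrow> {x, y} = f ` {..<2 :: nat}"
  "f 0 = x \<Longrightarrow> f 1 = y \<Longrightarrow> f 2 = z \<Longrightarrow> {x, y, z} = f ` {..<3 :: nat}"
  by (auto simp: numeral_eq_Suc lessThan_Suc)

text \<open>For an explicitly listed index set the conditions become finitely many memberships,
  which simplification decides.\<close>

lemma arc_ok_enum:
  assumes E: "{..<k} = E" and A: "A = (\<lambda>t. (b + t) mod k) ` {..<m}" and J: "J \<subseteq> I" "h \<in> A" "h \<in> I"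
    and r: "r \<in> E" "r \<notin> A"
    and out: "\<forall>i\<in>E. i \<notin> A \<longrightarrow> i \<in> I - sp" and ins: "\<forall>i\<in>A. i \<noteq> h \<longrightarrow> i \<notin> J"
  shows "arc_ok k I J sp"
proof (rule arc_okI[OF A J(2,3) _ r(2)])
  show "r < k" using r(1) E by blast
  fix i assume "i < k" "i \<notin> A"
  then show "i \<in> I - sp" using out E by blast
qed (use ins in blast)

text \<open>Up to rotation a set of at least three residues modulo 5 is one of four: two neighbours
  with the residue opposite to them (\<open>a0\<close> to \<open>a4\<close>), three in a row
  (\<open>b0\<close> to \<open>b4\<close>), four in a row (\<open>c0\<close> to \<open>c4\<close>),
  or all (\<open>d\<close>). In each case the interval retains one element of \<open>J\<close> and
  the ends of the others are deleted. These have a neighbour in \<open>J\<close>, so by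
  \<open>gap\<close> they are not in \<open>sp\<close>.\<close>

lemma select_arc_5:
  assumes J: "J \<subseteq> I" "sp \<subseteq> J" "I \<subseteq> {..<5}"
    and gap: "\<And>x y. x \<in> J \<Longrightarrow> y \<in> J \<Longrightarrow> x < y \<Longrightarrow> x \<in> sp \<or> y \<in> sp \<Longrightarrow> 2 \<le> y - x \<and> y - x \<le> 3"
    and abc: "a < b" "b < c" "a \<in> J" "b \<in> J" "c \<in> J"
  shows "arc_ok 5 I J sp"
proof -
  have E: "{..<5} = {0, 1, 2, 3, 4 :: nat}" by (auto simp: below_5)
  have a0: "arc_ok 5 I J sp" if "2 \<in> J - sp" "3 \<in> J - sp" "0 \<in> J" "1 \<notin> J" "4 \<notin> J"
    by (rule arc_ok_enum[OF E image_lessThan_small(3)[where x = 4 and y = 0 and z = 1], where b = 4 and h = 0 and r = 2])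
      (use that J(1) subsetD[OF J(1)] in simp_all)
  have b0: "arc_ok 5 I J sp" if "0 \<in> J - sp" "1 \<in> J - sp" "2 \<in> J" "3 \<notin> J" "4 \<notin> J"
    by (rule arc_ok_enum[OF E image_lessThan_small(3)[where x = 2 and y = 3 and z = 4], where b = 2 and h = 2 and r = 0])
      (use that J(1) subsetD[OF J(1)] in simp_all)
  have c0: "arc_ok 5 I J sp" if "0 \<in> J - sp" "1 \<in> J - sp" "2 \<in> J - sp" "3 \<in> J" "4 \<notin> J"
    by (rule arc_ok_enum[OF E image_lessThan_small(2)[where x = 3 and y = 4], where b = 3 and h = 3 and r = 0])
      (use that J(1) subsetD[OF J(1)] in simp_all)
  have a1: "arc_ok 5 I J sp" if "3 \<in> J - sp" "4 \<in> J - sp" "1 \<in> J" "2 \<notin> J" "0 \<notin> J"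
    by (rule arc_ok_enum[OF E image_lessThan_small(3)[where x = 0 and y = 1 and z = 2], where b = 0 and h = 1 and r = 3])
      (use that J(1) subsetD[OF J(1)] in simp_all)
  have b1: "arc_ok 5 I J sp" if "1 \<in> J - sp" "2 \<in> J - sp" "3 \<in> J" "4 \<notin> J" "0 \<notin> J"
    by (rule arc_ok_enum[OF E image_lessThan_small(3)[where x = 3 and y = 4 and z = 0], where b = 3 and h = 3 and r = 1])
      (use that J(1) subsetD[OF J(1)] in simp_all)
  have c1: "arc_ok 5 I J sp" if "1 \<in> J - sp" "2 \<in> J - sp" "3 \<in> J - sp" "4 \<in> J" "0 \<notin> J"
    by (rule arc_ok_enum[OF E image_lessThan_small(2)[where x = 4 and y = 0], where b = 4 and h = 4 and r = 1])
      (use that J(1) subsetD[OF J(1)] in simp_all)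
  have a2: "arc_ok 5 I J sp" if "4 \<in> J - sp" "0 \<in> J - sp" "2 \<in> J" "3 \<notin> J" "1 \<notin> J"
    by (rule arc_ok_enum[OF E image_lessThan_small(3)[where x = 1 and y = 2 and z = 3], where b = 1 and h = 2 and r = 4])
      (use that J(1) subsetD[OF J(1)] in simp_all)
  have b2: "arc_ok 5 I J sp" if "2 \<in> J - sp" "3 \<in> J - sp" "4 \<in> J" "0 \<notin> J" "1 \<notin> J"
    by (rule arc_ok_enum[OF E image_lessThan_small(3)[where x = 4 and y = 0 and z = 1], where b = 4 and h = 4 and r = 2])
      (use that J(1) subsetD[OF J(1)] in simp_all)
  have c2: "arc_ok 5 I J sp" if "2 \<in> J - sp" "3 \<in> J - sp" "4 \<in> J - sp" "0 \<in> J" "1 \<notin> J"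
    by (rule arc_ok_enum[OF E image_lessThan_small(2)[where x = 0 and y = 1], where b = 0 and h = 0 and r = 2])
      (use that J(1) subsetD[OF J(1)] in simp_all)
  have a3: "arc_ok 5 I J sp" if "0 \<in> J - sp" "1 \<in> J - sp" "3 \<in> J" "4 \<notin> J" "2 \<notin> J"
    by (rule arc_ok_enum[OF E image_lessThan_small(3)[where x = 2 and y = 3 and z = 4], where b = 2 and h = 3 and r = 0])
      (use that J(1) subsetD[OF J(1)] in simp_all)
  have b3: "arc_ok 5 I J sp" if "3 \<in> J - sp" "4 \<in> J - sp" "0 \<in> J" "1 \<notin> J" "2 \<notin> J"
    by (rule arc_ok_enum[OF E image_lessThan_small(3)[where x = 0 and y = 1 and z = 2], where b = 0 and h = 0 and r = 3])
      (use that J(1) subsetD[OF J(1)] in simp_all)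
  have c3: "arc_ok 5 I J sp" if "3 \<in> J - sp" "4 \<in> J - sp" "0 \<in> J - sp" "1 \<in> J" "2 \<notin> J"
    by (rule arc_ok_enum[OF E image_lessThan_small(2)[where x = 1 and y = 2], where b = 1 and h = 1 and r = 3])
      (use that J(1) subsetD[OF J(1)] in simp_all)
  have a4: "arc_ok 5 I J sp" if "1 \<in> J - sp" "2 \<in> J - sp" "4 \<in> J" "0 \<notin> J" "3 \<notin> J"
    by (rule arc_ok_enum[OF E image_lessThan_small(3)[where x = 3 and y = 4 and z = 0], where b = 3 and h = 4 and r = 1])
      (use that J(1) subsetD[OF J(1)] in simp_all)
  have b4: "arc_ok 5 I J sp" if "4 \<in> J - sp" "0 \<in> J - sp" "1 \<in> J" "2 \<notin> J" "3 \<notin> J"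
    by (rule arc_ok_enum[OF E image_lessThan_small(3)[where x = 1 and y = 2 and z = 3], where b = 1 and h = 1 and r = 4])
      (use that J(1) subsetD[OF J(1)] in simp_all)
  have c4: "arc_ok 5 I J sp" if "4 \<in> J - sp" "0 \<in> J - sp" "1 \<in> J - sp" "2 \<in> J" "3 \<notin> J"
    by (rule arc_ok_enum[OF E image_lessThan_small(2)[where x = 2 and y = 3], where b = 2 and h = 2 and r = 4])
      (use that J(1) subsetD[OF J(1)] in simp_all)
  have d: "arc_ok 5 I J sp" if "0 \<in> J - sp" "1 \<in> J - sp" "2 \<in> J - sp" "3 \<in> J - sp" "4 \<in> J"
    by (rule arc_ok_enum[OF E image_lessThan_small(1)[where x = 4], where b = 4 and h = 4 and r = 0])
      (use that J(1) subsetD[OF J(1)] in simp_all)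
  have S: "z \<in> sp \<Longrightarrow> y \<in> J \<Longrightarrow> z < y \<Longrightarrow> 2 \<le> y - z \<and> y - z \<le> 3"
    "z \<in> sp \<Longrightarrow> y \<in> J \<Longrightarrow> y < z \<Longrightarrow> 2 \<le> z - y \<and> z - y \<le> 3" for z y
    using gap[of z y] gap[of y z] J by auto
  have sJ: "z \<in> sp \<Longrightarrow> z \<in> J" for z using J by auto
  have "c < 5" using abc J by auto
  then have "c = 2 \<or> c = 3 \<or> c = 4" "b = 1 \<or> b = 2 \<or> b = 3" "a = 0 \<or> a = 1 \<or> a = 2"
    using abc(1,2) by arith+
  then have T: "(0 \<in> J \<and> 1 \<in> J \<and> 2 \<in> J) \<or> (0 \<in> J \<and> 1 \<in> J \<and> 3 \<in> J) \<or> (0 \<in> J \<and> 1 \<in> J \<and> 4 \<in> J) \<or>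
    (0 \<in> J \<and> 2 \<in> J \<and> 3 \<in> J) \<or> (0 \<in> J \<and> 2 \<in> J \<and> 4 \<in> J) \<or> (0 \<in> J \<and> 3 \<in> J \<and> 4 \<in> J) \<or>
    (1 \<in> J \<and> 2 \<in> J \<and> 3 \<in> J) \<or> (1 \<in> J \<and> 2 \<in> J \<and> 4 \<in> J) \<or> (1 \<in> J \<and> 3 \<in> J \<and> 4 \<in> J) \<or> (2 \<in> J \<and> 3 \<in> J \<and> 4 \<in> J)"
    using abc by (elim disjE; simp)
  \<comment> \<open>Differences 2 and 3 belong to the pairs that are not adjacent on the cycle of
    length 5; the adjacent pair 0, 4 has difference 4 and is excluded as well.\<close>
  have N: "0 \<in> sp \<Longrightarrow> 1 \<notin> J \<and> 4 \<notin> J" "1 \<in> sp \<Longrightarrow> 0 \<notin> J \<and> 2 \<notin> J" "2 \<in> sp \<Longrightarrow> 1 \<notin> J \<and> 3 \<notin> J"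
    "3 \<in> sp \<Longrightarrow> 2 \<notin> J \<and> 4 \<notin> J" "4 \<in> sp \<Longrightarrow> 3 \<notin> J \<and> 0 \<notin> J"
    using S[of 0 1] S[of 0 4] S[of 1 0] S[of 1 2] S[of 2 1] S[of 2 3] S[of 3 2] S[of 3 4] S[of 4 3] S[of 4 0] by auto
  show ?thesis
    using T N a0 b0 c0 a1 b1 c1 a2 b2 c2 a3 b3 c3 a4 b4 c4 d
    unfolding Diff_iff by satx
qed

text \<open>\<open>gap\<close> is \<open>two_paths_cycle\<close> with weights: an end that is seen
  counts 1, the predecessor of an end counts 2. The alternating pattern for \<open>k = 6\<close>
  with no further path attached is the case left over.\<close>

lemma select_arc:
  fixes k :: nat
  assumes k5: "5 \<le> k" and I: "I \<subseteq> {..<k}" "J \<subseteq> I" "sp \<subseteq> J" and two: "i1 \<in> I" "i2 \<in> I" "i1 \<noteq> i2"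
    and gap: "\<And>i g. i \<in> J \<Longrightarrow> 0 < g \<Longrightarrow> g < k \<Longrightarrow> (i + g) mod k \<in> J \<Longrightarrow>
      k \<le> (if i \<in> sp then 1 else 2) + (if (i + g) mod k \<in> sp then 1 else 2) + g"
  shows "arc_ok k I J sp \<or> k = 6 \<and> sp = {} \<and> I = J \<and> (J = {0, 2, 4} \<or> J = {1, 3, 5})"
proof -
  define w where "w i = (if i \<in> sp then 1 else 2 :: nat)" for i
  have Jk: "i < k" if "i \<in> J" for i using that I by auto
  \<comment> \<open>Read in both directions round the cycle, \<open>gap\<close> bounds the
    difference of two elements of \<open>J\<close> from below and from above.\<close>
  have pair: "k \<le> w x + w y + (y - x)" "y - x \<le> w x + w y" if "x \<in> J" "y \<in> J" "x < y" for x y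
  proof -
    have yk: "y < k" using Jk that by simp
    have e: "(x + (y - x)) mod k = y" "(y + (k - (y - x))) mod k = x" using that yk by auto
    have g: "0 < y - x" "y - x < k" "0 < k - (y - x)" "k - (y - x) < k" using that yk by auto
    show "k \<le> w x + w y + (y - x)"
      using gap[of x "y - x", unfolded e, OF that(1) g(1,2) that(2)] unfolding w_def .
    have "k \<le> w y + w x + (k - (y - x))"
      using gap[of y "k - (y - x)", unfolded e, OF that(2) g(3,4) that(1)] unfolding w_def .
    then show "y - x \<le> w x + w y" using g by linarith
  qed
  have w2: "w x \<le> 2" for x by (simp add: w_def)
  show ?thesis
  proof (cases "\<exists>a b c. a < b \<and> b < c \<and> a \<in> J \<and> b \<in> J \<and> c \<in> J")
    case True
    then obtain a b c where abc: "a < b" "b < c" "a \<in> J" "b \<in> J" "c \<in> J" by blast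
    have p: "k \<le> w a + w b + (b - a)" "k \<le> w b + w c + (c - b)" "c - a \<le> w a + w c" "k \<le> w a + w c + (c - a)"
      using pair[of a b] pair[of b c] pair[of a c] abc by auto
    \<comment> \<open>Two differences of at least \<open>k - 4\<close> have to fit into an outer
      difference of at most 4.\<close>
    have "k \<le> 6" using p w2[of a] w2[of b] w2[of c] abc by linarith
    then consider "k = 5" | "k = 6" using k5 by linarith
    then show ?thesis
    proof cases
      case 1
      have "arc_ok 5 I J sp"
      proof (rule select_arc_5[where a = a and b = b and c = c])
        fix x y assume xy: "x \<in> J" "y \<in> J" "x < y" "x \<in> sp \<or> y \<in> sp"
        then have "w x + w y \<le> 3" unfolding w_def by auto
        then show "2 \<le> y - x \<and> y - x \<le> 3" using pair[OF xy(1-3)] 1 by linarith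
      qed (use I abc 1 in auto)
      then show ?thesis using 1 by simp
    next
      case 2
      have "w a = 2 \<and> w b = 2 \<and> w c = 2 \<and> b = a + 2 \<and> c = a + 4"
        using p w2[of a] w2[of b] w2[of c] abc 2 by linarith
      then have ww: "b = a + 2" "c = a + 4" by auto
      have d2: "2 \<le> y - x \<and> y - x \<le> 4" if "x \<in> J" "y \<in> J" "x < y" for x y
        using pair[OF that] w2[of x] w2[of y] 2 by linarith
      have Jabc: "d = a \<or> d = b \<or> d = c" if d: "d \<in> J" for d
      proof (rule ccontr)
        assume n: "\<not> ?thesis"
        have "\<not> d < a" using d2[OF d abc(5)] ww abc by auto
        moreover have "\<not> c < d" using d2[OF abc(3) d] ww abc by auto
        moreover have "\<not> (a < d \<and> d < b)" using d2[OF abc(3) d] ww by auto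
        moreover have "\<not> (b < d \<and> d < c)" using d2[OF abc(4) d] ww by auto
        ultimately show False using n by linarith
      qed
      then have JJ: "J = {a, b, c}" using abc by auto
      have "a < 2" using Jk[OF abc(5)] ww 2 by simp
      then consider "a = 0" | "a = 1" by linarith
      then have Jset: "J = {0, 2, 4} \<or> J = {1, 3, 5}" using JJ ww by cases auto
      have "sp = {}"
        using \<open>w a = 2 \<and> w b = 2 \<and> w c = 2 \<and> b = a + 2 \<and> c = a + 4\<close> JJ I(3) unfolding w_def by (auto split: if_splits)
      show ?thesis
      proof (cases "I = J")
        case False
        then obtain f where f: "f \<in> I" "f \<notin> J" using I(2) by blast
        have f6: "f < 6" using f I(1) 2 by auto
        have E: "{..<6} = {0, 1, 2, 3, 4, 5 :: nat}" by (auto simp: below_6)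
        have JI: "i \<in> I" if "i \<in> J" for i using that I(2) by blast
        \<comment> \<open>A further path \<open>f\<close> lies between two elements of
          \<open>J\<close>. The ends of these three are deleted, and the opposite three indices form
          the interval, with the third element of \<open>J\<close> in the middle.\<close>
        have e0: "arc_ok 6 I J sp" if "J = {1, 3, 5}" "0 \<in> I"
          by (rule arc_ok_enum[OF E image_lessThan_small(3)[where x = 2 and y = 3 and z = 4], where b = 2 and h = 3 and r = 0])
            (use that JI \<open>sp = {}\<close> I(2) in simp_all)
        have e1: "arc_ok 6 I J sp" if "J = {0, 2, 4}" "1 \<in> I"
          by (rule arc_ok_enum[OF E image_lessThan_small(3)[where x = 3 and y = 4 and z = 5], where b = 3 and h = 4 and r = 1])
            (use that JI \<open>sp = {}\<close> I(2) in simp_all)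
        have e2: "arc_ok 6 I J sp" if "J = {1, 3, 5}" "2 \<in> I"
          by (rule arc_ok_enum[OF E image_lessThan_small(3)[where x = 4 and y = 5 and z = 0], where b = 4 and h = 5 and r = 2])
            (use that JI \<open>sp = {}\<close> I(2) in simp_all)
        have e3: "arc_ok 6 I J sp" if "J = {0, 2, 4}" "3 \<in> I"
          by (rule arc_ok_enum[OF E image_lessThan_small(3)[where x = 5 and y = 0 and z = 1], where b = 5 and h = 0 and r = 3])
            (use that JI \<open>sp = {}\<close> I(2) in simp_all)
        have e4: "arc_ok 6 I J sp" if "J = {1, 3, 5}" "4 \<in> I"
          by (rule arc_ok_enum[OF E image_lessThan_small(3)[where x = 0 and y = 1 and z = 2], where b = 0 and h = 1 and r = 4])
            (use that JI \<open>sp = {}\<close> I(2) in simp_all)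
        have e5: "arc_ok 6 I J sp" if "J = {0, 2, 4}" "5 \<in> I"
          by (rule arc_ok_enum[OF E image_lessThan_small(3)[where x = 1 and y = 2 and z = 3], where b = 1 and h = 2 and r = 5])
            (use that JI \<open>sp = {}\<close> I(2) in simp_all)
        have "f = 0 \<or> f = 1 \<or> f = 2 \<or> f = 3 \<or> f = 4 \<or> f = 5" using f6 by arith
        then have "arc_ok 6 I J sp" using Jset f e0 e1 e2 e3 e4 e5 by (elim disjE) simp_all
        then show ?thesis using 2 by simp
      qed (use 2 Jset \<open>sp = {}\<close> in simp)
    qed
  next
    case False
    consider "J = {}" | j where "J = {j}" | j1 j2 where "j1 \<in> J" "j2 \<in> J" "j1 < j2" by (metis all_not_in_conv insertI1 linorder_neqE_nat singletonD subsetI subset_singleton_iff)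
    then show ?thesis
    proof cases
      case 1
      then show ?thesis using arc_ok_single[of i1 I sp k i2 J] two I by auto
    next
      case 2
      obtain f where f: "f \<in> I" "f \<noteq> j" using two by metis
      then have "f \<notin> sp" using I(3) 2 by auto
      then show ?thesis using arc_ok_single[of f I sp k j J] f 2 I by auto
    next
      case 3
      have JJ: "i = j1 \<or> i = j2" if "i \<in> J" for i
        using False 3 that by (metis linorder_neqE_nat)
      \<comment> \<open>Two weights 1 would give \<open>k \<le> 4\<close>, by the computation in
        \<open>two_ends\<close>; so one of the two may lose its end, and the other one serves as
        \<open>h\<close>.\<close>
      have "\<not> (j1 \<in> sp \<and> j2 \<in> sp)"
        using pair[OF 3] k5 unfolding w_def by auto
      then show ?thesis
        using arc_ok_single[of j1 I sp k j2 J] arc_ok_single[of j2 I sp k j1 J] 3 JJ I by blast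
    qed
  qed
qed

context kstruct
begin

lemma connector_singleton:
  assumes "i < k" "v \<in> S - K" "u \<in> set (P i) - {s i}" "adj G u v" "q \<in> K - set (P i)" "adj G v q"
  shows "connector S i [v]"
  unfolding connector_def walk_in_def using assms by auto

lemma single_vertex:
  assumes v: "v \<in> verts G" "v \<notin> K" and i: "i < k" and u: "u \<in> set (P i) - {s i}" "adj G u v"
    and q: "q \<in> K - set (P i)" "adj G v q"
  shows "(\<exists>U\<subseteq>opts. good_cut G X (insert v K) U) \<or>
    k = 6 \<and> (\<exists>J. (J = {0, 2, 4} \<or> J = {1, 3, 5}) \<and> {w \<in> K. adj G v w} = (\<lambda>i. p i (L i - 2)) ` J)"
proof -
  define N where "N i = {a. a < L i \<and> adj G v (p i a)}" for i
  define I where "I = {i. i < k \<and> N i \<noteq> {}}"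
  define sp where "sp = {i. i < k \<and> L i - 1 \<in> N i}"
  \<comment> \<open>A cut at the predecessor of the end keeps the terminal attached to
    \<open>v\<close> only if \<open>v\<close> sees the path below that predecessor, and it frees the
    end from \<open>v\<close> only if the end is not seen. \<open>J\<close> collects the attached
    paths for which one of these fails.\<close>
  define J where "J = {i \<in> I. i \<in> sp \<or> \<not> (\<exists>a\<in>N i. a < L i - 2)}"
  obtain j where j: "j < k" "q \<in> set (P j)" "j \<noteq> i" using q by (auto simp: K_def)
  have "j \<in> I" using j q unfolding I_def N_def by (auto simp: in_set_conv_nth)
  have "i \<in> I" using i u adj_commute[of G u v] unfolding I_def N_def by (auto simp: in_set_conv_nth)
  have short: "\<exists>a\<in>N i. L i - a \<le> (if i \<in> sp then 1 else 2)" if iJ: "i \<in> J" for i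
  proof (cases "i \<in> sp")
    case True
    then show ?thesis unfolding sp_def by (intro bexI[of _ "L i - 1"]) auto
  next
    case False
    then obtain a where "a \<in> N i" "\<not> a < L i - 2" using iJ unfolding J_def I_def by blast
    then show ?thesis using False by (intro bexI[of _ a]) auto
  qed
  have "arc_ok k I J sp \<or> k = 6 \<and> sp = {} \<and> I = J \<and> (J = {0, 2, 4} \<or> J = {1, 3, 5})"
  proof (rule select_arc[OF k5 _ _ _ \<open>j \<in> I\<close> \<open>i \<in> I\<close> j(3)])
    show "I \<subseteq> {..<k}" "J \<subseteq> I" "sp \<subseteq> J" by (auto simp: I_def J_def sp_def)
    fix i g assume ig: "i \<in> J" "0 < g" "g < k" "(i + g) mod k \<in> J"
    let ?j = "(i + g) mod k"
    obtain a b where a: "a \<in> N i" "L i - a \<le> (if i \<in> sp then 1 else 2)"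
      and b: "b \<in> N ?j" "L ?j - b \<le> (if ?j \<in> sp then 1 else 2)"
      using short ig by meson
    have "i < k" using ig(1) by (simp add: J_def I_def)
    then have "k \<le> (L i - a) + (L ?j - b) + g"
      using two_paths_cycle[OF v _ ig(2,3) refl, of i a b] a b unfolding N_def by simp
    then show "k \<le> (if i \<in> sp then 1 else 2) + (if ?j \<in> sp then 1 else 2) + g"
      using a(2) b(2) by linarith
  qed
  then show ?thesis
  proof
    assume "arc_ok k I J sp"
    then obtain b m l0 r where A: "l0 \<in> (\<lambda>t. (b + t) mod k) ` {..<m}" "l0 \<in> I"
      "r < k" "r \<notin> (\<lambda>t. (b + t) mod k) ` {..<m}"
      "\<forall>i<k. i \<notin> (\<lambda>t. (b + t) mod k) ` {..<m} \<longrightarrow> i \<in> I - sp"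
      "\<forall>i\<in>(\<lambda>t. (b + t) mod k) ` {..<m}. i \<noteq> l0 \<longrightarrow> i \<in> I \<longrightarrow> i \<notin> J"
      unfolding arc_ok_def by blast
    have "\<exists>U\<subseteq>opts. good_cut G X (insert v K) U"
    proof (rule arc_good[OF v(2) N_def refl A(3,4,1)])
      show "N l0 \<noteq> {}" using A(2) by (simp add: I_def)
      fix i assume "i < k" "i \<notin> (\<lambda>t. (b + t) mod k) ` {..<m}"
      then show "N i \<noteq> {} \<and> L i - 1 \<notin> N i" using A(5) by (auto simp: I_def sp_def)
    next
      fix i assume *: "i \<in> (\<lambda>t. (b + t) mod k) ` {..<m}" "i \<noteq> l0" "N i \<noteq> {}"
      then have "i < k" using k_pos by auto
      then have "i \<in> I" "i \<notin> J" using A(6) * by (auto simp: I_def)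
      then show "L i - 1 \<notin> N i \<and> (\<exists>a\<in>N i. a < L i - 2)" using \<open>i < k\<close> by (auto simp: J_def sp_def)
    qed
    then show ?thesis ..
  next
    assume *: "k = 6 \<and> sp = {} \<and> I = J \<and> (J = {0, 2, 4} \<or> J = {1, 3, 5})"
    have NJ: "N i = {L i - 2}" if iJ: "i \<in> J" for i
    proof -
      have i: "i < k" "N i \<noteq> {}" using iJ by (auto simp: J_def I_def)
      moreover have "i \<notin> sp" using * by simp
      ultimately have i: "i < k" "N i \<noteq> {}" "L i - 1 \<notin> N i" by (auto simp: sp_def)
      have "a = L i - 2" if a: "a \<in> N i" for a
      proof -
        have "a < L i" using a unfolding N_def by simp
        moreover have "a \<noteq> L i - 1" using a i(3) by blast
        moreover have "i \<notin> sp" using * by simp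
        then have "\<not> a < L i - 2" using a iJ unfolding J_def by blast
        ultimately show ?thesis by linarith
      qed
      then show ?thesis using i(2) by auto
    qed
    have "{w \<in> K. adj G v w} = (\<lambda>i. p i (L i - 2)) ` J"
    proof (intro set_eqI iffI)
      fix w assume "w \<in> {w \<in> K. adj G v w}"
      then have w: "w \<in> K" "adj G v w" by auto
      obtain i a where ia: "i < k" "a < L i" "w = p i a" using in_K[OF w(1)] by blast
      then have a: "a \<in> N i" using w by (simp add: N_def)
      then have "i \<in> I" using ia by (auto simp: I_def)
      then have iJ: "i \<in> J" using * by simp
      have "a = L i - 2" using NJ[OF iJ] a by simp
      then show "w \<in> (\<lambda>i. p i (L i - 2)) ` J" using ia iJ by blast
    next
      fix w assume "w \<in> (\<lambda>i. p i (L i - 2)) ` J"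
      then obtain i where i: "i \<in> J" "w = p i (L i - 2)" by auto
      have "L i - 2 < L i" "adj G v w" using NJ[OF i(1)] i(2) unfolding N_def by auto
      moreover have "i < k" using i(1) unfolding J_def I_def by blast
      ultimately show "w \<in> {w \<in> K. adj G v w}" using i(2) p_in by simp
    qed
    then show ?thesis using * by blast
  qed
qed

text \<open>A shortest connector already leaks, so by minimality \<open>S\<close> consists of
  \<open>K\<close> and that connector alone, which is either a single vertex or long.\<close>

theorem leaky_structure:
  assumes S: "K \<subseteq> S" "S \<subseteq> verts G" and leak: "leaky G X (k_tests k P) S"
    and min: "\<And>u. u \<in> S - K \<Longrightarrow> \<not> leaky G X (k_tests k P) (S - {u})"
  shows "(\<exists>U\<subseteq>opts. good_cut G X S U) \<or>
    k = 6 \<and> (\<exists>v J. v \<in> S - K \<and> S = insert v K \<and> (J = {0, 2, 4} \<or> J = {1, 3, 5}) \<and>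
      {w \<in> K. adj G v w} = (\<lambda>i. p i (L i - 2)) ` J)"
proof -
  obtain i Q where Q: "short_connector S i Q" using ex_short_connector[OF leak S(1)] .
  then have c: "connector S i Q" by (simp add: short_connector_def)
  then have i: "i < k" "walk_in G (S - K) Q" "\<exists>u\<in>set (P i) - {s i}. adj G u (hd Q)" "\<exists>q\<in>K - set (P i). adj G (last Q) q"
    unfolding connector_def by blast+
  have QS: "set Q \<subseteq> S - K" "Q \<noteq> []" using i(2) by (auto simp: walk_in_def)
  have "walk_in G (K \<union> set Q - K) Q" using i(2) QS by (auto simp: walk_in_def)
  then have "connector (K \<union> set Q) i Q" unfolding connector_def using i by blast
  then have lk: "leaky G X (k_tests k P) (K \<union> set Q)" by (rule connector_leaky) auto
  have eq: "S = K \<union> set Q"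
  proof (rule ccontr)
    assume "S \<noteq> K \<union> set Q"
    then obtain u where u: "u \<in> S - K" "u \<notin> set Q" using S QS by blast
    have "K \<union> set Q \<subseteq> S - {u}" using S QS u by blast
    then show False using leaky_mono[OF lk] min[OF u(1)] by blast
  qed
  show ?thesis
  proof (cases "length Q = 1")
    case True
    then obtain v where v: "Q = [v]" by (cases Q) auto
    have vS: "v \<in> S - K" "S = insert v K" using QS v eq by auto
    obtain u q where "u \<in> set (P i) - {s i}" "adj G u v" "q \<in> K - set (P i)" "adj G v q"
      using i v by auto
    then have "(\<exists>U\<subseteq>opts. good_cut G X (insert v K) U) \<or>
      k = 6 \<and> (\<exists>J. (J = {0, 2, 4} \<or> J = {1, 3, 5}) \<and> {w \<in> K. adj G v w} = (\<lambda>i. p i (L i - 2)) ` J)"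
      using single_vertex[of v i u q] vS S i(1) by blast
    then show ?thesis
    proof
      assume "\<exists>U\<subseteq>opts. good_cut G X (insert v K) U"
      then show ?thesis using vS(2) by simp
    next
      assume "k = 6 \<and> (\<exists>J. (J = {0, 2, 4} \<or> J = {1, 3, 5}) \<and> {w \<in> K. adj G v w} = (\<lambda>i. p i (L i - 2)) ` J)"
      then obtain J where "k = 6" "J = {0, 2, 4} \<or> J = {1, 3, 5}" "{w \<in> K. adj G v w} = (\<lambda>i. p i (L i - 2)) ` J"
        by blast
      note J = this
      show ?thesis by (rule disjI2, intro conjI exI[of _ v] exI[of _ J]; (rule J vS))
    qed
  next
    case False
    then have l2: "2 \<le> length Q" using QS(2) by (cases Q) (auto simp: Suc_le_eq)
    have "good_cut G X S {s i}"
    proof (rule long_connector_good[OF Q l2 eq S(2)])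
      fix j u assume j: "j < k" "u \<in> set (P j) - {s j}" "adj G u (last Q)"
      \<comment> \<open>Otherwise \<open>last Q\<close> would be a connector by itself, and
        \<open>hd Q\<close> could be deleted from \<open>S\<close> without stopping the
        leak.\<close>
      show "\<forall>w\<in>K. adj G (last Q) w \<longrightarrow> w \<in> set (P j)"
      proof (intro ballI impI, rule ccontr)
        fix w assume w: "w \<in> K" "adj G (last Q) w" "w \<notin> set (P j)"
        let ?v = "last Q"
        have vQ: "?v \<in> set Q" "hd Q \<in> set Q" using QS by auto
        then have vS: "?v \<in> S" "?v \<notin> K" "hd Q \<in> S" "hd Q \<notin> K" using QS(1) by blast+
        have "connector (insert ?v K) j [?v]"
          by (rule connector_singleton[OF j(1) _ j(2,3), of _ w]) (use w vS in auto)
        then have lk: "leaky G X (k_tests k P) (insert ?v K)" by (rule connector_leaky) auto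
        have "hd Q \<noteq> ?v" using short_connector_props(1)[OF Q] l2 by (cases Q) (auto split: if_splits)
        then have "insert ?v K \<subseteq> S - {hd Q}" using vS S(1) by blast
        then show False using leaky_mono[OF lk] min[of "hd Q"] vS by blast
      qed
    qed
    moreover have "{s i} \<subseteq> opts" using s_nth i by auto
    ultimately show ?thesis by blast
  qed
qed

end

section \<open>The structures on K4\<close>

lemma K4_pairs_eq: "K4_pairs = {(0,1), (0,2), (0,3), (1,2), (1,3), (2,3)}"
  unfolding K4_pairs_def by (auto simp: numeral_eq_Suc less_Suc_eq)

lemma lessThan_4: "{..<4} = {0, 1, 2, 3 :: nat}"
  by auto

lemma lessThan_6: "{..<6} = {0, 1, 2, 3, 4, 5 :: nat}"
  by auto

lemma path_edges_snoc: "xs \<noteq> [] \<Longrightarrow> path_edges (xs @ [x]) = insert {last xs, x} (path_edges xs)"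
proof -
  assume ne: "xs \<noteq> []"
  have "path_edges (xs @ [x]) = (\<lambda>j. {(xs @ [x]) ! j, (xs @ [x]) ! Suc j}) ` {..<length xs}"
    by (auto simp: path_edges_def)
  also have "{..<length xs} = insert (length xs - 1) {..<length xs - 1}" using ne by (cases xs) auto
  also have "(\<lambda>j. {(xs @ [x]) ! j, (xs @ [x]) ! Suc j}) ` \<dots> =
      insert {last xs, x} ((\<lambda>j. {(xs @ [x]) ! j, (xs @ [x]) ! Suc j}) ` {..<length xs - 1})"
    using ne by (simp add: nth_append last_conv_nth)
  also have "(\<lambda>j. {(xs @ [x]) ! j, (xs @ [x]) ! Suc j}) ` {..<length xs - 1} =
      (\<lambda>j. {xs ! j, xs ! Suc j}) ` {..<length xs - 1}"
    by (intro image_cong) (auto simp: nth_append)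
  also have "(\<lambda>j. {xs ! j, xs ! Suc j}) ` {..<length xs - 1} = path_edges xs"
    by (auto simp: path_edges_def)
  finally show ?thesis .
qed

lemma doubleton_eqI: "(\<And>u. u \<in> {a, b} \<Longrightarrow> u = c \<or> u = d) \<Longrightarrow> a \<noteq> b \<Longrightarrow> {a, b} = {c, d}"
  by auto

lemma path_edges_sub: "e \<in> path_edges xs \<Longrightarrow> e \<subseteq> set xs"
  by (auto simp: path_edges_def)

definition K4_tests :: "(nat \<Rightarrow> 'a) \<Rightarrow> (nat \<times> nat \<Rightarrow> 'a list) \<Rightarrow> ('a set \<times> 'a) set" where
  "K4_tests w P = (\<lambda>(i, j). ({w i, w j}, hd (P (i, j)))) ` K4_pairs \<union> (\<lambda>e. ({last (P e)}, hd (P e))) ` K4_pairs"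

text \<open>These 16 vertices contain each branch vertex and also the ends and predecessors of the
  cycle structures that arise from its deletion.\<close>

definition K4_opts :: "(nat \<Rightarrow> 'a) \<Rightarrow> (nat \<times> nat \<Rightarrow> 'a list) \<Rightarrow> 'a set" where
  "K4_opts w P = w ` {..<4} \<union> (\<lambda>e. last (P e)) ` K4_pairs \<union> (\<lambda>e. P e ! (length (P e) - 2)) ` K4_pairs"

text \<open>The action of a permutation of the branch vertices on the edges of \<open>K4\<close>;
  minimum and maximum restore the increasing form in which pairs are kept.\<close>

definition pair_map :: "(nat \<Rightarrow> nat) \<Rightarrow> nat \<times> nat \<Rightarrow> nat \<times> nat" where
  "pair_map f = (\<lambda>(i, j). (min (f i) (f j), max (f i) (f j)))"

lemma finite_K4_pairs: "finite K4_pairs"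
  by (simp add: K4_pairs_eq)

lemma bij_pair_map:
  assumes "bij_betw f {..<4} {..<4}"
  shows "bij_betw (pair_map f) K4_pairs K4_pairs"
proof -
  have f4: "f i < 4" if "i < 4" for i using assms that by (auto simp: bij_betw_def)
  have inj: "f i = f j \<longleftrightarrow> i = j" if "i < 4" "j < 4" for i j
    using assms that by (auto simp: bij_betw_def inj_on_def)
  have "pair_map f ` K4_pairs \<subseteq> K4_pairs"
  proof
    fix e assume "e \<in> pair_map f ` K4_pairs"
    then obtain i j where ij: "i < j" "j < 4" "e = (min (f i) (f j), max (f i) (f j))"
      by (auto simp: pair_map_def K4_pairs_def)
    have "f i \<noteq> f j" "f i < 4" "f j < 4" using inj[of i j] f4[of i] f4[of j] ij by auto
    then show "e \<in> K4_pairs" using ij(3) by (auto simp: K4_pairs_def min_def max_def)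
  qed
  moreover have "inj_on (pair_map f) K4_pairs"
  proof (rule inj_onI)
    fix e e' assume e: "e \<in> K4_pairs" "e' \<in> K4_pairs" "pair_map f e = pair_map f e'"
    obtain i j i' j' where ij: "e = (i, j)" "e' = (i', j')" by (cases e; cases e') auto
    have lt: "i < j" "j < 4" "i' < j'" "j' < 4" using e ij by (auto simp: K4_pairs_def)
    have "{f i, f j} = {f i', f j'}" using e(3) ij by (auto simp: pair_map_def min_def max_def split: if_splits)
    then have "(f i = f i' \<and> f j = f j') \<or> (f i = f j' \<and> f j = f i')" by (auto simp: doubleton_eq_iff)
    then show "e = e'" using inj[of i i'] inj[of j j'] inj[of i j'] inj[of j i'] lt ij by auto
  qed
  ultimately show ?thesis using endo_inj_surj[OF finite_K4_pairs] by (simp add: bij_betw_def)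
qed

text \<open>The remaining index is found by \<open>0 + 1 + 2 + 3 = 6\<close>.\<close>

definition perm4 :: "nat \<Rightarrow> nat \<Rightarrow> nat \<Rightarrow> nat \<Rightarrow> nat" where
  "perm4 a b c = (\<lambda>n. if n = 0 then a else if n = 1 then b else if n = 3 then c else 6 - a - b - c)"

lemma below_4: "(n :: nat) < 4 \<longleftrightarrow> n = 0 \<or> n = 1 \<or> n = 2 \<or> n = 3"
  by auto

lemma bij_perm4:
  assumes "a < 4" "b < 4" "c < 4" "a \<noteq> b" "a \<noteq> c" "b \<noteq> c"
  shows "bij_betw (perm4 a b c) {..<4} {..<4}"
  using assms unfolding below_4 bij_betw_def
  by (elim disjE) (simp_all add: perm4_def lessThan_4 insert_commute)

locale kgraph6 = kgraph G 6 X for G :: "'a graph" and X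
begin

definition K4s :: "(nat \<Rightarrow> 'a) \<Rightarrow> (nat \<times> nat \<Rightarrow> 'a list) \<Rightarrow> bool" where
  "K4s w P \<longleftrightarrow> K4_verts w P \<subseteq> verts G \<and> K4_structure X (induced G (K4_verts w P)) w P"

lemma K4sD:
  assumes "K4s w P"
  shows "bij_betw (\<lambda>e. hd (P e)) K4_pairs X" "inj_on w {..<4}"
    "edges (induced G (K4_verts w P)) = (\<Union>e\<in>K4_pairs. path_edges (P e)) \<union>
       (\<Union>(i, j)\<in>K4_pairs. {{w i, last (P (i, j))}, {w j, last (P (i, j))}})"
    "\<And>e. e \<in> K4_pairs \<Longrightarrow> 2 \<le> length (P e)" "\<And>e. e \<in> K4_pairs \<Longrightarrow> distinct (P e)"
    "\<And>e f. e \<in> K4_pairs \<Longrightarrow> f \<in> K4_pairs \<Longrightarrow> e \<noteq> f \<Longrightarrow> set (P e) \<inter> set (P f) = {}"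
    "\<And>e i. e \<in> K4_pairs \<Longrightarrow> i < 4 \<Longrightarrow> w i \<notin> set (P e)"
    "\<And>e. e \<in> K4_pairs \<Longrightarrow> set (P e) \<subseteq> K4_verts w P" "\<And>i. i < 4 \<Longrightarrow> w i \<in> K4_verts w P"
    "K4_verts w P \<subseteq> verts G" "\<And>e. e \<in> K4_pairs \<Longrightarrow> last (P e) \<in> set (P e)"
proof -
  note a = assms[unfolded K4s_def K4_structure_def]
  show "bij_betw (\<lambda>e. hd (P e)) K4_pairs X" using a by (elim conjE)
  show "inj_on w {..<4}" using a by (elim conjE)
  show "edges (induced G (K4_verts w P)) = (\<Union>e\<in>K4_pairs. path_edges (P e)) \<union>
       (\<Union>(i, j)\<in>K4_pairs. {{w i, last (P (i, j))}, {w j, last (P (i, j))}})" using a by (elim conjE)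
  show "K4_verts w P \<subseteq> verts G" using a by (elim conjE)
  show l: "2 \<le> length (P e)" if "e \<in> K4_pairs" for e using a that by (elim conjE) blast
  show "distinct (P e)" if "e \<in> K4_pairs" for e using a that by (elim conjE) blast
  show "set (P e) \<inter> set (P f) = {}" if "e \<in> K4_pairs" "f \<in> K4_pairs" "e \<noteq> f" for e f
    using a that by (elim conjE) blast
  show "w i \<notin> set (P e)" if "e \<in> K4_pairs" "i < 4" for e i using a that by (elim conjE) blast
  show "set (P e) \<subseteq> K4_verts w P" if "e \<in> K4_pairs" for e using that by (auto simp: K4_verts_def)
  show "w i \<in> K4_verts w P" if "i < 4" for i using that by (auto simp: K4_verts_def)
  show "last (P e) \<in> set (P e)" if "e \<in> K4_pairs" for e using l[OF that] by (intro last_in_set) auto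
qed

lemma K4sI:
  assumes "K4_verts w P \<subseteq> verts G" "bij_betw (\<lambda>e. hd (P e)) K4_pairs X" "inj_on w {..<4}"
    and edg: "edges (induced G (K4_verts w P)) = (\<Union>e\<in>K4_pairs. path_edges (P e)) \<union>
       (\<Union>(i, j)\<in>K4_pairs. {{w i, last (P (i, j))}, {w j, last (P (i, j))}})"
    and len: "\<And>e. e \<in> K4_pairs \<Longrightarrow> 2 \<le> length (P e)" "\<And>e. e \<in> K4_pairs \<Longrightarrow> distinct (P e)"
    and "\<And>e f. e \<in> K4_pairs \<Longrightarrow> f \<in> K4_pairs \<Longrightarrow> e \<noteq> f \<Longrightarrow> set (P e) \<inter> set (P f) = {}"
    and "\<And>e i. e \<in> K4_pairs \<Longrightarrow> i < 4 \<Longrightarrow> w i \<notin> set (P e)"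
  shows "K4s w P"
proof -
  have t: "terminal (induced G (K4_verts w P)) x" if x: "x \<in> X" for x
  proof -
    obtain e where e: "e \<in> K4_pairs" "x = hd (P e)" using assms(2) x by (auto simp: bij_betw_def)
    obtain a b xs where P: "P e = a # b # xs"
      using len(1)[OF e(1)] by (cases "P e"; cases "tl (P e)") auto
    have "{a, b} \<in> path_edges (P e)" unfolding path_edges_def P by force
    then have "{a, b} \<in> edges (induced G (K4_verts w P))" using edg e(1) by blast
    then have ab: "adj (induced G (K4_verts w P)) a b" by (simp add: adj_def)
    then show ?thesis using e P x by (intro terminal_induced[where y = b]) (auto simp: adj_induced)
  qed
  have v: "verts (induced G (K4_verts w P)) = K4_verts w P" using assms(1) by (auto simp: induced_def)
  have w: "w ` {..<4} \<inter> set (P e) = {}" if "e \<in> K4_pairs" for e using assms(8)[OF that] by auto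
  show ?thesis
    unfolding K4s_def K4_structure_def
    by (intro conjI ballI impI) (assumption | rule assms simple_induced t v w)+
qed

lemma K4_adj:
  assumes "K4s w P" "e \<in> K4_pairs" "a < 4"
  shows "adj G (w a) (last (P e)) \<longleftrightarrow> a = fst e \<or> a = snd e"
proof -
  note K = K4sD[OF assms(1)]
  obtain i j where e: "e = (i, j)" by (cases e)
  have ij: "i < 4" "j < 4" using assms(2) e by (auto simp: K4_pairs_def)
  have "adj G (w a) (last (P e)) \<longleftrightarrow> {w a, last (P e)} \<in> edges (induced G (K4_verts w P))"
    using K(9)[OF assms(3)] K(8,11)[OF assms(2)] by (auto simp: adj_def induced_def)
  also have "\<dots> \<longleftrightarrow> a = i \<or> a = j"
  proof
    assume "{w a, last (P e)} \<in> edges (induced G (K4_verts w P))"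
    moreover have "{w a, last (P e)} \<notin> path_edges (P f)" if "f \<in> K4_pairs" for f
      using path_edges_sub[of "{w a, last (P e)}" "P f"] K(7)[OF that assms(3)] by blast
    ultimately obtain c d where cd: "(c, d) \<in> K4_pairs"
      "{w a, last (P e)} = {w c, last (P (c, d))} \<or> {w a, last (P e)} = {w d, last (P (c, d))}"
      unfolding K(3) by blast
    have c4: "c < 4" "d < 4" using cd(1) by (auto simp: K4_pairs_def)
    have "w a \<noteq> last (P (c, d))" using K(7)[OF cd(1) assms(3)] K(11)[OF cd(1)] by auto
    then have l: "last (P e) = last (P (c, d))" "w a = w c \<or> w a = w d" using cd(2) by (auto simp: doubleton_eq_iff)
    have "e = (c, d)"
    proof (rule ccontr)
      assume "e \<noteq> (c, d)"
      then show False using K(6)[OF assms(2) cd(1)] K(11)[OF assms(2)] K(11)[OF cd(1)] l(1) by auto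
    qed
    then show "a = i \<or> a = j" using l(2) K(2) c4 assms(3) e by (auto simp: inj_on_def)
  next
    assume "a = i \<or> a = j"
    then show "{w a, last (P e)} \<in> edges (induced G (K4_verts w P))"
      unfolding K(3) using assms(2) e by blast
  qed
  finally show ?thesis using e by simp
qed

text \<open>The end of a path sees exactly two branch vertices, so adjacency determines which pair a
  path belongs to. This covers permutations of the labels as well as the output of the program,
  where the branch vertices are first known only as a set.\<close>

lemma K4_relabel:
  assumes K: "K4s w P" and img: "w' ` {..<4} = w ` {..<4}" and inj: "inj_on w' {..<4}"
    and pi: "bij_betw \<pi> K4_pairs K4_pairs" and P': "\<And>e. e \<in> K4_pairs \<Longrightarrow> P' e = P (\<pi> e)"
    and adj: "\<And>i j. (i, j) \<in> K4_pairs \<Longrightarrow> adj G (w' i) (last (P' (i, j))) \<and> adj G (w' j) (last (P' (i, j)))"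
  shows "K4s w' P'" "K4_verts w' P' = K4_verts w P" "K4_tests w' P' = K4_tests w P" "K4_opts w' P' = K4_opts w P"
proof -
  note KD = K4sD[OF K]
  have pin: "\<pi> e \<in> K4_pairs" if "e \<in> K4_pairs" for e using pi that by (auto simp: bij_betw_def)
  have piI: "(\<lambda>e. F (\<pi> e)) ` K4_pairs = F ` K4_pairs" for F :: "nat \<times> nat \<Rightarrow> 'b"
  proof -
    have "\<pi> ` K4_pairs = K4_pairs" using pi by (simp add: bij_betw_def)
    then show ?thesis by (metis image_image)
  qed
  have piU: "(\<Union>e\<in>K4_pairs. F (\<pi> e)) = (\<Union>e\<in>K4_pairs. F e)" for F :: "nat \<times> nat \<Rightarrow> 'b set"
    unfolding piI[of F] ..
  \<comment> \<open>Both \<open>w'\<close> labels of \<open>e\<close> are adjacent to the end of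
    \<open>P (\<pi> e)\<close>, which by \<open>K4_adj\<close> sees only the two branch vertices of
    \<open>\<pi> e\<close>.\<close>
  have eq: "{w' (fst e), w' (snd e)} = {w (fst (\<pi> e)), w (snd (\<pi> e))}" if e: "e \<in> K4_pairs" for e
  proof -
    have e4: "fst e < 4" "snd e < 4" "fst e \<noteq> snd e" using e by (auto simp: K4_pairs_def)
    have "u = w (fst (\<pi> e)) \<or> u = w (snd (\<pi> e))" if u: "u \<in> {w' (fst e), w' (snd e)}" for u
    proof -
      have "u \<in> w ` {..<4}" using u e4 img by auto
      then obtain a where a: "a < 4" "u = w a" by auto
      have "adj G (w' (fst e)) (last (P (\<pi> e))) \<and> adj G (w' (snd e)) (last (P (\<pi> e)))"
        using adj[of "fst e" "snd e"] P'[OF e] e by simp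
      then have "adj G u (last (P (\<pi> e)))" using u by blast
      then show ?thesis using K4_adj[OF K pin[OF e] a(1)] a(2) by auto
    qed
    moreover have "w' (fst e) \<noteq> w' (snd e)" using inj e4 by (auto simp: inj_on_def)
    ultimately show ?thesis by (intro doubleton_eqI) simp_all
  qed
  have tst: "(\<lambda>(i, j). ({w' i, w' j}, hd (P' (i, j)))) ` K4_pairs = (\<lambda>(i, j). ({w i, w j}, hd (P (i, j)))) ` K4_pairs"
  proof -
    have "(\<lambda>(i, j). ({w' i, w' j}, hd (P' (i, j)))) ` K4_pairs = (\<lambda>e. ({w (fst (\<pi> e)), w (snd (\<pi> e))}, hd (P (\<pi> e)))) ` K4_pairs"
      using eq P' by (intro image_cong) (auto simp: case_prod_beta)
    also have "\<dots> = (\<lambda>e. ({w (fst e), w (snd e)}, hd (P e))) ` K4_pairs" by (rule piI)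
    finally show ?thesis by (simp add: case_prod_beta)
  qed
  have V: "(\<Union>e\<in>K4_pairs. set (P' e)) = (\<Union>e\<in>K4_pairs. set (P e))"
    using piU[of "\<lambda>e. set (P e)"] P' by simp
  show KV: "K4_verts w' P' = K4_verts w P" unfolding K4_verts_def V img ..
  have im: "(\<lambda>e. f (P' e)) ` K4_pairs = (\<lambda>e. f (P e)) ` K4_pairs" for f :: "'a list \<Rightarrow> 'b"
    using piI[of "\<lambda>e. f (P e)"] P' by (metis (no_types, lifting) image_cong)
  show "K4_tests w' P' = K4_tests w P"
    unfolding K4_tests_def tst im[of "\<lambda>p. ({last p}, hd p)"] ..
  show "K4_opts w' P' = K4_opts w P"
    unfolding K4_opts_def im[of last] im[of "\<lambda>p. p ! (length p - 2)"] img ..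
  show "K4s w' P'"
  proof (rule K4sI)
    show "K4_verts w' P' \<subseteq> verts G" using KV KD(10) by simp
    have "bij_betw ((\<lambda>e. hd (P e)) \<circ> \<pi>) K4_pairs X" using bij_betw_trans[OF pi KD(1)] .
    then show "bij_betw (\<lambda>e. hd (P' e)) K4_pairs X" using P' by (subst bij_betw_cong[where g = "(\<lambda>e. hd (P e)) \<circ> \<pi>"]) auto
    have "(\<Union>e\<in>K4_pairs. path_edges (P' e)) = (\<Union>e\<in>K4_pairs. path_edges (P e))"
      using piU[of "\<lambda>e. path_edges (P e)"] P' by simp
    moreover have "(\<Union>(i, j)\<in>K4_pairs. {{w' i, last (P' (i, j))}, {w' j, last (P' (i, j))}}) =
        (\<Union>(i, j)\<in>K4_pairs. {{w i, last (P (i, j))}, {w j, last (P (i, j))}})"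
    proof -
      define F where "F A l = (\<lambda>u. {u, l}) ` A" for A :: "'a set" and l
      have "(\<Union>(i, j)\<in>K4_pairs. {{w' i, last (P' (i, j))}, {w' j, last (P' (i, j))}}) =
          (\<Union>e\<in>K4_pairs. F {w' (fst e), w' (snd e)} (last (P' e)))" unfolding F_def by auto
      also have "\<dots> = (\<Union>e\<in>K4_pairs. F {w (fst (\<pi> e)), w (snd (\<pi> e))} (last (P (\<pi> e))))"
        using eq P' by simp
      also have "\<dots> = (\<Union>e\<in>K4_pairs. F {w (fst e), w (snd e)} (last (P e)))"
        by (rule piU[of "\<lambda>e. F {w (fst e), w (snd e)} (last (P e))"])
      also have "\<dots> = (\<Union>(i, j)\<in>K4_pairs. {{w i, last (P (i, j))}, {w j, last (P (i, j))}})" unfolding F_def by auto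
      finally show ?thesis .
    qed
    ultimately show "edges (induced G (K4_verts w' P')) = (\<Union>e\<in>K4_pairs. path_edges (P' e)) \<union>
       (\<Union>(i, j)\<in>K4_pairs. {{w' i, last (P' (i, j))}, {w' j, last (P' (i, j))}})"
      unfolding KV KD(3) by simp
    fix e assume e: "e \<in> K4_pairs"
    show "2 \<le> length (P' e)" "distinct (P' e)" using KD(4,5)[OF pin[OF e]] P'[OF e] by auto
    show "set (P' e) \<inter> set (P' f) = {}" if f: "f \<in> K4_pairs" "e \<noteq> f" for f
    proof -
      have "\<pi> e \<noteq> \<pi> f" using pi e f by (auto simp: bij_betw_def inj_on_def)
      then show ?thesis using KD(6)[OF pin[OF e] pin[OF f(1)]] P' e f by simp
    qed
    show "w' i \<notin> set (P' e)" if "i < 4" for i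
    proof -
      have "w' i \<in> w ` {..<4}" using that img by auto
      then show ?thesis using KD(7)[OF pin[OF e]] P'[OF e] by auto
    qed
  qed (rule inj)
qed

lemma K4_permute:
  assumes K: "K4s w P" and f: "bij_betw f {..<4} {..<4}"
  defines "w' \<equiv> w \<circ> f" and "P' \<equiv> P \<circ> pair_map f"
  shows "K4s w' P'" "K4_verts w' P' = K4_verts w P" "K4_tests w' P' = K4_tests w P" "K4_opts w' P' = K4_opts w P"
proof -
  have f4: "f i < 4" if "i < 4" for i using f that by (auto simp: bij_betw_def)
  have fi: "f ` {..<4} = {..<4}" "inj_on f {..<4}" using f by (auto simp: bij_betw_def)
  have "inj_on w (f ` {..<4})" using K4sD(2)[OF K] fi(1) by simp
  then have "inj_on w' {..<4}" unfolding w'_def by (rule comp_inj_on[OF fi(2)])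
  moreover have "w' ` {..<4} = w ` {..<4}" unfolding w'_def image_comp[symmetric] fi(1) ..
  ultimately have a: "w' ` {..<4} = w ` {..<4}" "inj_on w' {..<4}" by auto
  note pm = bij_pair_map[OF f]
  have adj: "adj G (w' i) (last (P' (i, j))) \<and> adj G (w' j) (last (P' (i, j)))" if ij: "(i, j) \<in> K4_pairs" for i j
  proof -
    have 4: "i < 4" "j < 4" using ij by (auto simp: K4_pairs_def)
    have "pair_map f (i, j) \<in> K4_pairs" using pm ij by (auto simp: bij_betw_def)
    from K4_adj[OF K this f4[OF 4(1)]] K4_adj[OF K this f4[OF 4(2)]] show ?thesis
      unfolding w'_def P'_def by (auto simp: pair_map_def min_def max_def)
  qed
  have P': "P' e = P (pair_map f e)" for e by (simp add: P'_def)
  note r = K4_relabel[OF K a pm P' adj]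
  show "K4s w' P'" by (rule r)
  show "K4_verts w' P' = K4_verts w P" by (rule r)
  show "K4_tests w' P' = K4_tests w P" by (rule r)
  show "K4_opts w' P' = K4_opts w P" by (rule r)
qed

end

lemma reach_split:
  assumes "reach G S x y" "x \<in> S" "x \<notin> B" "y \<in> B"
  obtains z where "z \<in> B" "z \<in> S" "reach G (insert z (S - B)) x z"
  using reach_first_hit[OF assms(1,4,2,3)] by blast

context kstruct
begin

text \<open>Through this lemma one structure is confronted with the cutsets of another in
  \<open>exclusive\<close>.\<close>

lemma linked_K: "linked G X K"
proof (rule linkedI)
  show "X \<subseteq> K" using X_eq p_in L2 by (fastforce simp: K_def hd_conv_nth)
  fix i assume i: "i < k"
  obtain t where t: "i = (0 + t) mod k" using cyclic_shift[OF k_pos i] by blast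
  have "reach G K (p i 0) (s i)" unfolding s_nth[OF i]
    by (rule segment_reach[OF i]) (use L2[OF i] p_in[OF i] in auto)
  moreover have "reach G K (s (0 mod k)) (s i)" unfolding t
    by (rule arc_reach) (use s_K k_pos in auto)
  ultimately show "reach G K (p i 0) (s 0)" using k_pos by (simp add: reach_commute[of G K "s 0"] reach_trans[of G K "p i 0" "s i"])
qed

lemma ends_cycle: "is_cycle G (map (\<lambda>i. s i) [0..<k])"
proof -
  let ?c = "map (\<lambda>i. s i) [0..<k]"
  have "successively (adj G) ?c"
    unfolding successively_nth
  proof (intro allI impI)
    fix j assume "Suc j < length ?c"
    then show "adj G (?c ! j) (?c ! Suc j)" using adj_s[of j] by simp
  qed
  moreover have "adj G (last ?c) (hd ?c)"
  proof -
    have "last ?c = s (k - 1)" "hd ?c = s 0" using k_pos by (simp_all add: last_map hd_map)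
    then show ?thesis using adj_s[of "k - 1"] k_pos by simp
  qed
  moreover have "distinct ?c" using s_eq by (auto simp: distinct_map inj_on_def)
  moreover have "set ?c \<subseteq> verts G" using s_K K_verts by auto
  ultimately show ?thesis unfolding is_cycle_iff using k5 by simp
qed

end

lemma filter_union:
  "(\<And>e. e \<in> A \<Longrightarrow> Q e) \<Longrightarrow> (\<And>e. e \<in> B \<Longrightarrow> Q e) \<Longrightarrow> (\<And>e. e \<in> C \<Longrightarrow> \<not> Q e) \<Longrightarrow> {e \<in> A \<union> B \<union> C. Q e} = A \<union> B"
  by blast

context kgraph6
begin

text \<open>The cycle structure that is left when \<open>d\<close> is deleted: the paths
  \<open>ad\<close>, \<open>bd\<close>, \<open>cd\<close> are prolonged by \<open>a\<close>,
  \<open>b\<close>, \<open>c\<close>, so that the ends are \<open>a\<close>, \<open>s_ab\<close>,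
  \<open>b\<close>, \<open>s_bc\<close>, \<open>c\<close>, \<open>s_ac\<close> in cyclic order. Even
  indices are the prolonged paths.\<close>

definition K4sub :: "(nat \<Rightarrow> 'a) \<Rightarrow> (nat \<times> nat \<Rightarrow> 'a list) \<Rightarrow> nat \<Rightarrow> 'a list" where
  "K4sub w P = (\<lambda>i. if i = 0 then P (0, 3) @ [w 0] else if i = 1 then P (0, 1) else if i = 2 then P (1, 3) @ [w 1]
     else if i = 3 then P (1, 2) else if i = 4 then P (2, 3) @ [w 2] else P (0, 2))"

definition K4sub_index :: "nat \<Rightarrow> nat \<times> nat" where
  "K4sub_index i = (if i = 0 then (0, 3) else if i = 1 then (0, 1) else if i = 2 then (1, 3)
     else if i = 3 then (1, 2) else if i = 4 then (2, 3) else (0, 2))"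

lemma bij_K4sub_index: "bij_betw K4sub_index {..<6} K4_pairs"
  unfolding bij_betw_def by (simp add: lessThan_6 K4sub_index_def K4_pairs_eq insert_commute)

lemma K4sub_verts:
  assumes "K4s w P" shows "(\<Union>i<6. set (K4sub w P i)) = K4_verts w P - {w 3}"
proof -
  note K = K4sD[OF assms]
  have "w 3 \<notin> set (P e)" if "e \<in> K4_pairs" for e using K(7)[OF that] by simp
  moreover have "w 3 \<noteq> w 0" "w 3 \<noteq> w 1" "w 3 \<noteq> w 2"
    using inj_onD[OF K(2), of 3 0] inj_onD[OF K(2), of 3 1] inj_onD[OF K(2), of 3 2] by auto
  ultimately show ?thesis
    by (simp add: lessThan_6 lessThan_4 K4_pairs_eq K4_verts_def K4sub_def) blast
qed

lemma kst_K4sub: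
  assumes "K4s w P" shows "kst (K4sub w P)"
proof -
  note K = K4sD[OF assms]
  let ?Q = "K4sub w P" and ?W = "K4_verts w P"
  have U: "(\<Union>i<6. set (?Q i)) = ?W - {w 3}" by (rule K4sub_verts[OF assms])
  have pr: "(0,1) \<in> K4_pairs" "(0,2) \<in> K4_pairs" "(0,3) \<in> K4_pairs" "(1,2) \<in> K4_pairs" "(1,3) \<in> K4_pairs" "(2,3) \<in> K4_pairs"
    by (auto simp: K4_pairs_eq)
  have ne: "P e \<noteq> []" if "e \<in> K4_pairs" for e using K(4)[OF that] by auto
  have idx: "set (P (K4sub_index i)) \<subseteq> set (?Q i)" "hd (?Q i) = hd (P (K4sub_index i))" if "i < 6" for i
    using that pr[THEN ne] by (auto simp: K4sub_def K4sub_index_def)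
  have wn: "w i \<noteq> w j" if "i < 4" "j < 4" "i \<noteq> j" for i j using inj_onD[OF K(2), of i j] that by auto
  have w3: "w 3 \<notin> e" if "e \<in> path_edges (P q)" "q \<in> K4_pairs" for e q
    using path_edges_sub[OF that(1)] K(7)[OF that(2)] by auto
  have l3: "w 3 \<noteq> last (P q)" if "q \<in> K4_pairs" for q
  proof -
    have "w 3 \<notin> set (P q)" using K(7)[OF that] by simp
    then show ?thesis using K(11)[OF that] by metis
  qed
  have E1: "edges (induced G (?W - {w 3})) = {e \<in> edges (induced G ?W). w 3 \<notin> e}"
    by (auto simp: induced_def)
  let ?PE = "path_edges (P (0,1)) \<union> path_edges (P (0,2)) \<union> path_edges (P (0,3)) \<union> path_edges (P (1,2)) \<union>
      path_edges (P (1,3)) \<union> path_edges (P (2,3))"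
  let ?C = "{{w 0, last (P (0,1))}, {w 1, last (P (0,1))}, {w 0, last (P (0,2))}, {w 2, last (P (0,2))}, {w 0, last (P (0,3))},
      {w 1, last (P (1,2))}, {w 2, last (P (1,2))}, {w 1, last (P (1,3))}, {w 2, last (P (2,3))}}"
  let ?C3 = "{{w 3, last (P (0,3))}, {w 3, last (P (1,3))}, {w 3, last (P (2,3))}}"
  have EW: "edges (induced G ?W) = ?PE \<union> ?C \<union> ?C3"
    unfolding K(3) K4_pairs_eq by auto
  have h1: "e \<in> ?PE \<Longrightarrow> w 3 \<notin> e" for e using w3 pr by blast
  have h2: "e \<in> ?C \<Longrightarrow> w 3 \<notin> e" for e
    using wn[of 3 0] wn[of 3 1] wn[of 3 2] l3[OF pr(1)] l3[OF pr(2)] l3[OF pr(3)] l3[OF pr(4)] l3[OF pr(5)] l3[OF pr(6)]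
    by (elim insertE emptyE) simp_all
  have h3: "e \<in> ?C3 \<Longrightarrow> \<not> w 3 \<notin> e" for e by (elim insertE emptyE) simp_all
  have E2: "edges (induced G (?W - {w 3})) = ?PE \<union> ?C"
    unfolding E1 EW by (rule filter_union[OF h1 h2 h3])
  have cyc: "{{last (?Q i), last (?Q (Suc i mod 6))} | i. i < 6} = {{w 0, last (P (0,1))}, {w 1, last (P (0,1))},
      {w 1, last (P (1,2))}, {w 2, last (P (1,2))}, {w 2, last (P (0,2))}, {w 0, last (P (0,2))}}"
  proof -
    have "{{last (?Q i), last (?Q (Suc i mod 6))} | i. i < 6} = (\<lambda>i. {last (?Q i), last (?Q (Suc i mod 6))}) ` {..<6}"
      by auto
    then show ?thesis by (simp add: lessThan_6 K4sub_def insert_commute)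
  qed
  have Q: "path_edges (?Q 0) = insert {w 0, last (P (0,3))} (path_edges (P (0,3)))" "path_edges (?Q 1) = path_edges (P (0,1))"
    "path_edges (?Q 2) = insert {w 1, last (P (1,3))} (path_edges (P (1,3)))" "path_edges (?Q 3) = path_edges (P (1,2))"
    "path_edges (?Q 4) = insert {w 2, last (P (2,3))} (path_edges (P (2,3)))" "path_edges (?Q 5) = path_edges (P (0,2))"
    by (simp_all add: K4sub_def path_edges_snoc[OF ne[OF pr(3)]] path_edges_snoc[OF ne[OF pr(5)]] path_edges_snoc[OF ne[OF pr(6)]] insert_commute del: One_nat_def)
  \<comment> \<open>The two lists of edges differ only in their grouping; with the edges and edge
    sets abstracted to variables this is plain set algebra.\<close>
  have gen: "A1 \<union> A2 \<union> A3 \<union> A4 \<union> A5 \<union> A6 \<union> {a, b, c, d, e, f, g, h, i} =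
      insert e A3 \<union> (A1 \<union> (insert h A5 \<union> (A4 \<union> (insert i A6 \<union> (A2 \<union> {}))))) \<union> {a, b, f, g, d, c}"
    for A1 A2 A3 A4 A5 A6 :: "'b set" and a b c d e f g h i
    by blast
  have E3: "?PE \<union> ?C = (\<Union>i<6. path_edges (?Q i)) \<union> {{last (?Q i), last (?Q (Suc i mod 6))} | i. i < 6}"
    unfolding cyc lessThan_6 UN_insert UN_empty Q by (rule gen)
  have bij: "bij_betw (\<lambda>i. hd (?Q i)) {..<6} X"
  proof -
    have "bij_betw ((\<lambda>e. hd (P e)) \<circ> K4sub_index) {..<6} X" by (rule bij_betw_trans[OF bij_K4sub_index K(1)])
    then show ?thesis using idx(2) by (subst bij_betw_cong[where g = "(\<lambda>e. hd (P e)) \<circ> K4sub_index"]) auto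
  qed
  have len: "2 \<le> length (?Q i)" "distinct (?Q i)" if "i < 6" for i
    using that K(4)[OF pr(1)] K(4)[OF pr(2)] K(4)[OF pr(3)] K(4)[OF pr(4)] K(4)[OF pr(5)] K(4)[OF pr(6)]
      K(5)[OF pr(1)] K(5)[OF pr(2)] K(5)[OF pr(3)] K(5)[OF pr(4)] K(5)[OF pr(5)] K(5)[OF pr(6)]
      K(7)[OF pr(3), of 0] K(7)[OF pr(5), of 1] K(7)[OF pr(6), of 2]
    by (auto simp: K4sub_def)
  have trm: "terminal (induced G (?W - {w 3})) x" if x: "x \<in> X" for x
  proof -
    obtain i where i: "i < 6" "x = hd (?Q i)" using bij x by (auto simp: bij_betw_def)
    obtain a b xs where Q: "?Q i = a # b # xs"
      using len(1)[OF i(1)] by (cases "?Q i"; cases "tl (?Q i)") auto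
    have "{a, b} \<in> path_edges (?Q i)" unfolding path_edges_def Q by force
    then have "{a, b} \<in> edges (induced G (?W - {w 3}))" unfolding E2 E3 using i(1) by blast
    then have ab: "adj (induced G (?W - {w 3})) a b" by (simp add: adj_def)
    then show ?thesis using i Q x by (intro terminal_induced[where y = b]) (auto simp: adj_induced)
  qed
  have dis: "set (?Q i) \<inter> set (?Q j) = {}" if "i < 6" "j < 6" "i \<noteq> j" for i j
  proof -
    \<comment> \<open>The vertex that prolongs the path at an even index \<open>i\<close> is
      \<open>w (i div 2)\<close>.\<close>
    have part: "u \<in> set (P (K4sub_index i)) \<or> (even i \<and> u = w (i div 2))" if "i < 6" "u \<in> set (?Q i)" for i u
      using that unfolding below_6 by (elim disjE) (auto simp: K4sub_def K4sub_index_def)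
    have pin: "K4sub_index i \<in> K4_pairs" if "i < 6" for i using bij_K4sub_index that by (auto simp: bij_betw_def)
    have pd: "set (P (K4sub_index i)) \<inter> set (P (K4sub_index j)) = {}"
      using K(6)[OF pin pin] that bij_K4sub_index by (auto simp: bij_betw_def inj_on_def)
    have "u \<notin> set (?Q j)" if u: "u \<in> set (?Q i)" for u
    proof
      assume u': "u \<in> set (?Q j)"
      have 4: "i div 2 < 4" "j div 2 < 4" using \<open>i < 6\<close> \<open>j < 6\<close> by auto
      show False
        using part[OF \<open>i < 6\<close> u] part[OF \<open>j < 6\<close> u'] pd K(7)[OF pin[OF \<open>i < 6\<close>] 4(2)] K(7)[OF pin[OF \<open>j < 6\<close>] 4(1)]
          wn[OF 4] \<open>i \<noteq> j\<close> by (auto elim!: evenE)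
    qed
    then show ?thesis by blast
  qed
  have KV: "?W - {w 3} \<subseteq> verts G" using K(10) by auto
  have "k_structure 6 X (induced G (?W - {w 3})) ?Q"
    unfolding k_structure_def E2 U
    using simple_induced bij trm len dis E3 KV by (auto simp: induced_def)
  then show ?thesis using structure_kst[of ?Q] U KV by simp
qed

lemma K4sub_tests:
  "k_tests 6 (K4sub w P) = {({w 0}, hd (P (0, 3) @ [w 0])), ({last (P (0, 1))}, hd (P (0, 1))), ({w 1}, hd (P (1, 3) @ [w 1])),
     ({last (P (1, 2))}, hd (P (1, 2))), ({w 2}, hd (P (2, 3) @ [w 2])), ({last (P (0, 2))}, hd (P (0, 2)))}"
  by (simp add: k_tests_def lessThan_6 K4sub_def insert_commute)

text \<open>With \<open>w 3\<close> deleted, the end \<open>w i\<close> of a prolonged path plays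
  the part of the cutset \<open>{w i, w 3}\<close>; the remaining tests are tests of the
  \<open>K4\<close> structure as they stand.\<close>

lemma leaky_K4sub:
  assumes K: "K4s w P" and l: "leaky G X (k_tests 6 (K4sub w P)) (S - {w 3})"
  shows "leaky G X (K4_tests w P) S"
proof -
  have pr: "(0,1) \<in> K4_pairs" "(0,2) \<in> K4_pairs" "(0,3) \<in> K4_pairs" "(1,2) \<in> K4_pairs" "(1,3) \<in> K4_pairs" "(2,3) \<in> K4_pairs"
    by (auto simp: K4_pairs_eq)
  have hd: "hd (P e @ [u]) = hd (P e)" if "e \<in> K4_pairs" for e u
    using K4sD(4)[OF K that] by (cases "P e") auto
  obtain D x y where t: "(D, x) \<in> k_tests 6 (K4sub w P)" "y \<in> X - {x}" "reach G (S - {w 3} - D) x y"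
    using l unfolding leaky_def by blast
  have ti: "({w i, w j}, hd (P (i, j))) \<in> K4_tests w P" "({last (P (i, j))}, hd (P (i, j))) \<in> K4_tests w P"
    if "(i, j) \<in> K4_pairs" for i j
    using that unfolding K4_tests_def by (auto simp: image_iff intro: bexI[of _ "(i, j)"])
  have "(insert (w 3) D, x) \<in> K4_tests w P \<or> (D, x) \<in> K4_tests w P"
    using t(1) unfolding K4sub_tests
    using ti[OF pr(1)] ti[OF pr(2)] ti[OF pr(3)] ti[OF pr(4)] ti[OF pr(5)] ti[OF pr(6)] hd[OF pr(3)] hd[OF pr(5)] hd[OF pr(6)]
    by (elim insertE emptyE) (simp_all add: insert_commute)
  then obtain D' where D': "(D', x) \<in> K4_tests w P" "D' \<subseteq> insert (w 3) D" by blast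
  have "reach G (S - D') x y" by (rule reach_mono[OF t(3)]) (use D'(2) in auto)
  then show ?thesis unfolding leaky_def using D'(1) t(2) by blast
qed

text \<open>Minimality passes to the cycle structure through \<open>leaky_K4sub\<close>, so
  \<open>leaky_structure\<close> applies after the deletion of \<open>w 3\<close>, which is then
  added to the cut. Of the two exceptional patterns only the one on the unprolonged paths
  survives.\<close>

lemma K4sub_leaky_structure:
  assumes K: "K4s w P" and S: "K4_verts w P \<subseteq> S" "S \<subseteq> verts G"
    and leak: "leaky G X (k_tests 6 (K4sub w P)) (S - {w 3})"
    and min: "\<And>u. u \<in> S - K4_verts w P \<Longrightarrow> \<not> leaky G X (K4_tests w P) (S - {u})"
  shows "(\<exists>U\<subseteq>K4_opts w P. good_cut G X S U) \<or>
    (\<exists>v. v \<in> S - K4_verts w P \<and> S = insert v (K4_verts w P) \<and>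
      {u \<in> K4_verts w P - {w 3}. adj G v u} = {P (0,1) ! (length (P (0,1)) - 2), P (1,2) ! (length (P (1,2)) - 2), P (0,2) ! (length (P (0,2)) - 2)})"
proof -
  let ?Q = "K4sub w P" and ?W = "K4_verts w P"
  note KD = K4sD[OF K]
  interpret Q: kstruct G 6 X ?Q by unfold_locales (rule kst_K4sub[OF K])
  have QK: "Q.K = ?W - {w 3}" unfolding Q.K_def by (rule K4sub_verts[OF K])
  have pr: "(0,1) \<in> K4_pairs" "(0,2) \<in> K4_pairs" "(0,3) \<in> K4_pairs" "(1,2) \<in> K4_pairs" "(1,3) \<in> K4_pairs" "(2,3) \<in> K4_pairs"
    by (auto simp: K4_pairs_eq)
  have w3S: "w 3 \<in> S" using KD(9)[of 3] S(1) by auto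
  have ex: "(\<exists>U\<subseteq>Q.opts. good_cut G X (S - {w 3}) U) \<or>
    (6 :: nat) = 6 \<and> (\<exists>v J. v \<in> S - {w 3} - Q.K \<and> S - {w 3} = insert v Q.K \<and> (J = {0, 2, 4} \<or> J = {1, 3, 5}) \<and>
      {u \<in> Q.K. adj G v u} = (\<lambda>i. ?Q i ! (length (?Q i) - 2)) ` J)"
  proof (rule Q.leaky_structure[OF _ _ leak])
    show "Q.K \<subseteq> S - {w 3}" "S - {w 3} \<subseteq> verts G" using QK S by auto
    fix u assume u: "u \<in> S - {w 3} - Q.K"
    have "S - {w 3} - {u} = S - {u} - {w 3}" by auto
    moreover have "u \<in> S - ?W" using u QK by auto
    ultimately show "\<not> leaky G X (k_tests 6 ?Q) (S - {w 3} - {u})"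
      using leaky_K4sub[OF K, of "S - {u}"] min[of u] by auto
  qed
  then show ?thesis
  proof
    assume "\<exists>U\<subseteq>Q.opts. good_cut G X (S - {w 3}) U"
    then obtain U where U: "U \<subseteq> Q.opts" "good_cut G X (S - {w 3}) U" by blast
    have "S - {w 3} - U = S - insert (w 3) U" by auto
    then have "good_cut G X S (insert (w 3) U)" using U(2) unfolding good_cut_def by simp
    moreover have "insert (w 3) U \<subseteq> K4_opts w P"
    proof -
      have l: "length (P e) - 1 < length (P e)" "P e ! (length (P e) - 1) = last (P e)" if "e \<in> K4_pairs" for e
        using KD(4)[OF that] by (cases "P e = []"; simp add: last_conv_nth)+
      have o: "last (P e) \<in> K4_opts w P" "P e ! (length (P e) - 2) \<in> K4_opts w P" if "e \<in> K4_pairs" for e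
        using that unfolding K4_opts_def by auto
      have ow: "w i \<in> K4_opts w P" if "i < 4" for i using that unfolding K4_opts_def by auto
      have sn: "(P e @ [u]) ! (length (P e @ [u]) - 1) = u" "(P e @ [u]) ! (length (P e @ [u]) - 2) = last (P e)"
        if "e \<in> K4_pairs" for e u
        using KD(4)[OF that] by (cases "P e = []"; simp add: nth_append last_conv_nth numeral_2_eq_2)+
      have qs: "?Q 0 = P (0,3) @ [w 0]" "?Q 1 = P (0,1)" "?Q 2 = P (1,3) @ [w 1]" "?Q 3 = P (1,2)"
        "?Q 4 = P (2,3) @ [w 2]" "?Q 5 = P (0,2)"
        by (simp_all add: K4sub_def)
      have w4: "w 0 \<in> K4_opts w P" "w 1 \<in> K4_opts w P" "w 2 \<in> K4_opts w P" by (rule ow; simp)+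
      have q: "?Q i ! (length (?Q i) - 1) \<in> K4_opts w P \<and> ?Q i ! (length (?Q i) - 2) \<in> K4_opts w P" if "i < 6" for i
        using that unfolding below_6
        by (elim disjE; hypsubst; simp only: qs sn[OF pr(3)] sn[OF pr(5)] sn[OF pr(6)] l(2)[OF pr(1)] l(2)[OF pr(2)] l(2)[OF pr(4)]
            o[OF pr(1)] o[OF pr(2)] o[OF pr(3)] o[OF pr(4)] o[OF pr(5)] o[OF pr(6)] w4 simp_thms)
      have "U \<subseteq> K4_opts w P"
      proof
        fix u assume "u \<in> U"
        then have "u \<in> Q.opts" using U(1) by blast
        then obtain i where i: "i < 6" "u = ?Q i ! (length (?Q i) - 1) \<or> u = ?Q i ! (length (?Q i) - 2)" by blast
        from i(2) q[OF i(1)] show "u \<in> K4_opts w P" by (elim disjE) simp_all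
      qed
      then show ?thesis using ow[of 3] by simp
    qed
    ultimately show ?thesis by blast
  next
    assume "(6 :: nat) = 6 \<and> (\<exists>v J. v \<in> S - {w 3} - Q.K \<and> S - {w 3} = insert v Q.K \<and> (J = {0, 2, 4} \<or> J = {1, 3, 5}) \<and>
      {u \<in> Q.K. adj G v u} = (\<lambda>i. ?Q i ! (length (?Q i) - 2)) ` J)"
    then obtain v J where v: "v \<in> S - {w 3} - Q.K" "S - {w 3} = insert v Q.K"
      and J: "J = {0, 2, 4} \<or> J = {1, 3, 5}" and N: "{u \<in> Q.K. adj G v u} = (\<lambda>i. ?Q i ! (length (?Q i) - 2)) ` J"
      by blast
    have vS: "v \<in> S - ?W" "S = insert v ?W" using v QK w3S KD(9)[of 3] by auto
    \<comment> \<open>On a prolonged path the predecessor of the end is the old end, which is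
      adjacent to \<open>w 3\<close>. Two of them would form a square with \<open>v\<close> and
      \<open>w 3\<close>.\<close>
    have "J \<noteq> {0, 2, 4}"
    proof
      assume "J = {0, 2, 4}"
      have l: "?Q 0 ! (length (?Q 0) - 2) = last (P (0,3))" "?Q 2 ! (length (?Q 2) - 2) = last (P (1,3))"
      proof -
        have sn: "(P e @ [u]) ! (length (P e @ [u]) - 2) = last (P e)" if "e \<in> K4_pairs" for e u
          using KD(4)[OF that] by (cases "P e = []") (simp_all add: nth_append last_conv_nth numeral_2_eq_2)
        have "?Q 0 = P (0,3) @ [w 0]" "?Q 2 = P (1,3) @ [w 1]" by (simp_all add: K4sub_def)
        then show "?Q 0 ! (length (?Q 0) - 2) = last (P (0,3))" "?Q 2 ! (length (?Q 2) - 2) = last (P (1,3))"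
          by (simp_all only: sn[OF pr(3)] sn[OF pr(5)])
      qed
      have "last (P (0,3)) \<in> {u \<in> Q.K. adj G v u}" "last (P (1,3)) \<in> {u \<in> Q.K. adj G v u}"
        by (simp_all only: N \<open>J = {0, 2, 4}\<close> image_insert l insert_iff simp_thms)
      then have a: "adj G v (last (P (0,3)))" "adj G v (last (P (1,3)))" by auto
      have b: "adj G (w 3) (last (P (0,3)))" "adj G (w 3) (last (P (1,3)))"
        using K4_adj[OF K pr(3), of 3] K4_adj[OF K pr(5), of 3] by auto
      have "v = w 3 \<or> last (P (0,3)) = last (P (1,3))"
        by (rule no_square[OF a(1) iffD1[OF adj_commute b(1)] b(2) iffD1[OF adj_commute a(2)]])
      then show False using KD(6)[OF pr(3,5)] KD(11)[OF pr(3)] KD(11)[OF pr(5)] v by auto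
    qed
    then have "J = {1, 3, 5}" using J by simp
    then have "{u \<in> ?W - {w 3}. adj G v u} = {P (0,1) ! (length (P (0,1)) - 2), P (1,2) ! (length (P (1,2)) - 2), P (0,2) ! (length (P (0,2)) - 2)}"
      using N unfolding QK by (simp add: K4sub_def)
    then show ?thesis using vS by blast
  qed
qed

end

section \<open>Decomposition as the absence of leaks\<close>

context kgraph
begin

text \<open>There is a further terminal besides \<open>x\<close>, so its separation from
  \<open>x\<close> already disconnects the graph without \<open>D\<close>.\<close>

lemma separating_iff:
  assumes "D \<subseteq> verts G" "x \<in> verts G - D" "X - {x} \<subseteq> verts G - D"
  shows "separating_cutset G D x (X - {x}) \<longleftrightarrow> \<not> (\<exists>y\<in>X - {x}. reach G (verts G - D) x y)"
proof -
  have "card (X - {x}) \<ge> 4" using card_X k5 finite_X by (cases "x \<in> X") auto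
  then obtain y where y: "y \<in> X - {x}" by (metis all_not_in_conv card.empty not_numeral_le_zero)
  have v: "verts (induced G (verts G - D)) = verts G - D" by (auto simp: induced_def)
  have "\<not> connected_graph (induced G (verts G - D))" if "\<not> (\<exists>y\<in>X - {x}. reach G (verts G - D) x y)"
    unfolding connected_graph_def v using that y assms unfolding reach_def by blast
  then show ?thesis unfolding separating_cutset_def cutset_def using assms unfolding reach_def by blast
qed

lemma tree_linked:
  assumes "induced_tree_containing G X S"
  shows "linked G X S" "S \<subseteq> verts G" "\<And>c. is_cycle G c \<Longrightarrow> \<not> set c \<subseteq> S"
proof -
  have a: "S \<subseteq> verts G" "X \<subseteq> S" "connected_graph (induced G S)" "\<nexists>c. is_cycle (induced G S) c"
    using assms unfolding induced_tree_containing_def is_tree_def by auto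
  have "verts (induced G S) = S" using a by (auto simp: induced_def)
  then show "linked G X S" using a(2,3) unfolding linked_def connected_graph_def reach_def by blast
  show "S \<subseteq> verts G" by (rule a)
  show "\<not> set c \<subseteq> S" if "is_cycle G c" for c using a(4) that is_cycle_induced by metis
qed

lemma linked_hits:
  assumes l: "linked G X T" and T: "T \<subseteq> verts G" and x: "x \<in> X" and n: "\<not> (\<exists>y\<in>X - {x}. reach G (verts G - D) x y)"
  shows "T \<inter> D \<noteq> {}"
proof
  assume "T \<inter> D = {}"
  then have "T \<subseteq> verts G - D" using T by auto
  moreover have "card (X - {x}) \<ge> 4" using card_X k5 finite_X x by simp
  then obtain y where y: "y \<in> X - {x}" by (metis all_not_in_conv card.empty not_numeral_le_zero)
  moreover have "reach G T x y" using l x y unfolding linked_def by blast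
  ultimately show False using n reach_mono by metis
qed

lemma ex_min_leaky:
  assumes "leaky G X T S0" "K \<subseteq> S0" "finite S0"
  obtains S where "K \<subseteq> S" "S \<subseteq> S0" "leaky G X T S" "\<And>u. u \<in> S - K \<Longrightarrow> \<not> leaky G X T (S - {u})"
proof -
  have "\<exists>S. K \<subseteq> S \<and> S \<subseteq> S0 \<and> leaky G X T S \<and> (\<forall>u\<in>S - K. \<not> leaky G X T (S - {u}))"
    using assms(3,1,2)
  proof (induction S0 rule: finite_psubset_induct)
    case (psubset S)
    show ?case
    proof (cases "\<forall>u\<in>S - K. \<not> leaky G X T (S - {u})")
      case True
      then show ?thesis using psubset.prems by blast
    next
      case False
      then obtain u where u: "u \<in> S - K" "leaky G X T (S - {u})" by blast
      then have "\<exists>S'. K \<subseteq> S' \<and> S' \<subseteq> S - {u} \<and> leaky G X T S' \<and> (\<forall>u\<in>S' - K. \<not> leaky G X T (S' - {u}))"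
        by (intro psubset.IH) (use psubset.prems in auto)
      then show ?thesis by blast
    qed
  qed
  then show ?thesis using that by blast
qed

lemma good_cut_tree:
  assumes "good_cut G X S U" "S \<subseteq> verts G"
  shows "\<exists>M. induced_tree_containing G X M"
proof -
  have "finite (S - U)" using assms(2) finite_verts by (meson finite_Diff finite_subset)
  then obtain M where M: "M \<subseteq> S - U" "min_linked G X M"
    using ex_min_linked[of G X "S - U"] assms(1) unfolding good_cut_def by blast
  then have "\<nexists>c. is_cycle G c \<and> set c \<subseteq> M" using assms(1) unfolding good_cut_def by blast
  then show ?thesis using min_linked_tree[OF M(2)] M(1) assms(2) by blast
qed

end

context kstruct
begin

lemma s_notin_X: "i < k \<Longrightarrow> s i \<notin> X"
proof
  assume i: "i < k" and "s i \<in> X"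
  then obtain l where "l < k" "s i = p l 0" using X_eq by auto
  then show False using p_neq_s[of l i 0] i L2[of l] by simp
qed

lemma decomposing_iff: "decomposing_k_structure k X G P \<longleftrightarrow> \<not> leaky G X (k_tests k P) (verts G)"
proof -
  have 1: "(\<Union>i<k. set (P i)) \<subseteq> verts G" "k_structure k X (induced G (\<Union>i<k. set (P i))) P"
    using kst kst_iff by auto
  have "separating_cutset G {s i} (hd (P i)) (X - {hd (P i)}) \<longleftrightarrow> \<not> (\<exists>y\<in>X - {hd (P i)}. reach G (verts G - {s i}) (hd (P i)) y)"
    if i: "i < k" for i
  proof (rule separating_iff)
    show "{s i} \<subseteq> verts G" using s_K[OF i] K_verts by auto
    have "hd (P i) \<in> X" using X_eq i x_nth by auto
    then show "hd (P i) \<in> verts G - {s i}" using s_notin_X[OF i] X_verts by auto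
    show "X - {hd (P i)} \<subseteq> verts G - {s i}" using s_notin_X[OF i] X_verts by auto
  qed
  then show ?thesis unfolding decomposing_k_structure_def leaky_def k_tests_def using 1 by auto
qed

lemma linked_ends:
  assumes "\<not> leaky G X (k_tests k P) (verts G)" "linked G X T" "T \<subseteq> verts G" "i < k"
  shows "s i \<in> T"
proof -
  have "\<not> (\<exists>y\<in>X - {hd (P i)}. reach G (verts G - {s i}) (hd (P i)) y)"
    using assms(1,4) unfolding leaky_def k_tests_def by auto
  moreover have "hd (P i) \<in> X" using X_eq assms(4) x_nth by auto
  ultimately show ?thesis using linked_hits[OF assms(2,3)] by blast
qed

end

context kgraph6
begin

text \<open>Rotation by one step turns the odd pattern of attachments into the even one.\<close>

lemma kst_rotate:
  assumes "kst P" shows "kst (\<lambda>i. P (Suc i mod 6))"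
proof -
  let ?r = "\<lambda>i :: nat. Suc i mod 6"
  have r6: "?r i < 6" for i by simp
  have inj0: "i = j" if "i < 6" "j < 6" "?r i = ?r j" for i j
    using that by (cases "Suc i = 6"; cases "Suc j = 6") auto
  then have "inj_on ?r {..<6}" by (auto intro: inj_onI)
  moreover have "?r ` {..<6} \<subseteq> {..<6}" by auto
  ultimately have b: "bij_betw ?r {..<6} {..<6}" unfolding bij_betw_def using endo_inj_surj[OF finite_lessThan] by blast
  have inj: "?r i = ?r j \<longleftrightarrow> i = j" if "i < 6" "j < 6" for i j
    using inj0[OF that] by auto
  note K = assms[unfolded kst_def]
  show ?thesis unfolding kst_def
  proof (intro conjI allI impI)
    have U: "(\<Union>i<6. set (P (?r i))) = (\<Union>i<6. set (P i))"
    proof -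
      have "(\<Union>i\<in>?r ` {..<6}. set (P i)) = (\<Union>i<6. set (P i))" using b by (simp only: bij_betw_def)
      then show ?thesis by simp
    qed
    show "(\<Union>i<6. set (P (?r i))) \<subseteq> verts G" unfolding U using K by (elim conjE)
    have "bij_betw ((\<lambda>i. hd (P i)) \<circ> ?r) {..<6} X" by (rule bij_betw_trans[OF b]) (use K in \<open>elim conjE\<close>)
    then show "bij_betw (\<lambda>i. hd (P (?r i))) {..<6} X" by (simp add: comp_def)
    fix i :: nat assume i: "i < 6"
    show "2 \<le> length (P (?r i))" "distinct (P (?r i))" "chordless G (P (?r i))" using K r6 by (elim conjE; simp)+
    fix j :: nat assume j: "j < 6" "i \<noteq> j"
    show "set (P (?r i)) \<inter> set (P (?r j)) = {}" using K r6[of i] r6[of j] inj[OF i j(1)] j(2) by (elim conjE) blast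
    have "?r j = ?r (?r i) \<longleftrightarrow> j = ?r i" "?r i = ?r (?r j) \<longleftrightarrow> i = ?r j" using inj[OF j(1) r6] inj[OF i r6] by auto
    moreover have "\<forall>u\<in>set (P (?r i)). \<forall>v\<in>set (P (?r j)). adj G u v \<longleftrightarrow> u = last (P (?r i)) \<and> v = last (P (?r j)) \<and> (?r j = ?r (?r i) \<or> ?r i = ?r (?r j))"
      using K r6[of i] r6[of j] inj[OF i j(1)] j(2) by (elim conjE) simp
    ultimately show "\<forall>u\<in>set (P (?r i)). \<forall>v\<in>set (P (?r j)). adj G u v \<longleftrightarrow> u = last (P (?r i)) \<and> v = last (P (?r j)) \<and> (j = ?r i \<or> i = ?r j)"
      by simp
  qed
qed

text \<open>\<open>v\<close> becomes \<open>a\<close>, and the ends \<open>s 0\<close>,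
  \<open>s 2\<close>, \<open>s 4\<close> become \<open>b\<close>, \<open>c\<close>,
  \<open>d\<close>. The paths 0, 2, 4 lose their ends, so that the predecessors seen by
  \<open>v\<close> become \<open>s_ab\<close>, \<open>s_ac\<close>, \<open>s_ad\<close>. The end of
  each odd path lies between two of \<open>b\<close>, \<open>c\<close>, \<open>d\<close> on the
  cycle; the paths 1, 3, 5 become \<open>bc\<close>, \<open>cd\<close>, \<open>bd\<close>.\<close>

lemma K4_from_even:
  assumes K: "kst P" and v: "v \<in> verts G" "v \<notin> (\<Union>i<6. set (P i))"
    and N: "{u \<in> (\<Union>i<6. set (P i)). adj G v u} = (\<lambda>i. P i ! (length (P i) - 2)) ` {0, 2, 4}"
  shows "\<exists>w Q. K4s w Q \<and> K4_verts w Q = insert v (\<Union>i<6. set (P i))"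
proof -
  interpret kstruct G 6 X P by unfold_locales (rule K)
  define B where "B i = butlast (P i)" for i
  define w where "w i = (if i = 0 then v else if i = 1 then s 0 else if i = 2 then s 2 else s 4)" for i :: nat
  define Q where "Q e = (if e = (0,1) then B 0 else if e = (0,2) then B 2 else if e = (0,3) then B 4
    else if e = (1,2) then P 1 else if e = (2,3) then P 3 else P 5)" for e :: "nat \<times> nat"
  have vK: "v \<notin> K" and NK: "{u \<in> K. adj G v u} = {p 0 (L 0 - 2), p 2 (L 2 - 2), p 4 (L 4 - 2)}"
    using v N by (auto simp: K_def)
  have tv: "adj G v (p i (L i - 2))" if "i \<in> {0, 2, 4}" for i using NK that by blast
  \<comment> \<open>On a path with two vertices the predecessor of the end would be the terminal,
    with the two neighbours \<open>v\<close> and the end. So the shortened paths still have two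
    vertices.\<close>
  have L3: "3 \<le> L i" if i: "i \<in> {0, 2, 4}" for i
  proof (rule ccontr)
    assume "\<not> ?thesis"
    have ik: "i < 6" using i by auto
    then have "L i = 2" using L2[OF ik] \<open>\<not> 3 \<le> L i\<close> by simp
    then have "adj G (p i 0) v" "adj G (p i 0) (p i 1)"
      using tv[OF i] adj_same[OF ik, of 0 1] adj_commute[of G v] by auto
    moreover have "p i 0 \<in> X" using X_eq ik by auto
    ultimately have "v = p i 1" using terminal_unique by blast
    then show False using vK p_in[OF ik, of 1] \<open>L i = 2\<close> by simp
  qed
  have PB: "P i = B i @ [s i]" if "i < 6" for i using L2[OF that] unfolding B_def by (metis append_butlast_last_id list.size(3) not_numeral_le_zero)
  have Bl: "2 \<le> length (B i)" "last (B i) = p i (L i - 2)" "hd (B i) = hd (P i)" if "i \<in> {0, 2, 4}" for i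
  proof -
    have ik: "i < 6" using that by auto
    show l: "2 \<le> length (B i)" using L3[OF that] by (simp add: B_def)
    have ne: "B i \<noteq> []" using l by auto
    then have "last (B i) = B i ! (length (B i) - 1)" by (rule last_conv_nth)
    also have "\<dots> = (B i @ [s i]) ! (length (B i) - 1)"
    proof -
      have "length (B i) - 1 < length (B i)" using l by simp
      then show ?thesis by (simp only: nth_append if_True)
    qed
    also have "\<dots> = p i (length (B i) - 1)" unfolding PB[OF ik, symmetric] ..
    finally show "last (B i) = p i (L i - 2)" by (simp add: B_def numeral_2_eq_2)
    show "hd (B i) = hd (P i)" using arg_cong[OF PB[OF ik], of hd] ne by (metis hd_append2)
  qed
  have Bd: "set (B i) \<subseteq> set (P i)" "s i \<notin> set (B i)" "distinct (P i)" "distinct (B i)" "set (P i) = insert (s i) (set (B i))" if "i < 6" for i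
  proof -
    show d: "distinct (P i)" using K that by (simp add: kst_def)
    have e: "set (P i) = set (B i @ [s i])" "distinct (B i @ [s i])" unfolding PB[OF that, symmetric] by (rule refl d)+
    then show "set (B i) \<subseteq> set (P i)" "s i \<notin> set (B i)" "distinct (B i)" "set (P i) = insert (s i) (set (B i))" by auto
  qed
  have k6: "0 < (6::nat)" "1 < (6::nat)" "2 < (6::nat)" "3 < (6::nat)" "4 < (6::nat)" "5 < (6::nat)" by auto
  have ne: "B 0 \<noteq> []" "B 2 \<noteq> []" "B 4 \<noteq> []" using Bl(1)[of 0] Bl(1)[of 2] Bl(1)[of 4] by auto
  have KU: "K = set (P 0) \<union> set (P 1) \<union> set (P 2) \<union> set (P 3) \<union> set (P 4) \<union> set (P 5)"
    unfolding K_def lessThan_6 by (simp add: Un_ac)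
  have Wv: "K4_verts w Q = insert v K"
    unfolding K4_verts_def KU K4_pairs_eq lessThan_4 using Bd(5)[OF k6(1)] Bd(5)[OF k6(3)] Bd(5)[OF k6(5)]
    by (simp add: w_def Q_def) blast
  define idx where "idx e = (if e = (0,1) then 0 else if e = (0,2) then 2 else if e = (0,3) then 4
    else if e = (1,2) then 1 else if e = (2,3) then 3 else 5 :: nat)" for e :: "nat \<times> nat"
  have bi: "bij_betw idx K4_pairs {..<6}" unfolding bij_betw_def K4_pairs_eq lessThan_6 by (simp add: idx_def insert_commute)
  have i6: "idx e < 6" if "e \<in> K4_pairs" for e using bi that by (auto simp: bij_betw_def)
  have Qi: "Q e = P (idx e) \<or> Q e = B (idx e) \<and> idx e \<in> {0, 2, 4}" for e by (auto simp: Q_def idx_def)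
  have Qs: "set (Q e) \<subseteq> set (P (idx e))" if "e \<in> K4_pairs" for e using Qi[of e] Bd(1)[OF i6[OF that]] by auto
  have "K4s w Q"
  proof (rule K4sI)
    show "K4_verts w Q \<subseteq> verts G" unfolding Wv using v K_verts by auto
    have "bij_betw ((\<lambda>i. hd (P i)) \<circ> idx) K4_pairs X" by (rule bij_betw_trans[OF bi]) (use K in \<open>simp add: kst_def\<close>)
    moreover have "hd (Q e) = hd (P (idx e))" for e using Qi[of e] Bl(3)[of "idx e"] by metis
    ultimately show "bij_betw (\<lambda>e. hd (Q e)) K4_pairs X" by (simp add: comp_def)
    have "v \<noteq> s i" if "i < 6" for i using vK s_K that by metis
    then show "inj_on w {..<4}" unfolding lessThan_4 using s_eq by (simp add: w_def)
    have E0: "edges (induced G K) = (\<Union>i<6. path_edges (P i)) \<union> {{s i, s (Suc i mod 6)} | i. i < 6}"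
    proof -
      have "k_structure 6 X (induced G (\<Union>i<6. set (P i))) P" by (rule kst_structure[OF K])
      then show ?thesis unfolding k_structure_def K_def by (elim conjE)
    qed
    have E1: "edges (induced G (insert v K)) = edges (induced G K) \<union> (\<lambda>u. {v, u}) ` {u \<in> K. adj G v u}"
    proof (intro set_eqI iffI)
      fix e assume "e \<in> edges (induced G (insert v K))"
      then obtain a b where ab: "e = {a, b}" "a \<in> insert v K" "b \<in> insert v K" "adj G a b" unfolding edges_induced by blast
      then consider "a = v" "b \<in> K" | "b = v" "a \<in> K" | "a \<in> K" "b \<in> K" using adj_irrefl by blast
      then show "e \<in> edges (induced G K) \<union> (\<lambda>u. {v, u}) ` {u \<in> K. adj G v u}"
      proof cases
        case 1
        then show ?thesis using ab by blast
      next
        case 2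
        then have "e = {v, a}" "adj G v a" using ab adj_commute by (simp add: insert_commute, metis)
        then show ?thesis using 2 by blast
      next
        case 3
        then show ?thesis using ab unfolding edges_induced by blast
      qed
    next
      fix e assume "e \<in> edges (induced G K) \<union> (\<lambda>u. {v, u}) ` {u \<in> K. adj G v u}"
      then show "e \<in> edges (induced G (insert v K))" unfolding edges_induced by blast
    qed
    have m6: "Suc 0 mod 6 = (1::nat)" "Suc 1 mod 6 = (2::nat)" "Suc 2 mod 6 = (3::nat)" "Suc 3 mod 6 = (4::nat)"
      "Suc 4 mod 6 = (5::nat)" "Suc 5 mod 6 = (0::nat)" by simp_all
    have cyc: "{{s i, s (Suc i mod 6)} | i. i < 6} = {{s 0, s 1}, {s 2, s 1}, {s 2, s 3}, {s 4, s 3}, {s 4, s 5}, {s 0, s 5}}"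
    proof -
      have "{{s i, s (Suc i mod 6)} | i. i < 6} = (\<lambda>i. {s i, s (Suc i mod 6)}) ` {..<6}" by auto
      then show ?thesis unfolding lessThan_6 image_insert image_empty m6 by (simp only: insert_commute)
    qed
    have pe: "path_edges (P 0) = insert {s 0, last (B 0)} (path_edges (B 0))" "path_edges (P 2) = insert {s 2, last (B 2)} (path_edges (B 2))"
      "path_edges (P 4) = insert {s 4, last (B 4)} (path_edges (B 4))"
      using path_edges_snoc[OF ne(1), of "s 0"] path_edges_snoc[OF ne(2), of "s 2"] path_edges_snoc[OF ne(3), of "s 4"]
      unfolding PB[OF k6(1), symmetric] PB[OF k6(3), symmetric] PB[OF k6(5), symmetric] by (simp_all only: insert_commute)
    have nv: "(\<lambda>u. {v, u}) ` {u \<in> K. adj G v u} = {{v, last (B 0)}, {v, last (B 2)}, {v, last (B 4)}}"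
      unfolding NK using Bl(2)[of 0] Bl(2)[of 2] Bl(2)[of 4] by simp
    have gen: "insert a A0 \<union> (A1 \<union> (insert b A2 \<union> (A3 \<union> (insert c A4 \<union> (A5 \<union> {}))))) \<union> {d, e, f, g, h, i} \<union> {l, m, n} =
      (A0 \<union> (A2 \<union> (A4 \<union> (A1 \<union> (A5 \<union> (A3 \<union> {})))))) \<union> ({l, a} \<union> ({m, b} \<union> ({n, c} \<union> ({d, e} \<union> ({i, h} \<union> ({f, g} \<union> {}))))))"
      for A0 A1 A2 A3 A4 A5 :: "'c set" and a b c d e f g h i l m n by blast
    have QE: "(\<Union>e\<in>K4_pairs. path_edges (Q e)) = path_edges (B 0) \<union> (path_edges (B 2) \<union> (path_edges (B 4) \<union> (path_edges (P 1) \<union> (path_edges (P 5) \<union> (path_edges (P 3) \<union> {})))))"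
      by (simp add: K4_pairs_eq Q_def)
    have QC: "(\<Union>(i, j)\<in>K4_pairs. {{w i, last (Q (i, j))}, {w j, last (Q (i, j))}}) = {{v, last (B 0)}, {s 0, last (B 0)}} \<union>
       ({{v, last (B 2)}, {s 2, last (B 2)}} \<union> ({{v, last (B 4)}, {s 4, last (B 4)}} \<union> ({{s 0, s 1}, {s 2, s 1}} \<union>
       ({{s 0, s 5}, {s 4, s 5}} \<union> ({{s 2, s 3}, {s 4, s 3}} \<union> {})))))"
      by (simp add: K4_pairs_eq Q_def w_def)
    show "edges (induced G (K4_verts w Q)) = (\<Union>e\<in>K4_pairs. path_edges (Q e)) \<union>
       (\<Union>(i, j)\<in>K4_pairs. {{w i, last (Q (i, j))}, {w j, last (Q (i, j))}})"
      unfolding Wv E1 E0 cyc nv QE QC lessThan_6 UN_insert UN_empty pe by (rule gen)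
    fix e assume e: "e \<in> K4_pairs"
    show "2 \<le> length (Q e)" using Qi[of e] L2[OF i6[OF e]] Bl(1)[of "idx e"] by metis
    show "distinct (Q e)" using Qi[of e] Bd(3)[OF i6[OF e]] Bd(4)[OF i6[OF e]] by metis
    show "set (Q e) \<inter> set (Q f) = {}" if f: "f \<in> K4_pairs" "e \<noteq> f" for f
    proof -
      have "idx e \<noteq> idx f" using bi e f by (auto simp: bij_betw_def inj_on_def)
      then show ?thesis using disjoint[OF i6[OF e] i6[OF f(1)]] Qs[OF e] Qs[OF f(1)] by blast
    qed
    show "w i \<notin> set (Q e)" if "i < 4" for i
    proof (cases "i = 0")
      case True
      then show ?thesis using Qs[OF e] path_K[OF i6[OF e]] vK by (auto simp: w_def)
    next
      case False
      then have "w i = s 0 \<or> w i = s 2 \<or> w i = s 4" by (simp add: w_def)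
      then obtain l where l: "w i = s l" "l \<in> {0, 2, 4}" by blast
      have l6: "l < 6" using l by auto
      show ?thesis
      proof (cases "l = idx e")
        case True
        have "Q e = B (idx e)" using True l(2) e by (auto simp: Q_def idx_def K4_pairs_eq split: if_splits)
        then show ?thesis using Bd(2)[OF i6[OF e]] l True by simp
      next
        case False
        have "s l \<in> set (P l)" using Bd(5)[OF l6] by auto
        then show ?thesis using disjoint[OF l6 i6[OF e] False] Qs[OF e] l by auto
      qed
    qed
  qed
  then show ?thesis using Wv unfolding K_def by blast
qed

lemma K4_from_kst:
  assumes K: "kst P" and v: "v \<in> verts G" "v \<notin> (\<Union>i<6. set (P i))" and J: "J = {0, 2, 4} \<or> J = {1, 3, 5}"
    and N: "{u \<in> (\<Union>i<6. set (P i)). adj G v u} = (\<lambda>i. P i ! (length (P i) - 2)) ` J"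
  shows "\<exists>w Q. K4s w Q \<and> K4_verts w Q = insert v (\<Union>i<6. set (P i))"
proof (cases "J = {0, 2, 4}")
  case True
  then show ?thesis using K4_from_even[OF K v] N by simp
next
  case False
  then have J: "J = {1, 3, 5}" using J by simp
  have U: "(\<Union>i<6. set (P (Suc i mod 6))) = (\<Union>i<6. set (P i))"
    unfolding lessThan_6 by (simp add: Un_ac) (simp add: numeral_eq_Suc Un_ac)
  have "{u \<in> (\<Union>i<6. set (P (Suc i mod 6))). adj G v u} = (\<lambda>i. P (Suc i mod 6) ! (length (P (Suc i mod 6)) - 2)) ` {0, 2, 4}"
    unfolding U N J by simp
  from K4_from_even[OF kst_rotate[OF K] _ _ this] show ?thesis using v unfolding U by blast
qed

end

section \<open>Leaks of a K4 structure\<close>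

context kgraph6
begin

lemma K4_X: "K4s w P \<Longrightarrow> e \<in> K4_pairs \<Longrightarrow> hd (P e) \<in> X"
  using bij_betwE[OF K4sD(1)] by blast

text \<open>The branch vertex to be deleted depends on the leaking test. For the pair
  \<open>w i\<close>, \<open>w j\<close> it is \<open>w i\<close>, which leaves \<open>w j\<close>
  as the end of the prolonged path. For the end of \<open>P (i, j)\<close> it is one of the two
  other branch vertices, chosen so that it does not interrupt the walk.\<close>

lemma K4_leaky_sub:
  assumes K: "K4s w P" and S: "K4_verts w P \<subseteq> S" and l: "leaky G X (K4_tests w P) S"
  obtains f where "bij_betw f {..<4} {..<4}"
    "leaky G X (k_tests 6 (K4sub (w \<circ> f) (P \<circ> pair_map f))) (S - {(w \<circ> f) 3})"
proof -
  note KD = K4sD[OF K]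
  let ?W = "K4_verts w P"
  obtain D x y where t: "(D, x) \<in> K4_tests w P" "y \<in> X - {x}" "reach G (S - D) x y"
    using l unfolding leaky_def by blast
  have "\<exists>f. bij_betw f {..<4} {..<4} \<and> leaky G X (k_tests 6 (K4sub (w \<circ> f) (P \<circ> pair_map f))) (S - {(w \<circ> f) 3})"
    using t(1) unfolding K4_tests_def
  proof (elim UnE)
    assume "(D, x) \<in> (\<lambda>(i, j). ({w i, w j}, hd (P (i, j)))) ` K4_pairs"
    then obtain i j where ij: "(i, j) \<in> K4_pairs" "D = {w i, w j}" "x = hd (P (i, j))" by auto
    have lt: "i < j" "j < 4" using ij(1) by (auto simp: K4_pairs_def)
    obtain a where a: "a < 4" "a \<noteq> i" "a \<noteq> j"
    proof -
      have "\<exists>a\<in>{0,1,2}. a \<noteq> i \<and> a \<noteq> j" by auto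
      then obtain a where "a \<in> {0,1,2}" "a \<noteq> i" "a \<noteq> j" by blast
      then show thesis using that[of a] by auto
    qed
    \<comment> \<open>Sends 3 to \<open>i\<close> and 0 to \<open>j\<close>, which puts
      \<open>P (i, j) @ [w j]\<close> at index 0 of the cycle structure without
      \<open>w i\<close>.\<close>
    let ?f = "perm4 j a i"
    have f: "bij_betw ?f {..<4} {..<4}" by (rule bij_perm4) (use lt a in auto)
    have "pair_map ?f (0, 3) = (i, j)" "?f 0 = j" "?f 3 = i" using lt by (auto simp: pair_map_def perm4_def)
    then have "({w j}, hd (P (i, j) @ [w j])) \<in> k_tests 6 (K4sub (w \<circ> ?f) (P \<circ> pair_map ?f))" "(w \<circ> ?f) 3 = w i"
      unfolding K4sub_tests by simp_all
    moreover have hx: "hd (P (i, j) @ [w j]) = x" using KD(4)[OF ij(1)] ij(3) by (cases "P (i, j)") auto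
    moreover have "S - {w i} - {w j} = S - D" using ij(2) by auto
    ultimately have "({w j}, x) \<in> k_tests 6 (K4sub (w \<circ> ?f) (P \<circ> pair_map ?f))" "S - {(w \<circ> ?f) 3} - {w j} = S - D"
      by simp_all
    then have "leaky G X (k_tests 6 (K4sub (w \<circ> ?f) (P \<circ> pair_map ?f))) (S - {(w \<circ> ?f) 3})"
      using t(2,3) unfolding leaky_def by (intro bexI[of _ "({w j}, x)"]) (simp_all, blast)
    then show ?thesis using f by blast
  next
    assume "(D, x) \<in> (\<lambda>e. ({last (P e)}, hd (P e))) ` K4_pairs"
    then obtain i j where ij: "(i, j) \<in> K4_pairs" "D = {last (P (i, j))}" "x = hd (P (i, j))" by auto
    let ?e = "(i, j)"
    have lt: "i < j" "j < 4" using ij(1) by (auto simp: K4_pairs_def)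
    let ?T = "S - {last (P ?e)}" and ?B = "?W - set (P ?e)"
    have hx: "hd (P ?e) \<in> set (P ?e)" "hd (P ?e) \<noteq> last (P ?e)"
      using KD(4)[OF ij(1)] KD(5)[OF ij(1)] by (cases "P ?e"; auto split: if_splits)+
    have xT: "x \<in> ?T" "x \<notin> ?B" using hx ij(3) KD(8)[OF ij(1)] S by auto
    have yB: "y \<in> ?B"
    proof -
      obtain e' where e': "e' \<in> K4_pairs" "y = hd (P e')" using KD(1) t(2) by (auto simp: bij_betw_def)
      have "e' \<noteq> ?e" using e' t(2) ij(3) by auto
      moreover have "y \<in> set (P e')" using e' KD(4)[OF e'(1)] by (cases "P e'") auto
      ultimately show ?thesis using KD(6)[OF e'(1) ij(1)] KD(8)[OF e'(1)] by auto
    qed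
    have r: "reach G ?T x y" using t(3) ij(2) by simp
    obtain z where z: "z \<in> ?B" "z \<in> ?T" "reach G (insert z (?T - ?B)) x z"
      using reach_split[OF r xT yB] by blast
    \<comment> \<open>Up to \<open>z\<close> the walk avoids all of the structure off
      \<open>P (i, j)\<close>. Of the two branch vertices outside the pair at least one is not
      \<open>z\<close>, and its deletion leaves this part of the walk intact.\<close>
    obtain c where c: "c < 4" "c \<noteq> i" "c \<noteq> j" "w c \<noteq> z"
    proof -
      have "\<exists>c1 c2. c1 < 4 \<and> c2 < 4 \<and> c1 \<noteq> c2 \<and> c1 \<noteq> i \<and> c1 \<noteq> j \<and> c2 \<noteq> i \<and> c2 \<noteq> j"
        using ij(1) unfolding K4_pairs_eq by (elim insertE emptyE) (simp_all, presburger+)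
      then obtain c1 c2 where c12: "c1 < 4" "c2 < 4" "c1 \<noteq> c2" "c1 \<noteq> i" "c1 \<noteq> j" "c2 \<noteq> i" "c2 \<noteq> j" by blast
      then have "w c1 \<noteq> w c2" using inj_onD[OF KD(2), of c1 c2] by auto
      then show thesis using that c12 by metis
    qed
    let ?f = "perm4 i j c"
    have f: "bij_betw ?f {..<4} {..<4}" by (rule bij_perm4) (use lt c in auto)
    let ?w = "w \<circ> ?f" and ?P = "P \<circ> pair_map ?f"
    note K' = K4_permute[OF K f]
    have f3: "?w 3 = w c" by (simp add: perm4_def)
    have f01: "?P (0, 1) = P ?e" using lt by (simp add: pair_map_def perm4_def)
    interpret Q: kstruct G 6 X "K4sub ?w ?P" by unfold_locales (rule kst_K4sub[OF K'(1)])
    have QK: "Q.K = ?W - {w c}" unfolding Q.K_def K4sub_verts[OF K'(1)] K'(2) f3 ..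
    have Q1: "K4sub ?w ?P 1 = P ?e" using f01 by (simp add: K4sub_def)
    let ?V = "S - {w c} - {last (P ?e)}"
    have wc: "w c \<in> ?B" using KD(7)[OF ij(1) c(1)] KD(9)[OF c(1)] by simp
    have zV: "insert z (?T - ?B) \<subseteq> ?V" using z(2) wc c(4) by blast
    have rz: "reach G ?V x z" by (rule reach_mono[OF z(3) zV])
    have "z \<in> Q.K" unfolding QK using z(1) c(4) by blast
    then obtain l b where lb: "l < 6" "b < length (K4sub ?w ?P l)" "z = K4sub ?w ?P l ! b" using Q.in_K by blast
    have zl: "z \<in> set (K4sub ?w ?P l)" unfolding lb(3) by (rule nth_mem[OF lb(2)])
    have l1: "l \<noteq> 1"
    proof
      assume "l = 1"
      then have "z \<in> set (P ?e)" using zl Q1 by (simp only:)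
      then show False by (rule DiffD2[OF z(1)])
    qed
    have inV: "K4sub ?w ?P l ! d \<in> ?V" if d: "d < length (K4sub ?w ?P l)" for d
    proof -
      have lt6: "1 < (6::nat)" by simp
      have 1: "K4sub ?w ?P l ! d \<in> ?W - {w c}" unfolding QK[symmetric] by (rule Q.p_in[OF lb(1) d])
      have 2: "K4sub ?w ?P l ! d \<notin> set (P ?e)" unfolding Q1[symmetric] Q.p_in_path[OF lb(1) lt6 d] by (rule l1)
      have gen: "a \<in> S - {u} - {v}" if "a \<in> A - {u}" "a \<notin> B" "v \<in> B" "A \<subseteq> S" for a u v :: 'a and A B S
        using that by blast
      show ?thesis by (rule gen[OF 1 2 KD(11)[OF ij(1)] S])
    qed
    \<comment> \<open>The original walk may need the deleted vertex after \<open>z\<close>. It is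
      replaced by the way from \<open>z\<close> to the terminal of the path in the cycle structure
      that contains \<open>z\<close>.\<close>
    have r0: "reach G ?V (K4sub ?w ?P l ! 0) z" unfolding lb(3)
      by (rule Q.segment_reach[OF lb(1)]) (use lb(2) inV in auto)
    have "reach G ?V x (K4sub ?w ?P l ! 0)" by (rule reach_trans[OF rz reach_commute[THEN iffD1, OF r0]])
    moreover have "K4sub ?w ?P l ! 0 \<in> X - {x}"
    proof -
      have "0 < length (K4sub ?w ?P l)" "0 < length (K4sub ?w ?P 1)" using Q.L2[OF lb(1)] Q.L2[of 1] by linarith+
      then have "K4sub ?w ?P l ! 0 \<noteq> K4sub ?w ?P 1 ! 0" using Q.p_eq[OF lb(1), of 1 0 0] l1 by simp
      moreover have "K4sub ?w ?P 1 ! 0 = x" using Q.x_nth[of 1] Q1 ij(3) by simp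
      ultimately show ?thesis using Q.X_eq lb(1) by auto
    qed
    moreover have "({last (P ?e)}, x) \<in> k_tests 6 (K4sub ?w ?P)" unfolding K4sub_tests f01 ij(3) by simp
    ultimately have "leaky G X (k_tests 6 (K4sub ?w ?P)) (S - {?w 3})" unfolding leaky_def f3 by blast
    then show ?thesis using f by blast
  qed
  then show ?thesis using that by blast
qed

text \<open>Suppose the deletion of \<open>d\<close> leads to the exceptional vertex
  \<open>v\<close>. It sees the paths \<open>ab\<close>, \<open>bc\<close> and \<open>ac\<close>, so
  it still joins \<open>ab\<close> to \<open>bc\<close> after the deletion of \<open>c\<close>
  instead. The exceptional pattern there would confine the neighbours of \<open>v\<close> to
  \<open>ab\<close>, \<open>bd\<close> and \<open>ad\<close>, against its neighbour on
  \<open>bc\<close>.\<close>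

theorem K4_leaky_structure:
  assumes K: "K4s w P" and S: "K4_verts w P \<subseteq> S" "S \<subseteq> verts G" and l: "leaky G X (K4_tests w P) S"
    and min: "\<And>u. u \<in> S - K4_verts w P \<Longrightarrow> \<not> leaky G X (K4_tests w P) (S - {u})"
  shows "\<exists>U\<subseteq>K4_opts w P. good_cut G X S U"
proof -
  obtain f where f: "bij_betw f {..<4} {..<4}"
    "leaky G X (k_tests 6 (K4sub (w \<circ> f) (P \<circ> pair_map f))) (S - {(w \<circ> f) 3})"
    using K4_leaky_sub[OF K S(1) l] .
  define w1 where "w1 = w \<circ> f"
  define P1 where "P1 = P \<circ> pair_map f"
  note K1 = K4_permute[OF K f(1), folded w1_def P1_def]
  have l1: "leaky G X (k_tests 6 (K4sub w1 P1)) (S - {w1 3})" using f(2) unfolding w1_def P1_def .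
  have m1: "\<not> leaky G X (K4_tests w1 P1) (S - {u})" if "u \<in> S - K4_verts w1 P1" for u using min that K1(2,3) by simp
  have S1: "K4_verts w1 P1 \<subseteq> S" using S(1) K1(2) by simp
  from K4sub_leaky_structure[OF K1(1) S1 S(2) l1 m1] show ?thesis
  proof
    assume "\<exists>U\<subseteq>K4_opts w1 P1. good_cut G X S U"
    then show ?thesis using K1(4) by simp
  next
    let ?t = "\<lambda>e. P1 e ! (length (P1 e) - 2)"
    assume "\<exists>v. v \<in> S - K4_verts w1 P1 \<and> S = insert v (K4_verts w1 P1) \<and>
      {u \<in> K4_verts w1 P1 - {w1 3}. adj G v u} = {?t (0,1), ?t (1,2), ?t (0,2)}"
    then obtain v where v: "v \<in> S - K4_verts w1 P1" "S = insert v (K4_verts w1 P1)"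
      and N: "{u \<in> K4_verts w1 P1 - {w1 3}. adj G v u} = {?t (0,1), ?t (1,2), ?t (0,2)}" by blast
    note KD = K4sD[OF K1(1)]
    \<comment> \<open>Exchanges the labels 2 and 3.\<close>
    let ?f = "perm4 0 1 2"
    have f2: "bij_betw ?f {..<4} {..<4}" by (rule bij_perm4) auto
    define w2 where "w2 = w1 \<circ> ?f"
    define P2 where "P2 = P1 \<circ> pair_map ?f"
    note K2 = K4_permute[OF K1(1) f2, folded w2_def P2_def]
    have w23: "w2 3 = w1 2" by (simp add: w2_def perm4_def)
    have P2v: "P2 (0,1) = P1 (0,1)" "P2 (1,2) = P1 (1,3)" "P2 (1,3) = P1 (1,2)" "P2 (0,2) = P1 (0,3)"
      by (simp_all add: P2_def pair_map_def perm4_def) (simp add: numeral_2_eq_2)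
    have S2: "K4_verts w2 P2 \<subseteq> S" using S1 K2(2) by simp
    have m2: "\<not> leaky G X (K4_tests w2 P2) (S - {u})" if "u \<in> S - K4_verts w2 P2" for u using m1 that K2(2,3) by simp
    have pr: "(0,1) \<in> K4_pairs" "(0,2) \<in> K4_pairs" "(0,3) \<in> K4_pairs" "(1,2) \<in> K4_pairs" "(1,3) \<in> K4_pairs"
      by (auto simp: K4_pairs_eq)
    have tin: "?t e \<in> set (P1 e)" "?t e \<noteq> last (P1 e)" if "e \<in> K4_pairs" for e
    proof -
      have le: "length (P1 e) - 2 < length (P1 e)" "length (P1 e) - 1 < length (P1 e)" "P1 e \<noteq> []"
        "length (P1 e) - 2 \<noteq> length (P1 e) - 1" using KD(4)[OF that] by auto
      show "?t e \<in> set (P1 e)" by (rule nth_mem[OF le(1)])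
      show "?t e \<noteq> last (P1 e)" unfolding last_conv_nth[OF le(3)]
        using nth_eq_iff_index_eq[OF KD(5)[OF that] le(1,2)] le(4) by simp
    qed
    have at: "adj G v (?t (0,1))" "adj G v (?t (1,2))" using N by blast+
    interpret Q: kstruct G 6 X "K4sub w2 P2" by unfold_locales (rule kst_K4sub[OF K2(1)])
    have QK: "Q.K = K4_verts w1 P1 - {w1 2}" unfolding Q.K_def K4sub_verts[OF K2(1)] K2(2) w23 ..
    have Q1: "K4sub w2 P2 1 = P1 (0,1)" using P2v by (simp add: K4sub_def)
    have t12: "?t (1,2) \<in> Q.K" "?t (1,2) \<notin> set (P1 (0,1))"
    proof -
      have "w1 2 \<notin> set (P1 (1,2))" by (rule KD(7)[OF pr(4)]) simp
      then show "?t (1,2) \<in> Q.K" using tin(1)[OF pr(4)] KD(8)[OF pr(4)] QK by auto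
      show "?t (1,2) \<notin> set (P1 (0,1))" using tin(1)[OF pr(4)] KD(6)[OF pr(4) pr(1)] by auto
    qed
    have vw: "v \<noteq> w1 2" using v(1) KD(9)[of 2] by auto
    have "Q.connector (S - {w2 3}) 1 [v]"
    proof (rule Q.connector_singleton[where u = "?t (0,1)" and q = "?t (1,2)"])
      show "v \<in> S - {w2 3} - Q.K" using v(1) QK vw w23 by auto
      show "?t (0,1) \<in> set (K4sub w2 P2 1) - {last (K4sub w2 P2 1)}" unfolding Q1 using tin[OF pr(1)] by simp
      show "?t (1,2) \<in> Q.K - set (K4sub w2 P2 1)" unfolding Q1 using t12 by simp
    qed (use at adj_commute[of G v] in auto)
    moreover have "Q.K \<subseteq> S - {w2 3}" using QK S1 w23 by auto
    ultimately have l2: "leaky G X (k_tests 6 (K4sub w2 P2)) (S - {w2 3})" by (rule Q.connector_leaky)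
    from K4sub_leaky_structure[OF K2(1) S2 S(2) l2 m2] show ?thesis
    proof
      assume "\<exists>U\<subseteq>K4_opts w2 P2. good_cut G X S U"
      then show ?thesis using K1(4) K2(4) by simp
    next
      assume "\<exists>v. v \<in> S - K4_verts w2 P2 \<and> S = insert v (K4_verts w2 P2) \<and>
        {u \<in> K4_verts w2 P2 - {w2 3}. adj G v u} = {P2 (0,1) ! (length (P2 (0,1)) - 2), P2 (1,2) ! (length (P2 (1,2)) - 2), P2 (0,2) ! (length (P2 (0,2)) - 2)}"
      then obtain v' where v': "v' \<in> S - K4_verts w1 P1"
        and N': "{u \<in> K4_verts w1 P1 - {w1 2}. adj G v' u} = {?t (0,1), ?t (1,3), ?t (0,3)}"
        unfolding K2(2) w23 P2v by blast
      have "v' = v" using v v' by auto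
      then have "?t (1,2) \<in> {u \<in> K4_verts w1 P1 - {w1 2}. adj G v' u}" using t12(1) at(2) QK by simp
      then have "?t (1,2) \<in> {?t (0,1), ?t (1,3), ?t (0,3)}" unfolding N' .
      then have "?t (1,2) \<in> set (P1 (0,1)) \<union> set (P1 (1,3)) \<union> set (P1 (0,3))"
        using tin(1)[OF pr(1)] tin(1)[OF pr(5)] tin(1)[OF pr(3)] by auto
      then have False
        using tin(1)[OF pr(4)] KD(6)[OF pr(4) pr(1)] KD(6)[OF pr(4) pr(5)] KD(6)[OF pr(4) pr(3)] by auto
      then show ?thesis ..
    qed
  qed
qed

lemma decomposing_K4_iff:
  assumes K: "K4s w P"
  shows "decomposing_K4_structure X G w P \<longleftrightarrow> \<not> leaky G X (K4_tests w P) (verts G)"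
proof -
  note KD = K4sD[OF K]
  have Xe: "\<exists>e\<in>K4_pairs. u = hd (P e) \<and> u \<in> set (P e)" if u: "u \<in> X" for u
  proof -
    obtain e where "e \<in> K4_pairs" "u = hd (P e)" using KD(1) u by (auto simp: bij_betw_def)
    moreover have "hd (P e) \<in> set (P e)" using KD(4)[OF \<open>e \<in> K4_pairs\<close>] by (cases "P e") auto
    ultimately show ?thesis by blast
  qed
  have wX: "w i \<notin> X" if "i < 4" for i using Xe KD(7) that by metis
  have lX: "last (P e) \<notin> X" if e: "e \<in> K4_pairs" for e
  proof
    assume "last (P e) \<in> X"
    then obtain e' where e': "e' \<in> K4_pairs" "last (P e) = hd (P e')" "last (P e) \<in> set (P e')" using Xe by metis
    have "e' = e" using KD(6)[OF e'(1) e] KD(11)[OF e] e'(3) by blast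
    then show False using e'(2) KD(4,5)[OF e] by (cases "P e") (auto split: if_splits)
  qed
  have sep: "separating_cutset G D (hd (P e)) (X - {hd (P e)}) \<longleftrightarrow> \<not> (\<exists>y\<in>X - {hd (P e)}. reach G (verts G - D) (hd (P e)) y)"
    if "e \<in> K4_pairs" "D \<subseteq> verts G" "D \<inter> X = {}" for e D
    by (rule separating_iff) (use that(2,3) K4_X[OF K that(1)] X_verts in auto)
  have s1: "separating_cutset G {w i, w j} (hd (P (i, j))) (X - {hd (P (i, j))}) \<longleftrightarrow>
      \<not> (\<exists>y\<in>X - {hd (P (i, j))}. reach G (verts G - {w i, w j}) (hd (P (i, j))) y)" if "(i, j) \<in> K4_pairs" for i j
  proof (rule sep[OF that])
    have "i < 4" "j < 4" using that by (auto simp: K4_pairs_def)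
    then show "{w i, w j} \<subseteq> verts G" "{w i, w j} \<inter> X = {}" using KD(9,10) wX by auto
  qed
  have s2: "separating_cutset G {last (P e)} (hd (P e)) (X - {hd (P e)}) \<longleftrightarrow>
      \<not> (\<exists>y\<in>X - {hd (P e)}. reach G (verts G - {last (P e)}) (hd (P e)) y)" if "e \<in> K4_pairs" for e
    by (rule sep[OF that]) (use KD(8)[OF that] KD(10) KD(11)[OF that] lX[OF that] in auto)
  have "decomposing_K4_structure X G w P \<longleftrightarrow> (\<forall>(i, j)\<in>K4_pairs.
     \<not> (\<exists>y\<in>X - {hd (P (i, j))}. reach G (verts G - {w i, w j}) (hd (P (i, j))) y) \<and>
     \<not> (\<exists>y\<in>X - {hd (P (i, j))}. reach G (verts G - {last (P (i, j))}) (hd (P (i, j))) y))"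
    using K s1 s2 unfolding decomposing_K4_structure_def K4s_def by (auto simp: split_beta)
  also have "\<dots> \<longleftrightarrow> \<not> leaky G X (K4_tests w P) (verts G)"
    unfolding leaky_def K4_tests_def by (fastforce simp: split_beta)
  finally show ?thesis .
qed

lemma decomposing_K4_K4s: "decomposing_K4_structure X G w P \<Longrightarrow> K4s w P"
  unfolding decomposing_K4_structure_def K4s_def by blast

lemma six_cycle:
  assumes K: "K4s w P" and abc: "a < b" "b < c" "c < 4"
  shows "is_cycle G [w a, last (P (a, b)), w b, last (P (b, c)), w c, last (P (a, c))]"
proof -
  note KD = K4sD[OF K]
  have pr: "(a, b) \<in> K4_pairs" "(b, c) \<in> K4_pairs" "(a, c) \<in> K4_pairs" using abc by (auto simp: K4_pairs_def)
  have 4: "a < 4" "b < 4" "c < 4" using abc by auto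
  have adj: "adj G (w a) (last (P (a, b)))" "adj G (w b) (last (P (a, b)))" "adj G (w b) (last (P (b, c)))" "adj G (w c) (last (P (b, c)))"
    "adj G (w a) (last (P (a, c)))" "adj G (w c) (last (P (a, c)))"
    using K4_adj[OF K pr(1) 4(1)] K4_adj[OF K pr(1) 4(2)] K4_adj[OF K pr(2) 4(2)] K4_adj[OF K pr(2) 4(3)]
      K4_adj[OF K pr(3) 4(1)] K4_adj[OF K pr(3) 4(3)] by auto
  have ww: "w a \<noteq> w b" "w a \<noteq> w c" "w b \<noteq> w c"
    using inj_onD[OF KD(2), of a b] inj_onD[OF KD(2), of a c] inj_onD[OF KD(2), of b c] abc by auto
  have wl: "w i \<noteq> last (P e)" if "i < 4" "e \<in> K4_pairs" for i e using KD(7)[OF that(2,1)] KD(11)[OF that(2)] by metis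
  have ll: "last (P e) \<noteq> last (P e')" if "e \<in> K4_pairs" "e' \<in> K4_pairs" "e \<noteq> e'" for e e'
    using KD(6)[OF that] KD(11)[OF that(1)] KD(11)[OF that(2)] by (metis disjoint_iff)
  have d: "distinct [w a, last (P (a, b)), w b, last (P (b, c)), w c, last (P (a, c))]"
    using ww wl[OF 4(1) pr(1)] wl[OF 4(1) pr(2)] wl[OF 4(1) pr(3)] wl[OF 4(2) pr(1)] wl[OF 4(2) pr(2)] wl[OF 4(2) pr(3)]
      wl[OF 4(3) pr(1)] wl[OF 4(3) pr(2)] wl[OF 4(3) pr(3)] ll[OF pr(1,2)] ll[OF pr(1,3)] ll[OF pr(2,3)] abc by auto
  show ?thesis unfolding is_cycle_iff
    using d adj adj_in_verts adj_commute[of G "w b"] adj_commute[of G "w c"] adj_commute[of G "w a"] by simp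
qed

text \<open>If no test leaks, each single cutset forces its end into \<open>T\<close>, and the six
  pair cutsets leave at most one branch vertex out. Three branch vertices and the ends between them
  form the cycle.\<close>

lemma linked_six_cycle:
  assumes K: "K4s w P" and n: "\<not> leaky G X (K4_tests w P) (verts G)" and T: "linked G X T" "T \<subseteq> verts G"
  obtains c a where "is_cycle G c" "set c \<subseteq> T" "length c = 6" "a < 4" "w a \<in> set c"
proof -
  have no: "\<not> (\<exists>y\<in>X - {x}. reach G (verts G - D) x y)" if "(D, x) \<in> K4_tests w P" for D x
    using n that unfolding leaky_def by blast
  have l: "last (P e) \<in> T" if "e \<in> K4_pairs" for e
  proof -
    have "({last (P e)}, hd (P e)) \<in> K4_tests w P" using that unfolding K4_tests_def by blast
    from linked_hits[OF T K4_X[OF K that] no[OF this]] show ?thesis by blast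
  qed
  have ww: "w i \<in> T \<or> w j \<in> T" if "(i, j) \<in> K4_pairs" for i j
  proof -
    have "({w i, w j}, hd (P (i, j))) \<in> K4_tests w P" using that unfolding K4_tests_def by force
    from linked_hits[OF T K4_X[OF K that] no[OF this]] show ?thesis by blast
  qed
  have "\<exists>a b c. a < b \<and> b < c \<and> c < 4 \<and> w a \<in> T \<and> w b \<in> T \<and> w c \<in> T"
  proof -
    have "w 0 \<in> T \<or> w 1 \<in> T" "w 0 \<in> T \<or> w 2 \<in> T" "w 0 \<in> T \<or> w 3 \<in> T" "w 1 \<in> T \<or> w 2 \<in> T" "w 1 \<in> T \<or> w 3 \<in> T" "w 2 \<in> T \<or> w 3 \<in> T"
      by (rule ww; simp add: K4_pairs_eq)+
    then have "(w 0 \<in> T \<and> w 1 \<in> T \<and> w 2 \<in> T) \<or> (w 0 \<in> T \<and> w 1 \<in> T \<and> w 3 \<in> T) \<or> (w 0 \<in> T \<and> w 2 \<in> T \<and> w 3 \<in> T) \<or> (w 1 \<in> T \<and> w 2 \<in> T \<and> w 3 \<in> T)"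
      by satx
    moreover have "(0::nat) < 1" "(1::nat) < 2" "(2::nat) < 3" "(2::nat) < 4" "(3::nat) < 4" "(1::nat) < 3" "(0::nat) < 2" by auto
    ultimately show ?thesis by metis
  qed
  then obtain a b c where abc: "a < b" "b < c" "c < 4" "w a \<in> T" "w b \<in> T" "w c \<in> T" by blast
  have "(a, b) \<in> K4_pairs" "(b, c) \<in> K4_pairs" "(a, c) \<in> K4_pairs" using abc by (auto simp: K4_pairs_def)
  then show thesis using that[OF six_cycle[OF K abc(1-3)], of a] l abc by simp
qed

end

section \<open>The three cases and their mutual exclusion\<close>

context kgraph
begin

theorem trichotomy:
  assumes conn: "linked G X (verts G)"
  shows "(\<exists>P. decomposing_k_structure k X G P) \<or> (k = 6 \<and> (\<exists>w P. decomposing_K4_structure X G w P)) \<or>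
    (\<exists>S. induced_tree_containing G X S)"
proof (cases "\<exists>S. induced_tree_containing G X S")
  case False
  obtain M where M: "M \<subseteq> verts G" "min_linked G X M" using ex_min_linked[OF conn finite_verts] .
  obtain c where c: "is_cycle G c" "set c \<subseteq> M" using min_linked_tree[OF M(2,1)] False by blast
  obtain P where P: "kst P" "M = (\<Union>i<k. set (P i))" using min_linked_cycle[OF M(2,1) c] .
  interpret kstruct G k X P by unfold_locales (rule P(1))
  show ?thesis
  proof (cases "leaky G X (k_tests k P) (verts G)")
    case True
    obtain S where S: "K \<subseteq> S" "S \<subseteq> verts G" "leaky G X (k_tests k P) S" "\<And>u. u \<in> S - K \<Longrightarrow> \<not> leaky G X (k_tests k P) (S - {u})"
      
    proof (rule ex_min_leaky[OF True K_verts finite_verts])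
      fix S assume "K \<subseteq> S" "S \<subseteq> verts G" "leaky G X (k_tests k P) S" "\<And>u. u \<in> S - K \<Longrightarrow> \<not> leaky G X (k_tests k P) (S - {u})"
      then show thesis by (rule that)
    qed
    \<comment> \<open>A good cut would give an induced tree, so of the two alternatives only the
      exceptional vertex remains.\<close>
    have "\<not> (\<exists>U\<subseteq>opts. good_cut G X S U)" using good_cut_tree S(2) False by blast
    then obtain v J where k6: "k = 6" and v: "v \<in> S - K" and J: "J = {0, 2, 4} \<or> J = {1, 3, 5}"
      and N: "{u \<in> K. adj G v u} = (\<lambda>i. p i (L i - 2)) ` J"
      using leaky_structure[OF S] by blast
    interpret H: kgraph6 G X using kgraph_axioms k6 by (simp add: kgraph6_def)
    obtain w Q where Q: "H.K4s w Q"
    proof -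
      have KU: "K = (\<Union>i<6. set (P i))" by (simp only: K_def) (simp only: k6)
      have P6: "H.kst P" using P(1) unfolding k6 .
      have v': "v \<in> verts G" "v \<notin> (\<Union>i<6. set (P i))" using v S(2) unfolding KU by (blast, simp)
      from H.K4_from_kst[OF P6 v' J N[unfolded KU]] show thesis using that by (elim exE conjE)
    qed
    have "\<not> leaky G X (K4_tests w Q) (verts G)"
    proof
      assume l: "leaky G X (K4_tests w Q) (verts G)"
      obtain S' where S': "K4_verts w Q \<subseteq> S'" "S' \<subseteq> verts G" "leaky G X (K4_tests w Q) S'"
        "\<And>u. u \<in> S' - K4_verts w Q \<Longrightarrow> \<not> leaky G X (K4_tests w Q) (S' - {u})"
        
      proof (rule ex_min_leaky[OF l H.K4sD(10)[OF Q] finite_verts])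
        fix S' assume "K4_verts w Q \<subseteq> S'" "S' \<subseteq> verts G" "leaky G X (K4_tests w Q) S'"
          "\<And>u. u \<in> S' - K4_verts w Q \<Longrightarrow> \<not> leaky G X (K4_tests w Q) (S' - {u})"
        then show thesis by (rule that)
      qed
      then obtain U where "good_cut G X S' U" using H.K4_leaky_structure[OF Q S'] by blast
      then show False using good_cut_tree S'(2) False by blast
    qed
    then show ?thesis using H.decomposing_K4_iff[OF Q] k6 by blast
  qed (use decomposing_iff in blast)
qed blast

text \<open>A decomposing structure forces a cycle into every linked set, which excludes a tree. If
  both structures decompose, the cycle of ends of the first is a cycle through some branch vertex
  \<open>w a\<close> of the second. But the second without \<open>w a\<close> is still linked,
  although the first makes each of its ends indispensable.\<close>

theorem exclusive:
  shows "\<not> (decomposing_k_structure k X G P \<and> induced_tree_containing G X S)"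
    and "k = 6 \<Longrightarrow> \<not> (decomposing_K4_structure X G w Q \<and> induced_tree_containing G X S)"
    and "k = 6 \<Longrightarrow> \<not> (decomposing_k_structure k X G P \<and> decomposing_K4_structure X G w Q)"
proof -
  have kP: "kst P" if "decomposing_k_structure k X G P" for P using that kst_iff unfolding decomposing_k_structure_def by blast
  show "\<not> (decomposing_k_structure k X G P \<and> induced_tree_containing G X S)"
  proof
    assume *: "decomposing_k_structure k X G P \<and> induced_tree_containing G X S"
    interpret kstruct G k X P by unfold_locales (rule kP[OF conjunct1[OF *]])
    have "\<not> leaky G X (k_tests k P) (verts G)" using * decomposing_iff by blast
    then have "set (map (\<lambda>i. s i) [0..<k]) \<subseteq> S" using linked_ends tree_linked * by auto
    then show False using ends_cycle tree_linked(3) * by blast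
  qed
  assume k6: "k = 6"
  interpret H: kgraph6 G X using kgraph_axioms k6 by (simp add: kgraph6_def)
  show "\<not> (decomposing_K4_structure X G w Q \<and> induced_tree_containing G X S)"
  proof
    assume *: "decomposing_K4_structure X G w Q \<and> induced_tree_containing G X S"
    then have Q: "H.K4s w Q" using H.decomposing_K4_K4s by blast
    have n: "\<not> leaky G X (K4_tests w Q) (verts G)" using * H.decomposing_K4_iff[OF Q] by blast
    obtain c where "is_cycle G c" "set c \<subseteq> S"
    proof (rule H.linked_six_cycle[OF Q n tree_linked(1,2)[OF conjunct2[OF *]]])
      fix c a assume "is_cycle G c" "set c \<subseteq> S"
      then show thesis by (rule that)
    qed
    then show False using tree_linked(3) * by blast
  qed
  show "\<not> (decomposing_k_structure k X G P \<and> decomposing_K4_structure X G w Q)"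
  proof
    assume *: "decomposing_k_structure k X G P \<and> decomposing_K4_structure X G w Q"
    then have Q: "H.K4s w Q" using H.decomposing_K4_K4s by blast
    have n: "\<not> leaky G X (K4_tests w Q) (verts G)" using * H.decomposing_K4_iff[OF Q] by blast
    interpret kstruct G k X P by unfold_locales (rule kP[OF conjunct1[OF *]])
    have np: "\<not> leaky G X (k_tests k P) (verts G)" using * decomposing_iff by blast
    obtain c a where c: "is_cycle G c" "set c \<subseteq> K" "length c = 6" "a < 4" "w a \<in> set c"
    proof (rule H.linked_six_cycle[OF Q n linked_K K_verts])
      fix c a assume "is_cycle G c" "set c \<subseteq> K" "length c = 6" "a < 4" "w a \<in> set c"
      then show thesis by (rule that)
    qed
    \<comment> \<open>A cycle inside \<open>K\<close> contains all six ends, and this one has only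
      six vertices.\<close>
    have "(\<lambda>i. s i) ` {..<k} = set c"
    proof (rule card_subset_eq)
      show "(\<lambda>i. s i) ` {..<k} \<subseteq> set c" using cycle_in_K[OF c(1,2)] by auto
      have "inj_on (\<lambda>i. s i) {..<k}" using s_eq by (auto simp: inj_on_def)
      then show "card ((\<lambda>i. s i) ` {..<k}) = card (set c)"
        using c(1,3) k6 by (simp add: card_image distinct_card is_cycle_iff)
    qed simp
    then obtain i where i: "i < k" "w a = s i" using c(5) by force
    obtain b d where bd: "b < 4" "d < 4" "b \<noteq> d" "b \<noteq> a" "d \<noteq> a"
    proof -
      have "\<exists>b d :: nat. b < 4 \<and> d < 4 \<and> b \<noteq> d \<and> b \<noteq> a \<and> d \<noteq> a"
        using c(4) unfolding below_4[of a] by (elim disjE) (simp, presburger)+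
      then show thesis using that by blast
    qed
    \<comment> \<open>Puts \<open>a\<close> in the place of the deleted label 3.\<close>
    let ?f = "perm4 b d a"
    have f: "bij_betw ?f {..<4} {..<4}" by (rule bij_perm4) (use bd c(4) in auto)
    note K' = H.K4_permute[OF Q f]
    interpret R: kstruct G 6 X "H.K4sub (w \<circ> ?f) (Q \<circ> pair_map ?f)"
      by unfold_locales (rule H.kst_K4sub[OF K'(1)])
    have RK: "R.K = K4_verts w Q - {w a}"
      unfolding R.K_def H.K4sub_verts[OF K'(1)] K'(2) by (simp add: perm4_def)
    have "s i \<in> R.K" by (rule linked_ends[OF np R.linked_K R.K_verts i(1)])
    then show False using RK i(2) by simp
  qed
qed

end

section \<open>Structured programs with bounded loops\<close>

text \<open>The only loop counts from 0 to \<open>n - 1\<close>. Termination is therefore built in,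
  and the degree of the running time is the nesting depth.\<close>

datatype prog =
    PSkip
  | PAssign string aexp
  | PStore string aexp aexp
  | PSeq prog prog
  | PIf bexp prog prog
  | PFor string prog

fun code :: "prog \<Rightarrow> com" where
  "code PSkip = Skip"
| "code (PAssign x e) = Assign x e"
| "code (PStore a e f) = Store a e f"
| "code (PSeq p q) = Seq (code p) (code q)"
| "code (PIf b p q) = If b (code p) (code q)"
| "code (PFor i p) = Seq (Assign i (Const 0))
     (While (Less (Var i) (Var ''n'')) (Seq (code p) (Assign i (Plus (Var i) (Const 1)))))"

definition set_var :: "string \<Rightarrow> nat \<Rightarrow> store \<Rightarrow> store" where
  "set_var x v s = s\<lparr>var := (var s)(x := v)\<rparr>"

definition set_arr :: "string \<Rightarrow> nat \<Rightarrow> nat \<Rightarrow> store \<Rightarrow> store" where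
  "set_arr a i v s = s\<lparr>arr := (arr s)(a := (arr s a)(i := v))\<rparr>"

text \<open>The final assignment records that the compiled while loop leaves its variable at
  \<open>n\<close>.\<close>

fun run :: "prog \<Rightarrow> store \<Rightarrow> store" where
  "run PSkip s = s"
| "run (PAssign x e) s = set_var x (aval e s) s"
| "run (PStore a e f) s = set_arr a (aval e s) (aval f s) s"
| "run (PSeq p q) s = run q (run p s)"
| "run (PIf b p q) s = (if bval b s then run p s else run q s)"
| "run (PFor i p) s = set_var i (var s ''n'')
     (fold (\<lambda>j t. run p (set_var i j t)) [0..<var s ''n''] s)"

fun wvars :: "prog \<Rightarrow> string set" where
  "wvars PSkip = {}"
| "wvars (PAssign x e) = {x}"
| "wvars (PStore a e f) = {}"
| "wvars (PSeq p q) = wvars p \<union> wvars q"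
| "wvars (PIf b p q) = wvars p \<union> wvars q"
| "wvars (PFor i p) = insert i (wvars p)"

fun warrs :: "prog \<Rightarrow> string set" where
  "warrs PSkip = {}"
| "warrs (PAssign x e) = {}"
| "warrs (PStore a e f) = {a}"
| "warrs (PSeq p q) = warrs p \<union> warrs q"
| "warrs (PIf b p q) = warrs p \<union> warrs q"
| "warrs (PFor i p) = warrs p"

text \<open>A body that changed its own loop variable could make the compiled while loop depart from
  the fixed sequence of rounds in \<open>run\<close>.\<close>

fun loops_ok :: "prog \<Rightarrow> bool" where
  "loops_ok (PSeq p q) \<longleftrightarrow> loops_ok p \<and> loops_ok q"
| "loops_ok (PIf b p q) \<longleftrightarrow> loops_ok p \<and> loops_ok q"
| "loops_ok (PFor i p) \<longleftrightarrow> i \<notin> wvars p \<and> loops_ok p"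
| "loops_ok _ \<longleftrightarrow> True"

fun depth :: "prog \<Rightarrow> nat" where
  "depth (PSeq p q) = max (depth p) (depth q)"
| "depth (PIf b p q) = max (depth p) (depth q)"
| "depth (PFor i p) = Suc (depth p)"
| "depth _ = 0"

text \<open>The coefficient of the bound in \<open>exec_code\<close>. Both branches of a conditional
  are charged; the 4 of a loop absorbs the initial assignment, the tests and the increments.\<close>

fun cost :: "prog \<Rightarrow> nat" where
  "cost (PSeq p q) = cost p + cost q"
| "cost (PIf b p q) = Suc (cost p + cost q)"
| "cost (PFor i p) = cost p + 4"
| "cost _ = 1"

lemma var_set_var [simp]: "var (set_var x v s) y = (if y = x then v else var s y)"
  by (simp add: set_var_def)

lemma arr_set_var [simp]: "arr (set_var x v s) = arr s"
  by (simp add: set_var_def)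

lemma var_set_arr [simp]: "var (set_arr a i v s) = var s"
  by (simp add: set_arr_def)

lemma arr_set_arr [simp]: "arr (set_arr a i v s) b = (if b = a then (arr s a)(i := v) else arr s b)"
  by (simp add: set_arr_def)

lemma run_var: "x \<notin> wvars p \<Longrightarrow> var (run p s) x = var s x"
proof (induction p arbitrary: s)
  case (PFor i p)
  have "var (fold (\<lambda>j t. run p (set_var i j t)) js s) x = var s x" for js
    using PFor by (induction js arbitrary: s) auto
  then show ?case using PFor by simp
qed auto

lemma run_arr: "a \<notin> warrs p \<Longrightarrow> arr (run p s) a = arr s a"
proof (induction p arbitrary: s)
  case (PFor i p)
  have "arr (fold (\<lambda>j t. run p (set_var i j t)) js s) a = arr s a" for js
    using PFor by (induction js arbitrary: s) auto
  then show ?case using PFor by simp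
qed auto

theorem exec_code:
  "loops_ok p \<Longrightarrow> ''n'' \<notin> wvars p \<Longrightarrow> \<exists>t. exec (code p) s t (run p s) \<and> t \<le> cost p * (var s ''n'' + 1) ^ depth p"
proof (induction p arbitrary: s)
  case PSkip
  show ?case using exec.Skip[of s] by (intro exI[of _ 1]) simp
next
  case (PAssign x e)
  show ?case using exec.Assign[of x e s] by (intro exI[of _ 1]) (simp add: set_var_def)
next
  case (PStore a e f)
  show ?case using exec.Store[of a e f s] by (intro exI[of _ 1]) (simp add: set_arr_def)
next
  case (PSeq p q)
  let ?N = "var s ''n'' + 1"
  obtain t where t: "exec (code p) s t (run p s)" "t \<le> cost p * ?N ^ depth p" using PSeq by fastforce
  obtain u where u: "exec (code q) (run p s) u (run q (run p s))" "u \<le> cost q * ?N ^ depth q"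
    using PSeq.IH(2)[of "run p s"] PSeq.prems run_var[of "''n''" p s] by auto
  have "t + u \<le> cost p * ?N ^ max (depth p) (depth q) + cost q * ?N ^ max (depth p) (depth q)"
    using t(2) u(2) by (intro add_mono order_trans[OF t(2)] order_trans[OF u(2)] mult_left_mono power_increasing) auto
  then show ?case using exec.Seq[OF t(1) u(1)] by (intro exI[of _ "t + u"]) (simp add: algebra_simps)
next
  case (PIf b p q)
  let ?N = "var s ''n'' + 1" and ?d = "max (depth p) (depth q)"
  have mono: "c * ?N ^ depth r \<le> c * ?N ^ ?d" if "r = p \<or> r = q" for r c
    using that by (intro mult_left_mono power_increasing) auto
  have one: "1 \<le> ?N ^ ?d" by simp
  show ?case
  proof (cases "bval b s")
    case True
    obtain t where t: "exec (code p) s t (run p s)" "t \<le> cost p * ?N ^ depth p" using PIf by fastforce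
    have "Suc t \<le> cost (PIf b p q) * ?N ^ ?d"
    proof -
      have "t \<le> cost p * ?N ^ ?d" using order_trans[OF t(2) mono[of p "cost p"]] by blast
      then have "Suc t \<le> ?N ^ ?d + (cost p * ?N ^ ?d + cost q * ?N ^ ?d)" using one by linarith
      then show ?thesis by (simp add: algebra_simps)
    qed
    then show ?thesis using exec.IfTrue[OF True t(1)] True by (intro exI[of _ "Suc t"]) simp
  next
    case False
    obtain t where t: "exec (code q) s t (run q s)" "t \<le> cost q * ?N ^ depth q" using PIf by fastforce
    have "Suc t \<le> cost (PIf b p q) * ?N ^ ?d"
    proof -
      have "t \<le> cost q * ?N ^ ?d" using order_trans[OF t(2) mono[of q "cost q"]] by blast
      then have "Suc t \<le> ?N ^ ?d + (cost p * ?N ^ ?d + cost q * ?N ^ ?d)" using one by linarith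
      then show ?thesis by (simp add: algebra_simps)
    qed
    then show ?thesis using exec.IfFalse[OF False t(1)] False by (intro exI[of _ "Suc t"]) simp
  qed
next
  case (PFor i p)
  let ?n = "var s ''n''"
  let ?B = "cost p * (?n + 1) ^ depth p"
  let ?W = "While (Less (Var i) (Var ''n'')) (Seq (code p) (Assign i (Plus (Var i) (Const 1))))"
  have i: "i \<noteq> ''n''" "i \<notin> wvars p" "''n'' \<notin> wvars p" using PFor.prems by auto
  \<comment> \<open>Stated for a loop that has already reached \<open>j\<close>, to allow induction
    on the remaining rounds. A round takes the test, the body and the increment, hence
    \<open>?B + 2\<close>; the last 1 is the failing test.\<close>
  have loop: "\<exists>t. exec ?W (set_var i j r) t (set_var i ?n (fold (\<lambda>j t. run p (set_var i j t)) [j..<?n] r)) \<and>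
      t \<le> (?n - j) * (?B + 2) + 1" if "j \<le> ?n" "var r ''n'' = ?n" for j r
    using that
  proof (induction "?n - j" arbitrary: j r)
    case 0
    then have "j = ?n" by simp
    then show ?case using exec.WhileFalse[of "Less (Var i) (Var ''n'')" "set_var i j r"] 0 i by (intro exI[of _ 1]) simp
  next
    case (Suc m)
    let ?r = "run p (set_var i j r)"
    have j: "j < ?n" using Suc by simp
    obtain t where t: "exec (code p) (set_var i j r) t ?r" "t \<le> ?B"
      using PFor.IH[of "set_var i j r"] PFor.prems Suc.prems i by auto
    have rv: "var ?r i = j" "var ?r ''n'' = ?n" using run_var[of i p] run_var[of "''n''" p] i Suc.prems by auto
    have a: "exec (Assign i (Plus (Var i) (Const 1))) ?r 1 (set_var i (Suc j) ?r)"
      using exec.Assign[of i "Plus (Var i) (Const 1)" ?r] rv by (simp add: set_var_def)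
    obtain u where u: "exec ?W (set_var i (Suc j) ?r) u (set_var i ?n (fold (\<lambda>j t. run p (set_var i j t)) [Suc j..<?n] ?r))"
      "u \<le> (?n - Suc j) * (?B + 2) + 1"
    proof -
      have "m = ?n - Suc j" "Suc j \<le> ?n" using Suc.hyps(2) j by auto
      from Suc.hyps(1)[OF this rv(2)] show thesis using that by blast
    qed
    have b: "bval (Less (Var i) (Var ''n'')) (set_var i j r)" using j i Suc.prems by simp
    have e: "exec ?W (set_var i j r) (Suc (t + 1 + u)) (set_var i ?n (fold (\<lambda>j t. run p (set_var i j t)) [j..<?n] r))"
      using exec.WhileTrue[OF b exec.Seq[OF t(1) a] u(1)] j by (simp add: upt_conv_Cons)
    have "?n - j = Suc (?n - Suc j)" using j by simp
    then have "Suc (t + 1 + u) \<le> (?n - j) * (?B + 2) + 1" using t(2) u(2) by simp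
    then show ?case using e by blast
  qed
  obtain t where t: "exec ?W (set_var i 0 s) t (run (PFor i p) s)" "t \<le> ?n * (?B + 2) + 1"
    using loop[of 0 s] by auto
  have a: "exec (Assign i (Const 0)) s 1 (set_var i 0 s)"
    using exec.Assign[of i "Const 0" s] by (simp add: set_var_def)
  have "exec (code (PFor i p)) s (1 + t) (run (PFor i p) s)"
    using exec.Seq[OF a t(1)] by simp
  moreover have "1 + t \<le> (cost p + 4) * (?n + 1) ^ Suc (depth p)"
  proof -
    let ?M = "(?n + 1) ^ depth p"
    have gen: "n * (B + 2) + 2 \<le> (n + 1) * B + (n + 1) * 4" for n B :: nat
      by (simp add: algebra_simps)
    have "1 + t \<le> ?n * (?B + 2) + 2" using t(2) by linarith
    also have "\<dots> \<le> (?n + 1) * ?B + (?n + 1) * 4" by (rule gen)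
    also have "\<dots> \<le> (?n + 1) * ?B + (?n + 1) * 4 * ?M" by (intro add_left_mono) simp
    also have "\<dots> = (cost p + 4) * (?n + 1) ^ Suc (depth p)" by (simp add: algebra_simps)
    finally show ?thesis .
  qed
  ultimately show ?case by (intro exI[of _ "1 + t"]) simp
qed

text \<open>A frame condition. Supplied by \<open>run_For\<close>, it spares the invariants from
  mentioning everything that a loop leaves alone.\<close>

definition agree :: "string set \<Rightarrow> string set \<Rightarrow> store \<Rightarrow> store \<Rightarrow> bool" where
  "agree V A s t \<longleftrightarrow> (\<forall>x. x \<notin> V \<longrightarrow> var t x = var s x) \<and> (\<forall>a. a \<notin> A \<longrightarrow> arr t a = arr s a)"

lemma agree_run: "agree (wvars p) (warrs p) s (run p s)"
  by (simp add: agree_def run_var run_arr)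

lemma run_For:
  assumes init: "I 0 s"
    and step: "\<And>j t. j < var s ''n'' \<Longrightarrow> agree (wvars (PFor i p)) (warrs p) s t \<Longrightarrow> I j t \<Longrightarrow>
      I (Suc j) (run p (set_var i j t))"
    and exit: "\<And>t. agree (wvars (PFor i p)) (warrs p) s t \<Longrightarrow> I (var s ''n'') t \<Longrightarrow> Q (set_var i (var s ''n'') t)"
  shows "Q (run (PFor i p) s)"
proof -
  let ?f = "\<lambda>m. fold (\<lambda>j t. run p (set_var i j t)) [0..<m] s"
  have "agree (wvars (PFor i p)) (warrs p) s (?f m) \<and> I m (?f m)" if "m \<le> var s ''n''" for m
    using that
  proof (induction m)
    case 0
    then show ?case using init by (simp add: agree_def)
  next
    case (Suc m)
    then show ?case using step[of m "?f m"] agree_run[of p "set_var i m (?f m)"] by (auto simp: agree_def)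
  qed
  then show ?thesis using exit by simp
qed

fun seqs :: "prog list \<Rightarrow> prog" where
  "seqs [] = PSkip"
| "seqs (p # ps) = PSeq p (seqs ps)"

lemma run_seqs: "run (seqs ps) s = fold run ps s"
  by (induction ps arbitrary: s) auto

lemma wvars_seqs: "wvars (seqs ps) = (\<Union>p\<in>set ps. wvars p)"
  by (induction ps) auto

lemma warrs_seqs: "warrs (seqs ps) = (\<Union>p\<in>set ps. warrs p)"
  by (induction ps) auto

fun allb :: "bexp list \<Rightarrow> bexp" where
  "allb [] = Equal (Const 0) (Const 0)"
| "allb (b # bs) = And b (allb bs)"

lemma bval_allb: "bval (allb bs) s \<longleftrightarrow> (\<forall>b\<in>set bs. bval b s)"
  by (induction bs) auto

definition nonzero :: "aexp \<Rightarrow> bexp" where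
  "nonzero e = Not (Equal e (Const 0))"

lemma bval_nonzero [simp]: "bval (nonzero e) s \<longleftrightarrow> aval e s \<noteq> 0"
  by (simp add: nonzero_def)

section \<open>Reachability, tests and greedy minimisation as programs\<close>

definition copy_prog :: "string \<Rightarrow> string \<Rightarrow> prog" where
  "copy_prog a b = PFor ''u'' (PStore b (Var ''u'') (Get a (Var ''u'')))"

definition fill_prog :: "string \<Rightarrow> nat \<Rightarrow> prog" where
  "fill_prog a c = PFor ''u'' (PStore a (Var ''u'') (Const c))"

text \<open>The machine has no multiplication, so the offsets \<open>u * n\<close> of the rows are
  tabulated beforehand in \<open>''row''\<close>, by repeated addition in
  \<open>row_prog\<close>.\<close>

definition edge_exp :: "aexp \<Rightarrow> aexp \<Rightarrow> aexp" where
  "edge_exp u v = Get ''adj'' (Plus (Get ''row'' u) v)"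

definition reach_inner :: prog where
  "reach_inner = PFor ''c'' (PIf (And (nonzero (Get ''W'' (Var ''c''))) (nonzero (edge_exp (Var ''b'') (Var ''c''))))
     (PStore ''R'' (Var ''c'') (Const 1)) PSkip)"

definition reach_round :: prog where
  "reach_round = PFor ''b'' (PIf (And (nonzero (Get ''R'' (Var ''b''))) (nonzero (Get ''W'' (Var ''b'')))) reach_inner PSkip)"

text \<open>\<open>n\<close> scans of the adjacency matrix, which makes three nested loops. The
  start is marked even if it lies outside \<open>''W''\<close>, in accordance with the reflexivity
  of \<open>reach\<close>.\<close>

definition reach_prog :: prog where
  "reach_prog = seqs [fill_prog ''R'' 0, PStore ''R'' (Var ''r'') (Const 1), PFor ''a'' reach_round]"

definition term_exp :: "nat \<Rightarrow> aexp" where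
  "term_exp i = Get ''term'' (Const i)"

definition linked_test :: "nat \<Rightarrow> prog" where
  "linked_test k = seqs [copy_prog ''S'' ''W'', PAssign ''r'' (term_exp 0), reach_prog,
     PIf (allb (map (\<lambda>i. And (nonzero (Get ''W'' (term_exp i))) (nonzero (Get ''R'' (term_exp i)))) [0..<k]))
       (PAssign ''ok'' (Const 1)) (PAssign ''ok'' (Const 0))]"

definition leaky_one :: "nat \<Rightarrow> aexp list \<times> aexp \<Rightarrow> prog" where
  "leaky_one k t = seqs [copy_prog ''S'' ''W'', seqs (map (\<lambda>d. PStore ''W'' d (Const 0)) (fst t)),
     PAssign ''r'' (snd t), reach_prog,
     PIf (allb (map (\<lambda>i. Not (And (Not (Equal (term_exp i) (Var ''r''))) (nonzero (Get ''R'' (term_exp i))))) [0..<k]))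
       PSkip (PAssign ''ok'' (Const 1))]"

definition leaky_test :: "nat \<Rightarrow> (aexp list \<times> aexp) list \<Rightarrow> prog" where
  "leaky_test k ts = PSeq (PAssign ''ok'' (Const 0)) (seqs (map (leaky_one k) ts))"

definition greedy_prog :: "prog \<Rightarrow> string \<Rightarrow> prog" where
  "greedy_prog test keep = PFor ''g'' (PIf (And (nonzero (Get ''S'' (Var ''g''))) (Equal (Get keep (Var ''g'')) (Const 0)))
     (seqs [PStore ''S'' (Var ''g'') (Const 0), test, PIf (Equal (Var ''ok'') (Const 0)) (PStore ''S'' (Var ''g'') (Const 1)) PSkip])
     PSkip)"

text \<open>Such expressions keep their values while a test runs, since a test writes only
  \<open>''W''\<close>, \<open>''R''\<close> and scalar variables. The cutsets and heads of a
  structure can therefore be passed to the tests as expressions.\<close>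

definition static :: "aexp \<Rightarrow> bool" where
  "static e \<longleftrightarrow> (\<forall>s t. (\<forall>a\<in>{''path'', ''len'', ''row'', ''branch''}. arr s a = arr t a) \<longrightarrow> aval e s = aval e t)"

lemma static_cong:
  assumes "static e" "\<forall>a. a \<notin> {''W'', ''R''} \<longrightarrow> arr t a = arr s a"
  shows "aval e t = aval e s"
proof -
  have "\<forall>a\<in>{''path'', ''len'', ''row'', ''branch''}. arr t a = arr s a" using assms(2) by simp
  then show ?thesis using assms(1) unfolding static_def by blast
qed

lemma agree_var: "agree V A s t \<Longrightarrow> x \<notin> V \<Longrightarrow> var t x = var s x"
  by (simp add: agree_def)

lemma agree_arr: "agree V A s t \<Longrightarrow> a \<notin> A \<Longrightarrow> arr t a = arr s a"
  by (simp add: agree_def)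

lemma wvars_reach_inner [simp]: "wvars reach_inner = {''c''}" "warrs reach_inner = {''R''}"
  by (auto simp: reach_inner_def)

lemma wvars_reach_round [simp]: "wvars reach_round = {''b'', ''c''}" "warrs reach_round = {''R''}"
  by (auto simp: reach_round_def)

lemma wvars_copy [simp]: "wvars (copy_prog a b) = {''u''}" "warrs (copy_prog a b) = {b}"
  by (auto simp: copy_prog_def)

lemma wvars_fill [simp]: "wvars (fill_prog a c) = {''u''}" "warrs (fill_prog a c) = {a}"
  by (auto simp: fill_prog_def)

lemma wvars_reach [simp]: "wvars reach_prog = {''u'', ''a'', ''b'', ''c''}" "warrs reach_prog = {''R''}"
  by (auto simp: reach_prog_def)

lemma wvars_linked [simp]: "wvars (linked_test k) = {''u'', ''a'', ''b'', ''c'', ''r'', ''ok''}" "warrs (linked_test k) = {''W'', ''R''}"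
  by (auto simp: linked_test_def)

lemma wvars_leaky_one: "wvars (leaky_one k t) = {''u'', ''a'', ''b'', ''c'', ''r'', ''ok''}" "warrs (leaky_one k t) = {''W'', ''R''}"
  by (auto simp: leaky_one_def wvars_seqs warrs_seqs)

lemma wvars_leaky: "wvars (leaky_test k ts) \<subseteq> {''u'', ''a'', ''b'', ''c'', ''r'', ''ok''}" "warrs (leaky_test k ts) \<subseteq> {''W'', ''R''}"
  by (auto simp: leaky_test_def wvars_seqs warrs_seqs wvars_leaky_one)

locale instance_graph =
  fixes n :: nat and G :: "nat graph" and k :: nat and x :: "nat \<Rightarrow> nat"
  assumes vertices: "verts G = {..<n}" and k_pos: "0 < k" and x_less: "\<And>i. i < k \<Longrightarrow> x i < n"
begin

abbreviation X where "X \<equiv> x ` {..<k}"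

text \<open>What every program after \<open>row_prog\<close> leaves unchanged: the size, the matrix,
  the row offsets and the terminals.\<close>

definition env :: "store \<Rightarrow> bool" where
  "env s \<longleftrightarrow> var s ''n'' = n \<and> (\<forall>u<n. \<forall>v<n. arr s ''adj'' (u * n + v) = (if adj G u v then 1 else 0)) \<and>
     (\<forall>u<n. arr s ''row'' u = u * n) \<and> (\<forall>i<k. arr s ''term'' i = x i)"

definition setof :: "store \<Rightarrow> string \<Rightarrow> nat set" where
  "setof s a = {v. v < n \<and> arr s a v \<noteq> 0}"

lemma env_agree: "env s \<Longrightarrow> agree V A s t \<Longrightarrow> ''n'' \<notin> V \<Longrightarrow> ''adj'' \<notin> A \<Longrightarrow> ''row'' \<notin> A \<Longrightarrow> ''term'' \<notin> A \<Longrightarrow> env t"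
  unfolding env_def agree_def by simp

lemma env_run: "env s \<Longrightarrow> ''n'' \<notin> wvars p \<Longrightarrow> ''adj'' \<notin> warrs p \<Longrightarrow> ''row'' \<notin> warrs p \<Longrightarrow> ''term'' \<notin> warrs p \<Longrightarrow> env (run p s)"
  using env_agree agree_run by blast

lemma env_n: "env s \<Longrightarrow> var s ''n'' = n"
  by (simp add: env_def)

lemma env_set_var: "y \<noteq> ''n'' \<Longrightarrow> env (set_var y v s) \<longleftrightarrow> env s"
  by (simp add: env_def)

lemma setof_cong: "arr s a = arr t b \<Longrightarrow> setof s a = setof t b"
  by (simp add: setof_def)

lemma edge_value: "env s \<Longrightarrow> aval u s < n \<Longrightarrow> aval v s < n \<Longrightarrow> aval (edge_exp u v) s \<noteq> 0 \<longleftrightarrow> adj G (aval u s) (aval v s)"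
  by (simp add: edge_exp_def env_def)

lemma term_value: "env s \<Longrightarrow> i < k \<Longrightarrow> aval (term_exp i) s = x i"
  by (simp add: term_exp_def env_def)

lemma copy_value:
  assumes "var s ''n'' = n" "a \<noteq> b" "v < n"
  shows "arr (run (copy_prog a b) s) b v = arr s a v"
  unfolding copy_prog_def
proof (rule run_For[where I = "\<lambda>j t. \<forall>v<j. arr t b v = arr s a v"])
  fix j t assume *: "agree (wvars (PFor ''u'' (PStore b (Var ''u'') (Get a (Var ''u''))))) (warrs (PStore b (Var ''u'') (Get a (Var ''u'')))) s t"
    "\<forall>v<j. arr t b v = arr s a v"
  have "arr t a = arr s a" using agree_arr[OF *(1)] assms(2) by simp
  then show "\<forall>v<Suc j. arr (run (PStore b (Var ''u'') (Get a (Var ''u''))) (set_var ''u'' j t)) b v = arr s a v"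
    using *(2) by (auto simp: less_Suc_eq)
qed (use assms in auto)

lemma setof_copy: "var s ''n'' = n \<Longrightarrow> a \<noteq> b \<Longrightarrow> setof (run (copy_prog a b) s) b = setof s a"
  using copy_value by (auto simp: setof_def)

lemma fill_value:
  assumes "var s ''n'' = n" "v < n"
  shows "arr (run (fill_prog a c) s) a v = c"
  unfolding fill_prog_def
  by (rule run_For[where I = "\<lambda>j t. \<forall>v<j. arr t a v = c"]) (use assms in \<open>auto simp: less_Suc_eq\<close>)

lemma reach_inner_set:
  assumes e: "env s" and b: "var s ''b'' = b" "b < n"
  shows "setof (run reach_inner s) ''R'' = setof s ''R'' \<union> {v \<in> setof s ''W''. adj G b v}"
  unfolding reach_inner_def
proof (rule run_For[where I = "\<lambda>j t. setof t ''R'' = setof s ''R'' \<union> {v \<in> setof s ''W''. v < j \<and> adj G b v}"])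
  let ?p = "PIf (And (nonzero (Get ''W'' (Var ''c''))) (nonzero (edge_exp (Var ''b'') (Var ''c''))))
     (PStore ''R'' (Var ''c'') (Const 1)) PSkip"
  fix j t assume j: "j < var s ''n''" and a: "agree (wvars (PFor ''c'' ?p)) (warrs ?p) s t"
    and I: "setof t ''R'' = setof s ''R'' \<union> {v \<in> setof s ''W''. v < j \<and> adj G b v}"
  let ?t = "set_var ''c'' j t"
  have W: "arr t ''W'' = arr s ''W''" and vb: "var t ''b'' = b" using agree_arr[OF a] agree_var[OF a] b by auto
  have et: "env ?t" using env_agree[OF e a] by (simp add: env_set_var)
  have jn: "j < n" using j env_n[OF e] by simp
  have "bval (And (nonzero (Get ''W'' (Var ''c''))) (nonzero (edge_exp (Var ''b'') (Var ''c'')))) ?t \<longleftrightarrow> j \<in> setof s ''W'' \<and> adj G b j"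
    using edge_value[OF et, of "Var ''b''" "Var ''c''"] W vb jn b by (simp add: setof_def)
  then have "setof (run ?p ?t) ''R'' = setof t ''R'' \<union> (if j \<in> setof s ''W'' \<and> adj G b j then {j} else {})"
    using jn by (auto simp: setof_def)
  then show "setof (run ?p ?t) ''R'' = setof s ''R'' \<union> {v \<in> setof s ''W''. v < Suc j \<and> adj G b v}"
    unfolding I by (auto simp: less_Suc_eq)
qed (auto simp: env_n[OF e] setof_def)

definition closed_under :: "nat set \<Rightarrow> nat set \<Rightarrow> bool" where
  "closed_under W Z \<longleftrightarrow> (\<forall>u\<in>Z \<inter> W. \<forall>v\<in>W. adj G u v \<longrightarrow> v \<in> Z)"

text \<open>Vertices found during a round may be expanded in the same round, so the outcome is only
  bracketed: it contains at least one further step and stays inside every closed set.\<close>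

lemma reach_round_set:
  assumes e: "env s"
  defines "R \<equiv> setof s ''R''" and "W \<equiv> setof s ''W''" and "R' \<equiv> setof (run reach_round s) ''R''"
  shows "R \<subseteq> R' \<and> (\<forall>u\<in>R \<inter> W. \<forall>v\<in>W. adj G u v \<longrightarrow> v \<in> R') \<and> (\<forall>Z. R \<subseteq> Z \<longrightarrow> closed_under W Z \<longrightarrow> R' \<subseteq> Z)"
  unfolding R'_def reach_round_def
proof (rule run_For[where I = "\<lambda>j t. R \<subseteq> setof t ''R'' \<and> (\<forall>u\<in>R \<inter> W. u < j \<longrightarrow> (\<forall>v\<in>W. adj G u v \<longrightarrow> v \<in> setof t ''R'')) \<and>
    (\<forall>Z. R \<subseteq> Z \<longrightarrow> closed_under W Z \<longrightarrow> setof t ''R'' \<subseteq> Z)"])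
  let ?c = "And (nonzero (Get ''R'' (Var ''b''))) (nonzero (Get ''W'' (Var ''b'')))"
  let ?p = "PIf ?c reach_inner PSkip"
  fix j t assume j: "j < var s ''n''" and a: "agree (wvars (PFor ''b'' ?p)) (warrs ?p) s t"
    and I: "R \<subseteq> setof t ''R'' \<and> (\<forall>u\<in>R \<inter> W. u < j \<longrightarrow> (\<forall>v\<in>W. adj G u v \<longrightarrow> v \<in> setof t ''R'')) \<and>
      (\<forall>Z. R \<subseteq> Z \<longrightarrow> closed_under W Z \<longrightarrow> setof t ''R'' \<subseteq> Z)"
  let ?t = "set_var ''b'' j t"
  have W: "setof t ''W'' = W" unfolding W_def by (rule setof_cong) (simp add: agree_arr[OF a])
  have et: "env ?t" using env_agree[OF e a] by (simp add: env_set_var)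
  have jn: "j < n" using j env_n[OF e] by simp
  have st: "setof ?t a = setof t a" for a by (simp add: setof_def)
  have "setof (run ?p ?t) ''R'' = setof t ''R'' \<union> (if j \<in> setof t ''R'' \<inter> W then {v \<in> W. adj G j v} else {})"
  proof (cases "j \<in> setof t ''R'' \<inter> W")
    case True
    then have "bval ?c ?t = True" using W by (auto simp: setof_def)
    then have "run ?p ?t = run reach_inner ?t" by (simp only: run.simps if_True)
    moreover have "setof (run reach_inner ?t) ''R'' = setof t ''R'' \<union> {v \<in> W. adj G j v}"
      using reach_inner_set[OF et _ jn] by (simp add: st W)
    ultimately show ?thesis using True by (simp only: if_True)
  next
    case False
    then have "bval ?c ?t = False" using W jn by (auto simp: setof_def)
    then have "run ?p ?t = ?t" by (simp only: run.simps if_False)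
    then have "setof (run ?p ?t) ''R'' = setof t ''R''" by (simp only: st)
    then show ?thesis using False by (simp only: if_False Un_empty_right)
  qed
  then show "R \<subseteq> setof (run ?p ?t) ''R'' \<and> (\<forall>u\<in>R \<inter> W. u < Suc j \<longrightarrow> (\<forall>v\<in>W. adj G u v \<longrightarrow> v \<in> setof (run ?p ?t) ''R'')) \<and>
    (\<forall>Z. R \<subseteq> Z \<longrightarrow> closed_under W Z \<longrightarrow> setof (run ?p ?t) ''R'' \<subseteq> Z)"
  proof (intro conjI ballI allI impI)
    let ?N = "if j \<in> setof t ''R'' \<inter> W then {v \<in> W. adj G j v} else {}"
    assume new: "setof (run ?p ?t) ''R'' = setof t ''R'' \<union> ?N"
    show "R \<subseteq> setof (run ?p ?t) ''R''" unfolding new using I by blast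
    fix u v assume u: "u \<in> R \<inter> W" "u < Suc j" "v \<in> W" "adj G u v"
    show "v \<in> setof (run ?p ?t) ''R''"
    proof (cases "u = j")
      case True
      then have "j \<in> setof t ''R'' \<inter> W" using I u by blast
      then have "v \<in> ?N" using u True by simp
      then show ?thesis unfolding new by blast
    next
      case False
      then have "u < j" using u by simp
      then show ?thesis unfolding new using I u by blast
    qed
  next
    let ?N = "if j \<in> setof t ''R'' \<inter> W then {v \<in> W. adj G j v} else {}"
    assume new: "setof (run ?p ?t) ''R'' = setof t ''R'' \<union> ?N"
    fix Z assume Z: "R \<subseteq> Z" "closed_under W Z"
    have "setof t ''R'' \<subseteq> Z" using I Z by blast
    moreover have "?N \<subseteq> Z" using Z(2) \<open>setof t ''R'' \<subseteq> Z\<close> by (auto simp: closed_under_def)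
    ultimately show "setof (run ?p ?t) ''R'' \<subseteq> Z" unfolding new by blast
  qed
next
  fix t assume I: "R \<subseteq> setof t ''R'' \<and> (\<forall>u\<in>R \<inter> W. u < var s ''n'' \<longrightarrow> (\<forall>v\<in>W. adj G u v \<longrightarrow> v \<in> setof t ''R'')) \<and>
      (\<forall>Z. R \<subseteq> Z \<longrightarrow> closed_under W Z \<longrightarrow> setof t ''R'' \<subseteq> Z)"
  have "u < var s ''n''" if "u \<in> W" for u using that env_n[OF e] by (auto simp: W_def setof_def)
  then show "R \<subseteq> setof (set_var ''b'' (var s ''n'') t) ''R'' \<and> (\<forall>u\<in>R \<inter> W. \<forall>v\<in>W. adj G u v \<longrightarrow> v \<in> setof (set_var ''b'' (var s ''n'') t) ''R'') \<and>
      (\<forall>Z. R \<subseteq> Z \<longrightarrow> closed_under W Z \<longrightarrow> setof (set_var ''b'' (var s ''n'') t) ''R'' \<subseteq> Z)"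
    using I by (simp add: setof_def)
qed (auto simp: R_def)

lemma reach_set:
  assumes e: "env s" and r: "var s ''r'' < n"
  shows "setof (run reach_prog s) ''R'' = {v. v < n \<and> reach G (setof s ''W'') (var s ''r'') v}"
proof -
  let ?r = "var s ''r''" and ?W = "setof s ''W''"
  let ?s = "set_arr ''R'' ?r 1 (run (fill_prog ''R'' 0) s)"
  let ?T = "{v. v < n \<and> reach G ?W ?r v}"
  have run: "run reach_prog s = run (PFor ''a'' reach_round) ?s"
    by (simp add: reach_prog_def run_var run_arr)
  have es: "env ?s" using env_run[OF e, of "fill_prog ''R'' 0"] by (simp add: env_def)
  have R0: "setof ?s ''R'' = {?r}" using fill_value[OF env_n[OF e]] r by (auto simp: setof_def)
  have W0: "setof ?s ''W'' = ?W" by (rule setof_cong) (simp add: run_arr)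
  have closedT: "closed_under ?W ?T"
    unfolding closed_under_def by (auto simp: setof_def intro: reach_trans reach_step)
  have fin: "card Z \<le> n" if "Z \<subseteq> {..<n}" for Z using card_mono[OF _ that] by simp
  have "?r \<in> setof (run (PFor ''a'' reach_round) ?s) ''R'' \<and> setof (run (PFor ''a'' reach_round) ?s) ''R'' \<subseteq> ?T \<and>
      closed_under ?W (setof (run (PFor ''a'' reach_round) ?s) ''R'')"
  \<comment> \<open>As long as the set is not closed, each round adds a vertex; after
    \<open>n\<close> rounds it would have more than \<open>n\<close> of them.\<close>
  proof (rule run_For[where I = "\<lambda>j t. ?r \<in> setof t ''R'' \<and> setof t ''R'' \<subseteq> ?T \<and> (closed_under ?W (setof t ''R'') \<or> j < card (setof t ''R''))"])
    show "?r \<in> setof ?s ''R'' \<and> setof ?s ''R'' \<subseteq> ?T \<and> (closed_under ?W (setof ?s ''R'') \<or> 0 < card (setof ?s ''R''))"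
      unfolding R0 using r by simp
  next
    fix j t assume a: "agree (wvars (PFor ''a'' reach_round)) (warrs reach_round) ?s t"
      and I: "?r \<in> setof t ''R'' \<and> setof t ''R'' \<subseteq> ?T \<and> (closed_under ?W (setof t ''R'') \<or> j < card (setof t ''R''))"
    let ?t = "set_var ''a'' j t"
    have W: "setof ?t ''W'' = ?W" using setof_cong[of t "''W''" ?s "''W''"] agree_arr[OF a] W0 by (simp add: setof_def)
    have R: "setof ?t ''R'' = setof t ''R''" by (simp add: setof_def)
    have et: "env ?t" using env_agree[OF es a] by (simp add: env_set_var)
    let ?R' = "setof (run reach_round ?t) ''R''"
    have *: "setof t ''R'' \<subseteq> ?R'" "\<forall>u\<in>setof t ''R'' \<inter> ?W. \<forall>v\<in>?W. adj G u v \<longrightarrow> v \<in> ?R'"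
      "\<And>Z. setof t ''R'' \<subseteq> Z \<Longrightarrow> closed_under ?W Z \<Longrightarrow> ?R' \<subseteq> Z"
      using reach_round_set[OF et] unfolding W R by auto
    have "?R' \<subseteq> ?T" using *(3)[of ?T] I closedT by blast
    moreover have "closed_under ?W ?R' \<or> Suc j < card ?R'"
    proof (cases "?R' = setof t ''R''")
      case True
      then show ?thesis using *(2) by (auto simp: closed_under_def)
    next
      case False
      have nc: "\<not> closed_under ?W (setof t ''R'')" using *(1) *(3)[of "setof t ''R''"] False by blast
      have "finite ?R'" by (simp add: setof_def)
      then have "card (setof t ''R'') < card ?R'" using *(1) False by (intro psubset_card_mono) auto
      then show ?thesis using I nc by linarith
    qed
    ultimately show "?r \<in> ?R' \<and> ?R' \<subseteq> ?T \<and> (closed_under ?W ?R' \<or> Suc j < card ?R')"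
      using I *(1) by blast
  next
    fix t assume I: "?r \<in> setof t ''R'' \<and> setof t ''R'' \<subseteq> ?T \<and> (closed_under ?W (setof t ''R'') \<or> var ?s ''n'' < card (setof t ''R''))"
    have "setof t ''R'' \<subseteq> {..<n}" by (auto simp: setof_def)
    then have "\<not> n < card (setof t ''R'')" using fin[of "setof t ''R''"] by simp
    then show "?r \<in> setof (set_var ''a'' (var ?s ''n'') t) ''R'' \<and> setof (set_var ''a'' (var ?s ''n'') t) ''R'' \<subseteq> ?T \<and>
        closed_under ?W (setof (set_var ''a'' (var ?s ''n'') t) ''R'')"
      using I env_n[OF es] by (simp add: setof_def)
  qed
  then have F: "?r \<in> setof (run reach_prog s) ''R''" "setof (run reach_prog s) ''R'' \<subseteq> ?T" "closed_under ?W (setof (run reach_prog s) ''R'')"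
    unfolding run by auto
  have "v \<in> setof (run reach_prog s) ''R''" if "reach G ?W ?r v" for v
    by (rule reach_closed[OF that F(1)]) (use F(3) in \<open>auto simp: closed_under_def\<close>)
  then show ?thesis using F(2) by blast
qed

lemma linked_iff: "linked G X S \<longleftrightarrow> (\<forall>i<k. x i \<in> S \<and> reach G S (x 0) (x i))"
proof
  assume *: "\<forall>i<k. x i \<in> S \<and> reach G S (x 0) (x i)"
  then show "linked G X S" unfolding linked_def
    by (auto intro: reach_trans[of G S _ "x 0"] simp: reach_commute[of G S _ "x 0"])
qed (use k_pos in \<open>auto simp: linked_def\<close>)

lemma linked_test_ok:
  assumes e: "env s"
  shows "var (run (linked_test k) s) ''ok'' \<noteq> 0 \<longleftrightarrow> linked G X (setof s ''S'')"
proof -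
  define s1 where "s1 = set_var ''r'' (x 0) (run (copy_prog ''S'' ''W'') s)"
  define s2 where "s2 = run reach_prog s1"
  have e0: "env (run (copy_prog ''S'' ''W'') s)" using env_run[OF e] by simp
  have e1: "env s1" using e0 by (simp add: s1_def env_set_var)
  have e2: "env s2" using env_run[OF e1] by (simp add: s2_def)
  have W1: "setof s1 ''W'' = setof s ''S''" using setof_copy[OF env_n[OF e], of "''S''" "''W''"] by (simp add: s1_def setof_def)
  have W2: "setof s2 ''W'' = setof s ''S''" using W1 by (simp add: s2_def setof_def run_arr)
  have R2: "setof s2 ''R'' = {v. v < n \<and> reach G (setof s ''S'') (x 0) v}"
    using reach_set[OF e1] W1 x_less[OF k_pos] by (simp add: s2_def) (simp add: s1_def)
  let ?b = "allb (map (\<lambda>i. And (nonzero (Get ''W'' (term_exp i))) (nonzero (Get ''R'' (term_exp i)))) [0..<k])"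
  have r: "run (linked_test k) s = run (PIf ?b (PAssign ''ok'' (Const 1)) (PAssign ''ok'' (Const 0))) s2"
    unfolding linked_test_def s2_def s1_def using term_value[OF e0 k_pos] by simp
  have "bval ?b s2 \<longleftrightarrow> (\<forall>i<k. x i \<in> setof s2 ''W'' \<and> x i \<in> setof s2 ''R'')"
    using term_value[OF e2] x_less by (auto simp: bval_allb setof_def)
  also have "\<dots> \<longleftrightarrow> linked G X (setof s ''S'')" unfolding W2 R2 linked_iff using x_less by auto
  finally show ?thesis unfolding r by simp
qed

text \<open>The old value of \<open>''ok''\<close> enters the result because a test only ever sets
  the flag, so that a sequence of tests forms a disjunction.\<close>

lemma leaky_one_ok:
  assumes e: "env s" and st: "static (snd t)" "\<And>d. d \<in> set (fst t) \<Longrightarrow> static d" and r: "aval (snd t) s < n"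
  shows "var (run (leaky_one k t) s) ''ok'' \<noteq> 0 \<longleftrightarrow> var s ''ok'' \<noteq> 0 \<or>
    (\<exists>y\<in>X - {aval (snd t) s}. reach G (setof s ''S'' - (\<lambda>d. aval d s) ` set (fst t)) (aval (snd t) s) y)"
proof -
  define s1 where "s1 = run (copy_prog ''S'' ''W'') s"
  define s2 where "s2 = run (seqs (map (\<lambda>d. PStore ''W'' d (Const 0)) (fst t))) s1"
  define s3 where "s3 = set_var ''r'' (aval (snd t) s) s2"
  define s4 where "s4 = run reach_prog s3"
  have e1: "env s1" using env_run[OF e] by (simp add: s1_def)
  have W1: "setof s1 ''W'' = setof s ''S''" using setof_copy[OF env_n[OF e]] by (simp add: s1_def)
  have same: "aval d s' = aval d s" if "static d" "\<forall>a. a \<notin> {''W'', ''R''} \<longrightarrow> arr s' a = arr s a" for d s'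
    using static_cong[OF that] .
  have s1a: "arr s1 a = arr s a" if "a \<notin> {''W'', ''R''}" for a using that by (simp add: s1_def run_arr)
  \<comment> \<open>The deleted vertices are evaluated while \<open>''W''\<close> is being changed;
    being static, their expressions still have the values they had in \<open>s\<close>.\<close>
  have del: "setof (run (seqs (map (\<lambda>d. PStore ''W'' d (Const 0)) ds)) s') ''W'' = setof s' ''W'' - (\<lambda>d. aval d s) ` set ds"
    if "\<And>d. d \<in> set ds \<Longrightarrow> static d" "\<forall>a. a \<notin> {''W'', ''R''} \<longrightarrow> arr s' a = arr s a" for ds s'
    using that
  proof (induction ds arbitrary: s')
    case (Cons d ds)
    have "aval d s' = aval d s" by (rule same) (use Cons.prems in auto)
    then have "setof (set_arr ''W'' (aval d s') 0 s') ''W'' = setof s' ''W'' - {aval d s}" by (auto simp: setof_def)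
    moreover have "setof (run (seqs (map (\<lambda>d. PStore ''W'' d (Const 0)) ds)) (set_arr ''W'' (aval d s') 0 s')) ''W'' =
        setof (set_arr ''W'' (aval d s') 0 s') ''W'' - (\<lambda>d. aval d s) ` set ds"
      by (rule Cons.IH) (use Cons.prems in auto)
    ultimately show ?case by auto
  qed simp
  have W2: "setof s2 ''W'' = setof s ''S'' - (\<lambda>d. aval d s) ` set (fst t)"
    unfolding s2_def W1[symmetric] by (rule del) (use st(2) s1a in blast)+
  have w2: "wvars (seqs (map (\<lambda>d. PStore ''W'' d (Const 0)) ds)) = {}" "warrs (seqs (map (\<lambda>d. PStore ''W'' d (Const 0)) ds)) \<subseteq> {''W''}" for ds
    by (auto simp: wvars_seqs warrs_seqs)
  have s2a: "arr s2 a = arr s a" if "a \<notin> {''W'', ''R''}" for a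
    using that w2(2)[of "fst t"] s1a[OF that] run_arr[of a "seqs (map (\<lambda>d. PStore ''W'' d (Const 0)) (fst t))" s1] unfolding s2_def by auto
  have s2v: "var s2 v = var s1 v" for v unfolding s2_def using w2(1) by (simp add: run_var)
  have e2: "env s2" using e1 s2a s1a s2v unfolding env_def by simp
  have e3: "env s3" using e2 by (simp add: s3_def env_set_var)
  have e4: "env s4" using env_run[OF e3] by (simp add: s4_def)
  have r2: "aval (snd t) s2 = aval (snd t) s" by (rule same[OF st(1)]) (use s2a in blast)
  have r4: "var s4 ''r'' = aval (snd t) s" "var s4 ''ok'' = var s ''ok''"
    by (simp_all add: s4_def s3_def run_var s2v s1_def)
  have R4: "setof s4 ''R'' = {v. v < n \<and> reach G (setof s ''S'' - (\<lambda>d. aval d s) ` set (fst t)) (aval (snd t) s) v}"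
    using reach_set[OF e3] r W2 by (simp add: s4_def) (simp add: s3_def setof_def)
  let ?b = "allb (map (\<lambda>i. Not (And (Not (Equal (term_exp i) (Var ''r''))) (nonzero (Get ''R'' (term_exp i))))) [0..<k])"
  have rn: "run (leaky_one k t) s = run (PIf ?b PSkip (PAssign ''ok'' (Const 1))) s4"
    unfolding leaky_one_def s4_def s3_def s2_def s1_def using r2[unfolded s2_def s1_def] by simp
  have "\<not> bval ?b s4 \<longleftrightarrow> (\<exists>i<k. x i \<noteq> aval (snd t) s \<and> x i \<in> setof s4 ''R'')"
    using term_value[OF e4] x_less r4 by (auto simp: bval_allb setof_def)
  also have "\<dots> \<longleftrightarrow> (\<exists>y\<in>X - {aval (snd t) s}. reach G (setof s ''S'' - (\<lambda>d. aval d s) ` set (fst t)) (aval (snd t) s) y)"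
    unfolding R4 using x_less by auto
  finally have b: "bval ?b s4 \<longleftrightarrow> \<not> (\<exists>y\<in>X - {aval (snd t) s}. reach G (setof s ''S'' - (\<lambda>d. aval d s) ` set (fst t)) (aval (snd t) s) y)"
    by blast
  show ?thesis unfolding rn using b r4(2) by simp
qed

lemma leaky_test_ok:
  assumes e: "env s" and st: "\<And>t. t \<in> set ts \<Longrightarrow> static (snd t) \<and> (\<forall>d\<in>set (fst t). static d) \<and> aval (snd t) s < n"
  shows "var (run (leaky_test k ts) s) ''ok'' \<noteq> 0 \<longleftrightarrow>
    leaky G X ((\<lambda>t. ((\<lambda>d. aval d s) ` set (fst t), aval (snd t) s)) ` set ts) (setof s ''S'')"
proof -
  have "var (run (seqs (map (leaky_one k) ts)) s') ''ok'' \<noteq> 0 \<longleftrightarrow> var s' ''ok'' \<noteq> 0 \<or>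
      leaky G X ((\<lambda>t. ((\<lambda>d. aval d s) ` set (fst t), aval (snd t) s)) ` set ts) (setof s ''S'')"
    if "env s'" "\<forall>a. a \<notin> {''W'', ''R''} \<longrightarrow> arr s' a = arr s a" for s'
    using that st
  proof (induction ts arbitrary: s')
    case Nil
    then show ?case by (simp add: leaky_def)
  next
    case (Cons t ts)
    let ?s = "run (leaky_one k t) s'"
    have st: "static (snd t)" "\<And>d. d \<in> set (fst t) \<Longrightarrow> static d" "aval (snd t) s < n" using Cons.prems(3)[of t] by auto
    have same: "aval d s' = aval d s" if "static d" for d
      by (rule static_cong[OF that Cons.prems(2)])
    have e': "env ?s" using env_run[OF Cons.prems(1)] by (simp add: wvars_leaky_one)
    have a': "\<forall>a. a \<notin> {''W'', ''R''} \<longrightarrow> arr ?s a = arr s a" using Cons.prems(2) by (simp add: run_arr wvars_leaky_one)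
    have S: "setof s' ''S'' = setof s ''S''" using Cons.prems(2) by (simp add: setof_def)
    have D: "(\<lambda>d. aval d s') ` set (fst t) = (\<lambda>d. aval d s) ` set (fst t)" using same st(2) by auto
    have 1: "var ?s ''ok'' \<noteq> 0 \<longleftrightarrow> var s' ''ok'' \<noteq> 0 \<or>
      (\<exists>y\<in>X - {aval (snd t) s}. reach G (setof s ''S'' - (\<lambda>d. aval d s) ` set (fst t)) (aval (snd t) s) y)"
      using leaky_one_ok[OF Cons.prems(1) st(1,2)] same[OF st(1)] st(3) unfolding S D by simp
    have 2: "var (run (seqs (map (leaky_one k) ts)) ?s) ''ok'' \<noteq> 0 \<longleftrightarrow> var ?s ''ok'' \<noteq> 0 \<or>
      leaky G X ((\<lambda>t. ((\<lambda>d. aval d s) ` set (fst t), aval (snd t) s)) ` set ts) (setof s ''S'')"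
      by (rule Cons.IH[OF e' a']) (use Cons.prems(3) in auto)
    show ?case using 1 2 by (auto simp: leaky_def)
  qed
  from this[of "set_var ''ok'' 0 s"] show ?thesis using e by (simp add: leaky_test_def env_set_var)
qed

text \<open>One pass suffices: a vertex that could not be deleted cannot be deleted later either,
  because the set has only become smaller and the property is monotone.\<close>

lemma greedy_set:
  assumes e: "env s"
    and w: "wvars test \<subseteq> {''u'', ''a'', ''b'', ''c'', ''r'', ''ok''}" "warrs test \<subseteq> {''W'', ''R''}"
    and keep: "keep \<notin> {''S'', ''W'', ''R''}"
    and test: "\<And>t. env t \<Longrightarrow> (\<forall>a. a \<notin> {''S'', ''W'', ''R''} \<longrightarrow> arr t a = arr s a) \<Longrightarrow>
      var (run test t) ''ok'' \<noteq> 0 \<longleftrightarrow> \<Phi> (setof t ''S'')"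
    and mono: "\<And>A B. \<Phi> A \<Longrightarrow> A \<subseteq> B \<Longrightarrow> \<Phi> B" and init: "\<Phi> (setof s ''S'')"
  defines "S \<equiv> setof s ''S''" and "K \<equiv> setof s keep" and "S' \<equiv> setof (run (greedy_prog test keep) s) ''S''"
  shows "S' \<subseteq> S \<and> S \<inter> K \<subseteq> S' \<and> \<Phi> S' \<and> (\<forall>u\<in>S' - K. \<not> \<Phi> (S' - {u}))"
  unfolding S'_def greedy_prog_def
proof (rule run_For[where I = "\<lambda>j t. setof t ''S'' \<subseteq> S \<and> S \<inter> K \<subseteq> setof t ''S'' \<and> \<Phi> (setof t ''S'') \<and>
    (\<forall>u\<in>setof t ''S'' - K. u < j \<longrightarrow> \<not> \<Phi> (setof t ''S'' - {u}))"])
  show "setof s ''S'' \<subseteq> S \<and> S \<inter> K \<subseteq> setof s ''S'' \<and> \<Phi> (setof s ''S'') \<and>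
    (\<forall>u\<in>setof s ''S'' - K. u < 0 \<longrightarrow> \<not> \<Phi> (setof s ''S'' - {u}))"
    using init by (auto simp: S_def)
next
  let ?q = "seqs [PStore ''S'' (Var ''g'') (Const 0), test, PIf (Equal (Var ''ok'') (Const 0)) (PStore ''S'' (Var ''g'') (Const 1)) PSkip]"
  let ?c = "And (nonzero (Get ''S'' (Var ''g''))) (Equal (Get keep (Var ''g'')) (Const 0))"
  let ?p = "PIf ?c ?q PSkip"
  fix j t assume j: "j < var s ''n''" and a: "agree (wvars (PFor ''g'' ?p)) (warrs ?p) s t"
    and I: "setof t ''S'' \<subseteq> S \<and> S \<inter> K \<subseteq> setof t ''S'' \<and> \<Phi> (setof t ''S'') \<and>
    (\<forall>u\<in>setof t ''S'' - K. u < j \<longrightarrow> \<not> \<Phi> (setof t ''S'' - {u}))"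
  let ?t = "set_var ''g'' j t"
  have wp: "wvars (PFor ''g'' ?p) \<subseteq> {''g'', ''u'', ''a'', ''b'', ''c'', ''r'', ''ok''}" "warrs ?p \<subseteq> {''S'', ''W'', ''R''}"
    using w by auto
  have ta: "arr t b = arr s b" if "b \<notin> {''S'', ''W'', ''R''}" for b using agree_arr[OF a] wp(2) that by blast
  have et: "env ?t"
  proof -
    have "env t" by (rule env_agree[OF e a]) (use wp in auto)
    then show ?thesis by (simp add: env_set_var)
  qed
  have jn: "j < n" using j env_n[OF e] by simp
  have Kt: "arr t keep = arr s keep" using ta keep by blast
  have c: "bval ?c ?t \<longleftrightarrow> j \<in> setof t ''S'' - K" using jn Kt by (auto simp: setof_def K_def)
  let ?T = "setof t ''S''"
  define t1 where "t1 = set_arr ''S'' j 0 ?t"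
  have T1: "setof t1 ''S'' = ?T - {j}" by (auto simp: t1_def setof_def)
  have e1: "env t1" using et by (simp add: t1_def env_def)
  have ok: "var (run test t1) ''ok'' \<noteq> 0 \<longleftrightarrow> \<Phi> (?T - {j})"
    using test[OF e1] ta T1 by (simp add: t1_def)
  have g1: "var (run test t1) ''g'' = j" using run_var[of "''g''" test t1] w(1) by (auto simp: t1_def)
  have S1: "arr (run test t1) ''S'' = arr t1 ''S''" using run_arr[of "''S''" test t1] w(2) by auto
  have new: "setof (run ?p ?t) ''S'' = (if j \<in> ?T - K \<and> \<Phi> (?T - {j}) then ?T - {j} else ?T)"
  proof (cases "j \<in> ?T - K")
    case False
    then have "bval ?c ?t = False" using c by blast
    then have "run ?p ?t = ?t" by (simp only: run.simps if_False)
    then have "setof (run ?p ?t) ''S'' = ?T" by (simp only: setof_def arr_set_var)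
    then show ?thesis using False by presburger
  next
    case True
    then have "bval ?c ?t = True" using c by blast
    then have "run ?p ?t = run ?q ?t" by (simp only: run.simps if_True)
    then have rn: "run ?p ?t = run (PIf (Equal (Var ''ok'') (Const 0)) (PStore ''S'' (Var ''g'') (Const 1)) PSkip) (run test t1)"
      by (simp add: t1_def)
    show ?thesis
    proof (cases "\<Phi> (?T - {j})")
      case True
      then have "setof (run ?p ?t) ''S'' = setof t1 ''S''" unfolding rn using ok S1 by (simp add: setof_def)
      then show ?thesis using T1 True \<open>j \<in> ?T - K\<close> by simp
    next
      case False
      then have "setof (run ?p ?t) ''S'' = insert j (setof t1 ''S'')" unfolding rn using ok S1 g1 jn by (auto simp: setof_def)
      then show ?thesis using T1 False \<open>j \<in> ?T - K\<close> by auto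
    qed
  qed
  show "setof (run ?p ?t) ''S'' \<subseteq> S \<and> S \<inter> K \<subseteq> setof (run ?p ?t) ''S'' \<and> \<Phi> (setof (run ?p ?t) ''S'') \<and>
    (\<forall>u\<in>setof (run ?p ?t) ''S'' - K. u < Suc j \<longrightarrow> \<not> \<Phi> (setof (run ?p ?t) ''S'' - {u}))"
  proof (cases "j \<in> ?T - K \<and> \<Phi> (?T - {j})")
    case True
    have "\<not> \<Phi> (?T - {j} - {u})" if "u \<in> ?T - {j} - K" "u < Suc j" for u
    proof
      assume "\<Phi> (?T - {j} - {u})"
      then have "\<Phi> (?T - {u})" by (rule mono) auto
      moreover have "u < j" using that by auto
      ultimately show False using I that by auto
    qed
    then show ?thesis unfolding new using True I by auto
  next
    case False
    then have "\<not> \<Phi> (?T - {u})" if "u \<in> ?T - K" "u < Suc j" for u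
      using I that by (cases "u = j") auto
    then show ?thesis unfolding new using False I by auto
  qed
next
  fix t assume I: "setof t ''S'' \<subseteq> S \<and> S \<inter> K \<subseteq> setof t ''S'' \<and> \<Phi> (setof t ''S'') \<and>
    (\<forall>u\<in>setof t ''S'' - K. u < var s ''n'' \<longrightarrow> \<not> \<Phi> (setof t ''S'' - {u}))"
  have "setof (set_var ''g'' (var s ''n'') t) ''S'' = setof t ''S''" by (simp add: setof_def)
  moreover have "u < var s ''n''" if "u \<in> setof t ''S''" for u using that env_n[OF e] by (simp add: setof_def)
  ultimately show "setof (set_var ''g'' (var s ''n'') t) ''S'' \<subseteq> S \<and> S \<inter> K \<subseteq> setof (set_var ''g'' (var s ''n'') t) ''S'' \<and>
    \<Phi> (setof (set_var ''g'' (var s ''n'') t) ''S'') \<and>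
    (\<forall>u\<in>setof (set_var ''g'' (var s ''n'') t) ''S'' - K. \<not> \<Phi> (setof (set_var ''g'' (var s ''n'') t) ''S'' - {u}))"
    using I by auto
qed

end

section \<open>Recovering a structure from its vertex set\<close>

definition walk_inner :: prog where
  "walk_inner = PFor ''b'' (PIf (And (nonzero (Get ''S'' (Var ''b'')))
       (And (Equal (Get ''V'' (Var ''b'')) (Const 0)) (nonzero (edge_exp (Var ''c1'') (Var ''b'')))))
     (PSeq (PAssign ''q'' (Plus (Var ''q'') (Const 1))) (PAssign ''y'' (Var ''b''))) PSkip)"

definition walk_round :: "nat \<Rightarrow> prog" where
  "walk_round i = seqs [PAssign ''q'' (Const 0), walk_inner,
     PIf (Equal (Var ''q'') (Const 1))
       (seqs [PAssign ''c1'' (Var ''y''), PStore ''V'' (Var ''c1'') (Const 1), PStore ''Z'' (Var ''c1'') (Const 0),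
          PStore ''path'' (Plus (Get ''row'' (Const i)) (Var ''l'')) (Var ''c1''), PAssign ''l'' (Plus (Var ''l'') (Const 1))])
       PSkip]"

text \<open>On a structure there is one way to go on until the end of the path, where two new
  neighbours appear and the walk stops. Thus the path is recovered from its terminal and the vertex
  set. Clearing \<open>''Z''\<close> on the way leaves there the vertices on no path, for a
  \<open>K4\<close> structure the branch vertices.\<close>

definition walk_prog :: "aexp \<Rightarrow> nat \<Rightarrow> prog" where
  "walk_prog src i = seqs [fill_prog ''V'' 0, PAssign ''c1'' src,
     PStore ''V'' (Var ''c1'') (Const 1), PStore ''Z'' (Var ''c1'') (Const 0),
     PStore ''path'' (Get ''row'' (Const i)) (Var ''c1''), PAssign ''l'' (Const 1),
     PFor ''a'' (walk_round i), PStore ''len'' (Const i) (Var ''l'')]"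

definition emit_prog :: "nat \<Rightarrow> nat list \<Rightarrow> prog" where
  "emit_prog m \<pi> = seqs (map (\<lambda>i. walk_prog (term_exp (\<pi> ! i)) i) [0..<m])"

text \<open>A search unrolled over a fixed list of candidates. The flag \<open>''f''\<close> stops
  it at the first success and reports the outcome.\<close>

definition pick_prog :: "nat \<Rightarrow> (nat list \<Rightarrow> bexp) \<Rightarrow> nat list list \<Rightarrow> prog" where
  "pick_prog m check ps = PSeq (PAssign ''f'' (Const 0)) (seqs (map (\<lambda>\<pi>.
     PIf (And (Equal (Var ''f'') (Const 0)) (check \<pi>)) (PSeq (PAssign ''f'' (Const 1)) (emit_prog m \<pi>)) PSkip) ps))"

definition branch_prog :: prog where
  "branch_prog = PSeq (PAssign ''h'' (Const 0)) (PFor ''u'' (PIf (nonzero (Get ''Z'' (Var ''u'')))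
     (PSeq (PStore ''branch'' (Var ''h'') (Var ''u'')) (PAssign ''h'' (Plus (Var ''h'') (Const 1)))) PSkip))"

definition end_exp :: "nat \<Rightarrow> aexp" where
  "end_exp i = Get ''path'' (Minus (Plus (Get ''row'' (Const i)) (Get ''len'' (Const i))) (Const 1))"

lemma wvars_walk_inner [simp]: "wvars walk_inner = {''b'', ''q'', ''y''}" "warrs walk_inner = {}"
  by (auto simp: walk_inner_def)

lemma wvars_walk_round [simp]: "wvars (walk_round i) = {''b'', ''q'', ''y'', ''c1'', ''l''}" "warrs (walk_round i) = {''V'', ''Z'', ''path''}"
  by (auto simp: walk_round_def)

lemma wvars_walk_prog [simp]: "wvars (walk_prog src i) = {''u'', ''a'', ''b'', ''q'', ''y'', ''c1'', ''l''}"
  "warrs (walk_prog src i) = {''V'', ''Z'', ''path'', ''len''}"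
  by (auto simp: walk_prog_def)

lemma wvars_emit: "wvars (emit_prog m \<pi>) \<subseteq> {''u'', ''a'', ''b'', ''q'', ''y'', ''c1'', ''l''}"
  "warrs (emit_prog m \<pi>) \<subseteq> {''V'', ''Z'', ''path'', ''len''}"
  by (auto simp: emit_prog_def wvars_seqs warrs_seqs)

lemma wvars_pick: "wvars (pick_prog m check ps) \<subseteq> {''f'', ''u'', ''a'', ''b'', ''q'', ''y'', ''c1'', ''l''}"
  "warrs (pick_prog m check ps) \<subseteq> {''V'', ''Z'', ''path'', ''len''}"
proof -
  show "wvars (pick_prog m check ps) \<subseteq> {''f'', ''u'', ''a'', ''b'', ''q'', ''y'', ''c1'', ''l''}"
    unfolding pick_prog_def using wvars_emit(1)[of m] by (simp add: wvars_seqs UN_subset_iff subset_insertI2)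
  show "warrs (pick_prog m check ps) \<subseteq> {''V'', ''Z'', ''path'', ''len''}"
    unfolding pick_prog_def using wvars_emit(2)[of m] by (simp add: warrs_seqs UN_subset_iff)
qed

lemma wvars_branch [simp]: "wvars branch_prog = {''u'', ''h''}" "warrs branch_prog = {''branch''}"
  by (auto simp: branch_prog_def)

context instance_graph
begin

definition walk_step :: "nat set \<Rightarrow> nat list \<Rightarrow> nat list" where
  "walk_step S xs = (let N = {v \<in> S. v \<notin> set xs \<and> adj G (last xs) v} in if card N = 1 then xs @ [the_elem N] else xs)"

text \<open>A walk that has stopped is a fixed point of \<open>walk_step\<close>, and a path has at
  most \<open>n\<close> vertices, so \<open>n\<close> steps complete it.\<close>

definition walk :: "nat set \<Rightarrow> nat \<Rightarrow> nat list" where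
  "walk S v = (walk_step S ^^ n) [v]"

text \<open>\<open>''y''\<close> keeps the last candidate seen; it is the candidate sought precisely
  when the count is 1.\<close>

lemma walk_inner_count:
  assumes e: "env s" and c: "var s ''c1'' < n" and q: "var s ''q'' = 0"
  defines "N \<equiv> {v \<in> setof s ''S''. arr s ''V'' v = 0 \<and> adj G (var s ''c1'') v}"
  shows "var (run walk_inner s) ''q'' = card N \<and> (card N = 1 \<longrightarrow> the_elem N = var (run walk_inner s) ''y'')"
proof -
  let ?c = "And (nonzero (Get ''S'' (Var ''b''))) (And (Equal (Get ''V'' (Var ''b'')) (Const 0)) (nonzero (edge_exp (Var ''c1'') (Var ''b''))))"
  let ?q = "PSeq (PAssign ''q'' (Plus (Var ''q'') (Const 1))) (PAssign ''y'' (Var ''b''))"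
  let ?p = "PIf ?c ?q PSkip"
  let ?N = "\<lambda>j. {v \<in> N. v < j}"
  have "var (run walk_inner s) ''q'' = card N \<and> (N \<noteq> {} \<longrightarrow> var (run walk_inner s) ''y'' \<in> N)"
    unfolding walk_inner_def
  proof (rule run_For[where I = "\<lambda>j t. var t ''q'' = card (?N j) \<and> (?N j \<noteq> {} \<longrightarrow> var t ''y'' \<in> N)"])
    fix j t assume j: "j < var s ''n''" and a: "agree (wvars (PFor ''b'' ?p)) (warrs ?p) s t"
      and I: "var t ''q'' = card (?N j) \<and> (?N j \<noteq> {} \<longrightarrow> var t ''y'' \<in> N)"
    let ?t = "set_var ''b'' j t"
    have jn: "j < n" using j env_n[OF e] by simp
    have et: "env ?t" using env_agree[OF e a] by (simp add: env_set_var)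
    have tc: "var t ''c1'' = var s ''c1''" "arr t ''S'' = arr s ''S''" "arr t ''V'' = arr s ''V''"
      using agree_var[OF a] agree_arr[OF a] by auto
    have "aval (edge_exp (Var ''c1'') (Var ''b'')) ?t \<noteq> 0 \<longleftrightarrow> adj G (var s ''c1'') j"
      using edge_value[OF et, of "Var ''c1''" "Var ''b''"] c tc jn by simp
    then have b: "bval ?c ?t \<longleftrightarrow> j \<in> N" using tc jn by (simp add: N_def setof_def)
    have fin: "finite (?N j)" by simp
    show "var (run ?p ?t) ''q'' = card (?N (Suc j)) \<and> (?N (Suc j) \<noteq> {} \<longrightarrow> var (run ?p ?t) ''y'' \<in> N)"
    proof (cases "j \<in> N")
      case True
      then have "?N (Suc j) = insert j (?N j)" by (auto simp: less_Suc_eq)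
      then have "card (?N (Suc j)) = Suc (card (?N j))" using fin by simp
      moreover have "bval ?c ?t = True" using b True by blast
      then have "run ?p ?t = run ?q ?t" by (simp only: run.simps if_True)
      ultimately show ?thesis using True I by simp
    next
      case False
      then have "?N (Suc j) = ?N j" by (auto simp: less_Suc_eq)
      moreover have "bval ?c ?t = False" using b False by blast
      then have "run ?p ?t = ?t" by (simp only: run.simps if_False)
      ultimately show ?thesis using I by (simp only: var_set_var) simp
    qed
  next
    fix t :: store assume "var t ''q'' = card (?N (var s ''n'')) \<and> (?N (var s ''n'') \<noteq> {} \<longrightarrow> var t ''y'' \<in> N)"
    moreover have "?N (var s ''n'') = N" using env_n[OF e] by (auto simp: N_def setof_def)
    ultimately show "var (set_var ''b'' (var s ''n'') t) ''q'' = card N \<and> (N \<noteq> {} \<longrightarrow> var (set_var ''b'' (var s ''n'') t) ''y'' \<in> N)"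
      by simp
  qed (use q in simp)
  moreover have "the_elem N = y" if "card N = 1" "y \<in> N" for y
    using that by (metis card_1_singletonE singletonD the_elem_eq)
  ultimately show ?thesis by fastforce
qed

text \<open>The loop invariant of \<open>walk_prog\<close>; its last clause protects the blocks of
  \<open>''path''\<close> that belong to other indices.\<close>

definition walk_state :: "store \<Rightarrow> nat \<Rightarrow> nat list \<Rightarrow> store \<Rightarrow> bool" where
  "walk_state s i xs t \<longleftrightarrow> xs \<noteq> [] \<and> distinct xs \<and> set xs \<subseteq> {..<n} \<and> var t ''c1'' = last xs \<and> var t ''l'' = length xs \<and>
     (\<forall>v<n. arr t ''V'' v \<noteq> 0 \<longleftrightarrow> v \<in> set xs) \<and> (\<forall>v<n. arr t ''Z'' v \<noteq> 0 \<longleftrightarrow> arr s ''Z'' v \<noteq> 0 \<and> v \<notin> set xs) \<and>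
     (\<forall>m<length xs. arr t ''path'' (i * n + m) = xs ! m) \<and>
     (\<forall>m. m < i * n \<or> i * n + n \<le> m \<longrightarrow> arr t ''path'' m = arr s ''path'' m)"

lemma distinct_length: "distinct xs \<Longrightarrow> set xs \<subseteq> {..<n} \<Longrightarrow> length xs \<le> n"
  by (metis card_lessThan card_mono distinct_card finite_lessThan)

lemma walk_round_state:
  assumes e: "env t" and i: "i < n" and w: "walk_state s i xs t"
  shows "walk_state s i (walk_step (setof t ''S'') xs) (run (walk_round i) t)"
proof -
  define t1 where "t1 = run walk_inner (set_var ''q'' 0 t)"
  have e1: "env (set_var ''q'' 0 t)" using e by (simp add: env_set_var)
  have c1: "last xs < n" "var t ''c1'' = last xs" using w unfolding walk_state_def by (auto simp: subset_iff)
  let ?N = "{v \<in> setof t ''S''. v \<notin> set xs \<and> adj G (last xs) v}"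
  have "{v \<in> setof (set_var ''q'' 0 t) ''S''. arr (set_var ''q'' 0 t) ''V'' v = 0 \<and> adj G (var (set_var ''q'' 0 t) ''c1'') v} = ?N"
    using w unfolding walk_state_def by (auto simp: setof_def)
  then have q: "var t1 ''q'' = card ?N" "card ?N = 1 \<Longrightarrow> the_elem ?N = var t1 ''y''"
    using walk_inner_count[OF e1] c1 unfolding t1_def by auto
  have same: "var t1 ''c1'' = var t ''c1''" "var t1 ''l'' = var t ''l''" "arr t1 = arr t"
    unfolding t1_def by (simp_all add: run_var run_arr fun_eq_iff)
  have w1: "walk_state s i xs t1" using w unfolding walk_state_def same .
  let ?b = "seqs [PAssign ''c1'' (Var ''y''), PStore ''V'' (Var ''c1'') (Const 1), PStore ''Z'' (Var ''c1'') (Const 0),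
          PStore ''path'' (Plus (Get ''row'' (Const i)) (Var ''l'')) (Var ''c1''), PAssign ''l'' (Plus (Var ''l'') (Const 1))]"
  have rn: "run (walk_round i) t = (if card ?N = 1 then run ?b t1 else t1)"
    unfolding walk_round_def using q(1) by (simp add: t1_def)
  show ?thesis
  proof (cases "card ?N = 1")
    case False
    then have "walk_step (setof t ''S'') xs = xs" by (simp add: walk_step_def Let_def)
    then show ?thesis using w1 False unfolding rn by simp
  next
    case True
    let ?y = "var t1 ''y''"
    have ws: "walk_step (setof t ''S'') xs = xs @ [?y]" using True q(2) by (simp add: walk_step_def Let_def)
    have "?y \<in> ?N" using True q(2) by (metis (no_types, lifting) card_1_singletonE singletonI the_elem_eq)
    then have y: "?y < n" "?y \<notin> set xs" by (auto simp: setof_def)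
    have row: "arr t1 ''row'' i = i * n" using e i same by (simp add: env_def)
    have lx: "length xs < n"
    proof -
      have "distinct (xs @ [?y])" "set (xs @ [?y]) \<subseteq> {..<n}" using w y unfolding walk_state_def by auto
      then have "length (xs @ [?y]) \<le> n" by (rule distinct_length)
      then show ?thesis by simp
    qed
    let ?r = "run ?b t1"
    have r: "var ?r ''c1'' = ?y" "var ?r ''l'' = Suc (length xs)" "arr ?r ''V'' = (arr t1 ''V'')(?y := 1)"
      "arr ?r ''Z'' = (arr t1 ''Z'')(?y := 0)" "arr ?r ''path'' = (arr t1 ''path'')(i * n + length xs := ?y)"
      using w1 row unfolding walk_state_def by simp_all
    have "walk_state s i (xs @ [?y]) ?r"
      using w1 y lx unfolding walk_state_def r by (auto simp: nth_append less_Suc_eq)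
    then show ?thesis using True unfolding rn ws by simp
  qed
qed

lemma walk_prog_spec:
  assumes e: "env s" and i: "i < n" and v: "aval src (run (fill_prog ''V'' 0) s) = v" "v < n"
  defines "t \<equiv> run (walk_prog src i) s" and "xs \<equiv> walk (setof s ''S'') v"
  shows "out_path n t i = xs" "distinct xs" "xs \<noteq> []" "set xs \<subseteq> {..<n}" "arr t ''len'' = (arr s ''len'')(i := length xs)"
    "setof t ''Z'' = setof s ''Z'' - set xs" "\<And>m. m < i * n \<or> i * n + n \<le> m \<Longrightarrow> arr t ''path'' m = arr s ''path'' m"
proof -
  define s1 where "s1 = run (fill_prog ''V'' 0) s"
  define s2 where "s2 = set_var ''l'' 1 (set_arr ''path'' (i * n) v (set_arr ''Z'' v 0 (set_arr ''V'' v 1 (set_var ''c1'' v s1))))"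
  define s3 where "s3 = run (PFor ''a'' (walk_round i)) s2"
  have e1: "env s1" using env_run[OF e] by (simp add: s1_def)
  have e2: "env s2" using e1 by (simp add: s2_def env_def)
  have row: "arr s1 ''row'' i = i * n" using e1 i by (simp add: env_def)
  have t: "t = set_arr ''len'' i (var s3 ''l'') s3"
    unfolding t_def walk_prog_def s3_def s2_def using v(1) row by (simp add: s1_def)
  have V0: "arr s1 ''V'' u = 0" if "u < n" for u using fill_value[OF env_n[OF e] that] by (simp add: s1_def)
  have s1a: "arr s1 a = arr s a" if "a \<noteq> ''V''" for a using that by (simp add: s1_def run_arr)
  have w2: "walk_state s i [v] s2"
    unfolding walk_state_def using v(2) V0 s1a by (auto simp: s2_def)
  have S2: "setof s2 ''S'' = setof s ''S''" using s1a by (simp add: s2_def setof_def)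
  have w3: "walk_state s i ((walk_step (setof s ''S'') ^^ n) [v]) s3"
    unfolding s3_def
  proof (rule run_For[where I = "\<lambda>j. walk_state s i ((walk_step (setof s ''S'') ^^ j) [v])"])
    show "walk_state s i ((walk_step (setof s ''S'') ^^ 0) [v]) s2" using w2 by simp
    fix j t assume a: "agree (wvars (PFor ''a'' (walk_round i))) (warrs (walk_round i)) s2 t"
      and I: "walk_state s i ((walk_step (setof s ''S'') ^^ j) [v]) t"
    have "env (set_var ''a'' j t)" using env_agree[OF e2 a] by (simp add: env_set_var)
    moreover have "setof (set_var ''a'' j t) ''S'' = setof s ''S''" using agree_arr[OF a] S2 by (simp add: setof_def)
    moreover have "walk_state s i ((walk_step (setof s ''S'') ^^ j) [v]) (set_var ''a'' j t)"
      using I by (simp add: walk_state_def)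
    ultimately show "walk_state s i ((walk_step (setof s ''S'') ^^ Suc j) [v]) (run (walk_round i) (set_var ''a'' j t))"
      using walk_round_state[OF _ i] by fastforce
  next
    fix t assume "walk_state s i ((walk_step (setof s ''S'') ^^ var s2 ''n'') [v]) t"
    then show "walk_state s i ((walk_step (setof s ''S'') ^^ n) [v]) (set_var ''a'' (var s2 ''n'') t)"
      using env_n[OF e2] by (simp add: walk_state_def)
  qed
  then have w: "walk_state s i xs s3" by (simp add: xs_def walk_def)
  have "arr s3 ''len'' = arr s2 ''len''" unfolding s3_def by (rule run_arr) simp
  then have l3: "arr s3 ''len'' = arr s ''len''" using s1a by (simp add: s2_def)
  have wD: "var s3 ''l'' = length xs" "\<forall>m<length xs. arr s3 ''path'' (i * n + m) = xs ! m" using w unfolding walk_state_def by blast+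
  show "out_path n t i = xs"
    unfolding out_path_def t using wD by (intro nth_equalityI) auto
  show "distinct xs" "xs \<noteq> []" "set xs \<subseteq> {..<n}" using w unfolding walk_state_def by blast+
  show "arr t ''len'' = (arr s ''len'')(i := length xs)" using wD(1) l3 by (simp add: t)
  show "setof t ''Z'' = setof s ''Z'' - set xs" using w unfolding walk_state_def by (auto simp: t setof_def)
  show "arr t ''path'' m = arr s ''path'' m" if "m < i * n \<or> i * n + n \<le> m" for m
  proof -
    have "\<forall>m. m < i * n \<or> i * n + n \<le> m \<longrightarrow> arr s3 ''path'' m = arr s ''path'' m"
      using w unfolding walk_state_def by blast
    then have "arr s3 ''path'' m = arr s ''path'' m" using that by blast
    then show ?thesis by (simp add: t)
  qed
qed

lemma walk_props:
  assumes "v < n"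
  shows "distinct (walk S v) \<and> walk S v \<noteq> [] \<and> hd (walk S v) = v \<and> set (walk S v) \<subseteq> insert v S"
proof -
  have "distinct ((walk_step S ^^ m) [v]) \<and> (walk_step S ^^ m) [v] \<noteq> [] \<and> hd ((walk_step S ^^ m) [v]) = v \<and> set ((walk_step S ^^ m) [v]) \<subseteq> insert v S" for m
  proof (induction m)
    case (Suc m)
    let ?xs = "(walk_step S ^^ m) [v]"
    let ?N = "{u \<in> S. u \<notin> set ?xs \<and> adj G (last ?xs) u}"
    have m: "the_elem ?N \<in> ?N" if "card ?N = 1" using that by (metis (no_types, lifting) card_1_singletonE singletonI the_elem_eq)
    show ?case
    proof (cases "card ?N = 1")
      case True
      then have "(walk_step S ^^ Suc m) [v] = ?xs @ [the_elem ?N]" by (simp add: walk_step_def[of S ?xs] Let_def)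
      moreover have "the_elem ?N \<in> S" "the_elem ?N \<notin> set ?xs" using m[OF True] by auto
      ultimately show ?thesis using Suc by simp
    next
      case False
      then have "(walk_step S ^^ Suc m) [v] = ?xs" by (simp add: walk_step_def[of S ?xs] Let_def)
      then show ?thesis using Suc by simp
    qed
  qed simp
  then show ?thesis unfolding walk_def by blast
qed

lemma walk_path:
  assumes P: "P \<noteq> []" "distinct P" "set P \<subseteq> S" "length P \<le> n" "hd P = v"
    and nxt: "\<And>j. Suc j < length P \<Longrightarrow> {u \<in> S. u \<notin> set (take (Suc j) P) \<and> adj G (P ! j) u} = {P ! Suc j}"
    and stop: "card {u \<in> S. u \<notin> set P \<and> adj G (last P) u} \<noteq> 1"
  shows "walk S v = P"
proof -
  have "(walk_step S ^^ m) [v] = take (Suc m) P" for m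
  proof (induction m)
    case 0
    then show ?case using P by (cases P) auto
  next
    case (Suc m)
    show ?case
    proof (cases "Suc m < length P")
      case True
      have "last (take (Suc m) P) = P ! m" using True by (simp add: take_Suc_conv_app_nth)
      then have "walk_step S (take (Suc m) P) = take (Suc m) P @ [P ! Suc m]"
        unfolding walk_step_def Let_def using nxt[OF True] by simp
      then show ?thesis using Suc True by (simp add: take_Suc_conv_app_nth)
    next
      case False
      then have "take (Suc m) P = P" by simp
      then have "walk_step S (take (Suc m) P) = P" unfolding walk_step_def Let_def using stop by simp
      then show ?thesis using Suc False by simp
    qed
  qed
  then show ?thesis unfolding walk_def using P(4) by simp
qed

text \<open>Each index owns a block of \<open>n\<close> cells, and a path of at most
  \<open>n\<close> vertices does not reach into the next block.\<close>

lemma out_path_same: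
  assumes "arr t ''len'' j = arr s ''len'' j" "arr s ''len'' j \<le> n" "i \<noteq> j"
    and "\<And>m. m < i * n \<or> i * n + n \<le> m \<Longrightarrow> arr t ''path'' m = arr s ''path'' m"
  shows "out_path n t j = out_path n s j"
proof -
  have "j * n + m < i * n \<or> i * n + n \<le> j * n + m" if "m < n" for m
  proof (cases "j < i")
    case True
    then have "(j + 1) * n \<le> i * n" by (intro mult_le_mono1) simp
    then show ?thesis using that by simp
  next
    case False
    then have "(i + 1) * n \<le> j * n" using assms(3) by (intro mult_le_mono1) simp
    then show ?thesis by simp
  qed
  then show ?thesis unfolding out_path_def using assms by auto
qed

lemma emit_spec:
  assumes e: "env s" and m: "m \<le> n" and \<pi>: "\<And>i. i < m \<Longrightarrow> \<pi> ! i < k"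
  defines "t \<equiv> run (emit_prog m \<pi>) s"
  shows "(\<forall>i<m. out_path n t i = walk (setof s ''S'') (x (\<pi> ! i))) \<and> (\<forall>i<m. arr t ''len'' i \<le> n \<and> 0 < arr t ''len'' i) \<and>
    setof t ''Z'' = setof s ''Z'' - (\<Union>i<m. set (walk (setof s ''S'') (x (\<pi> ! i))))"
  using m \<pi> unfolding t_def
proof (induction m)
  case 0
  then show ?case by (simp add: emit_prog_def)
next
  case (Suc m)
  let ?t = "run (emit_prog m \<pi>) s" and ?S = "setof s ''S''"
  let ?r = "run (walk_prog (term_exp (\<pi> ! m)) m) ?t"
  have IH: "\<forall>i<m. out_path n ?t i = walk ?S (x (\<pi> ! i))" "\<forall>i<m. arr ?t ''len'' i \<le> n \<and> 0 < arr ?t ''len'' i"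
    "setof ?t ''Z'' = setof s ''Z'' - (\<Union>i<m. set (walk ?S (x (\<pi> ! i))))" using Suc by auto
  have run: "run (emit_prog (Suc m) \<pi>) s = ?r" by (simp add: emit_prog_def run_seqs)
  have et: "env ?t" by (rule env_run[OF e]) (use wvars_emit[of m \<pi>] in auto)
  have S: "setof ?t ''S'' = ?S" by (rule setof_cong, rule run_arr) (use wvars_emit(2)[of m \<pi>] in auto)
  have mk: "\<pi> ! m < k" using Suc.prems by simp
  have v: "aval (term_exp (\<pi> ! m)) (run (fill_prog ''V'' 0) ?t) = x (\<pi> ! m)"
    using term_value[OF env_run[OF et, of "fill_prog ''V'' 0"] mk] by simp
  have mn: "m < n" using Suc.prems by simp
  note w = walk_prog_spec[OF et mn v x_less[OF mk], unfolded S]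
  have old: "out_path n ?r i = out_path n ?t i" if "i < m" for i
    by (rule out_path_same[where i = m]) (use w(5,7) IH(2) that in auto)
  have "length (walk ?S (x (\<pi> ! m))) \<le> n" using w(2,4) distinct_length by blast
  then have len: "\<forall>i<Suc m. arr ?r ''len'' i \<le> n \<and> 0 < arr ?r ''len'' i" using w(3,5) IH(2) by (auto simp: less_Suc_eq)
  show ?case unfolding run using old w(1,6) IH len by (auto simp: less_Suc_eq lessThan_Suc)
qed

lemma pick_spec:
  assumes free: "\<And>\<pi> v. \<pi> \<in> set ps \<Longrightarrow> bval (check \<pi>) (set_var ''f'' v s) \<longleftrightarrow> bval (check \<pi>) s"
  shows "(\<exists>\<pi>\<in>set ps. bval (check \<pi>) s \<and> run (pick_prog m check ps) s = run (emit_prog m \<pi>) (set_var ''f'' 1 s)) \<or>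
    (\<forall>\<pi>\<in>set ps. \<not> bval (check \<pi>) s) \<and> run (pick_prog m check ps) s = set_var ''f'' 0 s"
proof -
  let ?f = "\<lambda>\<pi>. PIf (And (Equal (Var ''f'') (Const 0)) (check \<pi>)) (PSeq (PAssign ''f'' (Const 1)) (emit_prog m \<pi>)) PSkip"
  have skip: "run (seqs (map ?f qs)) t = t" if "var t ''f'' \<noteq> 0" for qs t
    using that by (induction qs) auto
  have "(\<exists>\<pi>\<in>set qs. bval (check \<pi>) s \<and> run (seqs (map ?f qs)) (set_var ''f'' 0 s) = run (emit_prog m \<pi>) (set_var ''f'' 1 s)) \<or>
    (\<forall>\<pi>\<in>set qs. \<not> bval (check \<pi>) s) \<and> run (seqs (map ?f qs)) (set_var ''f'' 0 s) = set_var ''f'' 0 s"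
    if "set qs \<subseteq> set ps" for qs
    using that
  proof (induction qs)
    case (Cons \<pi> qs)
    have b: "bval (check \<pi>) (set_var ''f'' 0 s) \<longleftrightarrow> bval (check \<pi>) s" using free Cons.prems by simp
    show ?case
    proof (cases "bval (check \<pi>) s")
      case True
      have ss: "set_var ''f'' 1 (set_var ''f'' 0 s) = set_var ''f'' 1 s" by (simp add: set_var_def)
      have "''f'' \<notin> wvars (emit_prog m \<pi>)" using subsetD[OF wvars_emit(1)[of m \<pi>], of "''f''"] by auto
      then have "var (run (emit_prog m \<pi>) (set_var ''f'' 1 s)) ''f'' = 1" by (simp add: run_var)
      then have "run (seqs (map ?f (\<pi> # qs))) (set_var ''f'' 0 s) = run (emit_prog m \<pi>) (set_var ''f'' 1 s)"
        using skip[of "run (emit_prog m \<pi>) (set_var ''f'' 1 s)" qs] b True ss by simp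
      then show ?thesis using True by (metis list.set_intros(1))
    next
      case False
      then have "run (seqs (map ?f (\<pi> # qs))) (set_var ''f'' 0 s) = run (seqs (map ?f qs)) (set_var ''f'' 0 s)" using b by simp
      then show ?thesis using Cons False by auto
    qed
  qed simp
  from this[of ps] show ?thesis unfolding pick_prog_def by simp
qed

lemma branch_spec:
  assumes e: "env s"
  defines "t \<equiv> run branch_prog s"
  shows "arr t ''branch'' ` {..<card (setof s ''Z'')} = setof s ''Z''"
proof -
  let ?p = "PIf (nonzero (Get ''Z'' (Var ''u''))) (PSeq (PStore ''branch'' (Var ''h'') (Var ''u'')) (PAssign ''h'' (Plus (Var ''h'') (Const 1)))) PSkip"
  let ?Z = "\<lambda>j. {v \<in> setof s ''Z''. v < j}"
  have n: "var (set_var ''h'' 0 s) ''n'' = n" using env_n[OF e] by simp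
  have "var (run (PFor ''u'' ?p) (set_var ''h'' 0 s)) ''h'' = card (setof s ''Z'') \<and>
    arr (run (PFor ''u'' ?p) (set_var ''h'' 0 s)) ''branch'' ` {..<card (setof s ''Z'')} = setof s ''Z''"
  proof (rule run_For[where I = "\<lambda>j t. var t ''h'' = card (?Z j) \<and> arr t ''branch'' ` {..<card (?Z j)} = ?Z j"])
    fix j t assume j: "j < var (set_var ''h'' 0 s) ''n''" and a: "agree (wvars (PFor ''u'' ?p)) (warrs ?p) (set_var ''h'' 0 s) t"
      and I: "var t ''h'' = card (?Z j) \<and> arr t ''branch'' ` {..<card (?Z j)} = ?Z j"
    have jn: "j < n" using j n by simp
    have Z: "arr t ''Z'' = arr s ''Z''" using agree_arr[OF a] by simp
    have fin: "finite (?Z j)" by simp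
    show "var (run ?p (set_var ''u'' j t)) ''h'' = card (?Z (Suc j)) \<and>
      arr (run ?p (set_var ''u'' j t)) ''branch'' ` {..<card (?Z (Suc j))} = ?Z (Suc j)"
    proof (cases "j \<in> setof s ''Z''")
      case True
      then have Z': "?Z (Suc j) = insert j (?Z j)" by (auto simp: less_Suc_eq)
      then have c: "card (?Z (Suc j)) = Suc (card (?Z j))" using fin by simp
      have nz: "arr s ''Z'' j \<noteq> 0" using True by (simp add: setof_def)
      have "((arr t ''branch'')(card (?Z j) := j)) ` {..<Suc (card (?Z j))} = insert j (arr t ''branch'' ` {..<card (?Z j)})"
        by (auto simp: lessThan_Suc)
      then show ?thesis using I nz Z unfolding c by (simp add: Z')
    next
      case False
      then have Z': "?Z (Suc j) = ?Z j" by (auto simp: less_Suc_eq)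
      have nz: "arr s ''Z'' j = 0" using False jn by (simp add: setof_def)
      then show ?thesis unfolding Z' using I Z by simp
    qed
  next
    fix t :: store assume I: "var t ''h'' = card (?Z (var (set_var ''h'' 0 s) ''n'')) \<and>
      arr t ''branch'' ` {..<card (?Z (var (set_var ''h'' 0 s) ''n''))} = ?Z (var (set_var ''h'' 0 s) ''n'')"
    have "?Z (var (set_var ''h'' 0 s) ''n'') = setof s ''Z''" using n by (auto simp: setof_def)
    then show "var (set_var ''u'' (var (set_var ''h'' 0 s) ''n'') t) ''h'' = card (setof s ''Z'') \<and>
      arr (set_var ''u'' (var (set_var ''h'' 0 s) ''n'') t) ''branch'' ` {..<card (setof s ''Z'')} = setof s ''Z''"
      using I by simp
  qed simp
  then show ?thesis unfolding t_def branch_prog_def by simp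
qed

lemma end_value:
  assumes "env s" "i < n" "0 < arr s ''len'' i"
  shows "aval (end_exp i) s = last (out_path n s i)"
proof -
  have "last (out_path n s i) = out_path n s i ! (arr s ''len'' i - 1)"
    using assms(3) by (subst last_conv_nth) (auto simp: out_path_def)
  also have "\<dots> = arr s ''path'' (i * n + (arr s ''len'' i - 1))" using assms(3) by (simp add: out_path_def)
  finally show ?thesis using assms by (simp add: end_exp_def env_def)
qed

end

section \<open>Cyclic orders of the recovered paths\<close>

lemma ex_cyclic_pred:
  fixes i k :: nat
  assumes "i < k" "3 \<le> k"
  obtains h where "h < k" "Suc h mod k = i" "h \<noteq> Suc i mod k"
proof
  let ?h = "if i = 0 then k - 1 else i - 1"
  show "?h < k" "Suc ?h mod k = i" using assms by auto
  show "?h \<noteq> Suc i mod k" using assms by (cases "Suc i = k") auto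
qed

text \<open>An index has only two cyclic neighbours. By \<open>nb\<close> those of
  \<open>\<tau> i\<close> are already the images of the predecessor and the successor of
  \<open>i\<close>, so injectivity leaves no other index \<open>j\<close> to be sent to one of
  them.\<close>

lemma cyclic_reorder:
  fixes k :: nat
  assumes k: "3 \<le> k" and b: "bij_betw \<tau> {..<k} {..<k}"
    and nb: "\<And>i. i < k \<Longrightarrow> \<tau> (Suc i mod k) = Suc (\<tau> i) mod k \<or> \<tau> i = Suc (\<tau> (Suc i mod k)) mod k"
    and ij: "i < k" "j < k" and t: "\<tau> j = Suc (\<tau> i) mod k \<or> \<tau> i = Suc (\<tau> j) mod k"
  shows "j = Suc i mod k \<or> i = Suc j mod k"
proof -
  let ?N = "{b. b < k \<and> (b = Suc (\<tau> i) mod k \<or> \<tau> i = Suc b mod k)}"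
  let ?q = "if \<tau> i = 0 then k - 1 else \<tau> i - 1"
  have lt: "\<tau> a < k" if "a < k" for a using b that by (auto simp: bij_betw_def)
  have inj: "\<tau> a = \<tau> c \<Longrightarrow> a = c" if "a < k" "c < k" for a c using b that by (auto simp: bij_betw_def inj_on_def)
  obtain h where h: "h < k" "Suc h mod k = i" "h \<noteq> Suc i mod k" using ex_cyclic_pred[OF ij(1) k] .
  have si: "Suc i mod k < k" using k by simp
  have "?N \<subseteq> {Suc (\<tau> i) mod k, ?q}"
  proof
    fix a assume a: "a \<in> ?N"
    show "a \<in> {Suc (\<tau> i) mod k, ?q}" using a by (cases "Suc a = k") auto
  qed
  then have "card ?N \<le> card {Suc (\<tau> i) mod k, ?q}" by (intro card_mono) auto
  also have "\<dots> \<le> 2" by (cases "Suc (\<tau> i) mod k = ?q") auto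
  finally have cN: "card ?N \<le> 2" .
  have "\<tau> (Suc i mod k) \<in> ?N" using nb[OF ij(1)] lt[OF si] by simp
  moreover have "\<tau> h \<in> ?N" using nb[OF h(1)] lt[OF h(1)] h(2) by auto
  ultimately have sub: "{\<tau> (Suc i mod k), \<tau> h} \<subseteq> ?N" by blast
  have "\<tau> (Suc i mod k) \<noteq> \<tau> h" using inj[OF si h(1)] h(3) by metis
  then have "card {\<tau> (Suc i mod k), \<tau> h} = 2" by simp
  then have "{\<tau> (Suc i mod k), \<tau> h} = ?N" using cN by (intro card_seteq[OF _ sub]) auto
  moreover have "\<tau> j \<in> ?N" using t lt[OF ij(2)] by simp
  ultimately have "\<tau> j = \<tau> (Suc i mod k) \<or> \<tau> j = \<tau> h" by blast
  then show ?thesis using inj[OF ij(2) si] inj[OF ij(2) h(1)] h(2) by blast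
qed

text \<open>The program may find another cyclic order than that of \<open>P\<close>. All it checks
  is that consecutive ends are adjacent, and this is enough.\<close>

lemma (in kgraph) kst_reorder:
  assumes K: "kst P" and b: "bij_betw \<tau> {..<k} {..<k}"
    and adj: "\<And>i. i < k \<Longrightarrow> adj G (last (P (\<tau> i))) (last (P (\<tau> (Suc i mod k))))"
  shows "kst (\<lambda>i. P (\<tau> i))" "(\<Union>i<k. set (P (\<tau> i))) = (\<Union>i<k. set (P i))"
proof -
  interpret kstruct G k X P by unfold_locales (rule K)
  have lt: "\<tau> a < k" if "a < k" for a using b that by (auto simp: bij_betw_def)
  have inj: "\<tau> a = \<tau> c \<longleftrightarrow> a = c" if "a < k" "c < k" for a c using b that by (auto simp: bij_betw_def inj_on_def)
  have cyc: "\<tau> (Suc i mod k) = Suc (\<tau> i) mod k \<or> \<tau> i = Suc (\<tau> (Suc i mod k)) mod k" if i: "i < k" for i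
  proof -
    let ?j = "Suc i mod k"
    have j: "?j < k" by (rule Suc_mod_less)
    have ne: "\<tau> i \<noteq> \<tau> ?j" using inj[OF i j] Suc_mod_neq[OF i] by auto
    have l: "L (\<tau> i) - 1 < L (\<tau> i)" "L (\<tau> ?j) - 1 < L (\<tau> ?j)" using L2[OF lt[OF i]] L2[OF lt[OF j]] by auto
    have "adj G (p (\<tau> i) (L (\<tau> i) - 1)) (p (\<tau> ?j) (L (\<tau> ?j) - 1))"
      using adj[OF i] unfolding s_nth[OF lt[OF i]] s_nth[OF lt[OF j]] .
    then show ?thesis using adj_diff[OF lt[OF i] lt[OF j] ne l] by blast
  qed
  have k3: "3 \<le> k" using k5 by simp
  have C: "(\<tau> j = Suc (\<tau> i) mod k \<or> \<tau> i = Suc (\<tau> j) mod k) \<longleftrightarrow> (j = Suc i mod k \<or> i = Suc j mod k)" if ij: "i < k" "j < k" for i j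
    using cyclic_reorder[OF k3 b cyc ij] cyc[OF ij(1)] cyc[OF ij(2)] by blast
  note KD = K[unfolded kst_def]
  show U: "(\<Union>i<k. set (P (\<tau> i))) = (\<Union>i<k. set (P i))"
  proof -
    have "(\<Union>i\<in>\<tau> ` {..<k}. set (P i)) = (\<Union>i<k. set (P i))" using b by (simp only: bij_betw_def)
    then show ?thesis by simp
  qed
  show "kst (\<lambda>i. P (\<tau> i))" unfolding kst_def
  proof (intro conjI allI impI)
    show "(\<Union>i<k. set (P (\<tau> i))) \<subseteq> verts G" unfolding U using KD by (elim conjE)
    have "bij_betw ((\<lambda>i. hd (P i)) \<circ> \<tau>) {..<k} X" by (rule bij_betw_trans[OF b]) (use KD in \<open>elim conjE\<close>)
    then show "bij_betw (\<lambda>i. hd (P (\<tau> i))) {..<k} X" by (simp add: comp_def)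
    fix i assume i: "i < k"
    show "2 \<le> length (P (\<tau> i))" "distinct (P (\<tau> i))" "chordless G (P (\<tau> i))" using KD lt[OF i] by (elim conjE; simp)+
    fix j assume j: "j < k" "i \<noteq> j"
    have ne: "\<tau> i \<noteq> \<tau> j" using inj[OF i j(1)] j(2) by simp
    show "set (P (\<tau> i)) \<inter> set (P (\<tau> j)) = {}" by (rule disjoint[OF lt[OF i] lt[OF j(1)] ne])
    have "\<forall>u\<in>set (P (\<tau> i)). \<forall>v\<in>set (P (\<tau> j)). adj G u v \<longleftrightarrow> u = last (P (\<tau> i)) \<and> v = last (P (\<tau> j)) \<and> (\<tau> j = Suc (\<tau> i) mod k \<or> \<tau> i = Suc (\<tau> j) mod k)"
      using KD lt[OF i] lt[OF j(1)] ne by (elim conjE) simp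
    then show "\<forall>u\<in>set (P (\<tau> i)). \<forall>v\<in>set (P (\<tau> j)). adj G u v \<longleftrightarrow> u = last (P (\<tau> i)) \<and> v = last (P (\<tau> j)) \<and> (j = Suc i mod k \<or> i = Suc j mod k)"
      unfolding C[OF i j(1)] .
  qed
qed

definition ends_distinct :: "nat \<Rightarrow> bexp list" where
  "ends_distinct k = concat (map (\<lambda>i. map (\<lambda>j. Not (Equal (end_exp i) (end_exp j))) [0..<i]) [0..<k])"

text \<open>Walks in a tree may well stop at a common vertex. Demanding distinct ends makes every
  permutation that passes exhibit a cycle.\<close>

definition cycle_check :: "nat \<Rightarrow> nat list \<Rightarrow> bexp" where
  "cycle_check k \<pi> = allb (ends_distinct k @ map (\<lambda>i. nonzero (edge_exp (end_exp (\<pi> ! i)) (end_exp (\<pi> ! (Suc i mod k))))) [0..<k])"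

definition perms :: "nat \<Rightarrow> nat list list" where
  "perms k = filter distinct (List.n_lists k [0..<k])"

text \<open>The first emission lists the paths in the order of the terminals, which is what the
  checks refer to; the second one rewrites them in the cyclic order that was found. On a minimal
  linked set, failure to find an order means that the set induces a tree.\<close>

definition tree_prog :: "nat \<Rightarrow> prog" where
  "tree_prog k = PSeq (emit_prog k [0..<k]) (pick_prog k (cycle_check k) (perms k))"

definition min_prog :: "nat \<Rightarrow> prog" where
  "min_prog k = PSeq (fill_prog ''zero'' 0) (greedy_prog (linked_test k) ''zero'')"

lemma perms_bij:
  assumes "\<pi> \<in> set (perms k)"
  shows "bij_betw (\<lambda>i. \<pi> ! i) {..<k} {..<k}"
proof -
  have \<pi>: "length \<pi> = k" "set \<pi> \<subseteq> {..<k}" "distinct \<pi>"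
    using assms by (auto simp: perms_def set_n_lists)
  have "set \<pi> = {..<k}" using \<pi> by (intro card_subset_eq) (auto simp: distinct_card)
  then show ?thesis using \<pi> by (intro bij_betw_nth) auto
qed

lemma map_perms: "bij_betw \<sigma> {..<k} {..<k} \<Longrightarrow> map \<sigma> [0..<k] \<in> set (perms k)"
  by (auto simp: perms_def set_n_lists bij_betw_def distinct_map atLeast0LessThan)

locale tree_instance = instance_graph n G k x + kgraph G k "x ` {..<k}" for n G k x
begin

lemma k_n: "k \<le> n"
proof -
  have "card X \<le> card {..<n}" using x_less by (intro card_mono) auto
  then show ?thesis using card_X by simp
qed

lemma x_bij: "bij_betw x {..<k} X"
proof -
  have "inj_on x {..<k}" by (rule eq_card_imp_inj_on) (use card_X in auto)
  then show ?thesis by (simp add: bij_betw_def)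
qed

lemma setof_verts: "setof s a \<subseteq> verts G"
  by (auto simp: setof_def vertices)

text \<open>The criterion for both kinds of structures: before the last vertex there is no
  alternative to the next one, and at the last vertex the two candidates \<open>y\<close> and
  \<open>z\<close> stop the walk.\<close>

lemma walk_determined:
  assumes P: "distinct P" "2 \<le> length P" "set P \<subseteq> S" "S \<subseteq> verts G"
    and inner: "\<And>j u. Suc j < length P \<Longrightarrow> u \<in> S \<Longrightarrow> adj G (P ! j) u \<Longrightarrow> u = P ! Suc j \<or> 0 < j \<and> u = P ! (j - 1)"
    and step: "\<And>j. Suc j < length P \<Longrightarrow> adj G (P ! j) (P ! Suc j)"
    and stop: "y \<noteq> z" "y \<in> S - set P" "z \<in> S - set P" "adj G (last P) y" "adj G (last P) z"
  shows "walk S (hd P) = P"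
proof (rule walk_path)
  show "P \<noteq> []" "distinct P" "set P \<subseteq> S" "hd P = hd P" using P by auto
  show "length P \<le> n" by (rule distinct_length) (use P vertices in auto)
  let ?N = "{u \<in> S. u \<notin> set P \<and> adj G (last P) u}"
  have "finite ?N" using finite_verts P(4) by (auto intro: finite_subset)
  then have "card {y, z} \<le> card ?N" by (intro card_mono) (use stop in auto)
  then show "card ?N \<noteq> 1" using stop(1) by simp
  fix j assume j: "Suc j < length P"
  show "{u \<in> S. u \<notin> set (take (Suc j) P) \<and> adj G (P ! j) u} = {P ! Suc j}"
  proof (intro set_eqI iffI)
    fix u assume u: "u \<in> {u \<in> S. u \<notin> set (take (Suc j) P) \<and> adj G (P ! j) u}"
    have "P ! (j - 1) \<in> set (take (Suc j) P)" using j by (auto simp: in_set_conv_nth intro!: exI[of _ "j - 1"])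
    then show "u \<in> {P ! Suc j}" using inner[OF j, of u] u by auto
  next
    fix u assume "u \<in> {P ! Suc j}"
    moreover have "P ! Suc j \<notin> set (take (Suc j) P)"
      using P(1) j by (auto simp: in_set_conv_nth nth_eq_iff_index_eq)
    moreover have "P ! Suc j \<in> S" using P(3) j nth_mem by blast
    ultimately show "u \<in> {u \<in> S. u \<notin> set (take (Suc j) P) \<and> adj G (P ! j) u}" using step[OF j] by simp
  qed
qed

lemma walk_kst:
  assumes K: "kst P" and i: "i < k"
  shows "walk (\<Union>i<k. set (P i)) (hd (P i)) = P i"
proof -
  interpret S: kstruct G k X P by unfold_locales (rule K)
  have k3: "3 \<le> k" using k5 by simp
  obtain h where h: "h < k" "Suc h mod k = i" "h \<noteq> Suc i mod k" using ex_cyclic_pred[OF i k3] .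
  have j: "Suc i mod k < k" by (rule Suc_mod_less)
  have hi: "h \<noteq> i" using Suc_mod_neq[OF h(1)] h(2) by metis
  have out: "last (P a) \<in> S.K - set (P i)" if "a < k" "a \<noteq> i" for a
  proof -
    have "last (P a) \<in> set (P a)" using S.L2[OF that(1)] by (intro last_in_set) auto
    then show ?thesis using S.disjoint[OF that(1) i that(2)] S.path_K[OF that(1)] by blast
  qed
  have "walk S.K (hd (P i)) = P i"
  proof (rule walk_determined)
    show "distinct (P i)" using K i by (simp add: kst_def)
    show "last (P (Suc i mod k)) \<noteq> last (P h)" using S.s_eq[OF j h(1)] h(3) by metis
    show "last (P (Suc i mod k)) \<in> S.K - set (P i)" by (rule out[OF j Suc_mod_neq[OF i]])
    show "last (P h) \<in> S.K - set (P i)" by (rule out[OF h(1) hi])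
    show "adj G (last (P i)) (last (P (Suc i mod k)))" by (rule S.adj_s[OF i])
    show "adj G (last (P i)) (last (P h))" using S.adj_s[OF h(1)] unfolding h(2) by (simp only: adj_commute)
    show "u = P i ! Suc j \<or> 0 < j \<and> u = P i ! (j - 1)" if "Suc j < length (P i)" "u \<in> S.K" "adj G (P i ! j) u" for j u
      using S.neighbours_inner[OF i _ that(2,3)] that(1) by simp
    show "adj G (P i ! j) (P i ! Suc j)" if "Suc j < length (P i)" for j
      using S.adj_same[OF i, of j "Suc j"] that by simp
  qed (use S.L2[OF i] S.path_K[OF i] S.K_verts in auto)
  then show ?thesis unfolding S.K_def .
qed

lemma min_prog_spec:
  assumes e: "env s" and l: "linked G X (setof s ''S'')"
  shows "setof (run (min_prog k) s) ''S'' \<subseteq> setof s ''S'' \<and> min_linked G X (setof (run (min_prog k) s) ''S'')"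
proof -
  define s1 where "s1 = run (fill_prog ''zero'' 0) s"
  have e1: "env s1" using env_run[OF e] by (simp add: s1_def)
  have Z: "setof s1 ''zero'' = {}" using fill_value[OF env_n[OF e]] by (auto simp: s1_def setof_def)
  have S: "setof s1 ''S'' = setof s ''S''" by (rule setof_cong) (simp add: s1_def run_arr)
  define s2 where "s2 = run (greedy_prog (linked_test k) ''zero'') s1"
  have r: "run (min_prog k) s = s2" by (simp add: min_prog_def s2_def s1_def)
  have "setof s2 ''S'' \<subseteq> setof s1 ''S'' \<and> setof s1 ''S'' \<inter> setof s1 ''zero'' \<subseteq> setof s2 ''S'' \<and>
     linked G X (setof s2 ''S'') \<and> (\<forall>u\<in>setof s2 ''S'' - setof s1 ''zero''. \<not> linked G X (setof s2 ''S'' - {u}))"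
    unfolding s2_def
  proof (rule greedy_set[OF e1])
    show "linked G X (setof s1 ''S'')" using l S by simp
    show "\<And>A B. linked G X A \<Longrightarrow> A \<subseteq> B \<Longrightarrow> linked G X B" by (rule linked_mono)
    show "var (run (linked_test k) t) ''ok'' \<noteq> 0 \<longleftrightarrow> linked G X (setof t ''S'')" if "env t" for t
      by (rule linked_test_ok[OF that])
  qed simp_all
  then show ?thesis unfolding min_linked_def r S Z Diff_empty by (elim conjE) (intro conjI; assumption)
qed

lemma wvars_min: "wvars (min_prog k) \<subseteq> {''g'', ''u'', ''a'', ''b'', ''c'', ''r'', ''ok''}" "warrs (min_prog k) \<subseteq> {''zero'', ''S'', ''W'', ''R''}"
  by (auto simp: min_prog_def greedy_prog_def)

lemma wvars_tree: "wvars (tree_prog k) \<subseteq> {''f'', ''u'', ''a'', ''b'', ''q'', ''y'', ''c1'', ''l''}"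
  "warrs (tree_prog k) \<subseteq> {''V'', ''Z'', ''path'', ''len''}"
  using wvars_emit[of k "[0..<k]"] wvars_pick[of k "cycle_check k" "perms k"] by (auto simp: tree_prog_def)

lemma cycle_check_iff:
  assumes e: "env s" and len: "\<And>i. i < k \<Longrightarrow> 0 < arr s ''len'' i" and \<pi>: "\<pi> \<in> set (perms k)"
    and W: "\<And>i. i < k \<Longrightarrow> out_path n s i = W i" "\<And>i. i < k \<Longrightarrow> last (W i) < n"
  shows "bval (cycle_check k \<pi>) s \<longleftrightarrow> (\<forall>i<k. \<forall>j<i. last (W i) \<noteq> last (W j)) \<and>
    (\<forall>i<k. adj G (last (W (\<pi> ! i))) (last (W (\<pi> ! (Suc i mod k)))))"
proof -
  have ev: "aval (end_exp i) s = last (W i)" if "i < k" for i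
    using end_value[OF e _ len[OF that]] k_n that W(1)[OF that] by simp
  have \<pi>k: "\<pi> ! i < k" if "i < k" for i using perms_bij[OF \<pi>] that by (auto simp: bij_betw_def)
  have "(\<forall>i<k. \<forall>j<i. aval (end_exp i) s \<noteq> aval (end_exp j) s) \<longleftrightarrow> (\<forall>i<k. \<forall>j<i. last (W i) \<noteq> last (W j))"
    using ev by auto
  moreover have "aval (edge_exp (end_exp (\<pi> ! i)) (end_exp (\<pi> ! (Suc i mod k)))) s \<noteq> 0 \<longleftrightarrow>
      adj G (last (W (\<pi> ! i))) (last (W (\<pi> ! (Suc i mod k))))" if i: "i < k" for i
  proof -
    have j: "Suc i mod k < k" by (rule Suc_mod_less)
    show ?thesis using edge_value[OF e, of "end_exp (\<pi> ! i)" "end_exp (\<pi> ! (Suc i mod k))"]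
      unfolding ev[OF \<pi>k[OF i]] ev[OF \<pi>k[OF j]] using W(2)[OF \<pi>k[OF i]] W(2)[OF \<pi>k[OF j]] by blast
  qed
  moreover have "bval (cycle_check k \<pi>) s \<longleftrightarrow> (\<forall>i<k. \<forall>j<i. aval (end_exp i) s \<noteq> aval (end_exp j) s) \<and>
     (\<forall>i<k. aval (edge_exp (end_exp (\<pi> ! i)) (end_exp (\<pi> ! (Suc i mod k)))) s \<noteq> 0)"
    unfolding cycle_check_def bval_allb by (auto simp: ends_distinct_def ball_Un ball_UN)
  ultimately show ?thesis by simp
qed

lemma static_check:
  assumes "\<And>a. arr t a = arr s a"
  shows "bval (cycle_check k \<pi>) t \<longleftrightarrow> bval (cycle_check k \<pi>) s"
proof -
  have "aval (end_exp i) t = aval (end_exp i) s" for i using assms by (simp add: end_exp_def)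
  then show ?thesis unfolding cycle_check_def bval_allb by (simp add: ends_distinct_def edge_exp_def assms ball_Un)
qed

text \<open>If \<open>S\<close> contains a cycle, it is a structure whose paths are retraced by the
  walks, so its own cyclic order passes the check. If not, no order passes, because the ends of the
  walks would form a cycle inside \<open>S\<close>.\<close>

lemma tree_prog_spec:
  assumes e: "env s" and m: "min_linked G X (setof s ''S'')"
  defines "t \<equiv> run (tree_prog k) s" and "S \<equiv> setof s ''S''"
  shows "var t ''f'' = 0 \<and> induced_tree_containing G X S \<or>
    var t ''f'' \<noteq> 0 \<and> kst (out_path n t) \<and> S = (\<Union>i<k. set (out_path n t i)) \<and> (\<forall>i<k. 0 < arr t ''len'' i)"
proof -
  define s1 where "s1 = run (emit_prog k [0..<k]) s"
  define W where "W i = walk S (x i)" for i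
  have SV: "S \<subseteq> verts G" unfolding S_def by (rule setof_verts)
  have XS: "X \<subseteq> S" using m by (simp add: S_def min_linked_def linked_def)
  have e1: "env s1" unfolding s1_def by (rule env_run[OF e]) (use wvars_emit[of k "[0..<k]"] in auto)
  have S1: "setof s1 ''S'' = S" unfolding s1_def S_def by (rule setof_cong, rule run_arr) (use wvars_emit(2)[of k "[0..<k]"] in auto)
  have "(\<forall>i<k. out_path n s1 i = walk S (x ([0..<k] ! i))) \<and> (\<forall>i<k. arr s1 ''len'' i \<le> n \<and> 0 < arr s1 ''len'' i)"
    using emit_spec[OF e k_n, of "[0..<k]"] unfolding s1_def S_def by simp
  then have o1: "out_path n s1 i = W i" "0 < arr s1 ''len'' i" if "i < k" for i using that by (auto simp: W_def)
  have Wp: "W i \<noteq> []" "set (W i) \<subseteq> S" if "i < k" for i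
    using walk_props[OF x_less[OF that], of S] XS that unfolding W_def by auto
  have lW: "last (W i) \<in> S" "last (W i) < n" if "i < k" for i
  proof -
    show l: "last (W i) \<in> S" using Wp(2)[OF that] last_in_set[OF Wp(1)[OF that]] by blast
    show "last (W i) < n" using subsetD[OF SV l] vertices by simp
  qed
  have check: "bval (cycle_check k \<pi>) s1 \<longleftrightarrow> (\<forall>i<k. \<forall>j<i. last (W i) \<noteq> last (W j)) \<and>
    (\<forall>i<k. adj G (last (W (\<pi> ! i))) (last (W (\<pi> ! (Suc i mod k)))))" if "\<pi> \<in> set (perms k)" for \<pi>
    by (rule cycle_check_iff[OF e1 o1(2) that o1(1) lW(2)])
  have t: "t = run (pick_prog k (cycle_check k) (perms k)) s1" by (simp add: t_def tree_prog_def s1_def)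
  have pick: "(\<exists>\<pi>\<in>set (perms k). bval (cycle_check k \<pi>) s1 \<and> t = run (emit_prog k \<pi>) (set_var ''f'' 1 s1)) \<or>
    (\<forall>\<pi>\<in>set (perms k). \<not> bval (cycle_check k \<pi>) s1) \<and> t = set_var ''f'' 0 s1"
    unfolding t by (rule pick_spec) (rule static_check, simp)
  show ?thesis
  proof (cases "\<exists>c. is_cycle G c \<and> set c \<subseteq> S")
    case True
    then obtain c where c: "is_cycle G c" "set c \<subseteq> S" by blast
    obtain P where P: "kst P" "S = (\<Union>i<k. set (P i))"
      using min_linked_cycle[OF m[folded S_def] SV c] .
    interpret K: kstruct G k X P by unfold_locales (rule P(1))
    have hb: "bij_betw (\<lambda>j. hd (P j)) {..<k} X" using P(1) by (simp add: kst_def)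
    \<comment> \<open>\<open>\<sigma>\<close> sends a terminal number to the path of
      \<open>P\<close> that starts there. Its inverse \<open>\<rho>\<close> is the order that
      certainly passes the check, and \<open>\<tau>\<close> describes the order actually found,
      which may be a different one.\<close>
    define \<sigma> where "\<sigma> = inv_into {..<k} (\<lambda>j. hd (P j)) \<circ> x"
    have \<sigma>: "bij_betw \<sigma> {..<k} {..<k}" unfolding \<sigma>_def by (rule bij_betw_trans[OF x_bij bij_betw_inv_into[OF hb]])
    have \<sigma>k: "\<sigma> i < k" if "i < k" for i using \<sigma> that by (auto simp: bij_betw_def)
    have h\<sigma>: "hd (P (\<sigma> i)) = x i" if "i < k" for i
      using bij_betw_inv_into_right[OF hb, of "x i"] that by (simp add: \<sigma>_def)
    have WP: "W i = P (\<sigma> i)" if "i < k" for i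
      using walk_kst[OF P(1) \<sigma>k[OF that]] unfolding h\<sigma>[OF that] W_def P(2) .
    have WD: "\<forall>i<k. \<forall>j<i. last (W i) \<noteq> last (W j)"
    proof (intro allI impI)
      fix i j assume ij: "i < k" "j < i"
      then have j: "j < k" by simp
      have "\<sigma> i \<noteq> \<sigma> j" using inj_onD[OF bij_betw_imp_inj_on[OF \<sigma>], of i j] ij j by auto
      then show "last (W i) \<noteq> last (W j)" unfolding WP[OF ij(1)] WP[OF j] K.s_eq[OF \<sigma>k[OF ij(1)] \<sigma>k[OF j]] .
    qed
    define \<rho> where "\<rho> = inv_into {..<k} \<sigma>"
    have \<rho>: "bij_betw \<rho> {..<k} {..<k}" unfolding \<rho>_def by (rule bij_betw_inv_into[OF \<sigma>])
    have \<rho>k: "\<rho> i < k" if "i < k" for i using \<rho> that by (auto simp: bij_betw_def)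
    have \<sigma>\<rho>: "\<sigma> (\<rho> i) = i" if "i < k" for i using bij_betw_inv_into_right[OF \<sigma>, of i] that by (simp add: \<rho>_def)
    have "bval (cycle_check k (map \<rho> [0..<k])) s1"
      unfolding check[OF map_perms[OF \<rho>]]
    proof (intro conjI WD allI impI)
      fix i assume i: "i < k"
      have j: "Suc i mod k < k" by (rule Suc_mod_less)
      show "adj G (last (W (map \<rho> [0..<k] ! i))) (last (W (map \<rho> [0..<k] ! (Suc i mod k))))"
        using K.adj_s[OF i] i j WP[OF \<rho>k[OF i]] WP[OF \<rho>k[OF j]] \<sigma>\<rho>[OF i] \<sigma>\<rho>[OF j] by simp
    qed
    then obtain \<pi> where \<pi>: "\<pi> \<in> set (perms k)" "bval (cycle_check k \<pi>) s1" "t = run (emit_prog k \<pi>) (set_var ''f'' 1 s1)"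
      using pick map_perms[OF \<rho>] by blast
    note b = perms_bij[OF \<pi>(1)]
    have \<pi>k: "\<pi> ! i < k" if "i < k" for i using b that by (auto simp: bij_betw_def)
    define \<tau> where "\<tau> i = \<sigma> (\<pi> ! i)" for i
    have \<tau>: "bij_betw \<tau> {..<k} {..<k}" 
    proof -
      have "\<tau> = \<sigma> \<circ> (\<lambda>i. \<pi> ! i)" by (simp add: fun_eq_iff \<tau>_def)
      then show ?thesis using bij_betw_trans[OF b \<sigma>] by (simp only:)
    qed
    have ef: "env (set_var ''f'' 1 s1)" using e1 by (simp add: env_set_var)
    have Sf: "setof (set_var ''f'' 1 s1) ''S'' = S" using S1 by (simp add: setof_def)
    have o: "out_path n t i = P (\<tau> i)" "0 < arr t ''len'' i" if i: "i < k" for i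
    proof -
      note es = emit_spec[OF ef k_n \<pi>k, folded \<pi>(3), unfolded Sf]
      have "out_path n t i = W (\<pi> ! i)" using es i unfolding W_def by blast
      then show "out_path n t i = P (\<tau> i)" unfolding WP[OF \<pi>k[OF i]] \<tau>_def .
      show "0 < arr t ''len'' i" using es i by blast
    qed
    have adj: "adj G (last (P (\<tau> i))) (last (P (\<tau> (Suc i mod k))))" if i: "i < k" for i
    proof -
      have j: "Suc i mod k < k" by (rule Suc_mod_less)
      show ?thesis using \<pi>(2) i unfolding check[OF \<pi>(1)] \<tau>_def WP[OF \<pi>k[OF i], symmetric] WP[OF \<pi>k[OF j], symmetric] by blast
    qed
    note R = kst_reorder[OF P(1) \<tau> adj]
    have "bij_betw (\<lambda>i. hd (out_path n t i)) {..<k} X \<longleftrightarrow> bij_betw (\<lambda>i. hd (P (\<tau> i))) {..<k} X"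
      by (rule bij_betw_cong) (simp add: o(1))
    then have kc: "kst (out_path n t)" using R(1) o(1) unfolding kst_def by simp
    have "''f'' \<notin> wvars (emit_prog k \<pi>)" using wvars_emit(1)[of k \<pi>] by auto
    then have "var t ''f'' = 1" unfolding \<pi>(3) by (simp add: run_var)
    moreover have "S = (\<Union>i<k. set (out_path n t i))" using R(2) o(1) unfolding P(2) by simp
    ultimately show ?thesis using kc o(2) by simp
  next
    case False
    have "\<not> bval (cycle_check k \<pi>) s1" if \<pi>: "\<pi> \<in> set (perms k)" for \<pi>
    proof
      assume "bval (cycle_check k \<pi>) s1"
      then have d: "\<forall>i<k. \<forall>j<i. last (W i) \<noteq> last (W j)"
        and a: "\<forall>i<k. adj G (last (W (\<pi> ! i))) (last (W (\<pi> ! (Suc i mod k))))" unfolding check[OF \<pi>] by blast+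
      let ?c = "map (\<lambda>i. last (W (\<pi> ! i))) [0..<k]"
      note b = perms_bij[OF \<pi>]
      have \<pi>k: "\<pi> ! i < k" if "i < k" for i using b that by (auto simp: bij_betw_def)
      have k3: "3 \<le> k" using k5 by simp
      have di: "last (W i) \<noteq> last (W j)" if "i < k" "j < k" "i \<noteq> j" for i j
        using d that by (cases i j rule: linorder_cases) (auto dest: not_sym)
      have inj: "inj_on (\<lambda>i. last (W (\<pi> ! i))) {..<k}"
      proof (rule inj_onI)
        fix i j assume ij: "i \<in> {..<k}" "j \<in> {..<k}" "last (W (\<pi> ! i)) = last (W (\<pi> ! j))"
        then have "\<pi> ! i = \<pi> ! j" using di[of "\<pi> ! i" "\<pi> ! j"] \<pi>k by auto
        then show "i = j" using b ij by (auto simp: bij_betw_def inj_on_def)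
      qed
      have "is_cycle G ?c" unfolding is_cycle_iff
      proof (intro conjI)
        show "3 \<le> length ?c" using k3 by simp
        show "distinct ?c" using inj by (simp add: distinct_map atLeast0LessThan)
        show "set ?c \<subseteq> verts G" using lW(1)[OF \<pi>k] SV by auto
        show "successively (adj G) ?c" unfolding successively_nth
        proof (intro allI impI)
          fix i assume i: "Suc i < length ?c"
          then have "Suc i mod k = Suc i" by simp
          then show "adj G (?c ! i) (?c ! Suc i)" using a i by (metis (no_types, lifting) Suc_lessD add_0 diff_zero length_map length_upt nth_map nth_upt)
        qed
        have "Suc (k - 1) mod k = 0" using k3 by simp
        then have "adj G (last (W (\<pi> ! (k - 1)))) (last (W (\<pi> ! 0)))" using a k3 by (metis diff_less less_le_trans zero_less_numeral zero_less_one)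
        moreover have "hd ?c = last (W (\<pi> ! 0))" using k3 by (subst hd_conv_nth) auto
        moreover have "last ?c = last (W (\<pi> ! (k - 1)))" using k3 by (subst last_conv_nth) auto
        ultimately show "adj G (last ?c) (hd ?c)" by simp
      qed
      moreover have "set ?c \<subseteq> S" using lW(1)[OF \<pi>k] by auto
      ultimately show False using False by blast
    qed
    then have "t = set_var ''f'' 0 s1" using pick by blast
    then show ?thesis using min_linked_tree[OF m[folded S_def] SV] False by simp
  qed
qed

end

section \<open>Trying the deletions in a minimal leaky set\<close>

definition try_prog :: "nat \<Rightarrow> nat list \<Rightarrow> prog" where
  "try_prog k js = PIf (Equal (Var ''found'') (Const 0)) (seqs [copy_prog ''B'' ''S'',
     seqs (map (\<lambda>j. PStore ''S'' (Get ''o'' (Const j)) (Const 0)) js), linked_test k,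
     PIf (nonzero (Var ''ok'')) (seqs [min_prog k, tree_prog k,
       PIf (Equal (Var ''f'') (Const 0)) (PAssign ''found'' (Const 1)) PSkip]) PSkip]) PSkip"

text \<open>The vertices are stored in \<open>''o''\<close> once, since the tries overwrite
  \<open>''path''\<close> and \<open>''len''\<close>, from which the expressions are
  evaluated.\<close>

definition option_prog :: "aexp list \<Rightarrow> nat \<Rightarrow> prog" where
  "option_prog os m = seqs (map (\<lambda>j. PStore ''o'' (Const j) (os ! j)) [0..<m])"

definition test_prog :: "nat \<Rightarrow> (aexp list \<times> aexp) list \<Rightarrow> aexp list \<Rightarrow> prog" where
  "test_prog k ts os = seqs [PAssign ''found'' (Const 0), option_prog os (length os), copy_prog ''S'' ''keep'',
     fill_prog ''S'' 1, leaky_test k ts]"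

text \<open>Protocol of \<open>''found''\<close>: 2 if the structure decomposes, 1 if a tree has
  been left in \<open>''S''\<close>, 0 if every deletion failed, in which case \<open>''B''\<close>
  holds the minimal leaky set.\<close>

definition stage_prog :: "nat \<Rightarrow> (aexp list \<times> aexp) list \<Rightarrow> aexp list \<Rightarrow> prog" where
  "stage_prog k ts os = PSeq (test_prog k ts os) (PIf (Equal (Var ''ok'') (Const 0)) (PAssign ''found'' (Const 2))
     (PSeq (greedy_prog (leaky_test k ts) ''keep'') (PSeq (copy_prog ''S'' ''B'') (seqs (map (try_prog k) (subseqs [0..<length os]))))))"

definition head_exp :: "nat \<Rightarrow> aexp" where
  "head_exp i = Get ''path'' (Get ''row'' (Const i))"

definition pre_exp :: "nat \<Rightarrow> aexp" where
  "pre_exp i = Get ''path'' (Minus (Plus (Get ''row'' (Const i)) (Get ''len'' (Const i))) (Const 2))"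

definition branch_exp :: "nat \<Rightarrow> aexp" where
  "branch_exp i = Get ''branch'' (Const i)"

lemma static_exps: "static (head_exp i)" "static (pre_exp i)" "static (end_exp i)" "static (branch_exp i)"
  by (simp_all add: static_def head_exp_def pre_exp_def end_exp_def branch_exp_def)

definition cycle_tests :: "nat \<Rightarrow> (aexp list \<times> aexp) list" where
  "cycle_tests k = map (\<lambda>i. ([end_exp i], head_exp i)) [0..<k]"

definition cycle_opts :: "nat \<Rightarrow> aexp list" where
  "cycle_opts k = map end_exp [0..<k] @ map pre_exp [0..<k]"

lemma notin_superset: "A \<subseteq> B \<Longrightarrow> a \<notin> B \<Longrightarrow> a \<notin> A"
  by blast

lemma wvars_option: "wvars (option_prog os m) = {}" "warrs (option_prog os m) \<subseteq> {''o''}"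
  by (auto simp: option_prog_def wvars_seqs warrs_seqs)

lemma option_values:
  assumes "\<And>e. e \<in> set os \<Longrightarrow> static e" "m \<le> length os" "j < m"
  shows "arr (run (option_prog os m) s) ''o'' j = aval (os ! j) s"
  using assms(2,3)
proof (induction m)
  case (Suc m)
  let ?s = "run (option_prog os m) s"
  have "static (os ! m)" using assms(1) Suc.prems(1) by simp
  moreover have "\<forall>a\<in>{''path'', ''len'', ''row'', ''branch''}. arr ?s a = arr s a"
    using wvars_option(2)[of os m] by (auto intro!: run_arr)
  ultimately have "aval (os ! m) ?s = aval (os ! m) s" unfolding static_def by blast
  moreover have "run (option_prog os (Suc m)) s = set_arr ''o'' m (aval (os ! m) ?s) ?s"
    by (simp add: option_prog_def run_seqs)
  ultimately show ?case using Suc by (auto simp: less_Suc_eq)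
qed simp

context tree_instance
begin

lemma wvars_try: "wvars (try_prog k js) \<subseteq> {''found'', ''g'', ''u'', ''a'', ''b'', ''c'', ''r'', ''ok'', ''f'', ''q'', ''y'', ''c1'', ''l''}"
    (is "_ \<subseteq> ?V")
  and warrs_try: "warrs (try_prog k js) \<subseteq> {''S'', ''zero'', ''W'', ''R'', ''V'', ''Z'', ''path'', ''len''}" (is "_ \<subseteq> ?A")
proof -
  have "wvars (min_prog k) \<subseteq> ?V" by (rule order_trans[OF wvars_min(1)]) simp
  moreover have "wvars (tree_prog k) \<subseteq> ?V" by (rule order_trans[OF wvars_tree(1)]) simp
  moreover have "wvars (seqs (map (\<lambda>j. PStore ''S'' (Get ''o'' (Const j)) (Const 0)) js)) = {}" by (simp add: wvars_seqs)
  ultimately show "wvars (try_prog k js) \<subseteq> ?V" by (simp add: try_prog_def)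
  have "warrs (min_prog k) \<subseteq> ?A" by (rule order_trans[OF wvars_min(2)]) simp
  moreover have "warrs (tree_prog k) \<subseteq> ?A" by (rule order_trans[OF wvars_tree(2)]) simp
  moreover have "warrs (seqs (map (\<lambda>j. PStore ''S'' (Get ''o'' (Const j)) (Const 0)) js)) \<subseteq> ?A" by (auto simp: warrs_seqs)
  ultimately show "warrs (try_prog k js) \<subseteq> ?A" by (simp add: try_prog_def)
qed

text \<open>A failed try refutes a good cut: either the terminals are no longer linked, or a minimal
  linked subset with a cycle has been exhibited.\<close>

lemma try_prog_spec:
  fixes js :: "nat list"
  assumes e: "env s" and f: "var s ''found'' = 0"
  defines "t \<equiv> run (try_prog k js) s"
  shows "var t ''found'' = 1 \<and> induced_tree_containing G X (setof t ''S'') \<or>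
    var t ''found'' = 0 \<and> \<not> good_cut G X (setof s ''B'') (arr s ''o'' ` set js)"
proof -
  define s0 where "s0 = run (copy_prog ''B'' ''S'') s"
  define D where "D = (\<lambda>js. seqs (map (\<lambda>j. PStore ''S'' (Get ''o'' (Const j)) (Const 0)) js))"
  define s1 where "s1 = run (D js) s0"
  define s2 where "s2 = run (linked_test k) s1"
  have wD: "wvars (D js) = {}" "warrs (D js) \<subseteq> {''S''}" for js by (auto simp: D_def wvars_seqs warrs_seqs)
  have del: "setof (run (D js) s') ''S'' = setof s' ''S'' - arr s' ''o'' ` set js" for s'
  proof (induction js arbitrary: s')
    case (Cons j js)
    have "run (D (j # js)) s' = run (D js) (set_arr ''S'' (arr s' ''o'' j) 0 s')" by (simp add: D_def)
    then show ?case using Cons by (auto simp: setof_def)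
  qed (simp add: D_def)
  have e0: "env s0" using env_run[OF e] by (simp add: s0_def)
  have e1: "env s1" unfolding s1_def by (rule env_run[OF e0]) (use wD[of js] in auto)
  have e2: "env s2" using env_run[OF e1] by (simp add: s2_def)
  have "setof s0 ''S'' = setof s ''B''" unfolding s0_def by (rule setof_copy[OF env_n[OF e]]) simp
  moreover have "arr s0 ''o'' = arr s ''o''" by (simp add: s0_def run_arr)
  ultimately have S1: "setof s1 ''S'' = setof s ''B'' - arr s ''o'' ` set js" unfolding s1_def del by simp
  have S2: "setof s2 ''S'' = setof s ''B'' - arr s ''o'' ` set js" unfolding S1[symmetric] s2_def by (rule setof_cong) (simp add: run_arr)
  have f2: "var s2 ''found'' = 0" using f wD(1) by (simp add: s2_def s1_def s0_def run_var)
  let ?r = "PIf (nonzero (Var ''ok'')) (seqs [min_prog k, tree_prog k, PIf (Equal (Var ''f'') (Const 0)) (PAssign ''found'' (Const 1)) PSkip]) PSkip"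
  have t: "t = run ?r s2" unfolding t_def try_prog_def using f by (simp add: s2_def s1_def s0_def D_def)
  have ok: "var s2 ''ok'' \<noteq> 0 \<longleftrightarrow> linked G X (setof s2 ''S'')"
    using linked_test_ok[OF e1, folded s2_def] by (simp only: S1 S2)
  show ?thesis
  proof (cases "var s2 ''ok'' = 0")
    case True
    then have "t = s2" unfolding t by simp
    moreover have "\<not> good_cut G X (setof s ''B'') (arr s ''o'' ` set js)" using True ok S2 unfolding good_cut_def by simp
    ultimately show ?thesis using f2 by simp
  next
    case False
    define s3 where "s3 = run (min_prog k) s2"
    define s4 where "s4 = run (tree_prog k) s3"
    have m: "setof s3 ''S'' \<subseteq> setof s2 ''S''" "min_linked G X (setof s3 ''S'')"
      using min_prog_spec[OF e2] ok False unfolding s3_def by auto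
    have e3: "env s3" unfolding s3_def by (rule env_run[OF e2]) (rule notin_superset[OF wvars_min(1)] notin_superset[OF wvars_min(2)], simp)+
    have "''found'' \<notin> wvars (min_prog k)" "''found'' \<notin> wvars (tree_prog k)" 
      by (rule notin_superset[OF wvars_min(1)] notin_superset[OF wvars_tree(1)], simp)+
    then have f4: "var s4 ''found'' = 0" using f2 by (simp add: s4_def s3_def run_var)
    have "''S'' \<notin> warrs (tree_prog k)" by (rule notin_superset[OF wvars_tree(2)]) simp
    then have S4: "setof s4 ''S'' = setof s3 ''S''" unfolding s4_def by (intro setof_cong run_arr)
    have t4: "t = (if var s4 ''f'' = 0 then set_var ''found'' 1 s4 else s4)" unfolding t using False by (simp add: s4_def s3_def)
    from tree_prog_spec[OF e3 m(2), folded s4_def] show ?thesis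
    proof
      assume "var s4 ''f'' = 0 \<and> induced_tree_containing G X (setof s3 ''S'')"
      then show ?thesis using S4 unfolding t4 by (simp add: setof_def)
    next
      assume *: "var s4 ''f'' \<noteq> 0 \<and> kst (out_path n s4) \<and> setof s3 ''S'' = (\<Union>i<k. set (out_path n s4 i)) \<and> (\<forall>i<k. 0 < arr s4 ''len'' i)"
      then interpret K: kstruct G k X "out_path n s4" by unfold_locales blast
      have "set (map (\<lambda>i. last (out_path n s4 i)) [0..<k]) \<subseteq> setof s3 ''S''" using * K.s_K unfolding K.K_def by auto
      note sub = this
      have "\<not> good_cut G X (setof s ''B'') (arr s ''o'' ` set js)"
      proof
        assume gc: "good_cut G X (setof s ''B'') (arr s ''o'' ` set js)"
        have "\<nexists>c. is_cycle G c \<and> set c \<subseteq> setof s3 ''S''"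
          by (rule conjunct2[OF gc[unfolded good_cut_def], rule_format, OF m(1)[unfolded S2] m(2)])
        then show False by (rule notE) (rule exI, rule conjI[OF K.ends_cycle sub])
      qed
      then show ?thesis using * f4 unfolding t4 by simp
    qed
  qed
qed

lemma search_spec:
  fixes jss :: "nat list list"
  assumes "env s" "var s ''found'' = 0 \<or> var s ''found'' = 1 \<and> induced_tree_containing G X (setof s ''S'')"
  defines "t \<equiv> run (seqs (map (try_prog k) jss)) s"
  shows "env t \<and> arr t ''B'' = arr s ''B'' \<and> (var t ''found'' = 1 \<and> induced_tree_containing G X (setof t ''S'') \<or>
    var t ''found'' = 0 \<and> (\<forall>js\<in>set jss. \<not> good_cut G X (setof s ''B'') (arr s ''o'' ` set js)))"
  using assms(1,2) unfolding t_def
proof (induction jss arbitrary: s)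
  case (Cons js jss)
  let ?s = "run (try_prog k js) s"
  have e: "env ?s" by (rule env_run[OF Cons.prems(1)]) (rule notin_superset[OF wvars_try] notin_superset[OF warrs_try], simp)+
  have B: "arr ?s ''B'' = arr s ''B''" and O: "arr ?s ''o'' = arr s ''o''" by (rule run_arr, rule notin_superset[OF warrs_try], simp)+
  have SB: "setof ?s ''B'' = setof s ''B''" using B by (simp add: setof_def)
  show ?case
  proof (cases "var s ''found'' = 0")
    case True
    note T = try_prog_spec[OF Cons.prems(1) True, of js]
    then have "var ?s ''found'' = 0 \<or> var ?s ''found'' = 1 \<and> induced_tree_containing G X (setof ?s ''S'')" by blast
    from Cons.IH[OF e this] T show ?thesis unfolding B O SB
    proof (cases "var ?s ''found'' = 0")
      case F: False
      have skip: "run (seqs (map (try_prog k) jss)) r = r" if "var r ''found'' \<noteq> 0" for r jss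
        using that by (induction jss) (auto simp: try_prog_def)
      show ?thesis using T e B skip[OF F] F by simp
    qed simp
  next
    case False
    have "run (try_prog k js) s = s" using False by (simp add: try_prog_def)
    moreover have skip: "run (seqs (map (try_prog k) jss)) s = s"
      using False by (induction jss) (auto simp: try_prog_def)
    ultimately show ?thesis using Cons.prems False by simp
  qed
qed auto

text \<open>The third outcome is phrased to fit \<open>leaky_structure\<close> and
  \<open>K4_leaky_structure\<close>: it provides their hypotheses and denies the alternative of a
  good cut.\<close>

lemma stage_prog_spec:
  assumes e: "env s" and st: "\<And>t. t \<in> set ts \<Longrightarrow> static (snd t) \<and> (\<forall>d\<in>set (fst t). static d) \<and> aval (snd t) s < n"
    and so: "\<And>e. e \<in> set os \<Longrightarrow> static e"
  defines "t \<equiv> run (stage_prog k ts os) s" and "T \<equiv> (\<lambda>t. ((\<lambda>d. aval d s) ` set (fst t), aval (snd t) s)) ` set ts"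
  shows "env t \<and> (var t ''found'' = 2 \<and> \<not> leaky G X T (verts G) \<and> (\<forall>a\<in>{''path'', ''len'', ''row'', ''branch''}. arr t a = arr s a) \<or>
    var t ''found'' = 1 \<and> induced_tree_containing G X (setof t ''S'') \<or>
    var t ''found'' = 0 \<and> setof s ''S'' \<subseteq> setof t ''B'' \<and> leaky G X T (setof t ''B'') \<and>
      (\<forall>u\<in>setof t ''B'' - setof s ''S''. \<not> leaky G X T (setof t ''B'' - {u})) \<and>
      \<not> (\<exists>U\<subseteq>(\<lambda>e. aval e s) ` set os. good_cut G X (setof t ''B'') U))"
proof -
  define s1 where "s1 = run (option_prog os (length os)) (set_var ''found'' 0 s)"
  define s2 where "s2 = run (copy_prog ''S'' ''keep'') s1"
  define s3 where "s3 = run (fill_prog ''S'' 1) s2"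
  define s4 where "s4 = run (leaky_test k ts) s3"
  have s1a: "arr s1 a = arr s a" if "a \<noteq> ''o''" for a
    using that wvars_option(2)[of os "length os"] run_arr[of a "option_prog os (length os)" "set_var ''found'' 0 s"] by (auto simp: s1_def)
  have s1v: "var s1 ''found'' = 0" "var s1 ''n'' = var s ''n''" by (simp_all add: s1_def run_var wvars_option)
  have e1: "env s1" using e s1a s1v unfolding env_def by simp
  have o1: "arr s1 ''o'' j = aval (os ! j) s" if "j < length os" for j
  proof -
    have "aval (os ! j) (set_var ''found'' 0 s) = aval (os ! j) s" by (rule static_cong[OF so[OF nth_mem[OF that]]]) simp
    then show ?thesis unfolding s1_def using option_values[OF so order_refl that, of "set_var ''found'' 0 s"] by (rule trans[rotated])
  qed
  have e2: "env s2" using env_run[OF e1] by (simp add: s2_def)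
  have e3: "env s3" using env_run[OF e2] by (simp add: s3_def)
  have e4: "env s4" unfolding s4_def by (rule env_run[OF e3]) (rule notin_superset[OF wvars_leaky(1)] notin_superset[OF wvars_leaky(2)], simp)+
  have lw: "''S'' \<notin> warrs (leaky_test k ts)" "''keep'' \<notin> warrs (leaky_test k ts)" "''o'' \<notin> warrs (leaky_test k ts)"
    "''path'' \<notin> warrs (leaky_test k ts)" "''len'' \<notin> warrs (leaky_test k ts)" "''row'' \<notin> warrs (leaky_test k ts)"
    "''branch'' \<notin> warrs (leaky_test k ts)" "''found'' \<notin> wvars (leaky_test k ts)"
    by (rule notin_superset[OF wvars_leaky(1)] notin_superset[OF wvars_leaky(2)], simp)+
  have "setof s2 ''keep'' = setof s1 ''S''" unfolding s2_def by (rule setof_copy[OF env_n[OF e1]]) simp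
  then have K2: "setof s2 ''keep'' = setof s ''S''" using s1a by (simp add: setof_def)
  have K4: "setof s4 ''keep'' = setof s ''S''" unfolding K2[symmetric] by (rule setof_cong) (simp add: s4_def s3_def run_arr lw)
  have S3: "setof s3 ''S'' = verts G" using fill_value[OF env_n[OF e2]] by (auto simp: s3_def setof_def vertices)
  have S4: "setof s4 ''S'' = verts G" unfolding S3[symmetric] by (rule setof_cong) (simp add: s4_def run_arr lw)
  have st3: "arr s3 a = arr s a" "arr s4 a = arr s a" if "a \<in> {''path'', ''len'', ''row'', ''branch''}" for a
    using that s1a lw by (auto simp: s4_def s3_def s2_def run_arr)
  have f4: "var s4 ''found'' = 0" using s1v(1) lw by (simp add: s4_def s3_def s2_def run_var)
  have o4: "arr s4 ''o'' = arr s1 ''o''" using lw by (simp add: s4_def s3_def s2_def run_arr)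
  have test: "var (run (leaky_test k ts) r) ''ok'' \<noteq> 0 \<longleftrightarrow> leaky G X T (setof r ''S'')"
    if er: "env r" and r: "\<forall>a\<in>{''path'', ''len'', ''row'', ''branch''}. arr r a = arr s a" for r
  proof -
    have same: "aval d r = aval d s" if "static d" for d using that r unfolding static_def by blast
    have "(\<lambda>t. ((\<lambda>d. aval d r) ` set (fst t), aval (snd t) r)) ` set ts = T"
      unfolding T_def using same st by (intro image_cong refl) (auto intro!: image_cong)
    moreover have "static (snd t) \<and> (\<forall>d\<in>set (fst t). static d) \<and> aval (snd t) r < n" if "t \<in> set ts" for t
      using st[OF that] same by simp
    ultimately show ?thesis using leaky_test_ok[OF er, of ts] by simp
  qed
  have ok4: "var s4 ''ok'' \<noteq> 0 \<longleftrightarrow> leaky G X T (verts G)"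
    using test[OF e3] st3(1) unfolding s4_def S3 by blast
  have tp: "run (test_prog k ts os) s = s4" by (simp add: test_prog_def s4_def s3_def s2_def s1_def)
  show ?thesis
  proof (cases "var s4 ''ok'' = 0")
    case True
    then have t: "t = set_var ''found'' 2 s4" by (simp add: t_def stage_prog_def tp)
    show ?thesis unfolding t using e4 ok4 True st3(2) by (simp add: env_set_var)
  next
    case False
    define s5 where "s5 = run (greedy_prog (leaky_test k ts) ''keep'') s4"
    define s6 where "s6 = run (copy_prog ''S'' ''B'') s5"
    have t: "t = run (seqs (map (try_prog k) (subseqs [0..<length os]))) s6"
      using False by (simp add: t_def stage_prog_def tp s6_def s5_def)
    have gw: "wvars (greedy_prog (leaky_test k ts) ''keep'') \<subseteq> {''g'', ''u'', ''a'', ''b'', ''c'', ''r'', ''ok''}"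
      "warrs (greedy_prog (leaky_test k ts) ''keep'') \<subseteq> {''S'', ''W'', ''R''}"
      using wvars_leaky[of k ts] by (simp_all add: greedy_prog_def subset_insertI2)
    have e5: "env s5" unfolding s5_def by (rule env_run[OF e4]) (rule notin_superset[OF gw(1)] notin_superset[OF gw(2)], simp)+
    have e6: "env s6" using env_run[OF e5] by (simp add: s6_def)
    have "setof s5 ''S'' \<subseteq> setof s4 ''S'' \<and> setof s4 ''S'' \<inter> setof s4 ''keep'' \<subseteq> setof s5 ''S'' \<and> leaky G X T (setof s5 ''S'') \<and>
      (\<forall>u\<in>setof s5 ''S'' - setof s4 ''keep''. \<not> leaky G X T (setof s5 ''S'' - {u}))"
      unfolding s5_def
    proof (rule greedy_set[OF e4])
      show "wvars (leaky_test k ts) \<subseteq> {''u'', ''a'', ''b'', ''c'', ''r'', ''ok''}" "warrs (leaky_test k ts) \<subseteq> {''W'', ''R''}" by (rule wvars_leaky)+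
      show "leaky G X T (setof s4 ''S'')" using False ok4 S4 by simp
      show "\<And>A B. leaky G X T A \<Longrightarrow> A \<subseteq> B \<Longrightarrow> leaky G X T B" by (rule leaky_mono)
      fix r assume r: "env r" "\<forall>a. a \<notin> {''S'', ''W'', ''R''} \<longrightarrow> arr r a = arr s4 a"
      show "var (run (leaky_test k ts) r) ''ok'' \<noteq> 0 \<longleftrightarrow> leaky G X T (setof r ''S'')"
        by (rule test[OF r(1)]) (use r(2) st3(2) in auto)
    qed simp
    moreover have B6: "setof s6 ''B'' = setof s5 ''S''" unfolding s6_def by (rule setof_copy[OF env_n[OF e5]]) simp
    ultimately have g: "setof s ''S'' \<subseteq> setof s6 ''B''" "leaky G X T (setof s6 ''B'')"
      "\<forall>u\<in>setof s6 ''B'' - setof s ''S''. \<not> leaky G X T (setof s6 ''B'' - {u})"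
      using setof_verts[of s "''S''"] unfolding B6 S4 K4 by auto
    have "''found'' \<notin> wvars (greedy_prog (leaky_test k ts) ''keep'')" "''o'' \<notin> warrs (greedy_prog (leaky_test k ts) ''keep'')" 
      by (rule notin_superset[OF gw(1)] notin_superset[OF gw(2)], simp)+
    then have f6: "var s6 ''found'' = 0" and o6: "arr s6 ''o'' = arr s1 ''o''"
      using f4 o4 by (simp_all add: s6_def s5_def run_var run_arr)
    from search_spec[OF e6, of "subseqs [0..<length os]", folded t] f6
    have fin: "env t" "arr t ''B'' = arr s6 ''B''" "var t ''found'' = 1 \<and> induced_tree_containing G X (setof t ''S'') \<or>
      var t ''found'' = 0 \<and> (\<forall>js\<in>set (subseqs [0..<length os]). \<not> good_cut G X (setof s6 ''B'') (arr s6 ''o'' ` set js))" by auto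
    have B: "setof t ''B'' = setof s6 ''B''" using fin(2) by (simp add: setof_def)
    have "\<not> (\<exists>U\<subseteq>(\<lambda>e. aval e s) ` set os. good_cut G X (setof t ''B'') U)"
      if none: "\<forall>js\<in>set (subseqs [0..<length os]). \<not> good_cut G X (setof s6 ''B'') (arr s6 ''o'' ` set js)"
    proof
      assume "\<exists>U\<subseteq>(\<lambda>e. aval e s) ` set os. good_cut G X (setof t ''B'') U"
      then obtain U where U: "U \<subseteq> (\<lambda>e. aval e s) ` set os" "good_cut G X (setof t ''B'') U" by blast
      have "(\<lambda>e. aval e s) ` set os = arr s6 ''o'' ` {..<length os}"
        unfolding o6 using o1 by (force simp: in_set_conv_nth image_iff)
      \<comment> \<open>The search runs over sets of positions in \<open>''o''\<close>; different
        positions may hold the same vertex, so \<open>U\<close> has only to be the image of some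
        \<open>J\<close>.\<close>
      then obtain J where J: "J \<subseteq> {..<length os}" "U = arr s6 ''o'' ` J" using U(1) by (metis subset_imageE)
      then have "J \<in> set ` set (subseqs [0..<length os])" unfolding subseqs_powset by (simp add: atLeast0LessThan)
      then show False using none J(2) U(2) B by auto
    qed
    then show ?thesis using fin g unfolding B by blast
  qed
qed

end

section \<open>Recovering and testing a K4 structure\<close>

definition K4_list :: "(nat \<times> nat) list" where
  "K4_list = [(0,1), (0,2), (0,3), (1,2), (1,3), (2,3)]"

lemma set_K4_list: "set K4_list = K4_pairs"
  by (simp add: K4_list_def K4_pairs_eq)

lemma K4_index_bij: "bij_betw K4_index K4_pairs {..<6}"
proof -
  have m: "map K4_index K4_list = [0, 1, 2, 3, 4, 5]" by (simp add: K4_list_def K4_index_def)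
  then have "distinct (map K4_index K4_list)" by simp
  then have "inj_on K4_index K4_pairs" unfolding distinct_map set_K4_list by (rule conjunct2)
  moreover have "K4_index ` K4_pairs = {..<6}"
    using arg_cong[OF m, of set] unfolding set_map set_K4_list lessThan_6 by (simp only: list.set)
  ultimately show ?thesis unfolding bij_betw_def by (rule conjI)
qed

definition K4_check :: "nat list \<Rightarrow> bexp" where
  "K4_check \<pi> = allb (concat (map (\<lambda>e. [nonzero (edge_exp (branch_exp (fst e)) (end_exp (\<pi> ! K4_index e))),
     nonzero (edge_exp (branch_exp (snd e)) (end_exp (\<pi> ! K4_index e)))]) K4_list))"

text \<open>The branch vertices are what remains of \<open>''B''\<close> once the six paths are
  removed. They are numbered as they come, and the paths are then arranged to fit this
  numbering.\<close>

definition K4_prog :: prog where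
  "K4_prog = seqs [copy_prog ''B'' ''S'', copy_prog ''S'' ''Z'', emit_prog 6 [0..<6], branch_prog, pick_prog 6 K4_check (perms 6)]"

definition K4_test_exps :: "(aexp list \<times> aexp) list" where
  "K4_test_exps = map (\<lambda>e. ([branch_exp (fst e), branch_exp (snd e)], head_exp (K4_index e))) K4_list @
     map (\<lambda>e. ([end_exp (K4_index e)], head_exp (K4_index e))) K4_list"

definition K4_opt_exps :: "aexp list" where
  "K4_opt_exps = map branch_exp [0..<4] @ map (\<lambda>e. end_exp (K4_index e)) K4_list @ map (\<lambda>e. pre_exp (K4_index e)) K4_list"

lemma length_out_path [simp]: "length (out_path n s i) = arr s ''len'' i"
  by (simp add: out_path_def)

lemma out_path_arrs: "arr t ''path'' = arr s ''path'' \<Longrightarrow> arr t ''len'' = arr s ''len'' \<Longrightarrow> out_path n t = out_path n s"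
  by (simp add: out_path_def fun_eq_iff)

context instance_graph
begin

lemma head_value: "env s \<Longrightarrow> i < n \<Longrightarrow> 0 < arr s ''len'' i \<Longrightarrow> aval (head_exp i) s = hd (out_path n s i)"
proof -
  assume e: "env s" "i < n" "0 < arr s ''len'' i"
  have "hd (out_path n s i) = out_path n s i ! 0" using e(3) by (intro hd_conv_nth) (auto simp: out_path_def)
  then show ?thesis using e by (simp add: head_exp_def env_def out_path_def)
qed

lemma pre_value: "env s \<Longrightarrow> i < n \<Longrightarrow> 2 \<le> arr s ''len'' i \<Longrightarrow> aval (pre_exp i) s = out_path n s i ! (length (out_path n s i) - 2)"
  by (simp add: pre_exp_def env_def out_path_def)

end

locale tree_instance6 = tree_instance n G 6 x for n G x

sublocale tree_instance6 \<subseteq> kgraph6 G "x ` {..<6}"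
  by unfold_locales

context tree_instance6
begin

lemma K4_walk:
  assumes K: "K4s w P" and e: "e \<in> K4_pairs"
  shows "walk (K4_verts w P) (hd (P e)) = P e"
proof -
  note KD = K4sD[OF K]
  obtain i j where ij: "e = (i, j)" by (cases e)
  have lt: "i < j" "j < 4" "i < 4" using e ij by (auto simp: K4_pairs_def)
  show ?thesis
  proof (rule walk_determined)
    show "distinct (P e)" "2 \<le> length (P e)" "set (P e) \<subseteq> K4_verts w P" "K4_verts w P \<subseteq> verts G"
      by (rule KD(5)[OF e] KD(4)[OF e] KD(8)[OF e] KD(10))+
    show "w i \<noteq> w j" using inj_onD[OF KD(2), of i j] lt by auto
    show "w i \<in> K4_verts w P - set (P e)" "w j \<in> K4_verts w P - set (P e)"
      using KD(9)[OF lt(3)] KD(7)[OF e lt(3)] KD(9)[OF lt(2)] KD(7)[OF e lt(2)] by blast+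
    show "adj G (last (P e)) (w i)" "adj G (last (P e)) (w j)"
      using K4_adj[OF K e lt(3)] K4_adj[OF K e lt(2)] adj_commute[of G "last (P e)"] ij by auto
  next
    fix a assume a: "Suc a < length (P e)"
    have "{P e ! a, P e ! Suc a} \<in> path_edges (P e)" unfolding path_edges_def using a by blast
    then have "{P e ! a, P e ! Suc a} \<in> edges (induced G (K4_verts w P))" unfolding KD(3) using e by blast
    then show "adj G (P e ! a) (P e ! Suc a)" by (simp add: adj_def induced_def)
  next
    fix a u assume a: "Suc a < length (P e)" and u: "u \<in> K4_verts w P" "adj G (P e ! a) u"
    have al: "a < length (P e)" using a by simp
    have pa: "P e ! a \<in> set (P e)" by (rule nth_mem[OF al])
    have same: "f = e" if "f \<in> K4_pairs" "P e ! a \<in> set (P f)" for f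
      using KD(6)[OF e that(1)] pa that(2) by blast
    have "{P e ! a, u} \<in> edges (induced G (K4_verts w P))"
      using u subsetD[OF KD(8)[OF e] pa] by (auto simp: adj_def induced_def)
    then have "(\<exists>f\<in>K4_pairs. {P e ! a, u} \<in> path_edges (P f)) \<or>
      (\<exists>f\<in>K4_pairs. {P e ! a, u} = {w (fst f), last (P f)} \<or> {P e ! a, u} = {w (snd f), last (P f)})"
      unfolding KD(3) by (simp add: split_beta)
    then show "u = P e ! Suc a \<or> 0 < a \<and> u = P e ! (a - 1)"
    proof
      assume "\<exists>f\<in>K4_pairs. {P e ! a, u} \<in> path_edges (P f)"
      then obtain f where f: "f \<in> K4_pairs" "{P e ! a, u} \<in> path_edges (P f)" by blast
      have "f = e" using same[OF f(1)] path_edges_sub[OF f(2)] by blast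
      then obtain b where b: "{P e ! a, u} = {P e ! b, P e ! Suc b}" "Suc b < length (P e)"
        using f(2) unfolding path_edges_def by blast
      have bl: "b < length (P e)" using b(2) by simp
      from b(1) have "P e ! a = P e ! b \<and> u = P e ! Suc b \<or> P e ! a = P e ! Suc b \<and> u = P e ! b"
        by (simp only: doubleton_eq_iff)
      then show ?thesis
        unfolding nth_eq_iff_index_eq[OF KD(5)[OF e] al bl] nth_eq_iff_index_eq[OF KD(5)[OF e] al b(2)] by auto
    next
      assume "\<exists>f\<in>K4_pairs. {P e ! a, u} = {w (fst f), last (P f)} \<or> {P e ! a, u} = {w (snd f), last (P f)}"
      then obtain f where f: "f \<in> K4_pairs" "{P e ! a, u} = {w (fst f), last (P f)} \<or> {P e ! a, u} = {w (snd f), last (P f)}" by blast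
      have f4: "fst f < 4" "snd f < 4" using f(1) by (auto simp: K4_pairs_def)
      have "P e ! a = w (fst f) \<or> P e ! a = w (snd f) \<or> P e ! a = last (P f)" using f(2) by blast
      moreover have "P e ! a \<noteq> w (fst f)" "P e ! a \<noteq> w (snd f)" using KD(7)[OF e f4(1)] KD(7)[OF e f4(2)] pa by metis+
      ultimately have l: "P e ! a = last (P f)" by blast
      then have "P e ! a \<in> set (P f)" using KD(11)[OF f(1)] by simp
      then have "P e ! a = last (P e)" using same[OF f(1)] l by simp
      also have "\<dots> = P e ! (length (P e) - 1)" using KD(4)[OF e] by (intro last_conv_nth) auto
      finally have "a = length (P e) - 1" using nth_eq_iff_index_eq[OF KD(5)[OF e] al, of "length (P e) - 1"] KD(4)[OF e] by simp
      then show ?thesis using a by simp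
    qed
  qed
qed

lemma K4_check_iff:
  assumes e: "env s" and \<pi>: "\<pi> \<in> set (perms 6)" and len: "\<And>i. i < 6 \<Longrightarrow> 0 < arr s ''len'' i"
    and W: "\<And>i. i < 6 \<Longrightarrow> last (out_path n s i) < n" and b: "\<And>i. i < 4 \<Longrightarrow> arr s ''branch'' i < n"
  shows "bval (K4_check \<pi>) s \<longleftrightarrow> (\<forall>f\<in>K4_pairs. adj G (arr s ''branch'' (fst f)) (last (out_path n s (\<pi> ! K4_index f))) \<and>
    adj G (arr s ''branch'' (snd f)) (last (out_path n s (\<pi> ! K4_index f))))"
proof -
  have ev: "aval (end_exp i) s = last (out_path n s i)" if "i < 6" for i
    using end_value[OF e _ len[OF that]] k_n that by simp
  have ed: "aval (edge_exp (branch_exp i) (end_exp q)) s \<noteq> 0 \<longleftrightarrow> adj G (arr s ''branch'' i) (last (out_path n s q))" if "i < 4" "q < 6" for i q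
    using edge_value[OF e, of "branch_exp i" "end_exp q"] W[OF that(2)] b[OF that(1)] unfolding ev[OF that(2)]
    by (simp add: branch_exp_def)
  have q: "\<pi> ! K4_index f < 6" "fst f < 4" "snd f < 4" if "f \<in> K4_pairs" for f
  proof -
    have "K4_index f < 6" using K4_index_bij that by (auto simp: bij_betw_def)
    then show "\<pi> ! K4_index f < 6" using perms_bij[OF \<pi>] by (auto simp: bij_betw_def)
    show "fst f < 4" "snd f < 4" using that by (auto simp: K4_pairs_def)
  qed
  have "bval (K4_check \<pi>) s \<longleftrightarrow> (\<forall>f\<in>K4_pairs. aval (edge_exp (branch_exp (fst f)) (end_exp (\<pi> ! K4_index f))) s \<noteq> 0 \<and>
    aval (edge_exp (branch_exp (snd f)) (end_exp (\<pi> ! K4_index f))) s \<noteq> 0)"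
    unfolding K4_check_def bval_allb by (simp add: set_K4_list ball_UN)
  also have "\<dots> \<longleftrightarrow> (\<forall>f\<in>K4_pairs. adj G (arr s ''branch'' (fst f)) (last (out_path n s (\<pi> ! K4_index f))) \<and>
    adj G (arr s ''branch'' (snd f)) (last (out_path n s (\<pi> ! K4_index f))))"
    using ed[OF q(2) q(1)] ed[OF q(3) q(1)] by (intro ball_cong refl) blast
  finally show ?thesis .
qed

lemma K4_static_check:
  assumes "\<And>a. arr t a = arr s a"
  shows "bval (K4_check \<pi>) t \<longleftrightarrow> bval (K4_check \<pi>) s"
  unfolding K4_check_def bval_allb by (simp add: edge_exp_def end_exp_def branch_exp_def assms ball_UN)

text \<open>\<open>K4\<close> is symmetric in its branch vertices, so every numbering of them
  extends to a labelling of the structure. It remains to see that some order of the paths passes the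
  check, and \<open>K4_relabel\<close> accepts whichever one does.\<close>

lemma K4_prog_spec:
  assumes e: "env s" and K: "K4s w Q" and B: "setof s ''B'' = K4_verts w Q"
  defines "t \<equiv> run K4_prog s"
  shows "env t \<and> K4s (arr t ''branch'') (\<lambda>e. out_path n t (K4_index e)) \<and>
    setof t ''S'' = K4_verts (arr t ''branch'') (\<lambda>e. out_path n t (K4_index e))"
proof -
  let ?S = "K4_verts w Q"
  note KD = K4sD[OF K]
  define s1 where "s1 = run (copy_prog ''S'' ''Z'') (run (copy_prog ''B'' ''S'') s)"
  define s2 where "s2 = run (emit_prog 6 [0..<6]) s1"
  define s3 where "s3 = run branch_prog s2"
  have e0: "env (run (copy_prog ''B'' ''S'') s)" using env_run[OF e] by simp
  have S0: "setof (run (copy_prog ''B'' ''S'') s) ''S'' = ?S" using setof_copy[OF env_n[OF e], of "''B''" "''S''"] B by simp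
  have e1: "env s1" using env_run[OF e0] by (simp add: s1_def)
  have Z1: "setof s1 ''Z'' = ?S" using setof_copy[OF env_n[OF e0], of "''S''" "''Z''"] S0 by (simp add: s1_def)
  have S1: "setof s1 ''S'' = ?S" unfolding S0[symmetric] s1_def by (rule setof_cong) (simp add: run_arr)
  have ew: "''n'' \<notin> wvars (emit_prog 6 \<pi>)" "''f'' \<notin> wvars (emit_prog 6 \<pi>)" "''S'' \<notin> warrs (emit_prog 6 \<pi>)" "''adj'' \<notin> warrs (emit_prog 6 \<pi>)"
    "''row'' \<notin> warrs (emit_prog 6 \<pi>)" "''term'' \<notin> warrs (emit_prog 6 \<pi>)" "''branch'' \<notin> warrs (emit_prog 6 \<pi>)" for \<pi>
    by (rule notin_superset[OF wvars_emit(1)] notin_superset[OF wvars_emit(2)], simp)+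
  have e2: "env s2" unfolding s2_def by (rule env_run[OF e1 ew(1,4,5,6)])
  have e3: "env s3" using env_run[OF e2] by (simp add: s3_def)
  have S3: "setof s3 ''S'' = ?S" unfolding S1[symmetric] by (rule setof_cong) (simp add: s3_def s2_def run_arr ew)
  have k6: "[0..<6] ! i < 6" if "i < 6" for i using that by simp
  note es = emit_spec[OF e1 k_n k6, folded s2_def, unfolded S1 Z1]
  define \<eta> where "\<eta> = inv_into K4_pairs (\<lambda>e. hd (Q e)) \<circ> x"
  have \<eta>: "bij_betw \<eta> {..<6} K4_pairs" unfolding \<eta>_def by (rule bij_betw_trans[OF x_bij bij_betw_inv_into[OF KD(1)]])
  have \<eta>p: "\<eta> i \<in> K4_pairs" if "i < 6" for i using \<eta> that by (auto simp: bij_betw_def)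
  have h\<eta>: "hd (Q (\<eta> i)) = x i" if "i < 6" for i
    using bij_betw_inv_into_right[OF KD(1), of "x i"] that by (simp add: \<eta>_def)
  have W: "walk ?S (x i) = Q (\<eta> i)" if "i < 6" for i using K4_walk[OF K \<eta>p[OF that]] unfolding h\<eta>[OF that] .
  have o2: "out_path n s2 i = Q (\<eta> i)" "0 < arr s2 ''len'' i" if i: "i < 6" for i
  proof -
    have "out_path n s2 i = walk ?S (x ([0..<6] ! i))" using es i by blast
    then show "out_path n s2 i = Q (\<eta> i)" using W[OF i] i by simp
    show "0 < arr s2 ''len'' i" using es i by blast
  qed
  have "(\<Union>i<6. set (walk ?S (x ([0..<6] ! i)))) = (\<Union>i<6. set (Q (\<eta> i)))" by (rule SUP_cong) (use W in auto)
  also have "\<dots> = (\<Union>e\<in>\<eta> ` {..<6}. set (Q e))" by simp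
  also have "\<eta> ` {..<6} = K4_pairs" using \<eta> by (simp add: bij_betw_def)
  finally have "setof s2 ''Z'' = ?S - (\<Union>e\<in>K4_pairs. set (Q e))" using es by simp
  also have "\<dots> = w ` {..<4}" using KD(7) unfolding K4_verts_def by blast
  finally have Z2: "setof s2 ''Z'' = w ` {..<4}" .
  have c4: "card (w ` {..<4}) = 4" using KD(2) by (simp add: card_image)
  define b where "b = arr s3 ''branch''"
  have b: "b ` {..<4} = w ` {..<4}" using branch_spec[OF e2] unfolding Z2 c4 b_def s3_def .
  have bi: "inj_on b {..<4}" by (rule eq_card_imp_inj_on) (use b c4 in auto)
  have o3: "out_path n s3 = out_path n s2" by (rule out_path_arrs) (simp_all add: s3_def run_arr)
  have l3: "0 < arr s3 ''len'' i" if "i < 6" for i using o2(2)[OF that] by (simp add: s3_def run_arr)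
  have lQ: "last (out_path n s3 i) < n" if "i < 6" for i
  proof -
    have "last (Q (\<eta> i)) \<in> verts G" using KD(11)[OF \<eta>p[OF that]] KD(8)[OF \<eta>p[OF that]] KD(10) by blast
    then show ?thesis unfolding o3 o2(1)[OF that] vertices by simp
  qed
  have bn: "arr s3 ''branch'' i < n" if "i < 4" for i
  proof -
    have "b i \<in> w ` {..<4}" using b that by blast
    then obtain j where j: "j < 4" "b i = w j" by auto
    have "w j \<in> verts G" using KD(9)[OF j(1)] KD(10) by blast
    then show ?thesis using j(2) vertices unfolding b_def by simp
  qed
  have check: "bval (K4_check \<pi>) s3 \<longleftrightarrow> (\<forall>f\<in>K4_pairs. adj G (b (fst f)) (last (out_path n s2 (\<pi> ! K4_index f))) \<and>
    adj G (b (snd f)) (last (out_path n s2 (\<pi> ! K4_index f))))" if "\<pi> \<in> set (perms 6)" for \<pi>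
    using K4_check_iff[OF e3 that l3 lQ bn] unfolding o3 b_def .
  have t: "t = run (pick_prog 6 K4_check (perms 6)) s3" by (simp add: t_def K4_prog_def s3_def s2_def s1_def)
  have pick: "(\<exists>\<pi>\<in>set (perms 6). bval (K4_check \<pi>) s3 \<and> t = run (emit_prog 6 \<pi>) (set_var ''f'' 1 s3)) \<or>
    (\<forall>\<pi>\<in>set (perms 6). \<not> bval (K4_check \<pi>) s3) \<and> t = set_var ''f'' 0 s3"
    unfolding t by (rule pick_spec) (rule K4_static_check, simp)
  \<comment> \<open>Translates the numbering in the array \<open>''branch''\<close> into the labels
    of \<open>w\<close>.\<close>
  define \<rho> where "\<rho> = inv_into {..<4} w \<circ> b"
  have wb: "bij_betw w {..<4} (w ` {..<4})" "bij_betw b {..<4} (w ` {..<4})" using KD(2) bi b by (simp_all add: bij_betw_def)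
  have \<rho>: "bij_betw \<rho> {..<4} {..<4}" unfolding \<rho>_def by (rule bij_betw_trans[OF wb(2) bij_betw_inv_into[OF wb(1)]])
  have \<rho>4: "\<rho> i < 4" if "i < 4" for i using \<rho> that by (auto simp: bij_betw_def)
  have w\<rho>: "w (\<rho> i) = b i" if "i < 4" for i
    using bij_betw_inv_into_right[OF wb(1), of "b i"] b that by (auto simp: \<rho>_def)
  \<comment> \<open>Read from right to left: the pair with a given output index, its translation by
    \<open>\<rho>\<close>, and the number of the terminal whose walk traced that path. This is the
    order that certainly passes.\<close>
  define \<pi>0 where "\<pi>0 = inv_into {..<6} \<eta> \<circ> (pair_map \<rho> \<circ> inv_into K4_pairs K4_index)"
  have b0: "bij_betw \<pi>0 {..<6} {..<6}" unfolding \<pi>0_def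
    by (rule bij_betw_trans[OF bij_betw_trans[OF bij_betw_inv_into[OF K4_index_bij] bij_pair_map[OF \<rho>]] bij_betw_inv_into[OF \<eta>]])
  have i6: "K4_index f < 6" if "f \<in> K4_pairs" for f using K4_index_bij that by (auto simp: bij_betw_def)
  have \<pi>0: "\<eta> (\<pi>0 (K4_index f)) = pair_map \<rho> f" "\<pi>0 (K4_index f) < 6" if f: "f \<in> K4_pairs" for f
  proof -
    have "inv_into K4_pairs K4_index (K4_index f) = f" by (rule bij_betw_inv_into_left[OF K4_index_bij f])
    moreover have "pair_map \<rho> f \<in> K4_pairs" using bij_pair_map[OF \<rho>] f by (auto simp: bij_betw_def)
    ultimately show "\<eta> (\<pi>0 (K4_index f)) = pair_map \<rho> f"
      using bij_betw_inv_into_right[OF \<eta>, of "pair_map \<rho> f"] by (simp add: \<pi>0_def)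
    show "\<pi>0 (K4_index f) < 6" using b0 i6[OF f] by (auto simp: bij_betw_def)
  qed
  have "bval (K4_check (map \<pi>0 [0..<6])) s3"
    unfolding check[OF map_perms[OF b0]]
  proof
    fix f assume f: "f \<in> K4_pairs"
    obtain i j where ij: "f = (i, j)" by (cases f)
    have lt: "i < 4" "j < 4" using f ij by (auto simp: K4_pairs_def)
    have m: "map \<pi>0 [0..<6] ! K4_index f = \<pi>0 (K4_index f)" using i6[OF f] by simp
    have p: "pair_map \<rho> f \<in> K4_pairs" using bij_pair_map[OF \<rho>] f by (auto simp: bij_betw_def)
    have fs: "\<rho> i = fst (pair_map \<rho> f) \<or> \<rho> i = snd (pair_map \<rho> f)" "\<rho> j = fst (pair_map \<rho> f) \<or> \<rho> j = snd (pair_map \<rho> f)"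
      unfolding ij pair_map_def by (simp_all add: min_def max_def)
    have "adj G (w (\<rho> i)) (last (Q (pair_map \<rho> f)))" "adj G (w (\<rho> j)) (last (Q (pair_map \<rho> f)))"
      using K4_adj[OF K p \<rho>4[OF lt(1)]] K4_adj[OF K p \<rho>4[OF lt(2)]] fs by blast+
    then have A: "adj G (b i) (last (Q (pair_map \<rho> f)))" "adj G (b j) (last (Q (pair_map \<rho> f)))"
      unfolding w\<rho>[OF lt(1)] w\<rho>[OF lt(2)] .
    have o: "out_path n s2 (map \<pi>0 [0..<6] ! K4_index f) = Q (pair_map \<rho> f)"
      unfolding m o2(1)[OF \<pi>0(2)[OF f]] \<pi>0(1)[OF f] ..
    show "adj G (b (fst f)) (last (out_path n s2 (map \<pi>0 [0..<6] ! K4_index f))) \<and>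
      adj G (b (snd f)) (last (out_path n s2 (map \<pi>0 [0..<6] ! K4_index f)))"
      unfolding o using A ij by simp
  qed
  then obtain \<pi> where \<pi>: "\<pi> \<in> set (perms 6)" "bval (K4_check \<pi>) s3" "t = run (emit_prog 6 \<pi>) (set_var ''f'' 1 s3)"
    using pick map_perms[OF b0] by blast
  note pb = perms_bij[OF \<pi>(1)]
  have \<pi>6: "\<pi> ! i < 6" if "i < 6" for i using pb that by (auto simp: bij_betw_def)
  have ef: "env (set_var ''f'' 1 s3)" using e3 by (simp add: env_set_var)
  have Sf: "setof (set_var ''f'' 1 s3) ''S'' = ?S" using S3 by (simp add: setof_def)
  note et = emit_spec[OF ef k_n \<pi>6, folded \<pi>(3), unfolded Sf]
  have ot: "out_path n t i = Q (\<eta> (\<pi> ! i))" if i: "i < 6" for i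
    using et i unfolding W[OF \<pi>6[OF i], symmetric] by blast
  have bt: "arr t ''branch'' = b" unfolding \<pi>(3) b_def by (simp add: run_arr ew)
  have St: "setof t ''S'' = ?S" unfolding Sf[symmetric] \<pi>(3) by (rule setof_cong, rule run_arr, rule ew(3))
  have envt: "env t" unfolding \<pi>(3) by (rule env_run[OF ef ew(1,4,5,6)])
  have \<eta>\<pi>: "bij_betw (\<lambda>f. \<eta> (\<pi> ! K4_index f)) K4_pairs K4_pairs"
    using bij_betw_trans[OF bij_betw_trans[OF K4_index_bij pb] \<eta>] by (simp add: comp_def)
  have Pt: "out_path n t (K4_index f) = Q (\<eta> (\<pi> ! K4_index f))" if f: "f \<in> K4_pairs" for f
    by (rule ot[OF i6[OF f]])
  have adjt: "adj G (b i) (last (out_path n t (K4_index (i, j)))) \<and> adj G (b j) (last (out_path n t (K4_index (i, j))))"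
    if f: "(i, j) \<in> K4_pairs" for i j
  proof -
    have "adj G (b (fst (i, j))) (last (out_path n s2 (\<pi> ! K4_index (i, j)))) \<and> adj G (b (snd (i, j))) (last (out_path n s2 (\<pi> ! K4_index (i, j))))"
      using \<pi>(2) unfolding check[OF \<pi>(1)] by (rule bspec[OF _ f])
    then show ?thesis unfolding Pt[OF f] o2(1)[OF \<pi>6[OF i6[OF f]]] fst_conv snd_conv .
  qed
  have "K4s b (\<lambda>f. out_path n t (K4_index f)) \<and> K4_verts b (\<lambda>f. out_path n t (K4_index f)) = ?S"
    by (rule conjI[OF K4_relabel(1,2)[where P' = "\<lambda>f. out_path n t (K4_index f)", OF K b bi \<eta>\<pi> Pt adjt]])
  then show ?thesis unfolding bt St using envt by simp
qed

lemma K4_exps_value: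
  assumes e: "env s" and K: "K4s (arr s ''branch'') (\<lambda>e. out_path n s (K4_index e))"
  shows "(\<lambda>t. ((\<lambda>d. aval d s) ` set (fst t), aval (snd t) s)) ` set K4_test_exps = K4_tests (arr s ''branch'') (\<lambda>e. out_path n s (K4_index e))"
    "(\<lambda>e. aval e s) ` set K4_opt_exps = K4_opts (arr s ''branch'') (\<lambda>e. out_path n s (K4_index e))"
    "t \<in> set K4_test_exps \<Longrightarrow> static (snd t) \<and> (\<forall>d\<in>set (fst t). static d) \<and> aval (snd t) s < n"
    "d \<in> set K4_opt_exps \<Longrightarrow> static d"
proof -
  note KD = K4sD[OF K]
  have i: "K4_index f < n" if "f \<in> K4_pairs" for f
  proof -
    have "K4_index f < 6" using K4_index_bij that by (auto simp: bij_betw_def)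
    then show ?thesis using k_n by simp
  qed
  have l: "2 \<le> arr s ''len'' (K4_index f)" "0 < arr s ''len'' (K4_index f)" if "f \<in> K4_pairs" for f
    using KD(4)[OF that] by auto
  have v: "aval (head_exp (K4_index f)) s = hd (out_path n s (K4_index f))" "aval (end_exp (K4_index f)) s = last (out_path n s (K4_index f))"
    "aval (pre_exp (K4_index f)) s = out_path n s (K4_index f) ! (length (out_path n s (K4_index f)) - 2)" if "f \<in> K4_pairs" for f
    using head_value[OF e i[OF that] l(2)[OF that]] end_value[OF e i[OF that] l(2)[OF that]] pre_value[OF e i[OF that] l(1)[OF that]] by auto
  have b: "aval (branch_exp i) s = arr s ''branch'' i" for i by (simp add: branch_exp_def)
  have "(\<lambda>t. ((\<lambda>d. aval d s) ` set (fst t), aval (snd t) s)) ` set K4_test_exps =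
    (\<lambda>f. ({arr s ''branch'' (fst f), arr s ''branch'' (snd f)}, aval (head_exp (K4_index f)) s)) ` K4_pairs \<union>
    (\<lambda>f. ({aval (end_exp (K4_index f)) s}, aval (head_exp (K4_index f)) s)) ` K4_pairs"
    by (simp add: K4_test_exps_def image_Un image_image set_K4_list b)
  also have "\<dots> = K4_tests (arr s ''branch'') (\<lambda>e. out_path n s (K4_index e))"
    unfolding K4_tests_def using v by (intro arg_cong2[where f = "(\<union>)"] image_cong refl) (auto simp: split_beta)
  finally show "(\<lambda>t. ((\<lambda>d. aval d s) ` set (fst t), aval (snd t) s)) ` set K4_test_exps = K4_tests (arr s ''branch'') (\<lambda>e. out_path n s (K4_index e))" .
  have "(\<lambda>e. aval e s) ` set K4_opt_exps = arr s ''branch'' ` {..<4} \<union> (\<lambda>f. aval (end_exp (K4_index f)) s) ` K4_pairs \<union>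
     (\<lambda>f. aval (pre_exp (K4_index f)) s) ` K4_pairs"
    by (simp add: K4_opt_exps_def image_Un image_image set_K4_list b atLeast0LessThan Un_assoc del: upt_rec_numeral)
  also have "\<dots> = K4_opts (arr s ''branch'') (\<lambda>e. out_path n s (K4_index e))"
    unfolding K4_opts_def using v by (intro arg_cong2[where f = "(\<union>)"] image_cong refl) auto
  finally show "(\<lambda>e. aval e s) ` set K4_opt_exps = K4_opts (arr s ''branch'') (\<lambda>e. out_path n s (K4_index e))" .
  have "hd (out_path n s (K4_index f)) < n" if "f \<in> K4_pairs" for f
  proof -
    have "hd (out_path n s (K4_index f)) \<in> X" using bij_betwE[OF KD(1)] that by blast
    then show ?thesis using x_less by auto
  qed
  then show "static (snd t) \<and> (\<forall>d\<in>set (fst t). static d) \<and> aval (snd t) s < n" if "t \<in> set K4_test_exps"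
    using that v(1) unfolding K4_test_exps_def by (auto simp: set_K4_list static_exps)
  show "static d" if "d \<in> set K4_opt_exps" using that unfolding K4_opt_exps_def by (auto simp: static_exps)
qed

end

section \<open>The main program and its correctness\<close>

text \<open>Joins the hypotheses of \<open>exec_code\<close> with a bound on the nesting depth, so
  that all three pass through the program constructors together.\<close>

definition fits :: "nat \<Rightarrow> prog \<Rightarrow> bool" where
  "fits d p \<longleftrightarrow> loops_ok p \<and> depth p \<le> d \<and> ''n'' \<notin> wvars p"

lemma fits_simps:
  "fits d PSkip" "fits d (PAssign v e) \<longleftrightarrow> v \<noteq> ''n''" "fits d (PStore a e f)"
  "fits d (PSeq p q) \<longleftrightarrow> fits d p \<and> fits d q" "fits d (PIf c p q) \<longleftrightarrow> fits d p \<and> fits d q"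
  "fits d (PFor i p) \<longleftrightarrow> i \<noteq> ''n'' \<and> i \<notin> wvars p \<and> 0 < d \<and> fits (d - 1) p"
  by (cases d; auto simp: fits_def)+

lemma fits_seqs: "fits d (seqs ps) \<longleftrightarrow> (\<forall>p\<in>set ps. fits d p)"
  by (induction ps) (auto simp: fits_simps)

lemma fits_copy: "0 < d \<Longrightarrow> fits d (copy_prog a b)"
  by (simp add: copy_prog_def fits_simps)

lemma fits_fill: "0 < d \<Longrightarrow> fits d (fill_prog a c)"
  by (simp add: fill_prog_def fits_simps)

lemma fits_reach: "3 \<le> d \<Longrightarrow> fits d reach_prog"
  by (simp add: reach_prog_def reach_round_def fits_simps fits_seqs fits_fill) (simp add: reach_inner_def fits_simps)

lemma fits_linked: "3 \<le> d \<Longrightarrow> fits d (linked_test k)"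
  by (simp add: linked_test_def fits_simps fits_copy fits_reach fits_seqs)

lemma fits_leaky: "3 \<le> d \<Longrightarrow> fits d (leaky_test k ts)"
  by (auto simp: leaky_test_def leaky_one_def fits_simps fits_copy fits_reach fits_seqs)

text \<open>Here the exponent 4 arises: one loop over the vertices around a test of depth 3.\<close>

lemma fits_greedy:
  assumes "fits 3 test" "''g'' \<notin> wvars test" shows "fits 4 (greedy_prog test keep)"
  using assms by (simp add: greedy_prog_def fits_simps fits_seqs)

lemma fits_walk: "2 \<le> d \<Longrightarrow> fits d (walk_prog src i)"
  by (simp add: walk_prog_def fits_simps fits_seqs fits_fill) (simp add: walk_round_def fits_simps fits_seqs, simp add: walk_inner_def fits_simps)

lemma fits_emit: "2 \<le> d \<Longrightarrow> fits d (emit_prog m \<pi>)"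
  by (simp add: emit_prog_def fits_seqs fits_walk)

lemma fits_pick: "2 \<le> d \<Longrightarrow> fits d (pick_prog m check ps)"
  by (simp add: pick_prog_def fits_simps fits_seqs fits_emit)

lemma fits_min: "fits 4 (min_prog k)"
  by (simp add: min_prog_def fits_simps fits_fill fits_greedy fits_linked)

lemma fits_tree: "fits 4 (tree_prog k)"
  by (simp add: tree_prog_def fits_simps fits_emit fits_pick)

lemma fits_stage: "fits 4 (stage_prog k ts os)"
proof -
  have "''g'' \<notin> wvars (leaky_test k ts)" by (rule notin_superset[OF wvars_leaky(1)]) simp
  then show ?thesis
    by (auto simp: stage_prog_def test_prog_def option_prog_def try_prog_def fits_simps fits_seqs fits_copy fits_fill
        fits_leaky fits_greedy fits_linked fits_min fits_tree)
qed

lemma fits_K4: "fits 4 K4_prog"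
  by (simp add: K4_prog_def branch_prog_def fits_simps fits_seqs fits_copy fits_emit fits_pick)

definition row_prog :: prog where
  "row_prog = PSeq (PAssign ''m'' (Const 0)) (PFor ''u'' (PSeq (PStore ''row'' (Var ''u'') (Var ''m''))
     (PAssign ''m'' (Plus (Var ''m'') (Var ''n'')))))"

definition out_tree_prog :: prog where
  "out_tree_prog = PSeq (PAssign ''result'' (Const 0)) (copy_prog ''S'' ''tree'')"

definition K4_finish :: prog where
  "K4_finish = PSeq K4_prog (PSeq (stage_prog 6 K4_test_exps K4_opt_exps)
     (PIf (Equal (Var ''found'') (Const 2)) (PAssign ''result'' (Const 2)) out_tree_prog))"

text \<open>The distinction \<open>k = 6\<close> is made when the program is built, not when it
  runs. For other \<open>k\<close> the outcome 0 of the stage is impossible by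
  \<open>leaky_structure\<close>.\<close>

definition cycle_finish :: "nat \<Rightarrow> prog" where
  "cycle_finish k = PSeq (stage_prog k (cycle_tests k) (cycle_opts k))
     (PIf (Equal (Var ''found'') (Const 2)) (PAssign ''result'' (Const 1))
       (PIf (Equal (Var ''found'') (Const 1)) out_tree_prog (if k = 6 then K4_finish else PSkip)))"

definition main_prog :: "nat \<Rightarrow> prog" where
  "main_prog k = seqs [row_prog, fill_prog ''S'' 1, min_prog k, tree_prog k,
     PIf (Equal (Var ''f'') (Const 0)) out_tree_prog (cycle_finish k)]"

lemma fits_main: "fits 4 (main_prog k)"
  by (simp add: main_prog_def cycle_finish_def K4_finish_def out_tree_prog_def row_prog_def fits_simps fits_seqs fits_copy fits_fill
      fits_min fits_tree fits_stage fits_K4)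

context instance_graph
begin

lemma row_prog_env:
  defines "s \<equiv> input_store n G k x"
  shows "env (run row_prog s)"
proof -
  let ?p = "PSeq (PStore ''row'' (Var ''u'') (Var ''m'')) (PAssign ''m'' (Plus (Var ''m'') (Var ''n'')))"
  let ?s = "set_var ''m'' 0 s"
  have n: "var ?s ''n'' = n" by (simp add: s_def input_store_def)
  have "\<forall>u<n. arr (run (PFor ''u'' ?p) ?s) ''row'' u = u * n"
  proof (rule run_For[where I = "\<lambda>j t. var t ''m'' = j * n \<and> (\<forall>u<j. arr t ''row'' u = u * n)"])
    fix j t assume a: "agree (wvars (PFor ''u'' ?p)) (warrs ?p) ?s t" and I: "var t ''m'' = j * n \<and> (\<forall>u<j. arr t ''row'' u = u * n)"
    have "var t ''n'' = n" using agree_var[OF a, of "''n''"] n by simp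
    then show "var (run ?p (set_var ''u'' j t)) ''m'' = Suc j * n \<and> (\<forall>u<Suc j. arr (run ?p (set_var ''u'' j t)) ''row'' u = u * n)"
      using I by (auto simp: less_Suc_eq)
  qed (use n in auto)
  then have r: "\<forall>u<n. arr (run row_prog s) ''row'' u = u * n" by (simp add: row_prog_def)
  have v: "var (run row_prog s) ''n'' = n" using run_var[of "''n''" row_prog s] n by (simp add: row_prog_def)
  have a: "arr (run row_prog s) ''adj'' = arr s ''adj''" "arr (run row_prog s) ''term'' = arr s ''term''"
    by (rule run_arr; simp add: row_prog_def)+
  have "arr s ''adj'' (u * n + v) = (if adj G u v then 1 else 0)" if uv: "u < n" "v < n" for u v
  proof -
    have "u * n + v < (u + 1) * n" using uv by simp
    also have "\<dots> \<le> n * n" using uv by (intro mult_le_mono1) simp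
    finally have lt: "u * n + v < n * n" .
    have d: "(u * n + v) div n = u" "(u * n + v) mod n = v" using uv by auto
    show ?thesis unfolding s_def input_store_def using lt d by simp
  qed
  moreover have "arr s ''term'' i = x i" if "i < k" for i using that by (simp add: s_def input_store_def)
  ultimately show ?thesis unfolding env_def a using r v by simp
qed

end

context tree_instance
begin

lemma out_tree_correct:
  assumes e: "env s" and t: "induced_tree_containing G X (setof s ''S'')"
  shows "correct_output n G k X (run out_tree_prog s)"
proof -
  let ?s = "set_var ''result'' 0 s"
  have "setof (run (copy_prog ''S'' ''tree'') ?s) ''tree'' = setof ?s ''S''" by (rule setof_copy) (use env_n[OF e] in simp_all)
  then have "out_tree n (run out_tree_prog s) = setof s ''S''" by (simp add: out_tree_prog_def out_tree_def setof_def)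
  moreover have "var (run out_tree_prog s) ''result'' = 0" by (simp add: out_tree_prog_def run_var)
  ultimately show ?thesis using t unfolding correct_output_def by simp
qed

lemma cycle_exps_value:
  assumes e: "env s" and K: "kst (out_path n s)"
  shows "(\<lambda>t. ((\<lambda>d. aval d s) ` set (fst t), aval (snd t) s)) ` set (cycle_tests k) = k_tests k (out_path n s)"
    "(\<lambda>e. aval e s) ` set (cycle_opts k) = {out_path n s i ! (length (out_path n s i) - 1) | i. i < k} \<union> {out_path n s i ! (length (out_path n s i) - 2) | i. i < k}"
    "t \<in> set (cycle_tests k) \<Longrightarrow> static (snd t) \<and> (\<forall>d\<in>set (fst t). static d) \<and> aval (snd t) s < n"
    "d \<in> set (cycle_opts k) \<Longrightarrow> static d"
proof -
  interpret K: kstruct G k X "out_path n s" by unfold_locales (rule K)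
  have l: "2 \<le> arr s ''len'' i" "0 < arr s ''len'' i" if "i < k" for i using K.L2[OF that] by auto
  have i: "i < n" if "i < k" for i using that k_n by simp
  have v: "aval (head_exp i) s = hd (out_path n s i)" "aval (end_exp i) s = last (out_path n s i)"
    "aval (pre_exp i) s = out_path n s i ! (length (out_path n s i) - 2)" if "i < k" for i
    by (rule head_value[OF e i[OF that] l(2)[OF that]] end_value[OF e i[OF that] l(2)[OF that]] pre_value[OF e i[OF that] l(1)[OF that]])+
  have "(\<lambda>t. ((\<lambda>d. aval d s) ` set (fst t), aval (snd t) s)) ` set (cycle_tests k) =
     (\<lambda>i. ({aval (end_exp i) s}, aval (head_exp i) s)) ` {..<k}"
    by (simp add: cycle_tests_def image_image atLeast0LessThan)
  also have "\<dots> = k_tests k (out_path n s)" unfolding k_tests_def using v by (intro image_cong refl) auto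
  finally show "(\<lambda>t. ((\<lambda>d. aval d s) ` set (fst t), aval (snd t) s)) ` set (cycle_tests k) = k_tests k (out_path n s)" .
  have "(\<lambda>e. aval e s) ` set (cycle_opts k) = (\<lambda>i. aval (end_exp i) s) ` {..<k} \<union> (\<lambda>i. aval (pre_exp i) s) ` {..<k}"
    by (simp add: cycle_opts_def image_Un image_image atLeast0LessThan)
  also have "\<dots> = (\<lambda>i. out_path n s i ! (length (out_path n s i) - 1)) ` {..<k} \<union> (\<lambda>i. out_path n s i ! (length (out_path n s i) - 2)) ` {..<k}"
    using v K.s_nth by (intro arg_cong2[where f = "(\<union>)"] image_cong refl) auto
  also have "\<dots> = {out_path n s i ! (length (out_path n s i) - 1) | i. i < k} \<union> {out_path n s i ! (length (out_path n s i) - 2) | i. i < k}"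
    by blast
  finally show "(\<lambda>e. aval e s) ` set (cycle_opts k) = {out_path n s i ! (length (out_path n s i) - 1) | i. i < k} \<union> {out_path n s i ! (length (out_path n s i) - 2) | i. i < k}" .
  have "hd (out_path n s i) < n" if "i < k" for i
  proof -
    have "bij_betw (\<lambda>i. hd (out_path n s i)) {..<k} X" using K by (simp add: kst_def)
    then have "hd (out_path n s i) \<in> X" using bij_betwE that by blast
    then show ?thesis using x_less by auto
  qed
  then show "static (snd t) \<and> (\<forall>d\<in>set (fst t). static d) \<and> aval (snd t) s < n" if "t \<in> set (cycle_tests k)"
    using that v(1) unfolding cycle_tests_def by (auto simp: static_exps)
  show "static d" if "d \<in> set (cycle_opts k)" using that unfolding cycle_opts_def by (auto simp: static_exps)
qed

end

lemma (in tree_instance6) K4_finish_correct: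
  assumes e: "env s" and K: "K4s w Q" and B: "setof s ''B'' = K4_verts w Q"
  shows "correct_output n G 6 X (run K4_finish s)"
proof -
  define s1 where "s1 = run K4_prog s"
  define s2 where "s2 = run (stage_prog 6 K4_test_exps K4_opt_exps) s1"
  define w' where "w' = arr s1 ''branch''"
  define P' where "P' = (\<lambda>e. out_path n s1 (K4_index e))"
  have s1: "env s1" "K4s w' P'" "setof s1 ''S'' = K4_verts w' P'"
    using K4_prog_spec[OF e K B] unfolding s1_def w'_def P'_def by blast+
  note V = K4_exps_value[OF s1(1) s1(2)[unfolded w'_def P'_def], folded w'_def P'_def]
  have r: "run K4_finish s = (if var s2 ''found'' = 2 then set_var ''result'' 2 s2 else run out_tree_prog s2)"
    by (simp add: K4_finish_def s2_def s1_def)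
  have st: "env s2 \<and> (var s2 ''found'' = 2 \<and> \<not> leaky G X (K4_tests w' P') (verts G) \<and> (\<forall>a\<in>{''path'', ''len'', ''row'', ''branch''}. arr s2 a = arr s1 a) \<or>
    var s2 ''found'' = 1 \<and> induced_tree_containing G X (setof s2 ''S'') \<or>
    var s2 ''found'' = 0 \<and> K4_verts w' P' \<subseteq> setof s2 ''B'' \<and> leaky G X (K4_tests w' P') (setof s2 ''B'') \<and>
      (\<forall>u\<in>setof s2 ''B'' - K4_verts w' P'. \<not> leaky G X (K4_tests w' P') (setof s2 ''B'' - {u})) \<and>
      \<not> (\<exists>U\<subseteq>K4_opts w' P'. good_cut G X (setof s2 ''B'') U))"
    using stage_prog_spec[of s1 K4_test_exps K4_opt_exps, OF s1(1) V(3) V(4)] unfolding V(1,2) s1(3) s2_def .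
  from conjunct2[OF st] show ?thesis
  proof (elim disjE conjE)
    assume 1: "var s2 ''found'' = 2" "\<not> leaky G X (K4_tests w' P') (verts G)" "\<forall>a\<in>{''path'', ''len'', ''row'', ''branch''}. arr s2 a = arr s1 a"
    have d: "decomposing_K4_structure X G w' P'" using decomposing_K4_iff[OF s1(2)] 1(2) by blast
    let ?t = "set_var ''result'' 2 s2"
    have "out_path n ?t = out_path n s1" by (rule out_path_arrs) (use 1(3) in simp_all)
    moreover have "arr ?t ''branch'' = w'" using 1(3) by (simp add: w'_def)
    ultimately show ?thesis using d 1(1) unfolding r correct_output_def P'_def by simp
  next
    assume 2: "var s2 ''found'' = 1" "induced_tree_containing G X (setof s2 ''S'')"
    then show ?thesis unfolding r using out_tree_correct[OF conjunct1[OF st]] 2 by simp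
  next
    assume "var s2 ''found'' = 0" and 3: "K4_verts w' P' \<subseteq> setof s2 ''B''" "leaky G X (K4_tests w' P') (setof s2 ''B'')" "\<forall>u\<in>setof s2 ''B'' - K4_verts w' P'. \<not> leaky G X (K4_tests w' P') (setof s2 ''B'' - {u})" "\<not> (\<exists>U\<subseteq>K4_opts w' P'. good_cut G X (setof s2 ''B'') U)"
    have nl: "\<not> leaky G X (K4_tests w' P') (setof s2 ''B'' - {u})" if "u \<in> setof s2 ''B'' - K4_verts w' P'" for u
      using 3(3) that by blast
    \<comment> \<open>A minimal leaky set of a \<open>K4\<close> structure always has a good cut
      among the options, so the search cannot have failed.\<close>
    show ?thesis by (rule notE[OF 3(4) K4_leaky_structure[OF s1(2) 3(1) setof_verts 3(2) nl]])
  qed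
qed

context tree_instance
begin

lemma cycle_finish_correct:
  assumes e: "env s" and K: "kst (out_path n s)" and S: "setof s ''S'' = (\<Union>i<k. set (out_path n s i))"
  shows "correct_output n G k X (run (cycle_finish k) s)"
proof -
  interpret K: kstruct G k X "out_path n s" by unfold_locales (rule K)
  define s2 where "s2 = run (stage_prog k (cycle_tests k) (cycle_opts k)) s"
  note V = cycle_exps_value[OF e K]
  let ?T = "k_tests k (out_path n s)"
  have r: "run (cycle_finish k) s = (if var s2 ''found'' = 2 then set_var ''result'' 1 s2 else
     if var s2 ''found'' = 1 then run out_tree_prog s2 else run (if k = 6 then K4_finish else PSkip) s2)"
    by (simp add: cycle_finish_def s2_def)
  have SK: "setof s ''S'' = K.K" unfolding S K.K_def ..
  have st: "env s2 \<and> (var s2 ''found'' = 2 \<and> \<not> leaky G X ?T (verts G) \<and> (\<forall>a\<in>{''path'', ''len'', ''row'', ''branch''}. arr s2 a = arr s a) \<or>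
    var s2 ''found'' = 1 \<and> induced_tree_containing G X (setof s2 ''S'') \<or>
    var s2 ''found'' = 0 \<and> K.K \<subseteq> setof s2 ''B'' \<and> leaky G X ?T (setof s2 ''B'') \<and>
      (\<forall>u\<in>setof s2 ''B'' - K.K. \<not> leaky G X ?T (setof s2 ''B'' - {u})) \<and>
      \<not> (\<exists>U\<subseteq>K.opts. good_cut G X (setof s2 ''B'') U))"
    using stage_prog_spec[of s "cycle_tests k" "cycle_opts k", OF e V(3) V(4)] unfolding V(1,2) SK s2_def .
  from conjunct2[OF st] show ?thesis
  proof (elim disjE conjE)
    assume 1: "var s2 ''found'' = 2" "\<not> leaky G X ?T (verts G)" "\<forall>a\<in>{''path'', ''len'', ''row'', ''branch''}. arr s2 a = arr s a"
    have d: "decomposing_k_structure k X G (out_path n s)" using K.decomposing_iff 1(2) by blast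
    have "out_path n (set_var ''result'' 1 s2) = out_path n s" by (rule out_path_arrs) (use 1(3) in simp_all)
    then show ?thesis using d 1(1) unfolding r correct_output_def by simp
  next
    assume 2: "var s2 ''found'' = 1" "induced_tree_containing G X (setof s2 ''S'')"
    then show ?thesis unfolding r using out_tree_correct[OF conjunct1[OF st]] 2 by simp
  next
    assume 3: "var s2 ''found'' = 0" "K.K \<subseteq> setof s2 ''B''" "leaky G X ?T (setof s2 ''B'')" "\<forall>u\<in>setof s2 ''B'' - K.K. \<not> leaky G X ?T (setof s2 ''B'' - {u})" "\<not> (\<exists>U\<subseteq>K.opts. good_cut G X (setof s2 ''B'') U)"
    let ?B = "setof s2 ''B''"
    have min: "\<not> leaky G X ?T (?B - {u})" if "u \<in> ?B - K.K" for u using 3(4) that by blast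
    \<comment> \<open>The search has failed, so only the exceptional vertex is left, and
      \<open>?B\<close> is the vertex set of a \<open>K4\<close> structure.\<close>
    obtain v J where k6: "k = 6" and v: "v \<in> ?B - K.K" "?B = insert v K.K" and J: "J = {0, 2, 4} \<or> J = {1, 3, 5}"
      and N: "{u \<in> K.K. adj G v u} = (\<lambda>i. out_path n s i ! (length (out_path n s i) - 2)) ` J"
      using K.leaky_structure[OF 3(2) setof_verts 3(3) min] 3(5) by blast
    interpret I: tree_instance6 n G x using tree_instance_axioms unfolding k6 tree_instance6_def .
    have KU: "K.K = (\<Union>i<6. set (out_path n s i))" by (simp only: K.K_def) (simp only: k6)
    have P6: "I.kst (out_path n s)" using K unfolding k6 .
    have v': "v \<in> verts G" "v \<notin> (\<Union>i<6. set (out_path n s i))"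
      using subsetD[OF setof_verts, of v s2 "''B''"] v(1) unfolding KU by (blast, simp)
    obtain w Q where Q: "I.K4s w Q" "K4_verts w Q = insert v (\<Union>i<6. set (out_path n s i))"
      using I.K4_from_kst[OF P6 v' J N[unfolded KU]] by (elim exE conjE)
    have e6: "I.env s2" using st unfolding k6 by (elim conjE)
    have B6: "I.setof s2 ''B'' = K4_verts w Q" unfolding Q(2) v(2)[unfolded KU, symmetric] ..
    have "run (cycle_finish k) s = run K4_finish s2" unfolding r using 3(1) k6 by simp
    then show ?thesis using I.K4_finish_correct[OF e6 Q(1) B6] k6 by simp
  qed
qed

theorem main_prog_correct:
  assumes conn: "linked G X (verts G)"
  shows "correct_output n G k X (run (main_prog k) (input_store n G k x))"
proof -
  define s1 where "s1 = run (fill_prog ''S'' 1) (run row_prog (input_store n G k x))"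
  define s2 where "s2 = run (min_prog k) s1"
  define s3 where "s3 = run (tree_prog k) s2"
  have e1: "env s1" using env_run[OF row_prog_env] by (simp add: s1_def)
  have "setof s1 ''S'' = verts G" using fill_value[OF env_n[OF row_prog_env]] by (auto simp: s1_def setof_def vertices)
  then have m: "min_linked G X (setof s2 ''S'')" using min_prog_spec[OF e1] conn unfolding s2_def by simp
  have e2: "env s2" unfolding s2_def by (rule env_run[OF e1]) (rule notin_superset[OF wvars_min(1)] notin_superset[OF wvars_min(2)], simp)+
  have e3: "env s3" unfolding s3_def by (rule env_run[OF e2]) (rule notin_superset[OF wvars_tree(1)] notin_superset[OF wvars_tree(2)], simp)+
  have "''S'' \<notin> warrs (tree_prog k)" by (rule notin_superset[OF wvars_tree(2)]) simp
  then have S3: "setof s3 ''S'' = setof s2 ''S''" unfolding s3_def by (intro setof_cong run_arr)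
  have r: "run (main_prog k) (input_store n G k x) = (if var s3 ''f'' = 0 then run out_tree_prog s3 else run (cycle_finish k) s3)"
    by (simp add: main_prog_def s3_def s2_def s1_def)
  from tree_prog_spec[OF e2 m, folded s3_def] show ?thesis
  proof
    assume "var s3 ''f'' = 0 \<and> induced_tree_containing G X (setof s2 ''S'')"
    then show ?thesis unfolding r using out_tree_correct[OF e3] S3 by simp
  next
    assume *: "var s3 ''f'' \<noteq> 0 \<and> kst (out_path n s3) \<and> setof s2 ''S'' = (\<Union>i<k. set (out_path n s3 i)) \<and> (\<forall>i<k. 0 < arr s3 ''len'' i)"
    then have "setof s3 ''S'' = (\<Union>i<k. set (out_path n s3 i))" using S3 by (elim conjE) (rule trans)
    then show ?thesis unfolding r using * cycle_finish_correct[OF e3] by simp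
  qed
qed

end

lemma (in kgraph) connected_linked:
  assumes "connected_graph G" shows "linked G X (verts G)"
proof -
  have "adj (induced G (verts G)) = adj G" using adj_in_verts by (auto simp: fun_eq_iff adj_induced)
  then have r: "reach G (verts G) u v" if "u \<in> verts G" "v \<in> verts G" for u v
    using assms that unfolding connected_graph_def reach_def by simp
  show ?thesis unfolding linked_def using r X_verts by blast
qed

lemma input_kgraph:
  assumes "5 \<le> k" "k_in_a_tree_input k G x"
  shows "kgraph G k (x ` {..<k})"
  using assms by unfold_locales (auto simp: k_in_a_tree_input_def card_image)

lemma real_power4_bound: "(\<lambda>n. real (c * (n + 1) ^ 4)) \<in> O(\<lambda>n. real n ^ 4)"
proof (rule bigoI[where c = "real c * 16"])
  \<comment> \<open>From 1 on, \<open>n + 1\<close> is at most \<open>2 * n\<close>, whose fourth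
    power gives the factor 16.\<close>
  have "real (c * (n + 1) ^ 4) \<le> real c * 16 * real n ^ 4" if "1 \<le> n" for n
  proof -
    have "(n + 1) ^ 4 \<le> (2 * n) ^ 4" using that by (intro power_mono) auto
    then have "c * (n + 1) ^ 4 \<le> c * (2 * n) ^ 4" by (rule mult_le_mono2)
    then have "real (c * (n + 1) ^ 4) \<le> real (c * (2 * n) ^ 4)" by (simp only: of_nat_le_iff)
    also have "\<dots> = real c * 16 * real n ^ 4" by (simp add: power_mult_distrib)
    finally show ?thesis .
  qed
  then show "eventually (\<lambda>n. norm (real (c * (n + 1) ^ 4)) \<le> real c * 16 * norm (real n ^ 4)) sequentially"
    unfolding eventually_sequentially by (intro exI[of _ 1]) simp
qed

theorem theorem5p1:
  fixes k :: nat
  assumes "5 \<le> k"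
  shows "(\<forall>(G :: 'a graph) x. k_in_a_tree_input k G x \<longrightarrow>
            (let X = x ` {..<k};
                 A = (\<exists>P. decomposing_k_structure k X G P);
                 B = (k = 6 \<and> (\<exists>w P. decomposing_K4_structure X G w P));
                 C = (\<exists>S. induced_tree_containing G X S)
             in (A \<or> B \<or> C) \<and> \<not> (A \<and> B) \<and> \<not> (A \<and> C) \<and> \<not> (B \<and> C)))
       \<and> (\<exists>p (T :: nat \<Rightarrow> nat). (\<lambda>n. real (T n)) \<in> O(\<lambda>n. real n ^ 4) \<and>
            (\<forall>n (G :: nat graph) x. verts G = {..<n} \<and> k_in_a_tree_input k G x \<longrightarrow>
               (\<exists>t s. exec p (input_store n G k x) t s \<and> t \<le> T n \<and>
                      correct_output n G k (x ` {..<k}) s)))"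
proof (intro conjI allI impI)
  fix G :: "'a graph" and x assume i: "k_in_a_tree_input k G x"
  let ?X = "x ` {..<k}"
  interpret kgraph G k ?X by (rule input_kgraph[OF assms i])
  have l: "linked G ?X (verts G)" using connected_linked i by (simp add: k_in_a_tree_input_def)
  have t: "(\<exists>P. decomposing_k_structure k ?X G P) \<or> (k = 6 \<and> (\<exists>w P. decomposing_K4_structure ?X G w P)) \<or>
    (\<exists>S. induced_tree_containing G ?X S)" by (rule trichotomy[OF l])
  show "let X = x ` {..<k}; A = (\<exists>P. decomposing_k_structure k X G P);
      B = (k = 6 \<and> (\<exists>w P. decomposing_K4_structure X G w P)); C = (\<exists>S. induced_tree_containing G X S)
    in (A \<or> B \<or> C) \<and> \<not> (A \<and> B) \<and> \<not> (A \<and> C) \<and> \<not> (B \<and> C)"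
    unfolding Let_def using t exclusive by blast
next
  \<comment> \<open>The program is chosen after \<open>k\<close>, so its cost, which grows with the
    numbers of permutations and subsets tried, is a constant.\<close>
  let ?T = "\<lambda>n. cost (main_prog k) * (n + 1) ^ 4"
  show "\<exists>p (T :: nat \<Rightarrow> nat). (\<lambda>n. real (T n)) \<in> O(\<lambda>n. real n ^ 4) \<and>
    (\<forall>n (G :: nat graph) x. verts G = {..<n} \<and> k_in_a_tree_input k G x \<longrightarrow>
      (\<exists>t s. exec p (input_store n G k x) t s \<and> t \<le> T n \<and> correct_output n G k (x ` {..<k}) s))"
  proof (rule exI[of _ "code (main_prog k)"], rule exI[of _ ?T], rule conjI[OF real_power4_bound], intro allI impI)
    fix n and G :: "nat graph" and x assume i: "verts G = {..<n} \<and> k_in_a_tree_input k G x"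
    interpret kgraph G k "x ` {..<k}" by (rule input_kgraph) (use assms i in auto)
    interpret tree_instance n G k x
    proof unfold_locales
      show "verts G = {..<n}" "0 < k" using i assms by auto
      show "x j < n" if "j < k" for j using i that unfolding k_in_a_tree_input_def terminal_def by auto
    qed
    let ?s = "input_store n G k x"
    have c: "correct_output n G k (x ` {..<k}) (run (main_prog k) ?s)"
      by (rule main_prog_correct, rule connected_linked) (use i in \<open>simp add: k_in_a_tree_input_def\<close>)
    have f: "loops_ok (main_prog k)" "''n'' \<notin> wvars (main_prog k)" "depth (main_prog k) \<le> 4"
      using fits_main[of k] unfolding fits_def by auto
    obtain t where t: "exec (code (main_prog k)) ?s t (run (main_prog k) ?s)"
      "t \<le> cost (main_prog k) * (var ?s ''n'' + 1) ^ depth (main_prog k)" using exec_code[OF f(1,2)] by blast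
    have "var ?s ''n'' = n" by (simp add: input_store_def)
    then have "t \<le> cost (main_prog k) * (n + 1) ^ depth (main_prog k)" using t(2) by simp
    also have "\<dots> \<le> ?T n" by (intro mult_le_mono2 power_increasing f(3)) simp
    finally show "\<exists>t s. exec (code (main_prog k)) ?s t s \<and> t \<le> ?T n \<and> correct_output n G k (x ` {..<k}) s"
      using t(1) c by blast
  qed
qed

end
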